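(* Let $\Theta=\sum_{k=1}^{K}\theta_k\delta_{\psi_k}$ be a completely random signed measure on a complete separable metric space $\Psi$ satisfying Assumptions A00, A0, A1 and A2 stated in the context, and let $X_1,\dots,X_m$ be generated i.i.d. conditionally on $\Theta$ according to $X_1=\sum_{k=1}^{K}x_{1,k}\delta_{\psi_k}$ with $x_{1,k}\mid\theta_k\sim h(\cdot\mid\theta_k)$ independently across $k$. Let $\Theta_{post}$ be a random signed measure with the distribution of $\Theta\mid X_1,\dots,X_m$. Then $\Theta_{post}$ is a completely random signed measure with three parts. 1. For each $k\in\{1,\dots,K_{fix}\}$, $\Theta_{post}$ has a fixed atom at $\psi_{fix,k}$ with weight $\theta_{post,fix,k}$ distributed according to $F_{post,fix,k}(d\theta)\propto F_{fix,k}(d\theta)\prod_{j=1}^{m}h(x_{fix,j,k}\mid\theta)$, where $x_{fix,j,k}=X_j(\{\psi_{fix,k}\})$. 2. Let $\{\psi_{new,k}:k\in\{1,\dots,K_{new}\}\}$ be the union of the atom locations of $X_1,\dots,X_m$ minus the fixed atom locations in the prior $\Theta$. Then $K_{new}$ is finite. Let $x_{new,j,k}=X_j(\{\psi_{new,k}\})$ be the weight of $X_j$ at $\psi_{new,k}$, $j=1,\dots,m$. Then $\Theta_{post}$ has a fixed atom at $\psi_{new,k}$ with random weight $\theta_{post,new,k}$, whose distribution is $F_{post,new,k}(d\theta)\propto\nu(d\theta)\prod_{j=1}^{m}h(x_{new,j,k}\mid\theta)$. 3. The ordinary component of $\Theta_{post}$ has weight measure $\nu_{post}(d\theta)=\n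u(d\theta)\,h(0\mid\theta)^m$.
   Context: A completely random signed measure (CRSM) is a random signed measure (random real-valued countably additive set function on bounded Borel sets) whose values on disjoint bounded sets are jointly independent. It has an a.s. unique representation as $\sum_j Y_j\delta_{s_j}+\alpha+\int x\,N(\cdot\times dx)$, with independent random weights $Y_j$ at deterministic locations $s_j$ (fixed component), a deterministic atomless signed part $\alpha$, and a Poisson process $N$ on $\Psi\times(\mathbb{R}\setminus\{0\})$, independent of the $Y_j$, with intensity (Lévy) measure $F$ satisfying $\int(1\wedge|x|)F(B\times dx)<\infty$ for bounded $B$ and $F(\{s\}\times(\mathbb{R}\setminus\{0\}))=0$ for every $s$; the last term is the ordinary component. Prior: $\Theta=\sum_{k=1}^K\theta_k\delta_{\psi_k}$ is a CRSM on $\Psi$, where $K$ may be finite or infinite, and $K=K_{fix}+K_{ord}$ counts fixed and non-fixed atoms. The fixed component is $\sum_{k=1}^{K_{fix}}\theta_{fix,k}\delta_{\psi_{fix,k}}$ and $F_{fix,k}$ is the law of $\theta_{fix,k}=\Theta(\{\psi_{fix,k}\})$. Likelihood: $h(\cdot\mid\theta)$ is a probability mass function on $\mathbb{Z}$ depending on the parameter $\theta\in\mathbb{R}$; $X_j=\sum_k x_{j,k}\delta_{\psi_k}$ with $x_{j,k}\mid\theta_k\sim h(\cdot\mid\theta_k)$ independently across $j$ and $k$; $X_1,\dots,X_m$ are i.i.d. given $\Theta$. The atom locations of $X_j$ are the $\psi_k$ with $x_{j,k}\ne0$. Assumptions. A00: the deterministic part of $\Theta$ is zero, and its Lévy measure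 is $\mu(d\theta\times d\psi)=\nu(d\theta)\,G(d\psi)$, with $\nu$ a $\sigma$-finite measure on $\mathbb{R}\setminus\{0\}$ (the weight measure) and $G$ a probability distribution on $\Psi$ without atoms. A0: $\Theta$ has finitely many fixed atoms. A1: $\nu(\mathbb{R}\setminus\{0\})=\infty$. A2: $\sum_{x\in\mathbb{Z}\setminus\{0\}}\int_{\mathbb{R}\setminus\{0\}}h(x\mid\theta)\,\nu(d\theta)<\infty$. *)

theory Defs
  imports "HOL-Probability.Probability"
begin

text \<open>
  The ambient space is a type of class \<open>polish_space\<close>, that is, a complete separable metric
  space; "bounded" refers to its metric.
\<close>

definition bounded_borel :: "'a::metric_space set set" where
  "bounded_borel = {B \<in> sets borel. bounded B}"

definition signed_measure :: "('a::metric_space set \<Rightarrow> real) \<Rightarrow> bool" where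
  "signed_measure \<mu> \<longleftrightarrow>
     (\<forall>A :: nat \<Rightarrow> 'a set. range A \<subseteq> bounded_borel \<and> disjoint_family A \<and> bounded (\<Union>i. A i)
        \<longrightarrow> (\<lambda>i. \<mu> (A i)) sums \<mu> (\<Union>i. A i))"

text \<open>
  The measurable space of signed measures, with the sigma-algebra generated by the evaluations at
  bounded Borel sets. Only values on bounded Borel sets are meaningful; elsewhere the functions
  are \<open>undefined\<close>, as usual for \<open>PiM\<close>.
\<close>

definition signed_measures :: "('a::metric_space set \<Rightarrow> real) measure" where
  "signed_measures = restrict_space (\<Pi>\<^sub>M B\<in>bounded_borel. borel) {\<mu>. signed_measure \<mu>}"

abbreviation nonzero_reals :: "real measure" where
  "nonzero_reals \<equiv> restrict_space borel (- {0})"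

definition completely_random ::
    "'w measure \<Rightarrow> ('w \<Rightarrow> 'a::metric_space set \<Rightarrow> real) \<Rightarrow> bool" where
  "completely_random M \<Theta> \<longleftrightarrow>
     \<Theta> \<in> M \<rightarrow>\<^sub>M signed_measures \<and>
     (\<forall>A :: nat \<Rightarrow> 'a set. range A \<subseteq> bounded_borel \<and> disjoint_family A
        \<longrightarrow> prob_space.indep_vars M (\<lambda>_. borel) (\<lambda>i \<omega>. \<Theta> \<omega> (A i)) UNIV)"

definition poisson_process :: "'w measure \<Rightarrow> ('w \<Rightarrow> 'b measure) \<Rightarrow> 'b measure \<Rightarrow> bool" where
  "poisson_process M N F \<longleftrightarrow>
     (\<forall>\<omega>\<in>space M. sets (N \<omega>) = sets F \<and>
        (\<forall>A\<in>sets F. emeasure (N \<omega>) A \<in> insert \<infinity> (range of_nat))) \<and>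
     (\<forall>A\<in>sets F. (\<lambda>\<omega>. emeasure (N \<omega>) A) \<in> borel_measurable M) \<and>
     (\<forall>A\<in>sets F. emeasure F A < \<infinity> \<longrightarrow>
        (\<forall>n. measure M {\<omega>\<in>space M. emeasure (N \<omega>) A = of_nat n}
               = exp (- measure F A) * measure F A ^ n / fact n)) \<and>
     (\<forall>A\<in>sets F. emeasure F A = \<infinity> \<longrightarrow> (AE \<omega> in M. emeasure (N \<omega>) A = \<infinity>)) \<and>
     (\<forall>A :: nat \<Rightarrow> 'b set. range A \<subseteq> sets F \<and> disjoint_family A
        \<longrightarrow> prob_space.indep_vars M (\<lambda>_. borel) (\<lambda>i \<omega>. emeasure (N \<omega>) (A i)) UNIV)"

definition levy_measure :: "('a::metric_space \<times> real) measure \<Rightarrow> bool" where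
  "levy_measure F \<longleftrightarrow>
     sets F = sets (borel \<Otimes>\<^sub>M nonzero_reals) \<and>
     (\<forall>B\<in>bounded_borel. (\<integral>\<^sup>+ (s, y). indicator B s * ennreal (min 1 \<bar>y\<bar>) \<partial>F) < \<infinity>) \<and>
     (\<forall>s. emeasure F ({s} \<times> - {0}) = 0)"

text \<open>
  \<open>crsm_representation M \<Theta> S \<alpha> F\<close>: almost surely \<open>\<Theta>\<close> is the sum of a fixed component with
  independent weights at the locations in \<open>S\<close>, the deterministic atomless part \<open>\<alpha>\<close>, and the
  ordinary component driven by a Poisson process \<open>N\<close> with intensity \<open>F\<close> independent of the fixed
  weights. The weight at \<open>s \<in> S\<close> is \<open>\<Theta> {s}\<close>, since neither of the other two components charges
  \<open>{s}\<close>; it may vanish, even almost surely.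
\<close>

definition crsm_representation ::
    "'w measure \<Rightarrow> ('w \<Rightarrow> 'a::metric_space set \<Rightarrow> real) \<Rightarrow> 'a set \<Rightarrow> ('a set \<Rightarrow> real)
      \<Rightarrow> ('a \<times> real) measure \<Rightarrow> bool" where
  "crsm_representation M \<Theta> S \<alpha> F \<longleftrightarrow>
     countable S \<and>
     signed_measure \<alpha> \<and> (\<forall>s. \<alpha> {s} = 0) \<and>
     levy_measure F \<and>
     prob_space.indep_vars M (\<lambda>_. borel) (\<lambda>s \<omega>. \<Theta> \<omega> {s}) S \<and>
     (\<exists>N. poisson_process M N F \<and>
        prob_space.indep_set M
          (sets (vimage_algebra (space M) (\<lambda>\<omega>. \<lambda>s\<in>S. \<Theta> \<omega> {s}) (\<Pi>\<^sub>M s\<in>S. borel)))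
          (sets (vimage_algebra (space M) (\<lambda>\<omega>. \<lambda>A\<in>sets F. emeasure (N \<omega>) A)
                  (\<Pi>\<^sub>M A\<in>sets F. borel))) \<and>
        (AE \<omega> in M. \<forall>B\<in>bounded_borel.
           (\<lambda>s. \<Theta> \<omega> {s}) summable_on (S \<inter> B) \<and>
           integrable (N \<omega>) (\<lambda>(s, y). indicator B s * y) \<and>
           \<Theta> \<omega> B = (\<Sum>\<^sub>\<infinity>s\<in>S \<inter> B. \<Theta> \<omega> {s}) + \<alpha> B
                    + (\<integral>(s, y). indicator B s * y \<partial>N \<omega>)))"

text \<open>The identity \<open>\<mu> = (\<Sum>k<K. w k * \<delta>\<^bsub>\<psi> k\<^esub>)\<close>, where \<open>K\<close> may be infinite.\<close>

definition weighted_atoms ::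
    "enat \<Rightarrow> (nat \<Rightarrow> real) \<Rightarrow> (nat \<Rightarrow> 'a::metric_space) \<Rightarrow> ('a set \<Rightarrow> real) \<Rightarrow> bool" where
  "weighted_atoms K w \<psi> \<mu> \<longleftrightarrow>
     (\<forall>B\<in>bounded_borel. (w has_sum \<mu> B) {k. enat k < K \<and> \<psi> k \<in> B})"

text \<open>
  \<open>\<Theta> = (\<Sum>k<K. \<theta> k * \<delta>\<^bsub>\<psi> k\<^esub>)\<close> with distinct locations, where the atoms are those at the fixed
  locations \<open>S\<close> (listed even if their random weight happens to be zero) and the points, of nonzero
  weight, of the ordinary component.
\<close>

definition atom_enumeration ::
    "'w measure \<Rightarrow> ('w \<Rightarrow> 'a::metric_space set \<Rightarrow> real) \<Rightarrow> 'a set \<Rightarrow> ('w \<Rightarrow> enat)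
      \<Rightarrow> (nat \<Rightarrow> 'w \<Rightarrow> real) \<Rightarrow> (nat \<Rightarrow> 'w \<Rightarrow> 'a) \<Rightarrow> bool" where
  "atom_enumeration M \<Theta> S K \<theta> \<psi> \<longleftrightarrow>
     K \<in> M \<rightarrow>\<^sub>M count_space UNIV \<and>
     (\<forall>k. \<theta> k \<in> borel_measurable M) \<and>
     (\<forall>k. \<psi> k \<in> borel_measurable M) \<and>
     (AE \<omega> in M.
        inj_on (\<lambda>k. \<psi> k \<omega>) {k. enat k < K \<omega>} \<and>
        S \<subseteq> (\<lambda>k. \<psi> k \<omega>) ` {k. enat k < K \<omega>} \<and>
        (\<forall>k. enat k < K \<omega> \<and> \<psi> k \<omega> \<notin> S \<longrightarrow> \<theta> k \<omega> \<noteq> 0) \<and>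
        weighted_atoms (K \<omega>) (\<lambda>k. \<theta> k \<omega>) (\<lambda>k. \<psi> k \<omega>) (\<Theta> \<omega>))"

definition atoms_sigma ::
    "'w measure \<Rightarrow> ('w \<Rightarrow> enat) \<Rightarrow> (nat \<Rightarrow> 'w \<Rightarrow> real) \<Rightarrow> (nat \<Rightarrow> 'w \<Rightarrow> 'a::metric_space)
      \<Rightarrow> 'w measure" where
  "atoms_sigma M K \<theta> \<psi> =
     vimage_algebra (space M) (\<lambda>\<omega>. (K \<omega>, \<lambda>k. (\<psi> k \<omega>, \<theta> k \<omega>)))
       (count_space UNIV \<Otimes>\<^sub>M (\<Pi>\<^sub>M k\<in>UNIV. borel \<Otimes>\<^sub>M borel))"

text \<open>
  Given all atoms \<open>(\<psi> k, \<theta> k)\<close>, \<open>k < K\<close>, the variables \<open>x j k\<close> are independent over all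
  \<open>j \<in> {1..m}\<close> and \<open>k < K\<close>, and \<open>x j k\<close> has mass function \<open>h (\<theta> k)\<close>. The defining property of
  the conditional probabilities is spelled out for finite families of pairs \<open>(j, k)\<close>.
\<close>

definition likelihood_weights ::
    "'w measure \<Rightarrow> ('w \<Rightarrow> enat) \<Rightarrow> (nat \<Rightarrow> 'w \<Rightarrow> real) \<Rightarrow> (nat \<Rightarrow> 'w \<Rightarrow> 'a::metric_space)
      \<Rightarrow> (real \<Rightarrow> int pmf) \<Rightarrow> nat \<Rightarrow> (nat \<Rightarrow> nat \<Rightarrow> 'w \<Rightarrow> int) \<Rightarrow> bool" where
  "likelihood_weights M K \<theta> \<psi> h m x \<longleftrightarrow>
     (\<forall>j\<in>{1..m}. \<forall>k. x j k \<in> M \<rightarrow>\<^sub>M count_space UNIV) \<and>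
     (\<forall>E\<in>sets (atoms_sigma M K \<theta> \<psi>). \<forall>J v. finite J \<and> J \<subseteq> {1..m} \<times> UNIV \<longrightarrow>
        emeasure M {\<omega>\<in>E. \<forall>(j, k)\<in>J. enat k < K \<omega> \<and> x j k \<omega> = v j k}
          = (\<integral>\<^sup>+ \<omega>. indicator {\<omega>\<in>E. \<forall>(j, k)\<in>J. enat k < K \<omega>} \<omega>
                    * ennreal (\<Prod>(j, k)\<in>J. pmf (h (\<theta> k \<omega>)) (v j k)) \<partial>M))"

text \<open>
  \<open>\<kappa>\<close> is a regular conditional distribution of \<open>Y\<close> (with values in \<open>R\<close>) given \<open>Z\<close> (with values
  in \<open>D\<close>).
\<close>

definition conditional_distribution ::
    "'w measure \<Rightarrow> 'd measure \<Rightarrow> ('w \<Rightarrow> 'd) \<Rightarrow> 'r measure \<Rightarrow> ('w \<Rightarrow> 'r) \<Rightarrow> ('d \<Rightarrow> 'r measure)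
      \<Rightarrow> bool" where
  "conditional_distribution M D Z R Y \<kappa> \<longleftrightarrow>
     \<kappa> \<in> D \<rightarrow>\<^sub>M prob_algebra R \<and>
     (\<forall>A\<in>sets R. \<forall>B\<in>sets D.
        emeasure M {\<omega>\<in>space M. Y \<omega> \<in> A \<and> Z \<omega> \<in> B}
          = (\<integral>\<^sup>+ \<omega>. indicator B (Z \<omega>) * emeasure (\<kappa> (Z \<omega>)) A \<partial>M))"

text \<open>
  The probability measure on the real line proportional to \<open>f d\<mu>\<close>. If the normalising constant
  is \<open>0\<close> or \<open>\<infinity>\<close>, this is the null measure, so a statement that a random variable has law
  \<open>proportional_law \<mu> f\<close> includes that the constant is positive and finite. The outer \<open>distr\<close> only
  moves measures on the nonzero reals to the real line.
\<close>

definition proportional_law :: "real measure \<Rightarrow> (real \<Rightarrow> real) \<Rightarrow> real measure" where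
  "proportional_law \<mu> f =
     distr (density \<mu> (\<lambda>t. ennreal (f t) / (\<integral>\<^sup>+ u. ennreal (f u) \<partial>\<mu>))) borel (\<lambda>t. t)"

end

theory Submission
  imports Defs
begin

text \<open>
  Call the list of the \<open>m\<close> observed values at an atom its mark. Marking thins the Poisson process,
  so the joint Laplace functional of the marked atoms factorises over the fixed atoms and an
  exponential \<open>exp (- \<integral> E (1 - exp (- l)) d(G \<times> \<nu>))\<close> for the ordinary ones. By A2 only finitely many
  ordinary atoms have a nonzero mark, and these are seen in the data.

  For given data, let the candidate posterior consist of the ordinary atoms with zero mark of an
  independent copy of \<open>\<Theta>\<close> and of independent weights with the claimed laws at the fixed and the
  observed locations. Integrating out these weights replaces the test function by one that depends
  only on location and mark, so the same factorisation shows that the candidate together with the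
  data has the Laplace functional of \<open>(\<Theta>, X)\<close>. These functionals determine the joint law, because
  on purely atomic measures the sigma-algebra is generated by sums over the atoms. Hence the candidate
  is the conditional distribution, which is almost surely unique as the sigma-algebra is countably
  generated. Its own Laplace functional factorises over disjoint sets of atoms; the independence
  statements, the Poisson property and the intensity \<open>h(0|\<theta>)\<^sup>m \<nu>(d\<theta>) G(d\<psi>)\<close> are read off from that.
\<close>

section \<open>Exponentials and Laplace transforms\<close>

text \<open>The theorem covers every version of the conditional distribution and every random
  measure with that law, on a probability space of its own. This forces a measurable enumeration of
  the atoms of an atomic measure by the measure itself. Test functionals are sums over atoms of
  \<open>ennreal\<close>-valued functions instead of integrals against the signed measure. Such sums
  always exist and see location, weight and mark together. They may be infinite, where
  \<open>en\<close> is 0, so that an infinite test function detects forbidden atoms. Each number of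
  the unit interval is \<open>en\<close> of its \<open>lneg\<close>. Hence a mean of exponentials,
  over marks or over posterior weights, is again the exponential of a test function, and all
  computations stay within one class of functionals.\<close>

definition en :: "ennreal \<Rightarrow> ennreal" where
  "en x = (if x = \<top> then 0 else ennreal (exp (- enn2real x)))"

definition lneg :: "ennreal \<Rightarrow> ennreal" where
  "lneg t = (if t = 0 then \<top> else ennreal (- ln (enn2real t)))"

lemma en_0 [simp]: "en 0 = 1" and en_top [simp]: "en \<top> = 0"
  by (auto simp: en_def)

lemma en_ennreal: "0 \<le> r \<Longrightarrow> en (ennreal r) = ennreal (exp (- r))"
  by (simp add: en_def)

lemma en_le_1 [simp]: "en x \<le> 1"
  by (auto simp: en_def)

lemma en_less_top [simp]: "en x < \<top>" "en x \<noteq> \<top>"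
  using le_less_trans[OF en_le_1[of x] ennreal_one_less_top] by auto

lemma en_add: "en (x + y) = en x * en y"
  by (cases x; cases y) (auto simp: en_ennreal ennreal_mult[symmetric] mult_exp_exp ennreal_plus[symmetric] simp del: ennreal_plus)

lemma en_sum: "finite A \<Longrightarrow> en (\<Sum>a\<in>A. f a) = (\<Prod>a\<in>A. en (f a))"
  by (induction A rule: finite_induct) (auto simp: en_add)

lemma en_eq_0_iff [simp]: "en x = 0 \<longleftrightarrow> x = \<top>"
  by (auto simp: en_def)

lemma en_eq_1_iff [simp]: "en x = 1 \<longleftrightarrow> x = 0"
  by (cases x) (auto simp: en_def)

lemma en_mono: "x \<le> y \<Longrightarrow> en y \<le> en x"
  by (cases x; cases y) (auto simp: en_def top_unique)

lemma en_measurable [measurable]: "en \<in> borel_measurable borel"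
  unfolding en_def by measurable

lemma lneg_measurable [measurable]: "lneg \<in> borel_measurable borel"
  unfolding lneg_def by measurable

lemma en_lneg: "t \<le> 1 \<Longrightarrow> en (lneg t) = t"
  by (cases t) (auto simp: en_def lneg_def top_unique ln_le_zero_iff ennreal_eq_0_iff)

lemma lneg_en: "lneg (en x) = x"
  by (cases x) (auto simp: en_def lneg_def)

lemma en_power: "en (of_nat n * x) = en x ^ n"
  by (induction n) (auto simp: en_add algebra_simps)

text \<open>Continuity of \<open>exp\<close> covers finite limits; for the limit
  \<open>\<top>\<close> the values \<open>en (f n)\<close> fall below every positive bound. Infinite
  sums thus need no separate treatment in later limits.\<close>

lemma en_LIMSEQ_SUP:
  assumes "incseq f"
  shows "(\<lambda>n. en (f n)) \<longlonglongrightarrow> en (SUP n. f n)"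
proof (cases "(SUP n. f n) = \<top>")
  case False
  have lim: "f \<longlonglongrightarrow> (SUP n. f n)"
    using assms by (rule LIMSEQ_SUP)
  have fin: "f n \<noteq> \<top>" for n
  proof -
    have "f n \<le> (SUP n. f n)" by (rule SUP_upper) simp
    then show ?thesis using False by (metis top.extremum_uniqueI)
  qed
  have "(\<lambda>n. enn2real (f n)) \<longlonglongrightarrow> enn2real (SUP n. f n)"
    using lim False by (intro tendsto_enn2real) (auto simp: less_top[symmetric])
  then have "(\<lambda>n. ennreal (exp (- enn2real (f n)))) \<longlonglongrightarrow> ennreal (exp (- enn2real (SUP n. f n)))"
    by (intro tendsto_ennrealI tendsto_exp tendsto_minus)
  then show ?thesis
    by (simp only: en_def fin False if_False)
next
  case True
  have "\<exists>N. \<forall>n\<ge>N. en (f n) < e" if e: "0 < e" for e :: ennreal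
  proof -
    \<comment> \<open>Taking \<open>r\<close> below 1 makes \<open>- ln r\<close> positive, so that
      \<open>en (ennreal (- ln r))\<close> is exactly \<open>r\<close>.\<close>
    obtain r where r: "0 < r" "ennreal r < e" "r < 1"
    proof -
      have "0 < min e 1" using e by simp
      then obtain x where "0 < x" "x < min e 1" using dense by blast
      moreover from this obtain r where "x = ennreal r" "0 \<le> r" by (cases x) (auto simp: top_unique)
      ultimately show thesis by (intro that[of r]) (auto simp: ennreal_less_one_iff)
    qed
    have "ennreal (- ln r) < (SUP n. f n)" unfolding True by simp
    then obtain N where N: "ennreal (- ln r) < f N" by (auto simp: less_SUP_iff)
    have "en (f n) < e" if "n \<ge> N" for n
    proof -
      have "en (f n) \<le> en (ennreal (- ln r))"
        using N that assms by (intro en_mono) (meson incseqD less_imp_le order_trans)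
      also have "\<dots> = ennreal r" using r by (subst en_ennreal) auto
      finally show ?thesis using r by simp
    qed
    then show ?thesis by blast
  qed
  then have "(\<lambda>n. en (f n)) \<longlonglongrightarrow> 0"
    by (auto intro!: order_tendstoI simp: eventually_sequentially)
  then show ?thesis
    unfolding True by simp
qed

lemma nn_integral_en_SUP:
  assumes [measurable]: "\<And>n. f n \<in> borel_measurable M" and inc: "\<And>x. incseq (\<lambda>n. f n x)"
    and "finite_measure M"
  shows "(\<lambda>n. \<integral>\<^sup>+x. en (f n x) \<partial>M) \<longlonglongrightarrow> (\<integral>\<^sup>+x. en (SUP n. f n x) \<partial>M)"
proof (rule nn_integral_dominated_convergence[where w = "\<lambda>_. 1"])
  interpret finite_measure M by fact
  show "(\<integral>\<^sup>+x. 1 \<partial>M) < \<infinity>"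
    by (simp add: emeasure_finite less_top[symmetric])
qed (auto intro!: en_LIMSEQ_SUP inc)

section \<open>Measures that agree on a multiplicative class\<close>

text \<open>The ramps \<open>\<phi> n\<close> rise from 0 at \<open>a\<close> with slope
  \<open>n\<close> and increase to the indicator. Stone-Weierstrass replaces them by polynomials
  with error below \<open>1 / Suc n\<close>, whence the bound 2 for dominated convergence.\<close>

lemma polynomials_tendsto_indicator:
  fixes a :: real
  obtains p :: "nat \<Rightarrow> real poly" where "\<And>n x. x \<in> {0..1} \<Longrightarrow> \<bar>poly (p n) x\<bar> \<le> 2"
    "\<And>x. x \<in> {0..1} \<Longrightarrow> (\<lambda>n. poly (p n) x) \<longlonglongrightarrow> indicator {a<..} x"
proof -
  define \<phi> where "\<phi> n x = min 1 (max 0 (real n * (x - a)))" for n x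
  have "\<exists>p. \<forall>x\<in>{0..1}. \<bar>\<phi> n x - poly p x\<bar> < 1 / Suc n" for n
  proof -
    have "continuous_on {0..1} (\<phi> n)" unfolding \<phi>_def by (intro continuous_intros)
    then obtain g where g: "real_polynomial_function g" "\<And>x. x \<in> {0..1} \<Longrightarrow> \<bar>\<phi> n x - g x\<bar> < 1 / Suc n"
      using Stone_Weierstrass_real_polynomial_function[of "{0..1}" "\<phi> n" "1 / Suc n"] by auto
    obtain c d where g_eq: "g = (\<lambda>x. \<Sum>i\<le>d. c i * x ^ i)"
      using g(1) unfolding real_polynomial_function_iff_sum by auto
    have "poly (\<Sum>i\<le>d. Polynomial.monom (c i) i) x = g x" for x
      by (simp add: g_eq poly_sum poly_monom)
    then show ?thesis using g(2) by (intro exI[of _ "\<Sum>i\<le>d. Polynomial.monom (c i) i"]) auto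
  qed
  then obtain p where p: "\<And>n x. x \<in> {0..1} \<Longrightarrow> \<bar>\<phi> n x - poly (p n) x\<bar> < 1 / Suc n"
    by metis
  show thesis
  proof (rule that[of p])
    fix n and x :: real assume x: "x \<in> {0..1}"
    have "\<bar>\<phi> n x\<bar> \<le> 1" by (auto simp: \<phi>_def)
    moreover have "1 / real (Suc n) \<le> 1" by simp
    ultimately show "\<bar>poly (p n) x\<bar> \<le> 2" using p[OF x, of n] by linarith
  next
    fix x :: real assume x: "x \<in> {0..1}"
    have \<phi>: "(\<lambda>n. \<phi> n x) \<longlonglongrightarrow> indicator {a<..} x"
    proof (cases "x > a")
      case True
      obtain N where N: "real N * (x - a) > 1"
        using reals_Archimedean3[of "x - a"] True by auto
      have "\<phi> n x = 1" if "n \<ge> N" for n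
      proof -
        have "real N * (x - a) \<le> real n * (x - a)" using that True by (intro mult_right_mono) auto
        then show ?thesis using N by (auto simp: \<phi>_def)
      qed
      then show ?thesis using True
        by (intro tendsto_eventually) (auto simp: eventually_sequentially intro!: exI[of _ N])
    next
      case False
      then have "real n * (x - a) \<le> 0" for n by (simp add: mult_nonneg_nonpos)
      then have "max 0 (real n * (x - a)) = 0" for n by (rule max_absorb1)
      then have "\<phi> n x = 0" for n by (simp add: \<phi>_def)
      then show ?thesis using False by simp
    qed
    have "(\<lambda>n. \<phi> n x - poly (p n) x) \<longlonglongrightarrow> 0"
      by (rule Lim_null_comparison[OF _ LIMSEQ_inverse_real_of_nat])
         (use p[OF x] in \<open>auto simp: inverse_eq_divide intro!: always_eventually less_imp_le\<close>)
    from tendsto_diff[OF \<phi> this] show "(\<lambda>n. poly (p n) x) \<longlonglongrightarrow> indicator {a<..} x" by simp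
  qed
qed

text \<open>The moment problem on the unit interval: equal moments give equal integrals of
  polynomials in \<open>f\<close>, and these converge boundedly to the indicator of
  \<open>a < f x\<close>.\<close>

lemma emeasure_greater_eq_if_moments_eq:
  fixes f :: "'a \<Rightarrow> real"
  assumes "finite_measure M" "finite_measure N" and sets_eq [measurable_cong]: "sets N = sets M"
    and f [measurable]: "f \<in> borel_measurable M" and f01: "\<And>x. f x \<in> {0..1}"
    and moments: "\<And>p. (\<integral>x. f x ^ p \<partial>M) = (\<integral>x. f x ^ p \<partial>N)"
  shows "emeasure M {x\<in>space M. a < f x} = emeasure N {x\<in>space M. a < f x}"
proof -
  interpret M: finite_measure M by fact
  interpret N: finite_measure N by fact
  have [measurable]: "f \<in> borel_measurable N" by measurable
  have space_eq: "space N = space M" using sets_eq by (rule sets_eq_imp_space_eq)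
  obtain p where p: "\<And>n x. x \<in> {0..1} \<Longrightarrow> \<bar>poly (p n) x\<bar> \<le> 2"
    "\<And>x. x \<in> {0..1} \<Longrightarrow> (\<lambda>n. poly (p n) x) \<longlonglongrightarrow> indicator {a<..} x"
    by (rule polynomials_tendsto_indicator[of a]) blast
  have int_pow: "integrable M (\<lambda>x. f x ^ i)" "integrable N (\<lambda>x. f x ^ i)" for i
  proof -
    have "\<bar>f x ^ i\<bar> \<le> 1" for x using f01[of x] by (simp add: power_le_one)
    then show "integrable M (\<lambda>x. f x ^ i)" "integrable N (\<lambda>x. f x ^ i)"
      by (auto intro!: M.integrable_const_bound[where B = 1] N.integrable_const_bound[where B = 1])
  qed
  have poly_eq: "(\<integral>x. poly q (f x) \<partial>M) = (\<integral>x. poly q (f x) \<partial>N)" for q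
    by (simp add: poly_altdef int_pow moments)
  have [measurable]: "(\<lambda>x. poly q (f x)) \<in> borel_measurable M" "(\<lambda>x. poly q (f x)) \<in> borel_measurable N" for q
    unfolding poly_altdef by measurable
  have limM: "(\<lambda>n. \<integral>x. poly (p n) (f x) \<partial>M) \<longlonglongrightarrow> (\<integral>x. indicator {a<..} (f x) \<partial>M)"
    by (rule integral_dominated_convergence[where w = "\<lambda>_. 2"]) (use p f01 in auto)
  have limN: "(\<lambda>n. \<integral>x. poly (p n) (f x) \<partial>N) \<longlonglongrightarrow> (\<integral>x. indicator {a<..} (f x) \<partial>N)"
    by (rule integral_dominated_convergence[where w = "\<lambda>_. 2"]) (use p f01 in auto)
  have "(\<integral>x. indicator {a<..} (f x) \<partial>M) = (\<integral>x. indicator {a<..} (f x) \<partial>N :: real)"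
    using limM limN unfolding poly_eq by (rule LIMSEQ_unique)
  moreover have int_ind: "(\<integral>x. indicator A x \<partial>L :: real) = measure L A" if "A \<subseteq> space L" for A and L :: "'a measure"
    using that by (simp add: Int_absorb2)
  moreover have "(\<integral>x. indicator {a<..} (f x) \<partial>M :: real) = measure M {x\<in>space M. a < f x}"
    by (subst int_ind[symmetric]) (auto intro!: Bochner_Integration.integral_cong simp: indicator_def simp del: Bochner_Integration.integral_indicator)
  moreover have "(\<integral>x. indicator {a<..} (f x) \<partial>N :: real) = measure N {x\<in>space M. a < f x}"
    by (subst int_ind[symmetric]) (auto intro!: Bochner_Integration.integral_cong simp: indicator_def space_eq simp del: Bochner_Integration.integral_indicator)
  ultimately show ?thesis by (simp add: M.emeasure_eq_measure N.emeasure_eq_measure)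
qed

text \<open>
  Finite measures that integrate the functions of a class \<open>\<F>\<close> closed under products alike agree
  on the sigma-algebra generated by \<open>\<F>\<close>, since polynomials approximate the indicators of its
  generators.
\<close>

definition fsigma :: "'a set \<Rightarrow> ('a \<Rightarrow> ennreal) set \<Rightarrow> 'a measure" where
  "fsigma \<Omega> \<F> = sigma \<Omega> {{x\<in>\<Omega>. a < f x} | f a. f \<in> \<F>}"

lemma space_fsigma [simp]: "space (fsigma \<Omega> \<F>) = \<Omega>"
  by (auto simp: fsigma_def intro!: space_measure_of)

lemma sets_fsigma: "sets (fsigma \<Omega> \<F>) = sigma_sets \<Omega> {{x\<in>\<Omega>. a < f x} | f a. f \<in> \<F>}"
  unfolding fsigma_def by (rule sets_measure_of) auto

lemma measurable_fsigma: "f \<in> \<F> \<Longrightarrow> f \<in> borel_measurable (fsigma \<Omega> \<F>)"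
  by (rule borel_measurableI_greater) (auto simp: sets_fsigma intro!: sigma_sets.Basic)

lemma sets_fsigma_subset:
  assumes "\<And>f. f \<in> \<F> \<Longrightarrow> f \<in> borel_measurable R"
  shows "sets (fsigma (space R) \<F>) \<subseteq> sets R"
proof -
  have "{{x\<in>space R. a < f x} | f a. f \<in> \<F>} \<subseteq> sets R"
  proof safe
    fix f and a :: ennreal assume "f \<in> \<F>"
    then have [measurable]: "f \<in> borel_measurable R" by (rule assms)
    show "{x\<in>space R. a < f x} \<in> sets R" by measurable
  qed
  then show ?thesis unfolding sets_fsigma by (rule sets.sigma_sets_subset)
qed

lemma emeasure_eq_on_fsigma:
  assumes "finite_measure M" "finite_measure N" and sets_eq [measurable_cong]: "sets N = sets M"
    and meas: "\<And>f. f \<in> \<F> \<Longrightarrow> f \<in> borel_measurable M"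
    and le1: "\<And>f x. f \<in> \<F> \<Longrightarrow> f x \<le> 1"
    and mult: "\<And>f g. f \<in> \<F> \<Longrightarrow> g \<in> \<F> \<Longrightarrow> (\<lambda>x. f x * g x) \<in> \<F>"
    and one: "(\<lambda>_. 1) \<in> \<F>"
    and eq: "\<And>f. f \<in> \<F> \<Longrightarrow> (\<integral>\<^sup>+x. f x \<partial>M) = (\<integral>\<^sup>+x. f x \<partial>N)"
    and A: "A \<in> sets (fsigma (space M) \<F>)"
  shows "emeasure M A = emeasure N A"
proof -
  interpret M: finite_measure M by fact
  interpret N: finite_measure N by fact
  have space_eq: "space N = space M" using sets_eq by (rule sets_eq_imp_space_eq)
  define G where "G J a = {x\<in>space M. \<forall>f\<in>J. a f < f x}" for J and a :: "('a \<Rightarrow> ennreal) \<Rightarrow> ennreal"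
  have Gsets: "G J a \<in> sets M" if "finite J" "J \<subseteq> \<F>" for J a
    unfolding G_def using that
  proof (intro sets.sets_Collect_finite_All)
    fix f assume "f \<in> J"
    then have [measurable]: "f \<in> borel_measurable M" using that by (auto intro: meas)
    show "{x\<in>space M. a f < f x} \<in> sets M" by measurable
  qed
  \<comment> \<open>The functions of \<open>J\<close> are handled one at a time. A free factor
    \<open>h\<close> is needed because the moments of the next \<open>f\<close> under the weighted
    measure are integrals involving \<open>h x * f x ^ p\<close>, and these products lie in
    \<open>\<F>\<close> again.\<close>
  have step: "(\<integral>\<^sup>+x. h x * indicator (G J a) x \<partial>M) = (\<integral>\<^sup>+x. h x * indicator (G J a) x \<partial>N)"
    if "finite J" "J \<subseteq> \<F>" "h \<in> \<F>" for J a h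
    using that
  proof (induction J arbitrary: h rule: finite_induct)
    case empty
    have "(\<integral>\<^sup>+x. h x * indicator (G {} a) x \<partial>M) = (\<integral>\<^sup>+x. h x \<partial>M)"
      by (intro nn_integral_cong) (auto simp: G_def)
    also have "\<dots> = (\<integral>\<^sup>+x. h x \<partial>N)" by (rule eq) fact
    also have "\<dots> = (\<integral>\<^sup>+x. h x * indicator (G {} a) x \<partial>N)"
      by (intro nn_integral_cong) (auto simp: G_def space_eq)
    finally show ?case .
  next
    case (insert f J)
    have [measurable]: "h \<in> borel_measurable M" "f \<in> borel_measurable M" "G J a \<in> sets M"
      using insert by (auto intro: meas Gsets)
    have [simp]: "f x \<noteq> \<top>" for x using le1[of f x] insert by (auto simp: top_unique)
    define w where "w x = h x * indicator (G J a) x" for x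
    have [measurable]: "w \<in> borel_measurable M" unfolding w_def by measurable
    have w1: "w x \<le> 1" for x using le1[of h x] insert by (auto simp: w_def indicator_def)
    define g where "g x = enn2real (f x)" for x
    have [measurable]: "g \<in> borel_measurable M" unfolding g_def by measurable
    have fg: "f x = ennreal (g x)" for x by (simp add: g_def less_top[symmetric])
    have g01: "g x \<in> {0..1}" for x
    proof -
      have "ennreal (g x) \<le> 1" using le1[of f x] insert.prems by (simp add: fg[symmetric])
      then show ?thesis by (simp add: g_def)
    qed
    have pw: "(\<lambda>x. h x * f x ^ p) \<in> \<F>" for p
    proof (induction p)
      case 0 then show ?case using insert by simp
    next
      case (Suc p) show ?case using mult[OF Suc, of f] insert by (simp add: mult_ac)
    qed
    have fin: "finite_measure (density M w)" "finite_measure (density N w)"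
    proof -
      have "(\<integral>\<^sup>+x. w x \<partial>M) \<le> (\<integral>\<^sup>+x. 1 \<partial>M)" by (intro nn_integral_mono w1)
      also have "\<dots> < \<infinity>" by (simp add: less_top[symmetric])
      finally show "finite_measure (density M w)"
        by (intro finite_measureI) (auto simp: emeasure_density cong: nn_integral_cong)
      have "(\<integral>\<^sup>+x. w x \<partial>N) \<le> (\<integral>\<^sup>+x. 1 \<partial>N)" by (intro nn_integral_mono w1)
      also have "\<dots> < \<infinity>" by (simp add: less_top[symmetric])
      finally show "finite_measure (density N w)"
        by (intro finite_measureI) (auto simp: emeasure_density cong: nn_integral_cong)
    qed
    have mom: "(\<integral>x. g x ^ p \<partial>density M w) = (\<integral>x. g x ^ p \<partial>density N w)" for p
    proof -
      have "(\<integral>\<^sup>+x. ennreal (g x ^ p) \<partial>density M w) = (\<integral>\<^sup>+x. (h x * f x ^ p) * indicator (G J a) x \<partial>M)"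
        using g01 by (subst nn_integral_density) (auto simp: w_def fg ennreal_power mult_ac)
      also have "\<dots> = (\<integral>\<^sup>+x. (h x * f x ^ p) * indicator (G J a) x \<partial>N)"
        using insert by (intro insert.IH pw) auto
      also have "\<dots> = (\<integral>\<^sup>+x. ennreal (g x ^ p) \<partial>density N w)"
        using g01 by (subst nn_integral_density) (auto simp: w_def fg ennreal_power mult_ac)
      finally show ?thesis using g01 by (simp add: integral_eq_nn_integral)
    qed
    have "emeasure (density M w) {x\<in>space (density M w). enn2real (a f) < g x} = emeasure (density N w) {x\<in>space (density M w). enn2real (a f) < g x}"
      by (rule emeasure_greater_eq_if_moments_eq[OF fin]) (use g01 mom sets_eq in auto)
    then have *: "(\<integral>\<^sup>+x. w x * indicator {x\<in>space M. enn2real (a f) < g x} x \<partial>M) = (\<integral>\<^sup>+x. w x * indicator {x\<in>space M. enn2real (a f) < g x} x \<partial>N)"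
      by (subst (asm) (1 2) emeasure_density) (auto simp: space_eq)
    show ?case
    proof (cases "a f = \<top>")
      case True
      then have "G (insert f J) a = {}" by (auto simp: G_def)
      then show ?thesis by simp
    next
      case False
      then obtain r where "a f = ennreal r" "0 \<le> r" by (cases "a f") auto
      then have "a f < f x \<longleftrightarrow> enn2real (a f) < g x" for x
        using fg[of x] by (simp add: ennreal_less_iff)
      then have "w x * indicator {x\<in>space M. enn2real (a f) < g x} x = h x * indicator (G (insert f J) a) x" for x
        by (auto simp: G_def indicator_def w_def)
      then show ?thesis using * by simp
    qed
  qed
  have G_eq: "emeasure M (G J a) = emeasure N (G J a)" if "finite J" "J \<subseteq> \<F>" for J a
  proof -
    have "G J a \<in> sets M" "G J a \<in> sets N" using Gsets[OF that, of a] sets_eq by auto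
    then show ?thesis using step[OF that one, of a] by simp
  qed
  \<comment> \<open>Finite intersections of superlevel sets form an Int-stable generator; where two
    families share a function, the larger threshold describes the intersection.\<close>
  let ?E = "{G J a | J a. finite J \<and> J \<subseteq> \<F>}"
  have A': "A \<in> sigma_sets (space M) ?E"
  proof -
    have "{x\<in>space M. a < f x} \<in> ?E" if "f \<in> \<F>" for f a
      using that by (auto simp: G_def intro!: exI[of _ "{f}"] exI[of _ "\<lambda>_. a"])
    then have "{{x\<in>space M. a < f x} | f a. f \<in> \<F>} \<subseteq> ?E" by blast
    then show ?thesis using A unfolding sets_fsigma
      by (blast dest: sigma_sets_mono')
  qed
  have int: "Int_stable ?E"
  proof (rule Int_stableI)
    fix A B assume "A \<in> ?E" "B \<in> ?E"
    then obtain J a K b where J: "finite J" "J \<subseteq> \<F>" "A = G J a" and K: "finite K" "K \<subseteq> \<F>" "B = G K b"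
      by auto
    let ?c = "\<lambda>f. if f \<in> J \<inter> K then max (a f) (b f) else if f \<in> J then a f else b f"
    have "A \<inter> B = G (J \<union> K) ?c" unfolding J K G_def by auto
    then show "A \<inter> B \<in> ?E" using J K by blast
  qed
  have E_sets: "sigma_sets (space M) ?E \<subseteq> sets M"
    by (rule sets.sigma_sets_subset) (auto intro: Gsets)
  have "?E \<subseteq> Pow (space M)" by (auto simp: G_def)
  from int this A' show ?thesis
  proof (induction rule: sigma_sets_induct_disjoint)
    case (basic A) then show ?case by (auto simp: G_eq)
  next
    case empty then show ?case by simp
  next
    case (compl A)
    have m: "A \<in> sets M" using compl(1) E_sets by blast
    have "emeasure M (space M) = emeasure N (space M)" using G_eq[of "{}"] by (simp add: G_def)
    moreover have "emeasure M (space M - A) = emeasure M (space M) - emeasure M A"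
      using m by (intro emeasure_compl) auto
    moreover have "emeasure N (space N - A) = emeasure N (space N) - emeasure N A"
      using m sets_eq by (intro emeasure_compl) auto
    ultimately show ?case using compl(2) by (simp add: space_eq)
  next
    case (union A)
    have m: "A i \<in> sets M" for i using union(2) E_sets by blast
    have "(\<Sum>i. emeasure M (A i)) = (\<Sum>i. emeasure N (A i))" using union by simp
    then show ?case
      using union(1) m by (subst (asm) (1 2) suminf_emeasure) (auto simp: sets_eq)
  qed
qed

text \<open>
  The completion of \<open>fsigma\<close> by sets that are null for every measure in \<open>Ms\<close>. It is needed because
  values of a signed measure are functions of the sums over its enumerated atoms only almost surely.
\<close>

definition ae_sigma :: "'a measure set \<Rightarrow> 'a measure \<Rightarrow> ('a \<Rightarrow> ennreal) set \<Rightarrow> 'a measure" where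
  "ae_sigma Ms R \<F> = sigma (space R)
     {A \<in> sets R. \<exists>A'\<in>sets (fsigma (space R) \<F>). \<forall>M\<in>Ms. AE x in M. x \<in> A \<longleftrightarrow> x \<in> A'}"

lemma space_ae_sigma [simp]: "space (ae_sigma Ms R \<F>) = space R"
  unfolding ae_sigma_def by (intro space_measure_of) (auto dest: sets.sets_into_space)

text \<open>The generating family is already a sigma-algebra, as almost sure agreement under each
  member of \<open>Ms\<close> survives countable unions. Membership can therefore be
  unfolded.\<close>

lemma sets_ae_sigma:
  assumes "\<And>M. M \<in> Ms \<Longrightarrow> space M = space R"
  shows "sets (ae_sigma Ms R \<F>) =
    {A \<in> sets R. \<exists>A'\<in>sets (fsigma (space R) \<F>). \<forall>M\<in>Ms. AE x in M. x \<in> A \<longleftrightarrow> x \<in> A'}" (is "_ = ?S")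
proof -
  have "sigma_algebra (space R) ?S"
  proof (rule sigma_algebra_iff2[THEN iffD2], intro conjI ballI allI impI)
    show "?S \<subseteq> Pow (space R)" by (auto dest: sets.sets_into_space)
    show "{} \<in> ?S" by auto
  next
    fix A assume "A \<in> ?S"
    then obtain A' where A: "A \<in> sets R" "A' \<in> sets (fsigma (space R) \<F>)" "\<And>M. M \<in> Ms \<Longrightarrow> AE x in M. x \<in> A \<longleftrightarrow> x \<in> A'"
      by auto
    have "space R - A' \<in> sets (fsigma (space R) \<F>)"
      using sets.compl_sets[OF A(2)] by simp
    moreover have "AE x in M. x \<in> space R - A \<longleftrightarrow> x \<in> space R - A'" if "M \<in> Ms" for M
      using A(3)[OF that] by eventually_elim auto
    ultimately show "space R - A \<in> ?S" using A(1) by blast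
  next
    fix A :: "nat \<Rightarrow> 'a set" assume "range A \<subseteq> ?S"
    then have "\<forall>i. \<exists>A'. A i \<in> sets R \<and> A' \<in> sets (fsigma (space R) \<F>) \<and> (\<forall>M\<in>Ms. AE x in M. x \<in> A i \<longleftrightarrow> x \<in> A')"
      by blast
    then obtain A' where A: "\<And>i. A i \<in> sets R" "\<And>i. A' i \<in> sets (fsigma (space R) \<F>)"
      "\<And>M i. M \<in> Ms \<Longrightarrow> AE x in M. x \<in> A i \<longleftrightarrow> x \<in> A' i"
      by metis
    have "AE x in M. x \<in> (\<Union>i. A i) \<longleftrightarrow> x \<in> (\<Union>i. A' i)" if "M \<in> Ms" for M
    proof -
      have "AE x in M. \<forall>i. x \<in> A i \<longleftrightarrow> x \<in> A' i"
        using A(3)[OF that] by (simp add: AE_all_countable)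
      then show ?thesis by eventually_elim auto
    qed
    then show "(\<Union>i. A i) \<in> ?S"
      using A(1,2) by (intro CollectI conjI bexI[of _ "\<Union>i. A' i"]) auto
  qed
  then show ?thesis
    unfolding ae_sigma_def by (simp add: sigma_algebra.sets_measure_of_eq)
qed

lemma measurable_ae_sigma:
  assumes "\<And>M. M \<in> Ms \<Longrightarrow> space M = space R" and "\<And>f. f \<in> \<F> \<Longrightarrow> f \<in> borel_measurable R" and "f \<in> \<F>"
  shows "f \<in> borel_measurable (ae_sigma Ms R \<F>)"
proof (rule borel_measurableI_greater)
  fix a :: ennreal
  have S: "sets (ae_sigma Ms R \<F>) =
      {A \<in> sets R. \<exists>A'\<in>sets (fsigma (space R) \<F>). \<forall>M\<in>Ms. AE x in M. x \<in> A \<longleftrightarrow> x \<in> A'}"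
    by (rule sets_ae_sigma) (rule assms(1))
  have "{x\<in>space R. a < f x} \<in> sets (fsigma (space R) \<F>)"
    unfolding sets_fsigma using assms(3) by (intro sigma_sets.Basic) auto
  moreover have "{x\<in>space R. a < f x} \<in> sets R"
    using sets_fsigma_subset[of \<F> R] calculation assms(2) by auto
  ultimately show "{x\<in>space (ae_sigma Ms R \<F>). a < f x} \<in> sets (ae_sigma Ms R \<F>)"
    unfolding S space_ae_sigma by blast
qed

text \<open>The purpose of the completion: measurability passes to a variable from a version of it
  that agrees almost surely under every measure in \<open>Ms\<close>.\<close>

lemma measurable_ae_sigma_cong:
  assumes sp: "\<And>M. M \<in> Ms \<Longrightarrow> space M = space R"
    and Y: "Y \<in> R \<rightarrow>\<^sub>M N" and Y': "Y' \<in> ae_sigma Ms R \<F> \<rightarrow>\<^sub>M N"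
    and ae: "\<And>M. M \<in> Ms \<Longrightarrow> AE x in M. Y x = Y' x"
  shows "Y \<in> ae_sigma Ms R \<F> \<rightarrow>\<^sub>M N"
proof (rule measurableI)
  show "Y x \<in> space N" if "x \<in> space (ae_sigma Ms R \<F>)" for x
    using measurable_space[OF Y] that by simp
next
  fix A assume A: "A \<in> sets N"
  have S: "sets (ae_sigma Ms R \<F>) =
      {A \<in> sets R. \<exists>A'\<in>sets (fsigma (space R) \<F>). \<forall>M\<in>Ms. AE x in M. x \<in> A \<longleftrightarrow> x \<in> A'}"
    by (rule sets_ae_sigma) (rule sp)
  have "Y' -` A \<inter> space R \<in> sets (ae_sigma Ms R \<F>)"
    using measurable_sets[OF Y' A] by simp
  then obtain B where B: "B \<in> sets (fsigma (space R) \<F>)" "\<And>M. M \<in> Ms \<Longrightarrow> AE x in M. x \<in> Y' -` A \<inter> space R \<longleftrightarrow> x \<in> B"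
    unfolding S by blast
  have "AE x in M. x \<in> Y -` A \<inter> space R \<longleftrightarrow> x \<in> B" if "M \<in> Ms" for M
    using B(2)[OF that] ae[OF that] by eventually_elim auto
  then show "Y -` A \<inter> space (ae_sigma Ms R \<F>) \<in> sets (ae_sigma Ms R \<F>)"
    using measurable_sets[OF Y A] B(1) unfolding S space_ae_sigma by blast
qed

lemma emeasure_eq_on_ae_sigma:
  assumes "finite_measure M" "finite_measure N" and sets_eq: "sets N = sets M" "sets R = sets M"
    and meas: "\<And>f. f \<in> \<F> \<Longrightarrow> f \<in> borel_measurable M"
    and le1: "\<And>f x. f \<in> \<F> \<Longrightarrow> f x \<le> 1"
    and mult: "\<And>f g. f \<in> \<F> \<Longrightarrow> g \<in> \<F> \<Longrightarrow> (\<lambda>x. f x * g x) \<in> \<F>"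
    and one: "(\<lambda>_. 1) \<in> \<F>"
    and eq: "\<And>f. f \<in> \<F> \<Longrightarrow> (\<integral>\<^sup>+x. f x \<partial>M) = (\<integral>\<^sup>+x. f x \<partial>N)"
    and A: "A \<in> sets (ae_sigma Ms R \<F>)" and Ms: "M \<in> Ms" "N \<in> Ms" "\<And>M. M \<in> Ms \<Longrightarrow> space M = space R"
  shows "emeasure M A = emeasure N A"
proof -
  have sp: "space R = space M" using sets_eq(2) by (rule sets_eq_imp_space_eq)
  have S: "sets (ae_sigma Ms R \<F>) =
      {A \<in> sets R. \<exists>A'\<in>sets (fsigma (space R) \<F>). \<forall>M\<in>Ms. AE x in M. x \<in> A \<longleftrightarrow> x \<in> A'}"
    by (rule sets_ae_sigma) (rule Ms(3))
  obtain A' where A': "A \<in> sets M" "A' \<in> sets (fsigma (space M) \<F>)"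
    "AE x in M. x \<in> A \<longleftrightarrow> x \<in> A'" "AE x in N. x \<in> A \<longleftrightarrow> x \<in> A'"
    using A Ms(1,2) unfolding S sp sets_eq by blast
  have A'': "A' \<in> sets M" using sets_fsigma_subset[of \<F> M] A'(2) meas by auto
  have "emeasure M A = emeasure M A'" using A' A'' by (intro emeasure_eq_AE) auto
  also have "\<dots> = emeasure N A'"
    by (rule emeasure_eq_on_fsigma[where \<F> = \<F>, OF assms(1,2,3) _ _ _ one _ A'(2)]) (fact meas le1 mult eq)+
  also have "\<dots> = emeasure N A" using A' A'' sets_eq by (intro emeasure_eq_AE) auto
  finally show ?thesis .
qed

text \<open>Factorisation is assumed for test functions only. It passes to events by exchanging the
  test functions for indicators, one index at a time, through the uniqueness theorem for finite
  measures.\<close>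

lemma (in prob_space) indep_sets_ae_sigma:
  fixes \<F> :: "'i \<Rightarrow> ('a \<Rightarrow> ennreal) set"
  assumes meas: "\<And>i f. i \<in> I \<Longrightarrow> f \<in> \<F> i \<Longrightarrow> f \<in> borel_measurable M"
    and le1: "\<And>i f x. i \<in> I \<Longrightarrow> f \<in> \<F> i \<Longrightarrow> f x \<le> 1"
    and mult: "\<And>i f g. i \<in> I \<Longrightarrow> f \<in> \<F> i \<Longrightarrow> g \<in> \<F> i \<Longrightarrow> (\<lambda>x. f x * g x) \<in> \<F> i"
    and one: "\<And>i. i \<in> I \<Longrightarrow> (\<lambda>_. 1) \<in> \<F> i"
    and prod: "\<And>J f. finite J \<Longrightarrow> J \<subseteq> I \<Longrightarrow> (\<And>i. i \<in> J \<Longrightarrow> f i \<in> \<F> i) \<Longrightarrow>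
       (\<integral>\<^sup>+x. (\<Prod>i\<in>J. f i x) \<partial>M) = (\<Prod>i\<in>J. \<integral>\<^sup>+x. f i x \<partial>M)"
  shows "indep_sets (\<lambda>i. sets (ae_sigma {M} M (\<F> i))) I"
proof -
  have SA: "sets (ae_sigma {M} M F) =
      {A \<in> sets M. \<exists>A'\<in>sets (fsigma (space M) F). AE x in M. x \<in> A \<longleftrightarrow> x \<in> A'}" for F
    by (subst sets_ae_sigma) auto
  show ?thesis
  proof (rule indep_setsI)
  show "sets (ae_sigma {M} M (\<F> i)) \<subseteq> events" for i
    unfolding SA by auto
next
  fix A J assume J: "J \<noteq> {}" "J \<subseteq> I" "finite J" and A: "\<forall>i\<in>J. A i \<in> sets (ae_sigma {M} M (\<F> i))"
  have A_meas: "A i \<in> sets M" if "i \<in> J" for i using bspec[OF A that] unfolding SA by blast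
  \<comment> \<open>\<open>J1\<close> is the set of indices already exchanged; the remaining ones
    still carry arbitrary test functions.\<close>
  have "(\<integral>\<^sup>+x. (\<Prod>i\<in>J1. indicator (A i) x) * (\<Prod>i\<in>J - J1. f i x) \<partial>M)
      = (\<Prod>i\<in>J1. emeasure M (A i)) * (\<Prod>i\<in>J - J1. \<integral>\<^sup>+x. f i x \<partial>M)"
    if "J1 \<subseteq> J" "\<And>i. i \<in> J - J1 \<Longrightarrow> f i \<in> \<F> i" for J1 f
    using finite_subset[OF that(1) J(3)] that
  proof (induction J1 arbitrary: f rule: finite_induct)
    case empty
    then show ?case using J by (simp add: prod)
  next
    case (insert k K)
    let ?F = "\<lambda>g i. if i = k then g else f i"
    have JK: "J - K = insert k (J - insert k K)" "k \<notin> J - insert k K" "finite (J - insert k K)"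
      using insert J by auto
    have fi: "i \<in> I" "f i \<in> \<F> i" "f i \<in> borel_measurable M" if "i \<in> J - insert k K" for i
      using insert.prems(2)[OF that] that J by (auto intro: meas)
    have kI: "k \<in> I" "k \<in> J" using insert J by auto
    \<comment> \<open>All factors except that of index \<open>k\<close>. With \<open>c\<close> its
      integral, the measures with densities \<open>w\<close> and \<open>c\<close> agree on the test
      functions of \<open>k\<close>, hence on its completed sigma-algebra.\<close>
    define w where "w x = (\<Prod>i\<in>K. indicator (A i) x) * (\<Prod>i\<in>J - insert k K. f i x)" for x
    have [measurable]: "w \<in> borel_measurable M"
      unfolding w_def using A_meas insert(4) fi
      by (intro borel_measurable_times_ennreal borel_measurable_prod_ennreal borel_measurable_indicator) auto
    define c where "c = (\<Prod>i\<in>K. emeasure M (A i)) * (\<Prod>i\<in>J - insert k K. \<integral>\<^sup>+x. f i x \<partial>M)"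
    have *: "(\<integral>\<^sup>+x. w x * g x \<partial>M) = c * (\<integral>\<^sup>+x. g x \<partial>M)" if g: "g \<in> \<F> k" for g
    proof -
      have "(\<integral>\<^sup>+x. (\<Prod>i\<in>K. indicator (A i) x) * (\<Prod>i\<in>J - K. ?F g i x) \<partial>M)
          = (\<Prod>i\<in>K. emeasure M (A i)) * (\<Prod>i\<in>J - K. \<integral>\<^sup>+x. ?F g i x \<partial>M)"
        using g insert.prems fi by (intro insert.IH) auto
      moreover have "(\<Prod>i\<in>J - K. ?F g i x) = g x * (\<Prod>i\<in>J - insert k K. f i x)" for x
        unfolding JK(1) using JK(2,3) by (subst prod.insert) (auto intro!: prod.cong arg_cong2[of _ _ _ _ times])
      moreover have "(\<Prod>i\<in>J - K. \<integral>\<^sup>+x. ?F g i x \<partial>M) = (\<integral>\<^sup>+x. g x \<partial>M) * (\<Prod>i\<in>J - insert k K. \<integral>\<^sup>+x. f i x \<partial>M)"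
        unfolding JK(1) using JK(2,3) by (subst prod.insert) (auto intro!: prod.cong arg_cong2[of _ _ _ _ times])
      ultimately show ?thesis by (simp add: w_def c_def mult_ac)
    qed
    have [measurable]: "g \<in> borel_measurable M" if "g \<in> \<F> k" for g using meas kI that by blast
    have w1: "w x \<le> 1" for x
    proof -
      have "(\<Prod>i\<in>K. indicator (A i) x) \<le> (1::ennreal)" by (intro prod_le_1) (auto simp: indicator_def)
      moreover have "(\<Prod>i\<in>J - insert k K. f i x) \<le> 1"
        by (intro prod_le_1 conjI zero_le) (rule le1[OF fi(1,2)])
      ultimately have "w x \<le> 1 * 1" unfolding w_def by (intro mult_mono) auto
      then show ?thesis by simp
    qed
    have c_eq: "c = (\<integral>\<^sup>+x. w x \<partial>M)" using *[OF one[OF kI(1)]] by (simp add: emeasure_space_1)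
    have "c \<le> 1" unfolding c_eq using nn_integral_mono[of M w "\<lambda>_. 1"] w1 by (simp add: emeasure_space_1)
    then have cfin: "c < \<infinity>" using le_less_trans[OF _ ennreal_one_less_top] by simp
    have fin1: "finite_measure (density M w)"
      using cfin by (intro finite_measureI) (auto simp: emeasure_density c_eq cong: nn_integral_cong)
    have fin2: "finite_measure (density M (\<lambda>_. c))"
      using cfin by (intro finite_measureI) (auto simp: emeasure_density emeasure_space_1 ennreal_mult_eq_top_iff cong: nn_integral_cong)
    \<comment> \<open>Null sets of \<open>M\<close> stay null under both densities, so events
      completed with respect to \<open>M\<close> are covered by the uniqueness theorem.\<close>
    have AEeq: "{A \<in> sets M. \<exists>A'\<in>sets (fsigma (space M) (\<F> k)). AE x in M. (x \<in> A) = (x \<in> A')}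
        \<subseteq> sets (ae_sigma {density M w, density M (\<lambda>_. c)} M (\<F> k))"
    proof -
      have ae: "AE x in N. P x" if "AE x in M. P x" "N \<in> {density M w, density M (\<lambda>_. c)}" for P N
        using that by (auto simp: AE_density elim: eventually_mono)
      have S: "sets (ae_sigma {density M w, density M (\<lambda>_. c)} M (\<F> k)) =
          {A \<in> sets M. \<exists>A'\<in>sets (fsigma (space M) (\<F> k)).
             \<forall>N\<in>{density M w, density M (\<lambda>_. c)}. AE x in N. x \<in> A \<longleftrightarrow> x \<in> A'}"
        by (rule sets_ae_sigma) auto
      show ?thesis
      proof
        fix B assume "B \<in> {A \<in> sets M. \<exists>A'\<in>sets (fsigma (space M) (\<F> k)). AE x in M. (x \<in> A) = (x \<in> A')}"
        then obtain B' where B: "B \<in> sets M" "B' \<in> sets (fsigma (space M) (\<F> k))" "AE x in M. (x \<in> B) = (x \<in> B')"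
          by blast
        show "B \<in> sets (ae_sigma {density M w, density M (\<lambda>_. c)} M (\<F> k))"
          unfolding S using B(1,2) ae[OF B(3)] by (intro CollectI conjI bexI[of _ B'] ballI) auto
      qed
    qed
    have "emeasure (density M w) (A k) = emeasure (density M (\<lambda>_. c)) (A k)"
    proof (rule emeasure_eq_on_ae_sigma[OF fin1 fin2, where R = M and \<F> = "\<F> k" and Ms = "{density M w, density M (\<lambda>_. c)}"])
      show "A k \<in> sets (ae_sigma {density M w, density M (\<lambda>_. c)} M (\<F> k))"
        using bspec[OF A kI(2)] AEeq unfolding SA by blast
      show "(\<integral>\<^sup>+x. f x \<partial>density M w) = (\<integral>\<^sup>+x. f x \<partial>density M (\<lambda>_. c))" if "f \<in> \<F> k" for f
        using that *[OF that] by (simp add: nn_integral_density nn_integral_cmult)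
    qed (use kI meas le1 mult one in auto)
    then have "(\<integral>\<^sup>+x. w x * indicator (A k) x \<partial>M) = c * emeasure M (A k)"
      using A_meas[OF kI(2)] by (simp add: emeasure_density nn_integral_cmult)
    moreover have "(\<Prod>i\<in>insert k K. indicator (A i) x) * (\<Prod>i\<in>J - insert k K. f i x) = w x * indicator (A k) x" for x
      using insert(1,2) by (simp add: w_def mult_ac)
    ultimately show ?case using insert(1,2) by (simp add: c_def mult_ac)
  qed
  from this[of J] have "(\<integral>\<^sup>+x. (\<Prod>i\<in>J. indicator (A i) x) \<partial>M) = (\<Prod>i\<in>J. emeasure M (A i))" by simp
  moreover have "(\<Prod>i\<in>J. indicator (A i) x) = (indicator (\<Inter>i\<in>J. A i) x :: ennreal)" for x
    using J(3,1) by (auto simp: indicator_def intro!: prod.neutral)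
  moreover have "(\<Inter>i\<in>J. A i) \<in> sets M" using J A_meas by auto
  ultimately have "emeasure M (\<Inter>i\<in>J. A i) = (\<Prod>i\<in>J. emeasure M (A i))" by simp
  then show "prob (\<Inter>j\<in>J. A j) = (\<Prod>j\<in>J. prob (A j))"
    by (simp add: emeasure_eq_measure prod_ennreal prod_nonneg)
qed
qed

section \<open>Cells of a Polish space\<close>

definition base_set :: "nat \<Rightarrow> 'a::second_countable_topology set" where
  "base_set = from_nat_into (SOME B. countable B \<and> topological_basis B)"

lemma base_set:
  shows open_base_set: "open (base_set i :: 'a::second_countable_topology set)"
    and base_set_exists: "open V \<Longrightarrow> (s::'a) \<in> V \<Longrightarrow> \<exists>i. s \<in> base_set i \<and> base_set i \<subseteq> V"
    and topological_basis_base_set: "topological_basis (range base_set :: 'a set set)"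
proof -
  let ?B = "SOME B :: 'a set set. countable B \<and> topological_basis B"
  have B: "countable ?B \<and> topological_basis ?B"
    using ex_countable_basis by (rule someI_ex)
  have "?B \<noteq> {}"
  proof
    assume "?B = {}"
    with B have "topological_basis ({} :: 'a set set)" by simp
    from topological_basisE[OF this open_UNIV, of undefined] show False by auto
  qed
  then have r: "range (base_set :: nat \<Rightarrow> 'a set) = ?B"
    using B unfolding base_set_def by (intro range_from_nat_into) auto
  then show tb: "topological_basis (range base_set :: 'a set set)" using B by simp
  show "open (base_set i :: 'a set)" using tb by (rule topological_basis_open) auto
  show "\<exists>i. s \<in> base_set i \<and> base_set i \<subseteq> V" if "open V" "s \<in> V"
    using topological_basisE[OF tb that] by (metis imageE)
qed

lemma base_set_borel [measurable]: "base_set i \<in> sets borel"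
  by (intro borel_open open_base_set)

text \<open>
  Points are coded by their membership in the first \<open>n\<close> sets of a countable base; the cells of
  level \<open>n\<close> form a finite partition.
\<close>

definition code :: "nat \<Rightarrow> 'a::second_countable_topology \<Rightarrow> bool list" where
  "code n s = map (\<lambda>i. s \<in> base_set i) [0..<n]"

definition cell :: "bool list \<Rightarrow> 'a::second_countable_topology set" where
  "cell bs = {s. code (length bs) s = bs}"

lemma length_code [simp]: "length (code n s) = n"
  by (simp add: code_def)

lemma code_Suc: "code (Suc n) s = code n s @ [s \<in> base_set n]"
  by (simp add: code_def)

lemma code_measurable [measurable]:
  "(code n :: 'a::second_countable_topology \<Rightarrow> _) \<in> borel \<rightarrow>\<^sub>M count_space UNIV"
proof (induction n)
  case 0 then show ?case by (simp add: code_def)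
next
  case (Suc n)
  have "(\<lambda>s::'a. (\<lambda>bs s. bs @ [s \<in> base_set n]) (code n s) s) \<in> borel \<rightarrow>\<^sub>M count_space UNIV"
    by (rule measurable_compose_countable[where f = "\<lambda>bs s. bs @ [s \<in> base_set n]" and g = "code n", OF _ Suc]) measurable
  then show ?case by (simp add: code_Suc[abs_def])
qed

lemma cell_borel [measurable]: "cell bs \<in> sets borel"
proof -
  have "cell bs = code (length bs) -` {bs} \<inter> space borel" by (auto simp: cell_def)
  also have "\<dots> \<in> sets borel" by (rule measurable_sets[OF code_measurable]) simp
  finally show ?thesis .
qed

lemma code_take: "m \<le> n \<Longrightarrow> code m s = take m (code n s)"
  by (simp add: code_def take_map)

lemma code_eq_mono: "m \<le> n \<Longrightarrow> code n s = code n t \<Longrightarrow> code m s = code m t"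
  by (metis code_take)

lemma code_separates:
  assumes "s \<noteq> (t::'a::{second_countable_topology, t1_space})"
  shows "\<exists>n. code n s \<noteq> code n t"
proof -
  obtain V where "open V" "s \<in> V" "t \<notin> V" using t1_space[OF assms] by auto
  then obtain i where "s \<in> base_set i" "t \<notin> base_set i" using base_set_exists by (metis subsetD)
  then have "code (Suc i) s \<noteq> code (Suc i) t" by (simp add: code_Suc)
  then show ?thesis ..
qed

text \<open>An exhaustion by bounded sets; the centre of the balls is arbitrary.\<close>

definition bb :: "nat \<Rightarrow> 'a::metric_space set" where "bb n = cball undefined (real n)"

lemma bb_borel [measurable]: "bb n \<in> sets borel"
  by (simp add: bb_def)

lemma in_bb: "s \<in> bb (nat \<lceil>dist undefined s\<rceil>)"
  by (simp add: bb_def)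

lemma UN_bb: "(\<Union>n. bb n) = (UNIV :: 'a::metric_space set)"
  using in_bb by blast

lemma bounded_bb: "bounded (bb n)"
  by (simp add: bb_def)

lemma bounded_subset_bb: "bounded B \<Longrightarrow> \<exists>n. B \<subseteq> bb n"
proof -
  assume "bounded B"
  then obtain r where "\<forall>y\<in>B. dist undefined y \<le> r" using bounded_any_center[of B undefined] by auto
  then have "B \<subseteq> cball undefined r" by auto
  also have "\<dots> \<subseteq> bb (nat \<lceil>r\<rceil>)" unfolding bb_def by (intro subset_cball real_nat_ceiling_ge)
  finally have "B \<subseteq> bb (nat \<lceil>r\<rceil>)" .
  then show ?thesis ..
qed

lemma bounded_borelD [measurable_dest]: "B \<in> bounded_borel \<Longrightarrow> B \<in> sets borel"
  by (simp add: bounded_borel_def)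

lemma bounded_borel_intros [simp, intro]:
  "{} \<in> bounded_borel" "{s} \<in> bounded_borel" "bb n \<in> bounded_borel"
  "A \<in> sets borel \<Longrightarrow> B \<in> bounded_borel \<Longrightarrow> A \<inter> B \<in> bounded_borel"
  "A \<in> bounded_borel \<Longrightarrow> B \<in> sets borel \<Longrightarrow> A \<inter> B \<in> bounded_borel"
  "A \<in> bounded_borel \<Longrightarrow> B \<in> sets borel \<Longrightarrow> A - B \<in> bounded_borel"
  "A \<in> bounded_borel \<Longrightarrow> B \<in> bounded_borel \<Longrightarrow> A \<union> B \<in> bounded_borel"
  by (auto simp: bounded_borel_def bounded_bb intro: bounded_subset)

lemma bounded_borel_subset: "A \<in> sets borel \<Longrightarrow> A \<subseteq> B \<Longrightarrow> B \<in> bounded_borel \<Longrightarrow> A \<in> bounded_borel"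
  by (auto simp: bounded_borel_def intro: bounded_subset)

text \<open>Finite intersections of base sets, the whole space for the empty list: a countable
  Int-stable generator of the Borel sets.\<close>

definition cap :: "nat list \<Rightarrow> 'a::second_countable_topology set" where
  "cap js = (\<Inter>i\<in>set js. base_set i)"

lemma cap_borel [measurable]: "cap js \<in> sets borel"
  by (auto simp: cap_def intro!: borel_open open_INT open_base_set)

text \<open>Signed measures have meaningful values on bounded sets only, so Dynkin's argument runs
  on the trace of a ball: complements are taken inside \<open>bb n\<close>. The ball itself is the
  basic case for the empty list.\<close>

lemma bounded_borel_induct [consumes 1, case_names basic empty compl union]:
  fixes B :: "'a::{metric_space, second_countable_topology} set"
  assumes B: "B \<in> bounded_borel"
    and basic: "\<And>js n. P (cap js \<inter> bb n)"
    and empty: "P {}"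
    and compl: "\<And>A n. A \<in> bounded_borel \<Longrightarrow> A \<subseteq> bb n \<Longrightarrow> P A \<Longrightarrow> P (bb n) \<Longrightarrow> P (bb n - A)"
    and union: "\<And>A :: nat \<Rightarrow> 'a set. range A \<subseteq> bounded_borel \<Longrightarrow> disjoint_family A \<Longrightarrow> bounded (\<Union>i. A i) \<Longrightarrow>
       (\<And>i. P (A i)) \<Longrightarrow> P (\<Union>i. A i)"
  shows "P B"
proof -
  obtain n where n: "B \<subseteq> bb n" using B bounded_subset_bb by (auto simp: bounded_borel_def)
  have int: "Int_stable (range (cap :: nat list \<Rightarrow> 'a set))"
  proof -
    have "cap js \<inter> cap ks = (cap (js @ ks) :: 'a set)" for js ks by (auto simp: cap_def)
    then show ?thesis by (auto simp: Int_stable_def)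
  qed
  have gen: "sets borel = sigma_sets UNIV (range (cap :: nat list \<Rightarrow> 'a set))"
  proof -
    have "(borel :: 'a measure) = sigma UNIV (range base_set)"
      by (rule borel_eq_countable_basis) (auto intro: topological_basis_base_set)
    then have "sets (borel :: 'a measure) = sets (sigma UNIV (range base_set))" by (rule arg_cong)
    also have "\<dots> = sigma_sets UNIV (range base_set)" by (rule sets_measure_of) auto
    also have "\<dots> \<subseteq> sigma_sets UNIV (range (cap :: nat list \<Rightarrow> 'a set))"
    proof (rule sigma_sets_mono')
      show "range base_set \<subseteq> range (cap :: nat list \<Rightarrow> 'a set)"
        by (auto simp: cap_def intro!: image_eqI[where x = "[_]"])
    qed
    finally have "sets (borel :: 'a measure) \<subseteq> sigma_sets UNIV (range cap)" .
    moreover have "sigma_sets (space borel) (range (cap :: nat list \<Rightarrow> 'a set)) \<subseteq> sets borel"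
      by (rule sets.sigma_sets_subset) auto
    ultimately show ?thesis by simp
  qed
  have bbn: "P (bb n)" using basic[of "[]" n] by (simp add: cap_def)
  have Pow: "range (cap :: nat list \<Rightarrow> 'a set) \<subseteq> Pow UNIV" by simp
  have *: "P (A \<inter> bb n)" if "A \<in> sigma_sets UNIV (range cap)" for A
    using int Pow that
  proof (induction rule: sigma_sets_induct_disjoint)
    case (basic A) then show ?case using assms(2) by auto
  next
    case empty then show ?case using assms(3) by simp
  next
    case (compl A)
    have "P (bb n - A \<inter> bb n)"
      using compl bbn by (intro assms(4)) (auto simp: gen[symmetric])
    moreover have "bb n - A \<inter> bb n = (UNIV - A) \<inter> bb n" by auto
    ultimately show ?case by simp
  next
    case (union A)
    have "P (\<Union>i. A i \<inter> bb n)"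
      using union by (intro assms(5))
        (auto simp: gen[symmetric] disjoint_family_on_def intro: bounded_subset[OF bounded_bb[of n]])
    then show ?case by simp
  qed
  have "P (B \<inter> bb n)" using B by (intro *) (auto simp: gen[symmetric] bounded_borel_def)
  then show ?thesis using n by (simp add: Int_absorb2)
qed

section \<open>Signed measures and their atoms\<close>

lemma space_signed_measures:
  "\<mu> \<in> space signed_measures \<longleftrightarrow> \<mu> \<in> extensional bounded_borel \<and> signed_measure \<mu>"
  by (auto simp: signed_measures_def space_restrict_space space_PiM PiE_UNIV_domain PiE_def)

lemma eval_measurable:
  assumes "B \<in> bounded_borel"
  shows "(\<lambda>\<mu>. \<mu> B) \<in> borel_measurable signed_measures"
  unfolding signed_measures_def using assms
  by (intro measurable_restrict_space1 measurable_component_singleton)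

lemma eval_measurable':
  assumes "F \<in> N \<rightarrow>\<^sub>M signed_measures" "B \<in> bounded_borel"
  shows "(\<lambda>x. F x B) \<in> borel_measurable N"
  using measurable_compose[OF assms(1) eval_measurable[OF assms(2)]] .

lemma measurable_signed_measuresI:
  assumes sp: "\<And>x. x \<in> space N \<Longrightarrow> F x \<in> space signed_measures"
    and meas: "\<And>B. B \<in> bounded_borel \<Longrightarrow> (\<lambda>x. F x B) \<in> borel_measurable N"
  shows "F \<in> N \<rightarrow>\<^sub>M signed_measures"
  unfolding signed_measures_def
proof (rule measurable_restrict_space2)
  show "F \<in> space N \<rightarrow> {\<mu>. signed_measure \<mu>}" using sp by (auto simp: space_signed_measures)
  show "F \<in> N \<rightarrow>\<^sub>M Pi\<^sub>M bounded_borel (\<lambda>_. borel)"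
    using meas sp by (intro measurable_PiM_single') (auto simp: space_signed_measures PiE_def)
qed

lemma signed_measure_sums:
  assumes "signed_measure \<mu>" "\<And>i::nat. A i \<in> bounded_borel" "disjoint_family A" "bounded (\<Union>i. A i)"
  shows "(\<lambda>i. \<mu> (A i)) sums \<mu> (\<Union>i. A i)"
  using assms unfolding signed_measure_def by blast

lemma signed_measure_empty:
  assumes "signed_measure \<mu>"
  shows "\<mu> {} = 0"
proof -
  have "(\<lambda>i::nat. \<mu> {}) sums \<mu> (\<Union>i::nat. {})"
    using assms by (intro signed_measure_sums) (auto simp: disjoint_family_on_def)
  then have "(\<lambda>i::nat. \<mu> {}) \<longlonglongrightarrow> 0" by (auto intro: summable_LIMSEQ_zero sums_summable)
  then show ?thesis by (simp add: LIMSEQ_const_iff)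
qed

lemma signed_measure_Un:
  assumes \<mu>: "signed_measure \<mu>" and A: "A \<in> bounded_borel" and B: "B \<in> bounded_borel" and disj: "A \<inter> B = {}"
  shows "\<mu> (A \<union> B) = \<mu> A + \<mu> B"
proof -
  define C where "C i = (if i = (0::nat) then A else if i = 1 then B else {})" for i
  have UN: "(\<Union>i. C i) = A \<union> B" by (auto simp: C_def split: if_splits)
  have "(\<lambda>i. \<mu> (C i)) sums \<mu> (\<Union>i. C i)"
    unfolding UN[symmetric] using A B disj
    by (intro signed_measure_sums \<mu>) (auto simp: UN C_def disjoint_family_on_def bounded_borel_def)
  moreover have "(\<lambda>i. \<mu> (C i)) sums (\<Sum>i\<in>{0,1}. \<mu> (C i))"
    by (rule sums_finite) (auto simp: C_def signed_measure_empty[OF \<mu>])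
  ultimately show ?thesis unfolding UN by (auto dest: sums_unique2 simp: C_def)
qed

lemma signed_measure_Diff:
  assumes "signed_measure \<mu>" "A \<in> bounded_borel" "B \<in> bounded_borel" "A \<subseteq> B"
  shows "\<mu> (B - A) = \<mu> B - \<mu> A"
proof -
  have "B = (B - A) \<union> A" using assms by auto
  then have "\<mu> B = \<mu> ((B - A) \<union> A)" by simp
  also have "\<dots> = \<mu> (B - A) + \<mu> A" using assms by (intro signed_measure_Un) auto
  finally show ?thesis by simp
qed

text \<open>The differences \<open>C n - C (Suc n)\<close> are disjoint and exhaust
  \<open>C 0\<close> minus the intersection; their masses telescope.\<close>

lemma signed_measure_decseq:
  assumes \<mu>: "signed_measure \<mu>" and C: "\<And>n. C n \<in> bounded_borel" and dec: "decseq C"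
  shows "(\<lambda>n. \<mu> (C n)) \<longlonglongrightarrow> \<mu> (\<Inter>n. C n)"
proof -
  define D where "D n = C n - C (Suc n)" for n
  have sub: "C (Suc n) \<subseteq> C n" for n using dec by (simp add: decseq_Suc_iff)
  have Cb: "C n \<in> sets borel" for n using C by (simp add: bounded_borel_def)
  have INT: "(\<Inter>n. C n) \<in> bounded_borel"
    using Cb by (intro bounded_borel_subset[OF _ _ C[of 0]]) auto
  have UN: "(\<Union>n. D n) = C 0 - (\<Inter>n. C n)"
  proof (intro equalityI subsetI)
    fix x assume "x \<in> C 0 - (\<Inter>n. C n)"
    then have ex: "\<exists>n. x \<notin> C n" and x0: "x \<in> C 0" by auto
    define k where "k = (LEAST n. x \<notin> C n)"
    have k: "x \<notin> C k" unfolding k_def using ex by (rule LeastI_ex)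
    then obtain j where j: "k = Suc j" using x0 by (cases k) auto
    have "x \<in> C j" using not_less_Least[of j "\<lambda>n. x \<notin> C n"] unfolding k_def[symmetric] by (simp add: j)
    then have "x \<in> D j" using k by (simp add: D_def j)
    then show "x \<in> (\<Union>n. D n)" by auto
  next
    fix x assume "x \<in> (\<Union>n. D n)"
    then obtain n where "x \<in> D n" by auto
    moreover have "C n \<subseteq> C 0" using dec by (simp add: decseqD)
    ultimately show "x \<in> C 0 - (\<Inter>n. C n)" by (auto simp: D_def)
  qed
  have disj: "disjoint_family D"
  proof -
    have "D m \<inter> D n = {}" if "m < n" for m n
    proof -
      have "C n \<subseteq> C (Suc m)" by (rule decseqD[OF dec]) (use that in simp)
      then show ?thesis by (auto simp: D_def)
    qed
    then show ?thesis unfolding disjoint_family_on_def by (metis Int_commute linorder_neqE_nat)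
  qed
  have Db: "D n \<in> bounded_borel" for n unfolding D_def using C Cb by auto
  have "bounded (\<Union>n. D n)" unfolding UN using C[of 0] by (auto simp: bounded_borel_def intro: bounded_subset)
  then have "(\<lambda>n. \<mu> (D n)) sums \<mu> (\<Union>n. D n)" using Db disj by (intro signed_measure_sums \<mu>)
  moreover have "\<mu> (\<Union>n. D n) = \<mu> (C 0) - \<mu> (\<Inter>n. C n)"
    unfolding UN by (intro signed_measure_Diff \<mu> INT C) auto
  moreover have "\<mu> (D n) = \<mu> (C n) - \<mu> (C (Suc n))" for n
    unfolding D_def by (intro signed_measure_Diff \<mu> C sub)
  ultimately have "(\<lambda>n. \<Sum>i<n. \<mu> (C i) - \<mu> (C (Suc i))) \<longlonglongrightarrow> \<mu> (C 0) - \<mu> (\<Inter>n. C n)"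
    by (simp add: sums_def)
  then have "(\<lambda>n. \<mu> (C 0) - \<mu> (C n)) \<longlonglongrightarrow> \<mu> (C 0) - \<mu> (\<Inter>n. C n)"
    by (simp only: sum_lessThan_telescope'[of "\<lambda>n. \<mu> (C n)"])
  from tendsto_diff[OF tendsto_const[of "\<mu> (C 0)"] this] show ?thesis by simp
qed

lemma cell_code_Int:
  fixes s :: "'a::{metric_space, second_countable_topology}"
  shows "decseq (\<lambda>n. cell (code n s) \<inter> B)" and "s \<in> B \<Longrightarrow> (\<Inter>n. cell (code n s) \<inter> B) = {s}"
proof -
  show "decseq (\<lambda>n. cell (code n s) \<inter> B)"
    by (auto simp: decseq_def cell_def intro: code_eq_mono)
  show "(\<Inter>n. cell (code n s) \<inter> B) = {s}" if "s \<in> B"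
    using that code_separates[of _ s] by (auto simp: cell_def)
qed

text \<open>The cells of \<open>f x\<close>, cut down to a ball containing \<open>f x\<close>,
  shrink to the point, so its mass is a limit of their masses. For each level only countably many
  cells and balls occur, which makes the approximants measurable.\<close>

lemma point_mass_measurable:
  fixes f :: "'b \<Rightarrow> 'a::{metric_space, second_countable_topology}"
  assumes f: "f \<in> borel_measurable N" and F: "F \<in> N \<rightarrow>\<^sub>M signed_measures"
  shows "(\<lambda>x. F x {f x}) \<in> borel_measurable N"
proof (rule borel_measurable_LIMSEQ_real)
  define r where "r x = nat \<lceil>dist undefined (f x)\<rceil>" for x
  have [measurable]: "r \<in> N \<rightarrow>\<^sub>M count_space UNIV" unfolding r_def using f by measurable
  have [measurable]: "(\<lambda>x. code n (f x)) \<in> N \<rightarrow>\<^sub>M count_space UNIV" for n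
    using measurable_compose[OF f code_measurable] .
  fix x assume x: "x \<in> space N"
  have \<mu>: "signed_measure (F x)" using measurable_space[OF F x] by (simp add: space_signed_measures)
  have "(\<lambda>n. F x (cell (code n (f x)) \<inter> bb (r x))) \<longlonglongrightarrow> F x (\<Inter>n. cell (code n (f x)) \<inter> bb (r x))"
    by (intro signed_measure_decseq \<mu> cell_code_Int) auto
  then show "(\<lambda>n. F x (cell (code n (f x)) \<inter> bb (r x))) \<longlonglongrightarrow> F x {f x}"
    by (subst (asm) cell_code_Int) (auto simp: r_def in_bb)
next
  define r where "r x = nat \<lceil>dist undefined (f x)\<rceil>" for x
  have r: "r \<in> N \<rightarrow>\<^sub>M count_space UNIV" unfolding r_def using f by measurable
  have c: "(\<lambda>x. code n (f x)) \<in> N \<rightarrow>\<^sub>M count_space UNIV" for n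
    using measurable_compose[OF f code_measurable] .
  fix n
  have "(\<lambda>x. (\<lambda>j x. F x (cell (code n (f x)) \<inter> bb j)) (r x) x) \<in> borel_measurable N"
  proof (rule measurable_compose_countable[OF _ r])
    fix j
    have "(\<lambda>x. (\<lambda>bs x. F x (cell bs \<inter> bb j)) (code n (f x)) x) \<in> borel_measurable N"
      by (rule measurable_compose_countable[OF _ c]) (intro eval_measurable' F, auto)
    then show "(\<lambda>x. F x (cell (code n (f x)) \<inter> bb j)) \<in> borel_measurable N" .
  qed
  then show "(\<lambda>x. F x (cell (code n (f x)) \<inter> bb (nat \<lceil>dist undefined (f x)\<rceil>))) \<in> borel_measurable N"
    by (simp add: r_def)
qed

lemma has_sum_iff_integral:
  fixes f :: "'b \<Rightarrow> real"
  shows "(f has_sum x) A \<longleftrightarrow> integrable (count_space A) f \<and> (\<integral>a. f a \<partial>count_space A) = x"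
proof -
  have 1: "f summable_on A \<longleftrightarrow> integrable (count_space A) f"
    using abs_summable_equivalent[of f A] summable_on_iff_abs_summable_on_real[of f A]
    by (simp add: Infinite_Set_Sum.abs_summable_on_def)
  have 2: "(\<integral>a. f a \<partial>count_space A) = infsum f A" if "integrable (count_space A) f"
    using infsetsum_infsum[of f A] that by (simp add: Infinite_Set_Sum.abs_summable_on_def infsetsum_def)
  show ?thesis using 1 2 by (metis has_sum_imp_summable infsumI has_sum_infsum)
qed

text \<open>Expressed through the point masses of \<open>\<mu>\<close> itself, so that no list of
  atoms has to be chosen.\<close>

definition atomic :: "('a::metric_space set \<Rightarrow> real) \<Rightarrow> bool" where
  "atomic \<mu> \<longleftrightarrow> (\<forall>B\<in>bounded_borel. ((\<lambda>s. \<mu> {s}) has_sum \<mu> B) B)"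

text \<open>
  Starting from a cell, always descend into the half of larger absolute mass. If an atom dominates
  the rest of its cell, this path converges to it; as the starting cells run through all cells, the
  limits \<open>loc \<mu> k\<close> enumerate all atoms of an atomic \<open>\<mu>\<close> measurably in \<open>\<mu>\<close>.
\<close>

primrec path :: "('a::{metric_space, second_countable_topology} set \<Rightarrow> real) \<Rightarrow> nat \<Rightarrow> bool list \<Rightarrow> nat \<Rightarrow> bool list" where
  "path \<mu> b bs 0 = bs"
| "path \<mu> b bs (Suc n) = path \<mu> b bs n @
     [\<bar>\<mu> (cell (path \<mu> b bs n @ [False]) \<inter> bb b)\<bar> \<le> \<bar>\<mu> (cell (path \<mu> b bs n @ [True]) \<inter> bb b)\<bar>]"

lemma path_measurable [measurable]: "(\<lambda>\<mu>. path \<mu> b bs n) \<in> signed_measures \<rightarrow>\<^sub>M count_space UNIV"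
proof (induction n)
  case (Suc n)
  have ev: "(\<lambda>\<mu>. \<mu> (cell bs \<inter> bb b)) \<in> borel_measurable signed_measures" for bs
    by (rule eval_measurable) auto
  have [measurable]: "Measurable.pred signed_measures
      (\<lambda>\<mu>. \<bar>\<mu> (cell (bs @ [False]) \<inter> bb b)\<bar> \<le> \<bar>\<mu> (cell (bs @ [True]) \<inter> bb b)\<bar>)" for bs
    unfolding pred_def by (intro borel_measurable_le borel_measurable_abs ev)
  show ?case unfolding path.simps
    by (rule measurable_compose_countable[where g = "\<lambda>\<mu>. path \<mu> b bs n" and
        f = "\<lambda>cs \<mu>. cs @ [\<bar>\<mu> (cell (cs @ [False]) \<inter> bb b)\<bar> \<le> \<bar>\<mu> (cell (cs @ [True]) \<inter> bb b)\<bar>]", OF _ Suc]) measurable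
qed simp

definition cell_point :: "bool list \<Rightarrow> 'a::second_countable_topology" where
  "cell_point bs = (SOME t. t \<in> cell bs)"

text \<open>A path whose points do not converge is replaced by a constant sequence. Thus the limit
  always exists, and measurability passes to it.\<close>

definition path_lim :: "('a::polish_space set \<Rightarrow> real) \<Rightarrow> nat \<Rightarrow> bool list \<Rightarrow> 'a" where
  "path_lim \<mu> b bs = lim (\<lambda>n. if Cauchy (\<lambda>n. cell_point (path \<mu> b bs n) :: 'a) then cell_point (path \<mu> b bs n) else undefined)"

lemma path_lim_measurable [measurable]: "(\<lambda>\<mu>. path_lim \<mu> b bs) \<in> borel_measurable signed_measures"
proof -
  define u :: "nat \<Rightarrow> ('a set \<Rightarrow> real) \<Rightarrow> 'a" where "u n \<mu> = cell_point (path \<mu> b bs n)" for n \<mu>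
  have [measurable]: "u n \<in> borel_measurable signed_measures" for n
    unfolding u_def by (rule measurable_compose[OF path_measurable]) simp
  show ?thesis
  proof (rule borel_measurable_LIMSEQ_metric)
    show "(\<lambda>\<mu>. if Cauchy (\<lambda>n. u n \<mu>) then u n \<mu> else undefined) \<in> borel_measurable signed_measures" for n
      by measurable
    fix \<mu> :: "'a set \<Rightarrow> real"
    have "convergent (\<lambda>n. if Cauchy (\<lambda>n. u n \<mu>) then u n \<mu> else undefined)"
      by (cases "Cauchy (\<lambda>n. u n \<mu>)") (auto simp: Cauchy_convergent_iff convergent_const)
    then show "(\<lambda>n. if Cauchy (\<lambda>n. u n \<mu>) then u n \<mu> else undefined) \<longlonglongrightarrow> path_lim \<mu> b bs"
      unfolding path_lim_def u_def[symmetric] by (simp add: convergent_LIMSEQ_iff)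
  qed
qed

lemma path_lim_eq:
  fixes s :: "'a::polish_space"
  assumes "\<And>n. n \<ge> length bs \<Longrightarrow> path \<mu> b bs (n - length bs) = code n s"
  shows "path_lim \<mu> b bs = s"
proof -
  have pt: "(cell_point (code n s) :: 'a) \<in> cell (code n s)" for n
  proof -
    have "s \<in> cell (code n s)" by (simp add: cell_def)
    then show ?thesis unfolding cell_point_def by (rule someI)
  qed
  have "(\<lambda>n. cell_point (code n s)) \<longlonglongrightarrow> s"
  proof (rule topological_tendstoI)
    fix V assume "open V" "s \<in> V"
    then obtain i where i: "s \<in> base_set i" "base_set i \<subseteq> V" using base_set_exists by blast
    have "cell_point (code n s) \<in> V" if "n \<ge> Suc i" for n
    proof -
      have "code (Suc i) (cell_point (code n s) :: 'a) = code (Suc i) s"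
        using pt[of n] that by (intro code_eq_mono[of "Suc i" n]) (auto simp: cell_def)
      then show ?thesis using i by (auto simp: code_Suc)
    qed
    then show "\<forall>\<^sub>F n in sequentially. cell_point (code n s) \<in> V"
      by (auto simp: eventually_sequentially)
  qed
  then have "(\<lambda>n. cell_point (code (n + length bs) s)) \<longlonglongrightarrow> s" by (rule LIMSEQ_ignore_initial_segment)
  moreover have "path \<mu> b bs n = code (n + length bs) s" for n
    using assms[of "n + length bs"] by simp
  ultimately have lim: "(\<lambda>n. cell_point (path \<mu> b bs n)) \<longlonglongrightarrow> s" by simp
  then have "Cauchy (\<lambda>n. cell_point (path \<mu> b bs n) :: 'a)" by (intro LIMSEQ_imp_Cauchy)
  with lim show ?thesis by (simp add: path_lim_def limI)
qed

definition loc :: "('a::polish_space set \<Rightarrow> real) \<Rightarrow> nat \<Rightarrow> 'a" where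
  "loc \<mu> k = (case from_nat k of (b, bs) \<Rightarrow> path_lim \<mu> b bs)"

lemma loc_measurable [measurable]: "(\<lambda>\<mu>. loc \<mu> k) \<in> borel_measurable signed_measures"
  unfolding loc_def by (cases "from_nat k :: nat \<times> bool list") auto

text \<open>Let \<open>F\<close> carry all but a quarter of \<open>\<bar>\<mu> {s}\<bar>\<close> of
  the absolute point masses in a ball, and start at a level where no other point of \<open>F\<close>
  shares the cell of \<open>s\<close>. From there on the half containing \<open>s\<close> has
  absolute mass at least three quarters of that value and the other half at most one quarter, so the
  path follows \<open>s\<close>.\<close>

lemma atomic_loc:
  fixes s :: "'a::polish_space"
  assumes at: "atomic \<mu>" and s: "\<mu> {s} \<noteq> 0"
  shows "\<exists>k. loc \<mu> k = s"
proof -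
  obtain b where b: "s \<in> bb b" using in_bb by blast
  define \<delta> where "\<delta> = \<bar>\<mu> {s}\<bar>"
  have \<delta>: "\<delta> > 0" using s by (simp add: \<delta>_def)
  have abs: "(\<lambda>t. \<bar>\<mu> {t}\<bar>) summable_on (bb b)"
    using at[unfolded atomic_def, rule_format, of "bb b"] summable_on_iff_abs_summable_on_real[of "\<lambda>t. \<mu> {t}" "bb b"]
    by (auto dest: has_sum_imp_summable)
  define T where "T = infsum (\<lambda>t. \<bar>\<mu> {t}\<bar>) (bb b)"
  have "((\<lambda>t. \<bar>\<mu> {t}\<bar>) has_sum T) (bb b)" unfolding T_def using abs by (rule has_sum_infsum)
  then obtain F where F: "finite F" "F \<subseteq> bb b" "dist (sum (\<lambda>t. \<bar>\<mu> {t}\<bar>) F) T < \<delta> / 4"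
    using \<delta> unfolding has_sum_def tendsto_iff eventually_finite_subsets_at_top by (metis divide_pos_pos order_refl zero_less_numeral)
  have tail: "\<bar>\<mu> A\<bar> \<le> \<delta> / 4" if A: "A \<in> bounded_borel" "A \<subseteq> bb b - F" for A
  proof -
    have hs: "((\<lambda>t. \<mu> {t}) has_sum \<mu> A) A" using at A by (simp add: atomic_def)
    have absA: "(\<lambda>t. \<bar>\<mu> {t}\<bar>) summable_on A" using abs A by (auto intro: summable_on_subset_banach)
    have "\<bar>\<mu> A\<bar> = norm (infsum (\<lambda>t. \<mu> {t}) A)" using hs by (simp add: infsumI)
    also have "\<dots> \<le> infsum (\<lambda>t. norm (\<mu> {t})) A" using absA by (intro norm_infsum_bound) auto
    also have "\<dots> = infsum (\<lambda>t. \<bar>\<mu> {t}\<bar>) A" by simp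
    finally have 1: "\<bar>\<mu> A\<bar> \<le> infsum (\<lambda>t. \<bar>\<mu> {t}\<bar>) A" .
    have "infsum (\<lambda>t. \<bar>\<mu> {t}\<bar>) (A \<union> F) = infsum (\<lambda>t. \<bar>\<mu> {t}\<bar>) A + infsum (\<lambda>t. \<bar>\<mu> {t}\<bar>) F"
      using A F absA by (intro infsum_Un_disjoint) auto
    moreover have "infsum (\<lambda>t. \<bar>\<mu> {t}\<bar>) (A \<union> F) \<le> T"
      unfolding T_def using A F abs by (intro infsum_mono_neutral) (auto intro: summable_on_subset_banach)
    ultimately show ?thesis using 1 F by (simp add: dist_real_def)
  qed
  have "\<exists>n0. \<forall>t\<in>F - {s}. code n0 t \<noteq> code n0 s"
  proof -
    have "\<forall>t\<in>F - {s}. \<exists>n. code n t \<noteq> code n s" using code_separates by auto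
    then obtain n where n: "\<And>t. t \<in> F - {s} \<Longrightarrow> code (n t) t \<noteq> code (n t) s" by metis
    have "code (Max (n ` F)) t \<noteq> code (Max (n ` F)) s" if "t \<in> F - {s}" for t
      using n[OF that] code_eq_mono[of "n t" "Max (n ` F)" t s] F that by auto
    then show ?thesis by blast
  qed
  then obtain n0 where n0: "\<And>t. t \<in> F - {s} \<Longrightarrow> code n0 t \<noteq> code n0 s" by blast
  have small: "\<bar>\<mu> (A \<inter> bb b)\<bar> \<le> \<delta> / 4" if "A \<in> sets borel" "A \<subseteq> cell (code n0 s)" "s \<notin> A" for A
    using that n0 by (intro tail) (auto simp: cell_def)
  have big: "\<bar>\<mu> (A \<inter> bb b)\<bar> \<ge> 3 * \<delta> / 4" if A: "A \<in> sets borel" "A \<subseteq> cell (code n0 s)" "s \<in> A" for A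
  proof -
    have hs: "((\<lambda>t. \<mu> {t}) has_sum \<mu> C) C" if "C \<in> bounded_borel" for C using at that by (simp add: atomic_def)
    have Ab: "A \<inter> bb b \<in> bounded_borel" "A \<inter> bb b - {s} \<in> bounded_borel" using A by auto
    have "((\<lambda>t. \<mu> {t}) has_sum (\<mu> {s} + \<mu> (A \<inter> bb b - {s}))) ({s} \<union> (A \<inter> bb b - {s}))"
      by (intro has_sum_Un_disjoint hs Ab) auto
    moreover have "{s} \<union> (A \<inter> bb b - {s}) = A \<inter> bb b" using A b by auto
    ultimately have "\<mu> (A \<inter> bb b) = \<mu> {s} + \<mu> (A \<inter> bb b - {s})" using hs[OF Ab(1)] has_sum_unique by metis
    moreover have "\<bar>\<mu> (A \<inter> bb b - {s})\<bar> \<le> \<delta> / 4"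
      using A n0 by (intro tail Ab) (auto simp: cell_def)
    ultimately show ?thesis unfolding \<delta>_def by linarith
  qed
  have path: "path \<mu> b (code n0 s) j = code (n0 + j) s" for j
  proof (induction j)
    case (Suc j)
    let ?n = "n0 + j"
    have sub: "cell (code ?n s @ [v]) \<subseteq> cell (code n0 s)" for v
    proof
      fix t assume "t \<in> cell (code ?n s @ [v])"
      then have "code ?n t = code ?n s" by (simp add: cell_def code_Suc)
      then show "t \<in> cell (code n0 s)" using code_eq_mono[of n0 ?n t s] by (simp add: cell_def)
    qed
    have "\<bar>\<mu> (cell (code ?n s @ [s \<in> base_set ?n]) \<inter> bb b)\<bar> \<ge> 3 * \<delta> / 4"
      by (intro big sub) (auto simp: cell_def code_Suc)
    moreover have "\<bar>\<mu> (cell (code ?n s @ [s \<notin> base_set ?n]) \<inter> bb b)\<bar> \<le> \<delta> / 4"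
      by (intro small sub) (auto simp: cell_def code_Suc)
    ultimately have "(\<bar>\<mu> (cell (code ?n s @ [False]) \<inter> bb b)\<bar> \<le> \<bar>\<mu> (cell (code ?n s @ [True]) \<inter> bb b)\<bar>) = (s \<in> base_set ?n)"
      using \<delta> by (cases "s \<in> base_set ?n") auto
    then show ?case by (simp add: Suc code_Suc)
  qed simp
  have "path_lim \<mu> b (code n0 s) = s"
    by (rule path_lim_eq) (use path in simp)
  then show ?thesis by (intro exI[of _ "to_nat (b, code n0 s)"]) (simp add: loc_def)
qed

text \<open>Discards limits that are no atoms and all repetitions, so that \<open>loc\<close> lists
  every atom of an atomic measure once.\<close>

definition fresh :: "('a::polish_space set \<Rightarrow> real) \<Rightarrow> nat \<Rightarrow> bool" where
  "fresh \<mu> k \<longleftrightarrow> \<mu> {loc \<mu> k} \<noteq> 0 \<and> (\<forall>j<k. loc \<mu> j \<noteq> loc \<mu> k)"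

lemma loc_measurable' [measurable (raw)]:
  "F \<in> N \<rightarrow>\<^sub>M signed_measures \<Longrightarrow> (\<lambda>x. loc (F x) k) \<in> borel_measurable N"
  by (rule measurable_compose[OF _ loc_measurable])

lemma fresh_measurable [measurable]: "Measurable.pred signed_measures (\<lambda>\<mu>. fresh \<mu> k)"
proof -
  have [measurable]: "(\<lambda>\<mu>. \<mu> {loc \<mu> k}) \<in> borel_measurable signed_measures"
    by (rule point_mass_measurable[OF loc_measurable measurable_ident_sets[OF refl]])
  have [measurable]: "Measurable.pred signed_measures (\<lambda>\<mu>. loc \<mu> j = loc \<mu> k)" for j
  proof -
    have "Measurable.pred signed_measures (\<lambda>\<mu>. dist (loc \<mu> j) (loc \<mu> k) = 0)" by measurable
    then show ?thesis by simp
  qed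
  show ?thesis unfolding fresh_def by measurable
qed

lemma fresh_measurable' [measurable (raw)]:
  "F \<in> N \<rightarrow>\<^sub>M signed_measures \<Longrightarrow> Measurable.pred N (\<lambda>x. fresh (F x) k)"
  by (rule measurable_compose[OF _ fresh_measurable])

lemma inj_on_loc: "inj_on (loc \<mu>) {k. fresh \<mu> k}"
  by (rule linorder_inj_onI) (auto simp: fresh_def)

lemma loc_image_fresh: "s \<in> range (loc \<mu>) \<Longrightarrow> \<mu> {s} \<noteq> 0 \<Longrightarrow> s \<in> loc \<mu> ` {k. fresh \<mu> k}"
proof -
  assume "s \<in> range (loc \<mu>)" and s: "\<mu> {s} \<noteq> 0"
  then have ex: "\<exists>k. loc \<mu> k = s" by auto
  define k where "k = (LEAST k. loc \<mu> k = s)"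
  have k: "loc \<mu> k = s" unfolding k_def using ex by (rule LeastI_ex)
  moreover have "loc \<mu> j \<noteq> s" if "j < k" for j using that not_less_Least k_def by blast
  ultimately show ?thesis using s by (auto simp: fresh_def intro!: image_eqI[of _ _ k])
qed

lemma bij_betw_loc:
  assumes "atomic \<mu>"
  shows "bij_betw (loc \<mu>) {k. fresh \<mu> k} {s. \<mu> {s} \<noteq> 0}"
proof -
  have "loc \<mu> ` {k. fresh \<mu> k} \<subseteq> {s. \<mu> {s} \<noteq> 0}" by (auto simp: fresh_def)
  moreover have "s \<in> loc \<mu> ` {k. fresh \<mu> k}" if "\<mu> {s} \<noteq> 0" for s
    using atomic_loc[OF assms that] that by (intro loc_image_fresh) auto
  ultimately show ?thesis using inj_on_loc[of \<mu>] by (auto simp: bij_betw_def)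
qed

text \<open>
  The two sums agree on purely atomic measures, and the second one is measurable in the measure.
\<close>

definition atom_sum :: "('a::metric_space \<Rightarrow> real \<Rightarrow> ennreal) \<Rightarrow> ('a set \<Rightarrow> real) \<Rightarrow> ennreal" where
  "atom_sum f \<mu> = (\<integral>\<^sup>+s. f s (\<mu> {s}) \<partial>count_space {s. \<mu> {s} \<noteq> 0})"

definition loc_sum :: "('a::polish_space \<Rightarrow> real \<Rightarrow> ennreal) \<Rightarrow> ('a set \<Rightarrow> real) \<Rightarrow> ennreal" where
  "loc_sum f \<mu> = (\<Sum>k. if fresh \<mu> k then f (loc \<mu> k) (\<mu> {loc \<mu> k}) else 0)"

lemma loc_sum_nn_integral: "loc_sum f \<mu> = (\<integral>\<^sup>+s. f s (\<mu> {s}) \<partial>count_space (loc \<mu> ` {k. fresh \<mu> k}))"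
proof -
  have "loc_sum f \<mu> = (\<integral>\<^sup>+k. (if fresh \<mu> k then f (loc \<mu> k) (\<mu> {loc \<mu> k}) else 0) \<partial>count_space UNIV)"
    unfolding loc_sum_def by (simp add: nn_integral_count_space_nat)
  also have "\<dots> = (\<integral>\<^sup>+k. f (loc \<mu> k) (\<mu> {loc \<mu> k}) \<partial>count_space {k. fresh \<mu> k})"
    by (subst (2) nn_integral_count_space_indicator) (auto intro!: nn_integral_cong simp: indicator_def)
  also have "\<dots> = (\<integral>\<^sup>+s. f s (\<mu> {s}) \<partial>count_space (loc \<mu> ` {k. fresh \<mu> k}))"
    by (rule nn_integral_bij_count_space) (simp add: inj_on_imp_bij_betw inj_on_loc)
  finally show ?thesis .
qed

lemma loc_sum_eq_atom_sum: "atomic \<mu> \<Longrightarrow> loc_sum f \<mu> = atom_sum f \<mu>"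
  unfolding loc_sum_nn_integral atom_sum_def using bij_betw_loc[of \<mu>] by (simp add: bij_betw_def)

lemma loc_sum_measurable [measurable (raw)]:
  fixes F :: "'b \<Rightarrow> 'a::polish_space set \<Rightarrow> real"
  assumes [measurable]: "F \<in> N \<rightarrow>\<^sub>M signed_measures"
    and f: "(\<lambda>(x, s, y). f x s y) \<in> borel_measurable (N \<Otimes>\<^sub>M borel \<Otimes>\<^sub>M borel)"
  shows "(\<lambda>x. loc_sum (f x) (F x)) \<in> borel_measurable N"
proof -
  have [measurable]: "(\<lambda>x. f x (loc (F x) k) (F x {loc (F x) k})) \<in> borel_measurable N" for k
  proof -
    have [measurable]: "(\<lambda>x. F x {loc (F x) k}) \<in> borel_measurable N"
      by (intro point_mass_measurable) measurable
    have "(\<lambda>x. (x, loc (F x) k, F x {loc (F x) k})) \<in> N \<rightarrow>\<^sub>M N \<Otimes>\<^sub>M borel \<Otimes>\<^sub>M borel" by measurable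
    from measurable_compose[OF this f] show ?thesis by simp
  qed
  show ?thesis unfolding loc_sum_def by measurable
qed

section \<open>Recovering a measure from sums over its atoms\<close>

lemma atomic_cong:
  assumes "\<And>B. B \<in> bounded_borel \<Longrightarrow> \<mu> B = \<mu>' B"
  shows "atomic \<mu> \<longleftrightarrow> atomic \<mu>'"
  unfolding atomic_def using assms by simp

lemma nn_integral_count_space_restrict:
  assumes "J \<subseteq> I"
  shows "(\<integral>\<^sup>+i. g i * indicator J i \<partial>count_space I) = (\<integral>\<^sup>+i. g i \<partial>count_space J)"
  using assms by (subst (1 2) nn_integral_count_space_indicator)
    (auto intro!: nn_integral_cong simp: indicator_def)

lemma atom_sum_UNIV: "atom_sum f \<mu> = (\<integral>\<^sup>+s. (if \<mu> {s} = 0 then 0 else f s (\<mu> {s})) \<partial>count_space UNIV)"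
  unfolding atom_sum_def
  by (subst nn_integral_count_space_indicator) (auto intro!: nn_integral_cong simp: indicator_def)

text \<open>Positive and negative weights are summed separately, since test functions are
  nonnegative. This is how functionals of the atoms determine the values on bounded sets.\<close>

lemma atomic_eval:
  fixes \<mu> :: "'a::metric_space set \<Rightarrow> real"
  assumes at: "atomic \<mu>" and B: "B \<in> bounded_borel"
  shows "\<mu> B = enn2real (atom_sum (\<lambda>s y. indicator B s * ennreal y) \<mu>)
             - enn2real (atom_sum (\<lambda>s y. indicator B s * ennreal (- y)) \<mu>)"
    and "atom_sum (\<lambda>s y. indicator B s * ennreal \<bar>y\<bar>) \<mu> < \<top>"
proof -
  have *: "(\<integral>\<^sup>+s. ennreal (g (\<mu> {s})) \<partial>count_space B) = atom_sum (\<lambda>s y. indicator B s * ennreal (g y)) \<mu>"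
    if "g 0 = 0" for g :: "real \<Rightarrow> real"
    unfolding atom_sum_UNIV using that
    by (subst nn_integral_count_space_indicator) (auto intro!: nn_integral_cong simp: indicator_def)
  have hs: "integrable (count_space B) (\<lambda>s. \<mu> {s})" "\<mu> B = (\<integral>s. \<mu> {s} \<partial>count_space B)"
    using at B has_sum_iff_integral[where f = "\<lambda>s. \<mu> {s}" and x = "\<mu> B" and A = B] by (auto simp: atomic_def)
  show "\<mu> B = enn2real (atom_sum (\<lambda>s y. indicator B s * ennreal y) \<mu>)
             - enn2real (atom_sum (\<lambda>s y. indicator B s * ennreal (- y)) \<mu>)"
    using hs(2) real_lebesgue_integral_def[OF hs(1)] *[of "\<lambda>y. y"] *[of "\<lambda>y. - y"] by simp
  show "atom_sum (\<lambda>s y. indicator B s * ennreal \<bar>y\<bar>) \<mu> < \<top>"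
    using hs(1) *[of abs] by (simp add: integrable_iff_bounded)
qed

text \<open>Absolute summability of the weights in each ball; it makes the sums over any bounded set
  converge.\<close>

definition lfin :: "'i set \<Rightarrow> ('i \<Rightarrow> 'a::metric_space) \<Rightarrow> ('i \<Rightarrow> real) \<Rightarrow> bool" where
  "lfin I p f \<longleftrightarrow> (\<forall>n. (\<integral>\<^sup>+i. indicator (bb n) (p i) * ennreal \<bar>f i\<bar> \<partial>count_space I) < \<top>)"

text \<open>The restriction to \<open>bounded_borel\<close> gives the value \<open>undefined\<close>
  elsewhere, as required of points of \<open>signed_measures\<close>.\<close>

definition psum :: "'i set \<Rightarrow> ('i \<Rightarrow> 'a::metric_space) \<Rightarrow> ('i \<Rightarrow> real) \<Rightarrow> 'a set \<Rightarrow> real" where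
  "psum I p f = (\<lambda>B\<in>bounded_borel. \<integral>i. indicator B (p i) * f i \<partial>count_space I)"

lemma psum_integrable:
  assumes "lfin I p f" "B \<in> bounded_borel"
  shows "integrable (count_space I) (\<lambda>i. indicator B (p i) * f i)"
proof (rule integrableI_bounded)
  obtain n where n: "B \<subseteq> bb n" using assms(2) bounded_subset_bb by (auto simp: bounded_borel_def)
  have "(\<integral>\<^sup>+i. ennreal (norm (indicator B (p i) * f i)) \<partial>count_space I)
      \<le> (\<integral>\<^sup>+i. indicator (bb n) (p i) * ennreal \<bar>f i\<bar> \<partial>count_space I)"
    using n by (intro nn_integral_mono) (auto simp: indicator_def)
  also have "\<dots> < \<infinity>" using assms(1) by (simp add: lfin_def)
  finally show "(\<integral>\<^sup>+i. ennreal (norm (indicator B (p i) * f i)) \<partial>count_space I) < \<infinity>" .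
qed simp

lemma psum_eq: "B \<in> bounded_borel \<Longrightarrow> psum I p f B = (\<integral>i. indicator B (p i) * f i \<partial>count_space I)"
  by (simp add: psum_def)

lemma psum_eq_nn:
  assumes "lfin I p f" "B \<in> bounded_borel"
  shows "psum I p f B = enn2real (\<integral>\<^sup>+i. indicator B (p i) * ennreal (f i) \<partial>count_space I)
     - enn2real (\<integral>\<^sup>+i. indicator B (p i) * ennreal (- f i) \<partial>count_space I)"
proof -
  have "ennreal (indicator B (p i) * f i) = indicator B (p i) * ennreal (f i)"
    "ennreal (- (indicator B (p i) * f i)) = indicator B (p i) * ennreal (- f i)" for i
    by (auto simp: indicator_def)
  then show ?thesis
    using real_lebesgue_integral_def[OF psum_integrable[OF assms]] by (simp add: psum_eq assms(2))
qed

lemma psum_signed_measure: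
  fixes p :: "'i \<Rightarrow> 'a::metric_space"
  assumes lf: "lfin I p f"
  shows "signed_measure (psum I p f)"
  unfolding signed_measure_def
proof (intro allI impI, elim conjE)
  fix A :: "nat \<Rightarrow> 'a set"
  assume A: "range A \<subseteq> bounded_borel" and disj: "disjoint_family A" and bdd: "bounded (\<Union>i. A i)"
  have UN: "(\<Union>i. A i) \<in> bounded_borel" using A bdd by (auto simp: bounded_borel_def)
  have int: "integrable (count_space I) (\<lambda>i. indicator (\<Union>i. A i) (p i) * \<bar>f i\<bar>)"
    using integrable_norm[OF psum_integrable[OF lf UN]] by (simp add: abs_mult)
  have "(\<lambda>k. \<integral>i. indicator (\<Union>j<k. A j) (p i) * f i \<partial>count_space I)
      \<longlonglongrightarrow> (\<integral>i. indicator (\<Union>j. A j) (p i) * f i \<partial>count_space I)"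
  proof (rule integral_dominated_convergence[OF _ _ int])
    show "AE i in count_space I. (\<lambda>k. indicator (\<Union>j<k. A j) (p i) * f i) \<longlonglongrightarrow> indicator (\<Union>j. A j) (p i) * f i"
      by (intro AE_I2 tendsto_mult_right LIMSEQ_indicator_UN)
    show "AE i in count_space I. norm (indicator (\<Union>j<k. A j) (p i) * f i) \<le> indicator (\<Union>j. A j) (p i) * \<bar>f i\<bar>" for k
      by (intro AE_I2) (auto simp: indicator_def)
  qed auto
  moreover have "(\<integral>i. indicator (\<Union>j<k. A j) (p i) * f i \<partial>count_space I) = (\<Sum>j<k. psum I p f (A j))" for k
  proof -
    have Aj: "A j \<in> bounded_borel" for j using A by auto
    have "indicator (\<Union>j<k. A j) (p i) * f i = (\<Sum>j<k. indicator (A j) (p i) * f i)" for i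
      using disj by (subst indicator_UN_disjoint) (auto simp: sum_distrib_right disjoint_family_on_def)
    then have "(\<integral>i. indicator (\<Union>j<k. A j) (p i) * f i \<partial>count_space I)
        = (\<integral>i. (\<Sum>j<k. indicator (A j) (p i) * f i) \<partial>count_space I)" by (simp only:)
    also have "\<dots> = (\<Sum>j<k. \<integral>i. indicator (A j) (p i) * f i \<partial>count_space I)"
      by (rule Bochner_Integration.integral_sum) (rule psum_integrable[OF lf Aj])
    finally show ?thesis by (simp only: psum_eq[OF Aj])
  qed
  ultimately show "(\<lambda>i. psum I p f (A i)) sums psum I p f (\<Union>i. A i)"
    using UN by (simp add: sums_def psum_eq)
qed

lemma psum_space: "lfin I p f \<Longrightarrow> psum I p f \<in> space signed_measures"
  unfolding space_signed_measures by (simp add: psum_signed_measure) (simp add: psum_def)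

lemma psum_has_sum:
  assumes "lfin I p f" "B \<in> bounded_borel"
  shows "(f has_sum psum I p f B) {i\<in>I. p i \<in> B}"
proof -
  have "((\<lambda>i. indicator B (p i) * f i) has_sum psum I p f B) I"
    unfolding has_sum_iff_integral using psum_integrable[OF assms] assms by (simp add: psum_eq)
  then show ?thesis
    by (subst has_sum_cong_neutral[where g = "\<lambda>i. indicator B (p i) * f i" and T = I]) auto
qed

lemma psum_point:
  assumes "inj_on p I" "i \<in> I" "lfin I p f"
  shows "psum I p f {p i} = f i"
proof -
  have "{j\<in>I. p j \<in> {p i}} = {i}" using assms by (auto dest: inj_onD)
  then have "(f has_sum psum I p f {p i}) {i}" using psum_has_sum[OF assms(3), of "{p i}"] by simp
  moreover have "(f has_sum f i) {i}" by (rule has_sum_finiteI) auto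
  ultimately show ?thesis by (rule has_sum_unique)
qed

lemma psum_point_0:
  assumes "s \<notin> p ` I" "lfin I p f"
  shows "psum I p f {s} = 0"
proof -
  have e: "{j\<in>I. p j \<in> {s}} = {}" using assms by auto
  have "(f has_sum psum I p f {s}) {}"
    using psum_has_sum[OF assms(2) bounded_borel_intros(2), of s] unfolding e .
  then show ?thesis by (simp add: has_sum_unique)
qed

lemma atomic_psum:
  fixes p :: "'i \<Rightarrow> 'a::metric_space"
  assumes "inj_on p I" "lfin I p f"
  shows "atomic (psum I p f)"
  unfolding atomic_def
proof
  fix B :: "'a set" assume B: "B \<in> bounded_borel"
  let ?J = "{i\<in>I. p i \<in> B}" and ?\<mu> = "psum I p f"
  have "(((\<lambda>s. ?\<mu> {s}) \<circ> p) has_sum ?\<mu> B) ?J"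
    using psum_has_sum[OF assms(2) B] by (subst has_sum_cong[where g = f]) (auto simp: psum_point assms)
  then have "((\<lambda>s. ?\<mu> {s}) has_sum ?\<mu> B) (p ` ?J)"
    using assms(1) by (subst has_sum_reindex) (auto intro: inj_on_subset)
  then show "((\<lambda>s. ?\<mu> {s}) has_sum ?\<mu> B) B"
  proof (subst has_sum_cong_neutral[where T = "p ` ?J"])
    show "?\<mu> {x} = 0" if "x \<in> B - p ` ?J" for x
      using that by (intro psum_point_0[OF _ assms(2)]) auto
  qed auto
qed

lemma nn_integral_psum_atoms:
  assumes "inj_on p I" "lfin I p f"
  shows "atom_sum g (psum I p f) = (\<integral>\<^sup>+i. (if f i = 0 then 0 else g (p i) (f i)) \<partial>count_space I)"
proof -
  let ?\<mu> = "psum I p f" and ?J = "{i\<in>I. f i \<noteq> 0}"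
  have "{s. ?\<mu> {s} \<noteq> 0} = p ` ?J"
    using psum_point[OF assms(1) _ assms(2)] psum_point_0[OF _ assms(2)] by fastforce
  then have bij: "bij_betw p ?J {s. ?\<mu> {s} \<noteq> 0}"
    using assms(1) by (auto simp: bij_betw_def intro: inj_on_subset)
  have "atom_sum g ?\<mu> = (\<integral>\<^sup>+i. g (p i) (?\<mu> {p i}) \<partial>count_space ?J)"
    unfolding atom_sum_def by (rule nn_integral_bij_count_space[OF bij, symmetric])
  also have "\<dots> = (\<integral>\<^sup>+i. g (p i) (f i) \<partial>count_space ?J)"
    by (intro nn_integral_cong) (simp add: psum_point assms)
  also have "\<dots> = (\<integral>\<^sup>+i. g (p i) (f i) * indicator ?J i \<partial>count_space I)"
    by (rule nn_integral_count_space_restrict[symmetric]) auto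
  also have "\<dots> = (\<integral>\<^sup>+i. (if f i = 0 then 0 else g (p i) (f i)) \<partial>count_space I)"
    by (intro nn_integral_cong) (auto simp: indicator_def)
  finally show ?thesis .
qed

text \<open>Unconditional convergence of real sums is absolute convergence, so the
  \<open>has_sum\<close> in \<open>weighted_atoms\<close> already gives local absolute
  summability.\<close>

lemma weighted_atoms_psum:
  assumes w: "weighted_atoms K w p \<mu>"
  shows "lfin {k. enat k < K} p w" and "\<And>B. B \<in> bounded_borel \<Longrightarrow> \<mu> B = psum {k. enat k < K} p w B"
proof -
  let ?I = "{k. enat k < K}"
  have *: "integrable (count_space ?I) (\<lambda>i. indicator B (p i) * w i) \<and> (\<integral>i. indicator B (p i) * w i \<partial>count_space ?I) = \<mu> B"
    if "B \<in> bounded_borel" for B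
  proof -
    have "(w has_sum \<mu> B) {k. enat k < K \<and> p k \<in> B}" using w that by (simp add: weighted_atoms_def)
    then have "((\<lambda>i. indicator B (p i) * w i) has_sum \<mu> B) ?I"
      by (subst has_sum_cong_neutral[where g = w and T = "{k. enat k < K \<and> p k \<in> B}"]) auto
    then show ?thesis unfolding has_sum_iff_integral .
  qed
  show "lfin ?I p w" unfolding lfin_def
  proof
    fix n
    have "(\<integral>\<^sup>+i. ennreal (norm (indicator (bb n) (p i) * w i)) \<partial>count_space ?I) < \<infinity>"
      using *[of "bb n"] by (simp add: integrable_iff_bounded)
    moreover have "ennreal (norm (indicator (bb n) (p i) * w i)) = indicator (bb n) (p i) * ennreal \<bar>w i\<bar>" for i
      by (auto simp: indicator_def)
    ultimately show "(\<integral>\<^sup>+i. indicator (bb n) (p i) * ennreal \<bar>w i\<bar> \<partial>count_space ?I) < \<top>" by simp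
  qed
  show "\<mu> B = psum ?I p w B" if "B \<in> bounded_borel" for B using *[OF that] that by (simp add: psum_eq)
qed

section \<open>The sigma-algebra on signed measures\<close>

lemma loc_sum_fresh: "loc_sum g \<mu> = (\<integral>\<^sup>+k. g (loc \<mu> k) (\<mu> {loc \<mu> k}) \<partial>count_space {k. fresh \<mu> k})"
  unfolding loc_sum_nn_integral
  by (rule nn_integral_bij_count_space[symmetric]) (simp add: inj_on_imp_bij_betw inj_on_loc)

text \<open>The right-hand side consists of countably many measurable conditions. They suffice
  because both \<open>\<mu>\<close> and the sum over its listed atoms are signed measures, so
  equality on the generator extends to all bounded Borel sets.\<close>

lemma atomic_iff_loc_sum:
  fixes \<mu> :: "'a::polish_space set \<Rightarrow> real"
  assumes sm: "signed_measure \<mu>"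
  shows "atomic \<mu> \<longleftrightarrow> (\<forall>n. loc_sum (\<lambda>s y. indicator (bb n) s * ennreal \<bar>y\<bar>) \<mu> < \<top>) \<and>
    (\<forall>js n. \<mu> (cap js \<inter> bb n) = enn2real (loc_sum (\<lambda>s y. indicator (cap js \<inter> bb n) s * ennreal y) \<mu>)
             - enn2real (loc_sum (\<lambda>s y. indicator (cap js \<inter> bb n) s * ennreal (- y)) \<mu>))"
    (is "_ \<longleftrightarrow> ?A \<and> ?B")
proof
  assume at: "atomic \<mu>"
  have "cap js \<inter> bb n \<in> bounded_borel" for js n by simp
  then show "?A \<and> ?B" unfolding loc_sum_eq_atom_sum[OF at] using atomic_eval[OF at] by blast
next
  assume AB: "?A \<and> ?B"
  let ?I = "{k. fresh \<mu> k}" and ?w = "\<lambda>k. \<mu> {loc \<mu> k}"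
  let ?\<nu> = "psum ?I (loc \<mu>) ?w"
  have lf: "lfin ?I (loc \<mu>) ?w" using AB unfolding lfin_def loc_sum_fresh by blast
  have sm': "signed_measure ?\<nu>" by (rule psum_signed_measure[OF lf])
  have eq: "\<mu> B = ?\<nu> B" if "B \<in> bounded_borel" for B
    using that
  proof (induction rule: bounded_borel_induct)
    case (basic js n)
    then show ?case using AB by (subst psum_eq_nn[OF lf]) (simp_all add: loc_sum_fresh)
  next
    case empty
    then show ?case by (simp add: signed_measure_empty sm sm')
  next
    case (compl A n)
    then show ?case by (simp add: signed_measure_Diff[OF sm] signed_measure_Diff[OF sm'])
  next
    case (union A)
    have "(\<lambda>i. \<mu> (A i)) sums \<mu> (\<Union>i. A i)" using union by (intro signed_measure_sums sm) auto
    moreover have "(\<lambda>i. ?\<nu> (A i)) sums ?\<nu> (\<Union>i. A i)" using union by (intro signed_measure_sums sm') auto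
    ultimately show ?case using union by (simp add: sums_unique2)
  qed
  have "atomic ?\<nu>" by (rule atomic_psum[OF inj_on_loc lf])
  then show "atomic \<mu>" using atomic_cong[of \<mu> ?\<nu>] eq by blast
qed

lemma atomic_measurable [measurable]: "Measurable.pred signed_measures (atomic :: ('a::polish_space set \<Rightarrow> real) \<Rightarrow> bool)"
proof -
  have ls: "(\<lambda>\<mu>. loc_sum f \<mu>) \<in> borel_measurable signed_measures"
    if "(\<lambda>(s::'a, y). f s y) \<in> borel_measurable (borel \<Otimes>\<^sub>M borel)" for f
    using that by (intro loc_sum_measurable) (auto intro: measurable_compose[OF measurable_snd])
  have [measurable]: "(\<lambda>\<mu> :: 'a set \<Rightarrow> real. loc_sum (\<lambda>s y. indicator (bb n) s * ennreal \<bar>y\<bar>) \<mu>) \<in> borel_measurable signed_measures" for n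
    by (rule ls) measurable
  have 1: "(\<lambda>\<mu> :: 'a set \<Rightarrow> real. loc_sum (\<lambda>s y. indicator (cap js \<inter> bb n) s * ennreal y) \<mu>) \<in> borel_measurable signed_measures" for js n
    by (rule ls) measurable
  have 2: "(\<lambda>\<mu> :: 'a set \<Rightarrow> real. loc_sum (\<lambda>s y. indicator (cap js \<inter> bb n) s * ennreal (- y)) \<mu>) \<in> borel_measurable signed_measures" for js n
    by (rule ls) measurable
  have [measurable]: "Measurable.pred signed_measures (\<lambda>\<mu> :: 'a set \<Rightarrow> real.
      \<mu> (cap js \<inter> bb n) = enn2real (loc_sum (\<lambda>s y. indicator (cap js \<inter> bb n) s * ennreal y) \<mu>)
             - enn2real (loc_sum (\<lambda>s y. indicator (cap js \<inter> bb n) s * ennreal (- y)) \<mu>))" for js n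
    unfolding pred_def
    by (intro borel_measurable_eq borel_measurable_diff borel_measurable_enn2real[OF 1]
        borel_measurable_enn2real[OF 2] eval_measurable) simp
  have "Measurable.pred signed_measures (\<lambda>\<mu> :: 'a set \<Rightarrow> real.
    (\<forall>n. loc_sum (\<lambda>s y. indicator (bb n) s * ennreal \<bar>y\<bar>) \<mu> < \<top>) \<and>
    (\<forall>js n. \<mu> (cap js \<inter> bb n) = enn2real (loc_sum (\<lambda>s y. indicator (cap js \<inter> bb n) s * ennreal y) \<mu>)
             - enn2real (loc_sum (\<lambda>s y. indicator (cap js \<inter> bb n) s * ennreal (- y)) \<mu>)))"
    by measurable
  then show ?thesis
    by (rule measurable_cong[THEN iffD1, rotated]) (simp add: atomic_iff_loc_sum space_signed_measures)
qed

text \<open>Rational thresholds for the values on the countable generator suffice; induction over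
  bounded Borel sets then makes all evaluations measurable. Countability is what allows the versions
  of a conditional distribution to be compared.\<close>

lemma signed_measures_countably_generated:
  "\<exists>E. countable E \<and> Int_stable E \<and> E \<subseteq> Pow (space signed_measures) \<and> space signed_measures \<in> E \<and>
     sets (signed_measures :: ('a::polish_space set \<Rightarrow> real) measure) = sigma_sets (space signed_measures) E"
proof -
  let ?S = "signed_measures :: ('a set \<Rightarrow> real) measure"
  define c where "c = (\<lambda>(q, js, n). {\<mu>\<in>space ?S. real_of_rat q < \<mu> (cap js \<inter> bb n)})"
  define E where "E = (\<lambda>F. space ?S \<inter> (\<Inter>i\<in>F. c i)) ` {F. finite F}"
  have cS: "c i \<in> sets ?S" for i
  proof -
    obtain q js n where i: "i = (q, js, n)" by (cases i) auto
    have "(\<lambda>\<mu>. \<mu> (cap js \<inter> bb n)) \<in> borel_measurable ?S" by (rule eval_measurable) simp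
    then show ?thesis unfolding i c_def by simp measurable
  qed
  have ES: "E \<subseteq> sets ?S"
  proof
    fix A assume "A \<in> E"
    then obtain F where F: "finite F" "A = space ?S \<inter> (\<Inter>i\<in>F. c i)" by (auto simp: E_def)
    show "A \<in> sets ?S" unfolding F(2) using F(1)
    proof (induction F rule: finite_induct)
      case (insert i F)
      have "space ?S \<inter> (\<Inter>i\<in>insert i F. c i) = c i \<inter> (space ?S \<inter> (\<Inter>i\<in>F. c i))" by auto
      then show ?case using insert cS by (metis sets.Int)
    qed simp
  qed
  have pow: "E \<subseteq> Pow (space ?S)" by (auto simp: E_def)
  have "(\<lambda>\<mu>. \<mu>) \<in> sigma (space ?S) E \<rightarrow>\<^sub>M ?S"
  proof (rule measurable_signed_measuresI)
    have sp: "space (sigma (space ?S) E) = space ?S" using pow by (rule space_measure_of)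
    show "\<mu> \<in> space ?S" if "\<mu> \<in> space (sigma (space ?S) E)" for \<mu> using that sp by simp
    fix B :: "'a set" assume "B \<in> bounded_borel"
    then show "(\<lambda>\<mu>. \<mu> B) \<in> borel_measurable (sigma (space ?S) E)"
    proof (induction rule: bounded_borel_induct)
      case (basic js n)
      have c_sets: "c i \<in> sets (sigma (space ?S) E)" for i
      proof -
        have "c i = space ?S \<inter> (\<Inter>i\<in>{i}. c i)" by (auto simp: c_def)
        then have "c i \<in> E" unfolding E_def by (intro image_eqI[of _ _ "{i}"]) auto
        then show ?thesis using pow by (simp add: sets_measure_of)
      qed
      show ?case
      proof (rule borel_measurable_iff_greater[THEN iffD2, rule_format])
        fix a :: real
        have "{w \<in> space (sigma (space ?S) E). a < w (cap js \<inter> bb n)} = (\<Union>q\<in>{q. a < real_of_rat q}. c (q, js, n))"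
          unfolding sp c_def using of_rat_dense by (auto intro: less_trans)
        also have "\<dots> \<in> sets (sigma (space ?S) E)"
          by (rule sets.countable_UN'') (auto simp: c_sets)
        finally show "{w \<in> space (sigma (space ?S) E). a < w (cap js \<inter> bb n)} \<in> sets (sigma (space ?S) E)" .
      qed
    next
      case empty
      show ?case
        by (rule measurable_cong[THEN iffD2, of _ _ "\<lambda>_. 0"])
           (simp_all add: sp space_signed_measures signed_measure_empty)
    next
      case (compl A n)
      have "(\<lambda>\<mu>. \<mu> (bb n) - \<mu> A) \<in> borel_measurable (sigma (space ?S) E)" using compl by measurable
      then show ?case
        by (rule measurable_cong[THEN iffD1, rotated])
           (use compl in \<open>simp add: sp space_signed_measures signed_measure_Diff\<close>)
    next
      case (union A)
      show ?case
      proof (rule borel_measurable_LIMSEQ_real)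
        show "(\<lambda>\<mu>. \<Sum>i<k. \<mu> (A i)) \<in> borel_measurable (sigma (space ?S) E)" for k
          by (intro borel_measurable_sum union)
        fix \<mu> assume "\<mu> \<in> space (sigma (space ?S) E)"
        then have "signed_measure \<mu>" unfolding sp by (simp add: space_signed_measures)
        then show "(\<lambda>k. \<Sum>i<k. \<mu> (A i)) \<longlonglongrightarrow> \<mu> (\<Union>i. A i)"
          using union signed_measure_sums[of \<mu> A] by (auto simp: sums_def)
      qed
    qed
  qed
  from measurable_sets[OF this] have "sets ?S \<subseteq> sigma_sets (space ?S) E"
    using pow by (auto simp: sets_measure_of space_measure_of dest: sets.sets_into_space)
  moreover have "sigma_sets (space ?S) E \<subseteq> sets ?S" by (rule sets.sigma_sets_subset[OF ES])
  moreover have "countable E"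
    unfolding E_def by (intro countable_image countable_Collect_finite)
  moreover have "Int_stable E"
    unfolding Int_stable_def
  proof (intro ballI)
    fix a b assume "a \<in> E" "b \<in> E"
    then obtain F G where F: "finite F" "a = space ?S \<inter> (\<Inter>i\<in>F. c i)" and G: "finite G" "b = space ?S \<inter> (\<Inter>i\<in>G. c i)"
      unfolding E_def by blast
    have "a \<inter> b = space ?S \<inter> (\<Inter>i\<in>F \<union> G. c i)" unfolding F G by auto
    then show "a \<inter> b \<in> E" unfolding E_def using F G by blast
  qed
  moreover have "space ?S \<in> E" unfolding E_def by (intro image_eqI[of _ _ "{}"]) auto
  ultimately show ?thesis using pow by blast
qed

section \<open>Uniqueness of regular conditional distributions\<close>

text \<open>For a single event the two versions are densities of the same measure with respect to
  the law of \<open>Z\<close>, hence equal almost everywhere. A countable Int-stable generator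
  merges the exceptional sets into one null set.\<close>

lemma conditional_distribution_unique:
  assumes M: "prob_space M" and Z: "Z \<in> M \<rightarrow>\<^sub>M D"
    and E: "countable E" "Int_stable E" "E \<subseteq> Pow (space R)" "space R \<in> E" "sets R = sigma_sets (space R) E"
    and \<kappa>: "conditional_distribution M D Z R Y \<kappa>" and \<kappa>': "conditional_distribution M D Z R Y \<kappa>'"
  shows "AE \<omega> in M. \<kappa> (Z \<omega>) = \<kappa>' (Z \<omega>)"
proof -
  interpret prob_space M by fact
  interpret Q: prob_space "distr M D Z" using Z by (rule prob_space_distr)
  have Esets: "A \<in> sets R" if "A \<in> E" for A using that by (auto simp: E(5))
  have meas: "k \<in> D \<rightarrow>\<^sub>M prob_algebra R" if "conditional_distribution M D Z R Y k" for k
    using that by (simp add: conditional_distribution_def)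
  have em: "(\<lambda>z. emeasure (k z) A) \<in> borel_measurable D"
    if "conditional_distribution M D Z R Y k" "A \<in> sets R" for k A
    using measurable_prob_algebraD[OF meas[OF that(1)]] that(2)
    by (rule measurable_emeasure_kernel)
  have "AE z in distr M D Z. emeasure (\<kappa> z) A = emeasure (\<kappa>' z) A" if A: "A \<in> E" for A
  proof (rule Q.density_unique)
    note [measurable] = Z em[OF \<kappa> Esets[OF A]] em[OF \<kappa>' Esets[OF A]]
    show "(\<lambda>z. emeasure (\<kappa> z) A) \<in> borel_measurable (distr M D Z)" "(\<lambda>z. emeasure (\<kappa>' z) A) \<in> borel_measurable (distr M D Z)"
      by measurable
    show "density (distr M D Z) (\<lambda>z. emeasure (\<kappa> z) A) = density (distr M D Z) (\<lambda>z. emeasure (\<kappa>' z) A)"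
    proof (rule measure_eqI)
      fix B assume "B \<in> sets (density (distr M D Z) (\<lambda>z. emeasure (\<kappa> z) A))"
      then have [measurable]: "B \<in> sets D" by simp
      have *: "emeasure (density (distr M D Z) (\<lambda>z. emeasure (k z) A)) B = emeasure M {\<omega>\<in>space M. Y \<omega> \<in> A \<and> Z \<omega> \<in> B}"
        if k: "conditional_distribution M D Z R Y k" for k
      proof -
        note [measurable] = em[OF k Esets[OF A]]
        have "emeasure (density (distr M D Z) (\<lambda>z. emeasure (k z) A)) B = (\<integral>\<^sup>+ \<omega>. indicator B (Z \<omega>) * emeasure (k (Z \<omega>)) A \<partial>M)"
          by (simp add: emeasure_density nn_integral_distr mult.commute)
        then show ?thesis using k Esets[OF A] by (simp add: conditional_distribution_def)
      qed
      show "emeasure (density (distr M D Z) (\<lambda>z. emeasure (\<kappa> z) A)) B = emeasure (density (distr M D Z) (\<lambda>z. emeasure (\<kappa>' z) A)) B"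
        using *[OF \<kappa>] *[OF \<kappa>'] by simp
    qed simp
  qed
  then have "AE z in distr M D Z. \<forall>A\<in>E. emeasure (\<kappa> z) A = emeasure (\<kappa>' z) A"
    using E(1) by (simp add: AE_ball_countable)
  then have ae: "AE \<omega> in M. \<forall>A\<in>E. emeasure (\<kappa> (Z \<omega>)) A = emeasure (\<kappa>' (Z \<omega>)) A"
    by (rule AE_distrD[OF Z])
  have "AE \<omega> in M. \<omega> \<in> space M" by simp
  with ae show ?thesis
  proof eventually_elim
    case (elim \<omega>)
    have z: "Z \<omega> \<in> space D" using elim(2) Z by (auto dest: measurable_space)
    have k: "sets (k (Z \<omega>)) = sets R" "prob_space (k (Z \<omega>))" if "conditional_distribution M D Z R Y k" for k
      using measurable_space[OF meas[OF that] z] by (auto simp: space_prob_algebra)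
    show ?case
    proof (rule measure_eqI_generator_eq[OF E(2,3), where A = "\<lambda>_. space R"])
      show "emeasure (\<kappa> (Z \<omega>)) (space R) \<noteq> \<infinity>"
        using prob_space.emeasure_space_1[OF k(2)[OF \<kappa>]] sets_eq_imp_space_eq[OF k(1)[OF \<kappa>]] by simp
    qed (use elim(1) E k[OF \<kappa>] k[OF \<kappa>'] in auto)
  qed
qed

section \<open>Poisson processes\<close>

lemma nn_integral_kernel_measurable:
  assumes sets: "\<And>\<omega>. \<omega> \<in> space A \<Longrightarrow> sets (N \<omega>) = sets F"
    and em: "\<And>B. B \<in> sets F \<Longrightarrow> (\<lambda>\<omega>. emeasure (N \<omega>) B) \<in> borel_measurable A"
    and l: "l \<in> borel_measurable F"
  shows "(\<lambda>\<omega>. \<integral>\<^sup>+x. l x \<partial>N \<omega>) \<in> borel_measurable A"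
  using l
proof (induction rule: borel_measurable_induct)
  case (cong f g)
  have "(\<integral>\<^sup>+x. f x \<partial>N \<omega>) = (\<integral>\<^sup>+x. g x \<partial>N \<omega>)" if "\<omega> \<in> space A" for \<omega>
    using cong(3) sets_eq_imp_space_eq[OF sets[OF that]] by (intro nn_integral_cong) auto
  then show ?case using cong(4) by (subst (asm) measurable_cong) auto
next
  case (set B)
  then show ?case using em[OF set] by (subst measurable_cong[where g = "\<lambda>\<omega>. emeasure (N \<omega>) B"]) (auto simp: sets)
next
  case (mult u c)
  have "(\<lambda>\<omega>. c * (\<integral>\<^sup>+x. u x \<partial>N \<omega>)) \<in> borel_measurable A" using mult by measurable
  then show ?case
    by (rule measurable_cong[THEN iffD1, rotated])
       (use mult in \<open>auto intro!: nn_integral_cmult[symmetric] simp: measurable_cong_sets[OF sets refl]\<close>)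
next
  case (add u v)
  have "(\<lambda>\<omega>. (\<integral>\<^sup>+x. v x \<partial>N \<omega>) + (\<integral>\<^sup>+x. u x \<partial>N \<omega>)) \<in> borel_measurable A" using add by measurable
  then show ?case
    by (rule measurable_cong[THEN iffD1, rotated])
       (use add in \<open>auto intro!: nn_integral_add[symmetric] simp: measurable_cong_sets[OF sets refl]\<close>)
next
  case (seq U)
  have "(\<lambda>\<omega>. SUP i. (\<integral>\<^sup>+x. U i x \<partial>N \<omega>)) \<in> borel_measurable A" using seq by measurable
  then show ?case
    by (rule measurable_cong[THEN iffD1, rotated])
       (use seq in \<open>auto intro!: nn_integral_monotone_convergence_SUP[symmetric] simp: measurable_cong_sets[OF sets refl] image_comp\<close>)
qed

text \<open>The generating function of the Poisson law at \<open>en y\<close>. The value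
  \<open>y = \<top>\<close> is included, with \<open>en y = 0\<close> and only the term
  \<open>n = 0\<close> left.\<close>

lemma sums_poisson_en:
  assumes q: "0 \<le> q"
  shows "(\<Sum>n. en y ^ n * ennreal (exp (- q) * q ^ n / fact n)) = en ((1 - en y) * ennreal q)"
proof -
  obtain u where u: "en y = ennreal u" "0 \<le> u" "u \<le> 1"
    using en_le_1[of y] by (cases "en y") auto
  have "(\<lambda>n. exp (- q) * ((u * q) ^ n /\<^sub>R fact n)) sums (exp (- q) * exp (u * q))"
    by (intro sums_mult exp_converges)
  then have "(\<lambda>n. u ^ n * (exp (- q) * q ^ n / fact n)) sums exp (- ((1 - u) * q))"
    by (simp add: mult_exp_exp algebra_simps power_mult_distrib divide_inverse scaleR_conv_of_real)
  then have "(\<Sum>n. ennreal (u ^ n * (exp (- q) * q ^ n / fact n))) = ennreal (exp (- ((1 - u) * q)))"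
    using u q by (intro suminf_ennreal_eq) auto
  moreover have "ennreal (u ^ n * (exp (- q) * q ^ n / fact n)) = en y ^ n * ennreal (exp (- q) * q ^ n / fact n)" for n
    unfolding u(1) ennreal_power[OF u(2)] using u q by (intro ennreal_mult) auto
  moreover have "(1 - en y) * ennreal q = ennreal ((1 - u) * q)"
    using u q by (simp add: ennreal_mult ennreal_minus flip: ennreal_1)
  ultimately show ?thesis using u q by (simp add: en_ennreal)
qed

locale poisson = prob_space M for M :: "'w measure" +
  fixes N :: "'w \<Rightarrow> 'b measure" and F :: "'b measure"
  assumes poisson: "poisson_process M N F" and sigma_finite_F: "sigma_finite_measure F"
begin

lemma sets_N: "\<omega> \<in> space M \<Longrightarrow> sets (N \<omega>) = sets F"
  and N_values: "\<omega> \<in> space M \<Longrightarrow> A \<in> sets F \<Longrightarrow> emeasure (N \<omega>) A \<in> insert \<infinity> (range of_nat)"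
  and N_measurable: "A \<in> sets F \<Longrightarrow> (\<lambda>\<omega>. emeasure (N \<omega>) A) \<in> borel_measurable M"
  using poisson by (auto simp: poisson_process_def)

lemma space_N: "\<omega> \<in> space M \<Longrightarrow> space (N \<omega>) = space F"
  by (rule sets_eq_imp_space_eq) (rule sets_N)

lemma prob_N: "A \<in> sets F \<Longrightarrow> emeasure F A < \<infinity> \<Longrightarrow>
  prob {\<omega>\<in>space M. emeasure (N \<omega>) A = of_nat n} = exp (- measure F A) * measure F A ^ n / fact n"
  using poisson by (auto simp: poisson_process_def)

lemma laplace_set:
  assumes A: "A \<in> sets F" and fin: "emeasure F A < \<infinity>"
  shows "(\<integral>\<^sup>+\<omega>. en (y * emeasure (N \<omega>) A) \<partial>M) = en ((1 - en y) * emeasure F A)"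
proof -
  define C where "C n = {\<omega>\<in>space M. emeasure (N \<omega>) A = of_nat n}" for n
  note [measurable] = N_measurable[OF A]
  have [measurable]: "C n \<in> sets M" for n unfolding C_def by measurable
  have disj: "disjoint_family C" by (auto simp: disjoint_family_on_def C_def)
  have C: "emeasure M (C n) = ennreal (exp (- measure F A) * measure F A ^ n / fact n)" for n
    using prob_N[OF A fin, of n] by (simp add: emeasure_eq_measure C_def)
  \<comment> \<open>The Poisson weights add up to one, by the generating function at 1. So the count
    is almost surely finite, and the events \<open>C n\<close> carry the whole integral.\<close>
  have "emeasure M (\<Union>n. C n) = (\<Sum>n. emeasure M (C n))"
    using disj by (intro suminf_emeasure[symmetric]) auto
  also have "\<dots> = (\<Sum>n. en 0 ^ n * ennreal (exp (- measure F A) * measure F A ^ n / fact n))"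
    by (simp only: C en_0 power_one mult_1_left)
  also have "\<dots> = en ((1 - en 0) * ennreal (measure F A))" by (rule sums_poisson_en) simp
  also have "\<dots> = 1" by simp
  finally have "prob (\<Union>n. C n) = 1" by (simp add: measure_def)
  moreover have "(\<Union>n. C n) \<in> events" by auto
  ultimately have "AE \<omega> in M. \<omega> \<in> (\<Union>n. C n)" using prob_eq_1 by blast
  then have "(\<integral>\<^sup>+\<omega>. en (y * emeasure (N \<omega>) A) \<partial>M) = (\<integral>\<^sup>+\<omega>. (\<Sum>n. en y ^ n * indicator (C n) \<omega>) \<partial>M)"
  proof (intro nn_integral_cong_AE, eventually_elim)
    case (elim \<omega>)
    then obtain n where n: "\<omega> \<in> C n" by auto
    then show ?case
      using suminf_cmult_indicator[OF disj n, of "\<lambda>n. en y ^ n"] by (simp add: C_def mult.commute[of y] en_power)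
  qed
  also have "\<dots> = (\<Sum>n. en y ^ n * emeasure M (C n))"
    by (subst nn_integral_suminf) (auto simp: nn_integral_cmult_indicator)
  also have "\<dots> = en ((1 - en y) * emeasure F A)"
    using fin by (simp add: C sums_poisson_en emeasure_eq_ennreal_measure less_top)
  finally show ?thesis .
qed

lemma laplace_disjoint:
  fixes A :: "nat \<Rightarrow> 'b set"
  assumes A: "\<And>i. A i \<in> sets F" and fin: "\<And>i. emeasure F (A i) < \<infinity>" and disj: "disjoint_family A"
  shows "(\<integral>\<^sup>+\<omega>. en (\<Sum>i<r. y i * emeasure (N \<omega>) (A i)) \<partial>M) = en (\<Sum>i<r. (1 - en (y i)) * emeasure F (A i))"
proof -
  have ind: "\<forall>A :: nat \<Rightarrow> 'b set. range A \<subseteq> sets F \<and> disjoint_family A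
        \<longrightarrow> indep_vars (\<lambda>_. borel) (\<lambda>i \<omega>. emeasure (N \<omega>) (A i)) UNIV"
    using poisson unfolding poisson_process_def by (elim conjE)
  have "range A \<subseteq> sets F \<and> disjoint_family A" using A disj by auto
  from ind[rule_format, OF this]
  have "indep_vars (\<lambda>_. borel) (\<lambda>i \<omega>. emeasure (N \<omega>) (A i)) UNIV" .
  then have "indep_vars (\<lambda>_. borel) (\<lambda>i \<omega>. en (y i * emeasure (N \<omega>) (A i))) UNIV"
    by (rule indep_vars_compose2) measurable
  then have iv: "indep_vars (\<lambda>_. borel) (\<lambda>i \<omega>. en (y i * emeasure (N \<omega>) (A i))) {..<r}"
    by (rule indep_vars_subset) auto
  have "(\<integral>\<^sup>+\<omega>. en (\<Sum>i<r. y i * emeasure (N \<omega>) (A i)) \<partial>M)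
      = (\<integral>\<^sup>+\<omega>. (\<Prod>i<r. en (y i * emeasure (N \<omega>) (A i))) \<partial>M)" by (simp add: en_sum)
  also have "\<dots> = (\<Prod>i<r. \<integral>\<^sup>+\<omega>. en (y i * emeasure (N \<omega>) (A i)) \<partial>M)"
    by (rule indep_vars_nn_integral[OF _ iv]) auto
  also have "\<dots> = en (\<Sum>i<r. (1 - en (y i)) * emeasure F (A i))"
    using A fin by (simp add: laplace_set en_sum)
  finally show ?thesis .
qed

lemma laplace_simple:
  assumes l: "simple_function F l" and C: "C \<in> sets F" "emeasure F C < \<infinity>" and l0: "\<And>x. x \<in> space F - C \<Longrightarrow> l x = 0"
  shows "(\<integral>\<^sup>+\<omega>. en (\<integral>\<^sup>+x. l x \<partial>N \<omega>) \<partial>M) = en (\<integral>\<^sup>+x. (1 - en (l x)) \<partial>F)"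
proof -
  define V where "V = l ` space F - {0}"
  have "finite V" using l by (auto simp: V_def simple_function_def)
  then obtain v where v: "bij_betw v {0..<card V} V" using ex_bij_betw_nat_finite by blast
  define r where "r = card V"
  define A where "A i = (if i < r then l -` {v i} \<inter> space F else {})" for i
  have A: "A i \<in> sets F" for i using simple_functionD(2)[OF l, of "{v i}"] by (auto simp: A_def)
  have vV: "v i \<in> V" if "i < r" for i using v that by (auto simp: r_def bij_betw_def)
  have AC: "A i \<subseteq> C" for i
  proof
    fix x assume "x \<in> A i"
    then have "x \<in> space F" "l x \<noteq> 0" using vV[of i] by (auto simp: A_def V_def split: if_splits)
    then show "x \<in> C" using l0[of x] by blast
  qed
  have fin: "emeasure F (A i) < \<infinity>" for i
    using emeasure_mono[OF AC C(1)] C(2) by (rule le_less_trans)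
  have disj: "disjoint_family A"
    unfolding disjoint_family_on_def
  proof (intro ballI impI)
    fix i j :: nat assume "i \<noteq> j"
    then have "i < r \<Longrightarrow> j < r \<Longrightarrow> v i \<noteq> v j"
      using v by (auto simp: r_def bij_betw_def inj_on_def)
    then show "A i \<inter> A j = {}" by (auto simp: A_def)
  qed
  \<comment> \<open>The function \<open>g\<close> is left open: the decomposition is used for
    \<open>l\<close> itself under \<open>N \<omega>\<close> and for \<open>1 - en\<close> of it
    under \<open>F\<close>.\<close>
  have decomp: "g (l x) = (\<Sum>i<r. g (v i) * indicator (A i) x)" if "g 0 = 0" "x \<in> space F" for g :: "ennreal \<Rightarrow> ennreal" and x
  proof (cases "l x = 0")
    case True
    then have "x \<notin> A i" for i using vV[of i] by (auto simp: A_def V_def)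
    then show ?thesis using that True by simp
  next
    case False
    then have "l x \<in> V" using that by (auto simp: V_def)
    then have "l x \<in> v ` {0..<card V}" using v by (simp add: bij_betw_def)
    then obtain i where i: "i < r" "v i = l x" by (auto simp: r_def)
    then have "x \<in> A i" using that by (auto simp: A_def)
    then have "g (v j) * indicator (A j) x = (if j = i then g (l x) else 0)" for j
      using disj i by (auto simp: disjoint_family_on_def indicator_def)
    then show ?thesis using i by simp
  qed
  have int: "(\<integral>\<^sup>+x. g (l x) \<partial>L) = (\<Sum>i<r. g (v i) * emeasure L (A i))"
    if "g 0 = 0" "sets L = sets F" for g :: "ennreal \<Rightarrow> ennreal" and L
  proof -
    have "(\<integral>\<^sup>+x. g (l x) \<partial>L) = (\<integral>\<^sup>+x. (\<Sum>i<r. g (v i) * indicator (A i) x) \<partial>L)"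
      using that by (intro nn_integral_cong decomp) (auto dest: sets_eq_imp_space_eq)
    also have "\<dots> = (\<Sum>i<r. g (v i) * emeasure L (A i))"
      using A that by (subst nn_integral_sum) (auto simp: nn_integral_cmult_indicator)
    finally show ?thesis .
  qed
  have "(\<integral>\<^sup>+\<omega>. en (\<integral>\<^sup>+x. l x \<partial>N \<omega>) \<partial>M) = (\<integral>\<^sup>+\<omega>. en (\<Sum>i<r. v i * emeasure (N \<omega>) (A i)) \<partial>M)"
    by (intro nn_integral_cong) (simp add: int[of "\<lambda>y. y"] sets_N)
  also have "\<dots> = en (\<Sum>i<r. (1 - en (v i)) * emeasure F (A i))"
    by (rule laplace_disjoint[OF A fin disj])
  also have "\<dots> = en (\<integral>\<^sup>+x. (1 - en (l x)) \<partial>F)" by (subst int[of "\<lambda>y. 1 - en y"]) auto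
  finally show ?thesis .
qed

text \<open>Simple functions that vanish off a set of finite intensity increase to \<open>l\<close>.
  Both sides converge because \<open>en\<close> is continuous along increasing sequences, infinite
  integrals included.\<close>

lemma laplace:
  assumes l: "l \<in> borel_measurable F"
  shows "(\<integral>\<^sup>+\<omega>. en (\<integral>\<^sup>+x. l x \<partial>N \<omega>) \<partial>M) = en (\<integral>\<^sup>+x. (1 - en (l x)) \<partial>F)"
proof -
  interpret F: sigma_finite_measure F by (rule sigma_finite_F)
  obtain f where f: "\<And>i. simple_function F (f i)" "incseq f" "\<And>x. (SUP i. f i x) = l x"
    using borel_measurable_implies_simple_function_sequence'[OF l] by metis
  obtain C :: "nat \<Rightarrow> 'b set" where C: "range C \<subseteq> sets F" "(\<Union>i. C i) = space F" "\<And>i. emeasure F (C i) \<noteq> \<infinity>" "incseq C"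
    by (rule F.sigma_finite_incseq) blast
  define g where "g i x = f i x * indicator (C i) x" for i x
  have gs: "simple_function F (g i)" for i
    unfolding g_def using f(1) C(1) by (intro simple_function_mult simple_function_indicator) auto
  have gm [measurable]: "g i \<in> borel_measurable F" for i using gs by (rule borel_measurable_simple_function)
  have ginc: "incseq (\<lambda>i. g i x)" for x
    unfolding g_def using f(2) C(4)
    by (intro incseq_SucI mult_mono) (auto simp: incseq_Suc_iff le_fun_def indicator_def)
  have gsup: "(SUP i. g i x) = l x" if x: "x \<in> space F" for x
  proof (rule antisym)
    show "(SUP i. g i x) \<le> l x"
      unfolding f(3)[symmetric] by (intro SUP_mono) (auto simp: g_def indicator_def)
    obtain k where k: "x \<in> C k" using x C(2) by auto
    show "l x \<le> (SUP i. g i x)"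
      unfolding f(3)[symmetric]
    proof (rule SUP_least)
      fix i
      have "x \<in> C (max i k)" using k C(4) by (meson incseqD max.cobounded2 subsetD)
      moreover have "f i x \<le> f (max i k) x" using f(2) by (meson incseqD le_funD max.cobounded1)
      ultimately have "f i x \<le> g (max i k) x" by (simp add: g_def)
      also have "\<dots> \<le> (SUP i. g i x)" by (rule SUP_upper) simp
      finally show "f i x \<le> (SUP i. g i x)" .
    qed
  qed
  have eq: "(\<integral>\<^sup>+\<omega>. en (\<integral>\<^sup>+x. g i x \<partial>N \<omega>) \<partial>M) = en (\<integral>\<^sup>+x. (1 - en (g i x)) \<partial>F)" for i
    using C by (intro laplace_simple[OF gs, of "C i"]) (auto simp: g_def less_top)
  have N_SUP: "(SUP i. \<integral>\<^sup>+x. g i x \<partial>N \<omega>) = (\<integral>\<^sup>+x. l x \<partial>N \<omega>)" if \<omega>: "\<omega> \<in> space M" for \<omega>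
  proof -
    have [measurable]: "g i \<in> borel_measurable (N \<omega>)" for i
      using gm[of i] by (simp add: measurable_cong_sets[OF sets_N[OF \<omega>] refl])
    have "(\<integral>\<^sup>+x. l x \<partial>N \<omega>) = (\<integral>\<^sup>+x. (SUP i. g i x) \<partial>N \<omega>)"
      using space_N[OF \<omega>] gsup by (intro nn_integral_cong) simp
    also have "\<dots> = (SUP i. \<integral>\<^sup>+x. g i x \<partial>N \<omega>)"
      using ginc by (intro nn_integral_monotone_convergence_SUP) (auto simp: incseq_def le_fun_def)
    finally show ?thesis by simp
  qed
  have meas: "(\<lambda>\<omega>. \<integral>\<^sup>+x. g i x \<partial>N \<omega>) \<in> borel_measurable M" for i
    by (rule nn_integral_kernel_measurable[of M N F]) (auto simp: sets_N N_measurable)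
  have "(\<lambda>i. \<integral>\<^sup>+\<omega>. en (\<integral>\<^sup>+x. g i x \<partial>N \<omega>) \<partial>M) \<longlonglongrightarrow> (\<integral>\<^sup>+\<omega>. en (SUP i. \<integral>\<^sup>+x. g i x \<partial>N \<omega>) \<partial>M)"
    using ginc by (intro nn_integral_en_SUP meas finite_measure_axioms)
      (auto simp: incseq_def intro!: nn_integral_mono)
  also have "(\<integral>\<^sup>+\<omega>. en (SUP i. \<integral>\<^sup>+x. g i x \<partial>N \<omega>) \<partial>M) = (\<integral>\<^sup>+\<omega>. en (\<integral>\<^sup>+x. l x \<partial>N \<omega>) \<partial>M)"
    by (intro nn_integral_cong) (simp add: N_SUP)
  finally have lim1: "(\<lambda>i. en (\<integral>\<^sup>+x. (1 - en (g i x)) \<partial>F)) \<longlonglongrightarrow> (\<integral>\<^sup>+\<omega>. en (\<integral>\<^sup>+x. l x \<partial>N \<omega>) \<partial>M)"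
    unfolding eq .
  have inc1: "incseq (\<lambda>i. 1 - en (g i x))" for x
    using ginc by (auto simp: incseq_def intro!: ennreal_minus_mono en_mono)
  have sup1: "(SUP i. 1 - en (g i x)) = 1 - en (l x)" if "x \<in> space F" for x
  proof (rule LIMSEQ_unique)
    show "(\<lambda>i. 1 - en (g i x)) \<longlonglongrightarrow> (SUP i. 1 - en (g i x))" by (rule LIMSEQ_SUP[OF inc1])
    show "(\<lambda>i. 1 - en (g i x)) \<longlonglongrightarrow> 1 - en (l x)"
      unfolding gsup[OF that, symmetric] by (intro tendsto_diff_ennreal tendsto_const en_LIMSEQ_SUP ginc) auto
  qed
  have "(\<lambda>i. en (\<integral>\<^sup>+x. (1 - en (g i x)) \<partial>F)) \<longlonglongrightarrow> en (SUP i. \<integral>\<^sup>+x. (1 - en (g i x)) \<partial>F)"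
    using inc1 by (intro en_LIMSEQ_SUP) (auto simp: incseq_def intro!: nn_integral_mono)
  also have "(SUP i. \<integral>\<^sup>+x. (1 - en (g i x)) \<partial>F) = (\<integral>\<^sup>+x. (SUP i. 1 - en (g i x)) \<partial>F)"
    using inc1 by (intro nn_integral_monotone_convergence_SUP[symmetric]) (auto simp: incseq_def le_fun_def)
  also have "\<dots> = (\<integral>\<^sup>+x. (1 - en (l x)) \<partial>F)" by (intro nn_integral_cong sup1)
  finally show ?thesis using lim1 by (rule LIMSEQ_unique[rotated])
qed

end

text \<open>For each separating set keep the side that carries the mass of \<open>A\<close>; the
  discarded part is null, because the only masses up to 1 are 0 and 1. What remains has mass 1 and
  contains no two points.\<close>

lemma unit_mass_point:
  assumes V: "\<And>i::nat. V i \<in> sets N" and sep: "\<And>x y. x \<in> space N \<Longrightarrow> y \<in> space N \<Longrightarrow> x \<noteq> y \<Longrightarrow> \<exists>i. (x \<in> V i) \<noteq> (y \<in> V i)"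
    and vals: "\<And>A. A \<in> sets N \<Longrightarrow> emeasure N A \<in> insert \<infinity> (range of_nat)"
    and A: "A \<in> sets N" "emeasure N A = 1"
  shows "\<exists>p\<in>A. {p} \<in> sets N \<and> emeasure N {p} = 1"
proof -
  define W where "W i = (if emeasure N (A \<inter> V i) = 1 then V i else space N - V i)" for i
  have W: "W i \<in> sets N" for i using V by (auto simp: W_def)
  have null: "emeasure N (A - W i) = 0" for i
  proof (cases "emeasure N (A \<inter> V i) = 1")
    case True
    then have "A - W i = A - (A \<inter> V i)" by (auto simp: W_def)
    also have "emeasure N \<dots> = 0" using True A V by (subst emeasure_Diff) auto
    finally show ?thesis .
  next
    case False
    have "emeasure N (A \<inter> V i) \<le> 1" using A V emeasure_mono[of "A \<inter> V i" A N] by auto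
    moreover obtain n where "emeasure N (A \<inter> V i) = \<infinity> \<or> emeasure N (A \<inter> V i) = of_nat n"
      using vals[of "A \<inter> V i"] A V by auto
    ultimately have "emeasure N (A \<inter> V i) = 0" using False
      by (auto simp: top_unique)
    moreover have "A - W i = A \<inter> V i" using False sets.sets_into_space[OF A(1)] by (auto simp: W_def)
    ultimately show ?thesis by simp
  qed
  have "emeasure N (\<Union>i. A - W i) = 0" using null A W by (intro emeasure_UN_eq_0) auto
  moreover define B where "B = A - (\<Union>i. A - W i)"
  ultimately have B: "emeasure N B = 1" "B \<in> sets N" using A W by (auto simp: B_def intro!: emeasure_Diff_null_set[THEN trans] null_setsI)
  then obtain p where p: "p \<in> B" by (metis emeasure_empty ex_in_conv zero_neq_one)
  have "q = p" if "q \<in> B" for q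
  proof (rule ccontr)
    assume "q \<noteq> p"
    moreover have "p \<in> space N" "q \<in> space N" using p that B(2) sets.sets_into_space by auto
    ultimately obtain i where "(q \<in> V i) \<noteq> (p \<in> V i)" using sep by blast
    moreover have "p \<in> W i" "q \<in> W i" using p that by (auto simp: B_def)
    ultimately show False by (auto simp: W_def split: if_splits)
  qed
  then have Bp: "B = {p}" using p by blast
  have "p \<in> A" using p unfolding B_def by blast
  then show ?thesis using B unfolding Bp by blast
qed

text \<open>Weights bounded away from zero. They form windows that increase to all nonzero weights
  and have finite mass under the weight measure.\<close>

definition Eset :: "nat \<Rightarrow> real set" where
  "Eset r = {y. inverse (real (Suc r)) \<le> \<bar>y\<bar>}"

lemma Eset_props: "0 \<notin> Eset r" "Eset r \<in> sets nonzero_reals" "y \<noteq> 0 \<Longrightarrow> \<exists>r. y \<in> Eset r" "r \<le> r' \<Longrightarrow> Eset r \<subseteq> Eset r'"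
proof -
  show n: "0 \<notin> Eset r" by (simp add: Eset_def not_le)
  have "Eset r \<in> sets borel" unfolding Eset_def by measurable
  then show "Eset r \<in> sets nonzero_reals" using n by (subst sets_restrict_space_iff) auto
  show "\<exists>r. y \<in> Eset r" if "y \<noteq> 0"
  proof -
    have "0 < \<bar>y\<bar>" using that by simp
    from reals_Archimedean[OF this] show ?thesis by (auto simp: Eset_def intro: less_imp_le)
  qed
  show "Eset r \<subseteq> Eset r'" if "r \<le> r'"
  proof
    fix y assume "y \<in> Eset r"
    moreover have "inverse (real (Suc r')) \<le> inverse (real (Suc r))" using that by (intro le_imp_inverse_le) auto
    ultimately show "y \<in> Eset r'" unfolding Eset_def by (metis (mono_tags, lifting) mem_Collect_eq order_trans)
  qed
qed

lemma space_nonzero_reals [simp]: "space nonzero_reals = - {0}"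
  by (simp add: space_restrict_space)

lemma borel_pair_nonzero:
  "A \<in> sets borel \<Longrightarrow> B \<in> sets nonzero_reals \<Longrightarrow> A \<times> B \<in> sets (borel \<Otimes>\<^sub>M nonzero_reals)"
  by (rule pair_measureI)

lemma separating_pairs:
  "\<exists>V :: nat \<Rightarrow> ('a::polish_space \<times> real) set. (\<forall>i. V i \<in> sets (borel \<Otimes>\<^sub>M nonzero_reals)) \<and>
     (\<forall>x y. x \<in> UNIV \<times> - {0} \<longrightarrow> y \<in> UNIV \<times> - {0} \<longrightarrow> x \<noteq> y \<longrightarrow> (\<exists>i. (x \<in> V i) \<noteq> (y \<in> V i)))"
proof -
  let ?B = "base_set :: nat \<Rightarrow> ('a \<times> real) set"
  have "?B i \<inter> (UNIV \<times> - {0}) \<in> sets (borel \<Otimes>\<^sub>M nonzero_reals)" for i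
  proof -
    have "(\<lambda>x. x) \<in> borel \<Otimes>\<^sub>M nonzero_reals \<rightarrow>\<^sub>M (borel :: ('a \<times> real) measure)"
      unfolding borel_prod[symmetric]
      by (rule measurable_pair) (auto intro: measurable_compose[OF measurable_snd] simp: comp_def measurable_restrict_space1)
    from measurable_sets[OF this base_set_borel[of i]] show ?thesis
      by (simp add: space_pair_measure)
  qed
  moreover have "\<exists>i. (x \<in> ?B i \<inter> (UNIV \<times> - {0})) \<noteq> (y \<in> ?B i \<inter> (UNIV \<times> - {0}))"
    if xy: "x \<in> UNIV \<times> - {0}" "y \<in> UNIV \<times> - {0}" "x \<noteq> y" for x y
  proof -
    obtain O' where "open O'" "x \<in> O'" "y \<notin> O'" using t1_space[OF xy(3)] by auto
    then obtain i where "x \<in> ?B i" "y \<notin> ?B i" using base_set_exists by (metis subsetD)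
    then show ?thesis using xy by (intro exI[of _ i]) auto
  qed
  ultimately show ?thesis by (intro exI[of _ "\<lambda>i. ?B i \<inter> (UNIV \<times> - {0})"]) auto
qed

lemma emeasure_null_cover:
  assumes "\<And>i::nat. emeasure N (A i) = 0" "\<And>i. A i \<in> sets N" "B \<in> sets N" "B \<subseteq> (\<Union>i. A i)"
  shows "emeasure N B = 0"
proof -
  have "emeasure N (\<Union>i. A i) = 0" using assms by (intro emeasure_UN_eq_0) auto
  then show ?thesis using emeasure_mono[OF assms(4), of N] assms(2) by auto
qed

text \<open>
  An integer-valued measure with at most one point above each location is recovered from the
  signed measure it induces: its points are the pairs \<open>(s, \<mu> {s})\<close>.
\<close>

lemma point_process_eq_atoms:
  fixes \<mu> :: "'a::polish_space set \<Rightarrow> real"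
  assumes sets: "sets N = sets (borel \<Otimes>\<^sub>M nonzero_reals)"
    and vals: "\<And>A. A \<in> sets N \<Longrightarrow> emeasure N A \<in> insert \<infinity> (range of_nat)"
    and simple: "\<And>r. \<exists>n. \<forall>bs. length bs = n \<longrightarrow> emeasure N (cell bs \<times> Eset r) \<le> 1"
    and S: "\<And>s. s \<in> S \<Longrightarrow> emeasure N ({s} \<times> - {0}) = 0"
    and \<mu>: "\<And>s. s \<notin> S \<Longrightarrow> \<mu> {s} = (\<integral>(t, y). indicator {s} t * y \<partial>N)"
    and l: "l \<in> borel_measurable N"
  shows "(\<integral>\<^sup>+x. l x \<partial>N) = (\<integral>\<^sup>+s. l (s, \<mu> {s}) \<partial>count_space {s. s \<notin> S \<and> \<mu> {s} \<noteq> 0})"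
proof -
  have sp: "space N = UNIV \<times> - {0}" using sets_eq_imp_space_eq[OF sets] by (simp add: space_pair_measure)
  have cell_sets: "cell bs \<times> Eset r \<in> sets N" for bs r
    unfolding sets by (intro borel_pair_nonzero cell_borel Eset_props(2))
  have line_sets: "{s} \<times> Eset r \<in> sets N" "{s} \<times> - {0} \<in> sets N" for s :: 'a and r
    unfolding sets using sets.top[of nonzero_reals] by (auto intro!: borel_pair_nonzero Eset_props(2))
  have pt_sets: "{p} \<in> sets N" if "p \<in> UNIV \<times> - {0}" for p
  proof -
    have "{snd p} \<in> sets nonzero_reals" using that by (subst sets_restrict_space_iff) auto
    then have "{fst p} \<times> {snd p} \<in> sets N" unfolding sets by (intro borel_pair_nonzero) auto
    then show ?thesis by simp
  qed
  obtain V :: "nat \<Rightarrow> ('a \<times> real) set" where V: "\<And>i. V i \<in> sets N"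
    "\<And>x y. x \<in> space N \<Longrightarrow> y \<in> space N \<Longrightarrow> x \<noteq> y \<Longrightarrow> \<exists>i. (x \<in> V i) \<noteq> (y \<in> V i)"
    using separating_pairs[where 'a='a] unfolding sets sp by metis
  obtain n where n: "\<And>r bs. length bs = n r \<Longrightarrow> emeasure N (cell bs \<times> Eset r) \<le> 1"
    using simple by metis
  have unit: "emeasure N A = 0 \<or> emeasure N A = 1" if A: "A \<in> sets N" "emeasure N A \<le> 1" for A
  proof -
    obtain k where "emeasure N A = \<infinity> \<or> emeasure N A = of_nat k" using vals[OF A(1)] by auto
    then show ?thesis using A(2) by (cases k) (auto simp: top_unique)
  qed
  \<comment> \<open>For each window \<open>Eset r\<close>, the cells of level \<open>n r\<close>
    hold at most one point each. The index set picks those that hold one; \<open>p\<close> will be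
    that point.\<close>
  define I where "I = {(r, bs). length bs = n r \<and> emeasure N (cell bs \<times> Eset r) = 1}"
  have "\<forall>i\<in>I. \<exists>p. p \<in> cell (snd i) \<times> Eset (fst i) \<and> emeasure N {p} = 1"
  proof
    fix i assume "i \<in> I"
    then have "emeasure N (cell (snd i) \<times> Eset (fst i)) = 1" by (auto simp: I_def)
    from unit_mass_point[OF V vals cell_sets this]
    show "\<exists>p. p \<in> cell (snd i) \<times> Eset (fst i) \<and> emeasure N {p} = 1" by blast
  qed
  then obtain p where p: "\<And>i. i \<in> I \<Longrightarrow> p i \<in> cell (snd i) \<times> Eset (fst i)" "\<And>i. i \<in> I \<Longrightarrow> emeasure N {p i} = 1"
    by metis
  define P where "P = p ` I"
  have cP: "countable P" unfolding P_def by (rule countable_image[OF countableI_type[of I]])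
  have Psub: "P \<subseteq> UNIV \<times> - {0}" using p(1) Eset_props(1) unfolding P_def by fastforce
  have P1: "emeasure N {q} = 1" if "q \<in> P" for q using that p(2) by (auto simp: P_def)
  have Psets: "B \<in> sets N" if B: "B \<subseteq> P" for B
  proof (rule sets.countable)
    show "{a} \<in> sets N" if "a \<in> B" for a using that B Psub by (intro pt_sets) blast
    show "countable B" using B cP by (rule countable_subset)
  qed
  \<comment> \<open>The cells of level \<open>n r\<close> with the windows \<open>Eset r\<close>
    cover everything, and each of these products is null off \<open>P\<close>.\<close>
  have Pnull: "emeasure N (space N - P) = 0"
  proof (rule emeasure_null_cover[where A = "\<lambda>k. case from_nat k of (r, bs) \<Rightarrow> if length bs = n r then cell bs \<times> Eset r - P else {}"])
    fix k
    obtain r bs where k: "from_nat k = (r::nat, bs::bool list)" by (cases "from_nat k :: nat \<times> bool list")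
    have "emeasure N (cell bs \<times> Eset r - P) = 0" if len: "length bs = n r"
    proof (cases "emeasure N (cell bs \<times> Eset r) = 1")
      case True
      then have i: "(r, bs) \<in> I" using len by (simp add: I_def)
      then have pin: "p (r, bs) \<in> cell bs \<times> Eset r" "p (r, bs) \<in> P" using p(1)[OF i] by (auto simp: P_def)
      have "emeasure N (cell bs \<times> Eset r - P) \<le> emeasure N (cell bs \<times> Eset r - {p (r, bs)})"
        using pin cell_sets Psets[of "{p (r, bs)}"] by (intro emeasure_mono) auto
      also have "\<dots> = emeasure N (cell bs \<times> Eset r) - emeasure N {p (r, bs)}"
        using pin cell_sets Psets[of "{p (r, bs)}"] p(2)[OF i] by (intro emeasure_Diff) auto
      also have "\<dots> = 0" using True p(2)[OF i] by simp
      finally show ?thesis by simp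
    next
      case False
      then have "emeasure N (cell bs \<times> Eset r) = 0" using unit[OF cell_sets n[OF len]] by blast
      then show ?thesis using emeasure_mono[of "cell bs \<times> Eset r - P" "cell bs \<times> Eset r" N] cell_sets by auto
    qed
    then show "emeasure N (case from_nat k of (r, bs) \<Rightarrow> if length bs = n r then cell bs \<times> Eset r - P else {}) = 0"
      by (simp add: k)
    show "(case from_nat k of (r, bs) \<Rightarrow> if length bs = n r then cell bs \<times> Eset r - P else {}) \<in> sets N"
      using cell_sets Psets[of P] by (simp add: k)
  next
    show "space N - P \<in> sets N" using Psets[of P] by auto
    show "space N - P \<subseteq> (\<Union>k. case from_nat k of (r, bs) \<Rightarrow> if length bs = n r then cell bs \<times> Eset r - P else {})"
    proof
      fix q assume q: "q \<in> space N - P"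
      then have "snd q \<noteq> 0" unfolding sp by auto
      then obtain r where r: "snd q \<in> Eset r" using Eset_props(3)[of "snd q"] by blast
      let ?bs = "code (n r) (fst q)"
      have "q \<in> cell ?bs \<times> Eset r - P" using q r by (cases q) (auto simp: cell_def)
      then show "q \<in> (\<Union>k. case from_nat k of (r, bs) \<Rightarrow> if length bs = n r then cell bs \<times> Eset r - P else {})"
        by (intro UN_I[of "to_nat (r, ?bs)"]) auto
    qed
  qed
  \<comment> \<open>Only one point lies above \<open>s\<close>: a window large enough to contain
    \<open>y\<close> has at most one point over the cell of \<open>s\<close>. So the integral that
    gives \<open>\<mu> {s}\<close> reduces to \<open>y\<close>.\<close>
  have B: "s \<notin> S \<and> \<mu> {s} = y" if sy: "(s, y) \<in> P" for s y
  proof -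
    have y: "y \<noteq> 0" using Psub sy by auto
    have one: "emeasure N {(s, y)} = 1" by (rule P1[OF sy])
    have ps: "{(s, y)} \<in> sets N" using y by (intro pt_sets) auto
    have sS: "s \<notin> S"
    proof
      assume "s \<in> S"
      have "emeasure N {(s, y)} \<le> emeasure N ({s} \<times> - {0})" using y line_sets by (intro emeasure_mono) auto
      then show False using one S[OF \<open>s \<in> S\<close>] by simp
    qed
    have "emeasure N ({s} \<times> - {0} - {(s, y)}) = 0"
    proof -
      obtain r0 where r0: "y \<in> Eset r0" using Eset_props(3)[OF y] by auto
      have "emeasure N ({s} \<times> Eset (r0 + r) - {(s, y)}) = 0" for r
      proof -
        have yr: "y \<in> Eset (r0 + r)" using r0 Eset_props(4)[of r0 "r0 + r"] by auto
        have "emeasure N ({s} \<times> Eset (r0 + r)) \<le> emeasure N (cell (code (n (r0 + r)) s) \<times> Eset (r0 + r))"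
          by (intro emeasure_mono cell_sets) (auto simp: cell_def)
        also have "\<dots> \<le> 1" by (rule n) simp
        finally have "emeasure N ({s} \<times> Eset (r0 + r)) \<le> 1" .
        moreover have "emeasure N ({s} \<times> Eset (r0 + r) - {(s, y)}) = emeasure N ({s} \<times> Eset (r0 + r)) - emeasure N {(s, y)}"
          using yr line_sets ps one by (intro emeasure_Diff) auto
        moreover have "emeasure N ({s} \<times> Eset (r0 + r)) < \<top>"
          using calculation(1) ennreal_one_less_top by (rule le_less_trans)
        ultimately show ?thesis using one by (simp add: diff_eq_0_ennreal)
      qed
      then show ?thesis
      proof (rule emeasure_null_cover)
        show "{s} \<times> - {0} - {(s, y)} \<subseteq> (\<Union>r. {s} \<times> Eset (r0 + r) - {(s, y)})"
        proof
          fix q assume q: "q \<in> {s} \<times> - {0} - {(s, y)}"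
          then have "snd q \<noteq> 0" by auto
          then obtain r where "snd q \<in> Eset r" using Eset_props(3)[of "snd q"] by blast
          then have "snd q \<in> Eset (r0 + r)" using Eset_props(4)[of r "r0 + r"] by auto
          then show "q \<in> (\<Union>r. {s} \<times> Eset (r0 + r) - {(s, y)})" using q by (intro UN_I[of r]) auto
        qed
      qed (use line_sets ps in auto)
    qed
    then have ae: "AE x in N. (case x of (t, z) \<Rightarrow> indicator {s} t * z) = y * indicator {(s, y)} x"
      using line_sets ps sp by (intro AE_I[where N = "{s} \<times> - {0} - {(s, y)}"]) (auto simp: indicator_def)
    have id_meas: "(\<lambda>(t, z). indicator {s} t * z) \<in> borel_measurable N"
    proof -
      have "(\<lambda>x. x) \<in> nonzero_reals \<rightarrow>\<^sub>M borel" by (rule measurable_restrict_space1) simp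
      then have [measurable]: "snd \<in> borel \<Otimes>\<^sub>M nonzero_reals \<rightarrow>\<^sub>M borel"
        using measurable_compose[OF measurable_snd] by fastforce
      have "(\<lambda>x :: 'a \<times> real. indicator {s} (fst x) * snd x) \<in> borel_measurable (borel \<Otimes>\<^sub>M nonzero_reals)" by measurable
      then show ?thesis unfolding measurable_cong_sets[OF sets refl] by (simp add: split_beta')
    qed
    have "(\<integral>(t, z). indicator {s} t * z \<partial>N) = (\<integral>x. y * indicator {(s, y)} x \<partial>N)"
      using ae id_meas ps by (intro integral_cong_AE) auto
    also have "\<dots> = y" using ps one by (simp add: measure_def)
    finally show ?thesis using \<mu>[of s] sS by simp
  qed
  have C: "(s, \<mu> {s}) \<in> P" if s: "s \<notin> S" "\<mu> {s} \<noteq> 0" for s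
  proof (rule ccontr)
    assume nP: "(s, \<mu> {s}) \<notin> P"
    have "AE x in N. (case x of (t, z) \<Rightarrow> indicator {s} t * z) = (0::real)"
    proof (rule AE_I[OF _ Pnull])
      show "{x \<in> space N. (case x of (t, z) \<Rightarrow> indicator {s} t * z) \<noteq> (0::real)} \<subseteq> space N - P"
        using B nP by (auto simp: indicator_def split: if_splits)
      show "space N - P \<in> sets N" using Psets[of P] by auto
    qed
    then have "(\<integral>(t, z). indicator {s} t * z \<partial>N) = 0" by (rule integral_eq_zero_AE)
    then show False using \<mu>[OF s(1)] s(2) by simp
  qed
  define J where "J = {s. s \<notin> S \<and> \<mu> {s} \<noteq> 0}"
  have P_eq: "P = (\<lambda>s. (s, \<mu> {s})) ` J"
    using B C Psub unfolding J_def by fastforce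
  \<comment> \<open>Each point of \<open>P\<close> has mass 1, and \<open>P\<close> is the graph of
    \<open>\<mu> {s}\<close> as a function of \<open>s \<in> J\<close>. So \<open>N\<close> is the
    image of counting measure on \<open>J\<close>.\<close>
  have "N = distr (count_space J) N (\<lambda>s. (s, \<mu> {s}))"
  proof (rule measure_eqI)
    fix A assume A: "A \<in> sets N"
    have "emeasure N A = emeasure N (A \<inter> P)"
      using Pnull A Psets[of P] sets.sets_into_space[OF A]
      by (intro emeasure_eq_AE AE_I[OF _ Pnull]) auto
    also have "\<dots> = (\<integral>\<^sup>+q. emeasure N {q} \<partial>count_space (A \<inter> P))"
      using Psets cP by (intro emeasure_countable_singleton) auto
    also have "\<dots> = (\<integral>\<^sup>+q. 1 \<partial>count_space (A \<inter> P))" by (intro nn_integral_cong) (simp add: P1)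
    also have "\<dots> = (\<integral>\<^sup>+s. 1 \<partial>count_space {s\<in>J. (s, \<mu> {s}) \<in> A})"
      by (rule nn_integral_bij_count_space[symmetric, where g = "\<lambda>s. (s, \<mu> {s})"])
         (auto simp: P_eq bij_betw_def inj_on_def)
    also have "\<dots> = emeasure (count_space {s\<in>J. (s, \<mu> {s}) \<in> A}) {s\<in>J. (s, \<mu> {s}) \<in> A}" by simp
    also have "\<dots> = emeasure (count_space J) {s\<in>J. (s, \<mu> {s}) \<in> A}"
      by (cases "finite {s\<in>J. (s, \<mu> {s}) \<in> A}") (auto simp: emeasure_count_space)
    also have "\<dots> = emeasure (distr (count_space J) N (\<lambda>s. (s, \<mu> {s}))) A"
      using A sp by (subst emeasure_distr) (auto simp: J_def intro!: arg_cong[where f = "emeasure _"])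
    finally show "emeasure N A = emeasure (distr (count_space J) N (\<lambda>s. (s, \<mu> {s}))) A" .
  qed simp
  then have "(\<integral>\<^sup>+x. l x \<partial>N) = (\<integral>\<^sup>+x. l x \<partial>distr (count_space J) N (\<lambda>s. (s, \<mu> {s})))" by simp
  also have "\<dots> = (\<integral>\<^sup>+s. l (s, \<mu> {s}) \<partial>count_space J)"
    using l sp by (subst nn_integral_distr) (auto simp: J_def)
  finally show ?thesis by (simp add: J_def)
qed

text \<open>The sum is the mean under \<open>G\<close> of the mass of the cell that contains the
  point, and this mass decreases to that of the point itself, which is 0.\<close>

lemma sum_cell_squares_tendsto:
  fixes G :: "'a::polish_space measure"
  assumes sets: "sets G = sets borel" and "prob_space G" and G0: "\<And>s. emeasure G {s} = 0"
  shows "(\<lambda>n. \<Sum>bs | length bs = n. (measure G (cell bs))\<^sup>2) \<longlonglongrightarrow> 0"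
proof -
  interpret G: prob_space G by fact
  have sp: "space G = UNIV" using sets_eq_imp_space_eq[OF sets] by simp
  have cG: "cell bs \<in> sets G" for bs by (simp add: sets)
  have fin: "finite {bs :: bool list. length bs = n}" for n
    using finite_lists_length_eq[of "UNIV :: bool set" n] by simp
  have decomp: "measure G (cell (code n s)) = (\<Sum>bs | length bs = n. measure G (cell bs) * indicator (cell bs) s)" for n and s :: 'a
  proof -
    have "measure G (cell bs) * indicator (cell bs) s = (if bs = code n s then measure G (cell bs) else 0)" if "length bs = n" for bs
      using that by (auto simp: cell_def)
    then have "(\<Sum>bs | length bs = n. measure G (cell bs) * indicator (cell bs) s)
        = (\<Sum>bs | length bs = n. if bs = code n s then measure G (cell bs) else 0)" by (intro sum.cong) auto
    then show ?thesis using fin[of n] by simp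
  qed
  have eq: "(\<integral>s. measure G (cell (code n s)) \<partial>G) = (\<Sum>bs | length bs = n. (measure G (cell bs))\<^sup>2)" for n
    unfolding decomp using cG
    by (subst Bochner_Integration.integral_sum) (auto simp: power2_eq_square G.emeasure_eq_measure sp less_top[symmetric])
  have "(\<lambda>n. \<integral>s. measure G (cell (code n s)) \<partial>G) \<longlonglongrightarrow> (\<integral>s. 0 \<partial>G)"
  proof (rule integral_dominated_convergence[where w = "\<lambda>_. 1"])
    show "(\<lambda>s. measure G (cell (code n s))) \<in> borel_measurable G" for n
      unfolding decomp using cG by measurable
    show "AE s in G. (\<lambda>n. measure G (cell (code n s))) \<longlonglongrightarrow> 0"
    proof (intro AE_I2)
      fix s :: 'a
      have "(\<lambda>n. measure G (cell (code n s) \<inter> UNIV)) \<longlonglongrightarrow> measure G (\<Inter>n. cell (code n s) \<inter> UNIV)"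
      proof (rule G.finite_Lim_measure_decseq)
        show "range (\<lambda>n. cell (code n s) \<inter> UNIV) \<subseteq> G.events" using cG by auto
        show "decseq (\<lambda>n. cell (code n s) \<inter> (UNIV :: 'a set))" by (rule cell_code_Int(1))
      qed
      moreover have "measure G {s} = 0" using G0[of s] by (simp add: measure_def)
      ultimately show "(\<lambda>n. measure G (cell (code n s))) \<longlonglongrightarrow> 0"
        by (subst (asm) cell_code_Int) auto
    qed
  qed auto
  then show ?thesis by (simp add: eq)
qed

text \<open>The bound \<open>exp (- q) \<ge> 1 - q\<close> gives
  \<open>exp (- q) * (1 + q) \<ge> 1 - q\<^sup>2\<close> for the probability of at most one
  point.\<close>

lemma (in poisson) prob_N_ge_2:
  assumes A: "A \<in> sets F" and fin: "emeasure F A < \<infinity>"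
  shows "prob {\<omega>\<in>space M. \<not> emeasure (N \<omega>) A \<le> 1} \<le> (measure F A)\<^sup>2"
proof -
  let ?q = "measure F A"
  note [measurable] = N_measurable[OF A]
  have eq: "{\<omega>\<in>space M. \<not> emeasure (N \<omega>) A \<le> 1}
      = space M - ({\<omega>\<in>space M. emeasure (N \<omega>) A = of_nat 0} \<union> {\<omega>\<in>space M. emeasure (N \<omega>) A = of_nat 1})" (is "_ = space M - (?A0 \<union> ?A1)")
  proof (intro equalityI subsetI)
    fix \<omega> assume "\<omega> \<in> space M - (?A0 \<union> ?A1)"
    moreover from this obtain k where "emeasure (N \<omega>) A = \<infinity> \<or> emeasure (N \<omega>) A = of_nat k"
      using N_values[OF _ A, of \<omega>] by auto
    ultimately show "\<omega> \<in> {\<omega>\<in>space M. \<not> emeasure (N \<omega>) A \<le> 1}"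
      by (cases k) (auto simp: top_unique)
  qed auto
  have [measurable]: "?A0 \<in> sets M" "?A1 \<in> sets M" by measurable
  have "prob (?A0 \<union> ?A1) = prob ?A0 + prob ?A1"
    by (intro finite_measure_Union) auto
  also have "\<dots> = exp (- ?q) * (1 + ?q)"
    using prob_N[OF A fin, of 0] prob_N[OF A fin, of 1] by (simp add: algebra_simps)
  also have "\<dots> \<ge> (1 - ?q) * (1 + ?q)"
    using exp_ge_add_one_self[of "- ?q"] by (intro mult_right_mono) auto
  finally have "prob (?A0 \<union> ?A1) \<ge> 1 - ?q\<^sup>2" by (simp add: algebra_simps power2_eq_square)
  then show ?thesis unfolding eq by (subst prob_compl) auto
qed

text \<open>Some ball has positive mass under \<open>G\<close>. Over it the integrand
  \<open>min 1 \<bar>y\<bar>\<close> is at least \<open>inverse (real (Suc r))\<close> on the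
  window, so the integral bound for Levy measures limits the mass of the window.\<close>

lemma levy_measure_Eset:
  fixes G :: "'a::polish_space measure"
  assumes levy: "levy_measure (G \<Otimes>\<^sub>M \<nu>)" and nu: "sets \<nu> = sets nonzero_reals" "sigma_finite_measure \<nu>"
    and G: "sets G = sets borel" "prob_space G"
  shows "emeasure \<nu> (Eset r) < \<infinity>"
proof -
  interpret G: prob_space G by fact
  interpret \<nu>: sigma_finite_measure \<nu> by fact
  have [measurable_cong]: "sets G = sets borel" "sets \<nu> = sets nonzero_reals" by fact+
  have spG: "space G = UNIV" using sets_eq_imp_space_eq[OF G(1)] by simp
  have "\<exists>n. emeasure G (bb n) \<noteq> 0"
  proof (rule ccontr)
    assume "\<not> ?thesis"
    then have "emeasure G (\<Union>n. bb n) = 0" using G(1) by (intro emeasure_UN_eq_0) auto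
    then show False using G.emeasure_space_1 by (simp add: UN_bb spG)
  qed
  then obtain n where n: "emeasure G (bb n) \<noteq> 0" ..
  have bbG [measurable]: "bb n \<in> sets G" by (simp add: G(1))
  have E [measurable]: "Eset r \<in> sets \<nu>" using Eset_props(2) nu(1) by simp
  let ?c = "ennreal (inverse (real (Suc r)))"
  have "?c * (emeasure G (bb n) * emeasure \<nu> (Eset r)) = ?c * emeasure (G \<Otimes>\<^sub>M \<nu>) (bb n \<times> Eset r)"
    by (subst \<nu>.emeasure_pair_measure_Times) auto
  also have "\<dots> = (\<integral>\<^sup>+x. ?c * indicator (bb n \<times> Eset r) x \<partial>(G \<Otimes>\<^sub>M \<nu>))"
    by (simp add: nn_integral_cmult_indicator)
  also have "\<dots> \<le> (\<integral>\<^sup>+ (s, y). indicator (bb n) s * ennreal (min 1 \<bar>y\<bar>) \<partial>(G \<Otimes>\<^sub>M \<nu>))"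
  proof (intro nn_integral_mono)
    fix x :: "'a \<times> real"
    have "inverse (real (Suc r)) \<le> 1" by (simp add: field_simps)
    then show "?c * indicator (bb n \<times> Eset r) x \<le> (case x of (s, y) \<Rightarrow> indicator (bb n) s * ennreal (min 1 \<bar>y\<bar>))"
      by (cases x) (auto simp: indicator_def Eset_def intro!: ennreal_leI)
  qed
  also have "\<dots> < \<infinity>" using levy by (auto simp: levy_measure_def)
  finally have fin: "?c * (emeasure G (bb n) * emeasure \<nu> (Eset r)) < \<infinity>" .
  show ?thesis
  proof (rule ccontr)
    assume "\<not> ?thesis"
    then have "emeasure \<nu> (Eset r) = \<top>" by (simp add: less_top[symmetric])
    then show False using fin n by (simp add: ennreal_mult_top ennreal_top_mult)
  qed
qed

text \<open>By the union bound, some cell of level \<open>n\<close> holds two points in the window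
  with probability at most a constant times the sum of the squared cell masses. Since
  \<open>G\<close> has no atoms, this tends to zero as the cells are refined.\<close>

lemma poisson_AE_simple:
  fixes G :: "'a::polish_space measure" and N :: "'w \<Rightarrow> ('a \<times> real) measure"
  assumes "poisson M N F" and F: "F = G \<Otimes>\<^sub>M \<nu>" and levy: "levy_measure (G \<Otimes>\<^sub>M \<nu>)" and nu: "sets \<nu> = sets nonzero_reals" "sigma_finite_measure \<nu>"
    and G: "sets G = sets borel" "prob_space G" "\<And>s. emeasure G {s} = 0"
  shows "AE \<omega> in M. \<exists>n. \<forall>bs. length bs = n \<longrightarrow> emeasure (N \<omega>) (cell bs \<times> Eset r) \<le> 1"
proof -
  interpret poisson M N F by fact
  interpret G: prob_space G by (rule G(2))
  interpret \<nu>: sigma_finite_measure \<nu> by fact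
  define c where "c = measure \<nu> (Eset r)"
  have fin: "emeasure \<nu> (Eset r) < \<infinity>" by (rule levy_measure_Eset[OF levy nu G(1,2)])
  have E: "Eset r \<in> sets \<nu>" using Eset_props(2) nu(1) by simp
  have cG: "cell bs \<in> sets G" for bs by (simp add: G(1))
  have CE: "cell bs \<times> Eset r \<in> sets F" for bs unfolding F using E cG by (intro pair_measureI)
  have em: "emeasure F (cell bs \<times> Eset r) = emeasure G (cell bs) * emeasure \<nu> (Eset r)" for bs
    unfolding F using E cG by (intro \<nu>.emeasure_pair_measure_Times)
  have emfin: "emeasure F (cell bs \<times> Eset r) < \<infinity>" for bs
    unfolding em using fin by (auto simp: ennreal_mult_less_top G.emeasure_eq_measure)
  have meq: "measure F (cell bs \<times> Eset r) = measure G (cell bs) * c" for bs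
    unfolding measure_def em c_def by (simp add: enn2real_mult)
  define bad where "bad n = (\<Union>bs\<in>{bs. length bs = n}. {\<omega>\<in>space M. \<not> emeasure (N \<omega>) (cell bs \<times> Eset r) \<le> 1})" for n
  have fl: "finite {bs :: bool list. length bs = n}" for n
    using finite_lists_length_eq[of "UNIV :: bool set" n] by simp
  have bm: "{\<omega>\<in>space M. \<not> emeasure (N \<omega>) (cell bs \<times> Eset r) \<le> 1} \<in> sets M" for bs
    using N_measurable[OF CE[of bs]] by measurable
  have [measurable]: "bad n \<in> sets M" for n unfolding bad_def using fl bm by auto
  have "prob (bad n) \<le> c\<^sup>2 * (\<Sum>bs | length bs = n. (measure G (cell bs))\<^sup>2)" for n
  proof -
    have "prob (bad n) \<le> (\<Sum>bs | length bs = n. prob {\<omega>\<in>space M. \<not> emeasure (N \<omega>) (cell bs \<times> Eset r) \<le> 1})"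
      unfolding bad_def using fl bm by (intro finite_measure_subadditive_finite) auto
    also have "\<dots> \<le> (\<Sum>bs | length bs = n. (measure G (cell bs) * c)\<^sup>2)"
      using prob_N_ge_2[OF CE emfin] by (intro sum_mono) (simp add: meq)
    also have "\<dots> = c\<^sup>2 * (\<Sum>bs | length bs = n. (measure G (cell bs))\<^sup>2)"
      by (simp add: sum_distrib_left power_mult_distrib mult_ac)
    finally show ?thesis .
  qed
  moreover have "(\<lambda>n. c\<^sup>2 * (\<Sum>bs | length bs = n. (measure G (cell bs))\<^sup>2)) \<longlonglongrightarrow> c\<^sup>2 * 0"
    by (intro tendsto_mult_left sum_cell_squares_tendsto G)
  ultimately have lim: "(\<lambda>n. prob (bad n)) \<longlonglongrightarrow> 0"
    by (intro tendsto_sandwich[of "\<lambda>_. 0" "\<lambda>n. prob (bad n)" _ "\<lambda>n. c\<^sup>2 * (\<Sum>bs | length bs = n. (measure G (cell bs))\<^sup>2)"]) auto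
  have "prob (\<Inter>n. bad n) \<le> prob (bad n)" for n by (intro finite_measure_mono) auto
  then have "prob (\<Inter>n. bad n) \<le> 0" using lim by (intro LIMSEQ_le_const) auto
  then have "prob (\<Inter>n. bad n) = 0" using measure_nonneg[of M "\<Inter>n. bad n"] by linarith
  then have null: "emeasure M (\<Inter>n. bad n) = 0" by (simp add: emeasure_eq_measure)
  show ?thesis
  proof (rule AE_I[OF _ null])
    show "{\<omega>\<in>space M. \<not> (\<exists>n. \<forall>bs. length bs = n \<longrightarrow> emeasure (N \<omega>) (cell bs \<times> Eset r) \<le> 1)} \<subseteq> (\<Inter>n. bad n)"
      by (auto simp: bad_def)
    show "(\<Inter>n. bad n) \<in> events" by measurable
  qed
qed

section \<open>Marks\<close>

text \<open>The law of \<open>n\<close> independent draws. As a single mass function on lists it has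
  total mass one, which the likelihood of a mark inherits.\<close>

primrec mark_pmf :: "nat \<Rightarrow> int pmf \<Rightarrow> int list pmf" where
  "mark_pmf 0 p = return_pmf []"
| "mark_pmf (Suc n) p = map_pmf (\<lambda>(a, v). a # v) (pair_pmf p (mark_pmf n p))"

lemma pmf_mark_pmf: "pmf (mark_pmf n p) v = (if length v = n then \<Prod>i<n. pmf p (v ! i) else 0)"
proof (induction n arbitrary: v)
  case 0
  then show ?case by (auto simp: pmf_return indicator_def)
next
  case (Suc n)
  have inj: "inj (\<lambda>(a :: int, v). a # v)" by (auto simp: inj_def)
  show ?case
  proof (cases v)
    case Nil
    then have "v \<notin> set_pmf (mark_pmf (Suc n) p)" by auto
    then show ?thesis using Nil by (simp add: pmf_eq_0_set_pmf)
  next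
    case (Cons a w)
    have "pmf (mark_pmf (Suc n) p) v = pmf (map_pmf (\<lambda>(a, v). a # v) (pair_pmf p (mark_pmf n p))) ((\<lambda>(a, v). a # v) (a, w))"
      using Cons by simp
    also have "\<dots> = pmf p a * pmf (mark_pmf n p) w"
      by (subst pmf_map_inj'[OF inj]) (simp add: pmf_pair)
    also have "\<dots> = (if length v = Suc n then \<Prod>i<Suc n. pmf p (v ! i) else 0)"
      using Cons by (simp add: Suc prod.lessThan_Suc_shift del: prod.lessThan_Suc)
    finally show ?thesis .
  qed
qed

text \<open>Integrals over marks become series, so that measurability and the exchange of integrals
  follow from the facts about countable sums.\<close>

lemma nn_integral_int_list:
  obtains e :: "nat \<Rightarrow> int list" where "\<And>f. (\<integral>\<^sup>+v. f v \<partial>count_space UNIV) = (\<Sum>n. f (e n) :: ennreal)"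
proof -
  have "bij_betw (from_nat_into UNIV) UNIV (UNIV :: int list set)"
    by (rule bij_betw_from_nat_into) (auto simp: infinite_UNIV_listI)
  then show thesis
    by (intro that[of "from_nat_into UNIV"])
      (simp add: nn_integral_bij_count_space[symmetric] nn_integral_count_space_nat)
qed

lemma borel_measurable_nn_integral_int_list [measurable (raw)]:
  assumes "\<And>v :: int list. (\<lambda>x. f x v) \<in> borel_measurable N"
  shows "(\<lambda>x. \<integral>\<^sup>+v. f x v \<partial>count_space UNIV) \<in> borel_measurable N"
proof -
  obtain e where e: "\<And>f. (\<integral>\<^sup>+v. f v \<partial>count_space UNIV) = (\<Sum>n. f (e n :: int list) :: ennreal)"
    by (rule nn_integral_int_list) blast
  have [measurable]: "(\<lambda>x. f x (e n)) \<in> borel_measurable N" for n by (rule assms)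
  show ?thesis unfolding e by measurable
qed

lemma nn_integral_swap_int_list:
  assumes "\<And>v :: int list. (\<lambda>x. f x v) \<in> borel_measurable N"
  shows "(\<integral>\<^sup>+x. \<integral>\<^sup>+v. f x v \<partial>count_space UNIV \<partial>N) = (\<integral>\<^sup>+v. \<integral>\<^sup>+x. f x v \<partial>N \<partial>count_space UNIV)"
proof -
  obtain e where e: "\<And>f. (\<integral>\<^sup>+v. f v \<partial>count_space UNIV) = (\<Sum>n. f (e n :: int list) :: ennreal)"
    by (rule nn_integral_int_list) blast
  show ?thesis unfolding e using assms by (intro nn_integral_suminf) auto
qed

text \<open>Equality of the conditional expectations of \<open>P\<close> and \<open>Q\<close> given
  \<open>A\<close>, extended from events to nonnegative functions. In this form no integrability is
  required.\<close>

lemma nn_integral_subalgebra_eq: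
  assumes sp: "space A = space M" and sub: "sets A \<subseteq> sets M"
    and [measurable]: "P \<in> borel_measurable M" "Q \<in> borel_measurable M"
    and eq: "\<And>E. E \<in> sets A \<Longrightarrow> (\<integral>\<^sup>+x. indicator E x * P x \<partial>M) = (\<integral>\<^sup>+x. indicator E x * Q x \<partial>M)"
    and f: "f \<in> borel_measurable A"
  shows "(\<integral>\<^sup>+x. f x * P x \<partial>M) = (\<integral>\<^sup>+x. f x * Q x \<partial>M)"
  using f
proof (induction rule: borel_measurable_induct)
  case (cong f g)
  then show ?case using sp by (simp cong: nn_integral_cong)
next
  case (set E)
  then show ?case by (rule eq)
next
  case (mult u c)
  have [measurable]: "u \<in> borel_measurable M"
    using mult(2) measurable_mono[of borel borel A M] sub sp by auto
  show ?case using mult(4) by (simp add: mult.assoc nn_integral_cmult)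
next
  case (add u v)
  have [measurable]: "u \<in> borel_measurable M" "v \<in> borel_measurable M"
    using add.hyps(1,3) measurable_mono[of borel borel A M] sub sp by auto
  show ?case using add by (simp add: distrib_right nn_integral_add)
next
  case (seq U)
  have [measurable]: "U i \<in> borel_measurable M" for i
    using seq(1) measurable_mono[of borel borel A M] sub sp by auto
  have *: "(\<integral>\<^sup>+x. (SUP i. U i) x * R x \<partial>M) = (SUP i. \<integral>\<^sup>+x. U i x * R x \<partial>M)"
    if [measurable]: "R \<in> borel_measurable M" for R
  proof -
    have "(\<integral>\<^sup>+x. (SUP i. U i) x * R x \<partial>M) = (\<integral>\<^sup>+x. (SUP i. U i x * R x) \<partial>M)"
      by (simp add: SUP_mult_right_ennreal image_comp)
    also have "\<dots> = (SUP i. \<integral>\<^sup>+x. U i x * R x \<partial>M)"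
      using seq(3) by (intro nn_integral_monotone_convergence_SUP)
        (auto simp: incseq_def le_fun_def intro!: mult_right_mono)
    finally show ?thesis .
  qed
  show ?case by (simp only: * seq.IH \<open>P \<in> borel_measurable M\<close> \<open>Q \<in> borel_measurable M\<close>)
qed

text \<open>Two passes from events to functions, one for each factor.\<close>

lemma (in prob_space) indep_set_nn_integral:
  assumes ind: "indep_set (sets A) (sets B)" and sp: "space A = space M" "space B = space M"
    and f: "f \<in> borel_measurable A" and g: "g \<in> borel_measurable B"
  shows "(\<integral>\<^sup>+x. f x * g x \<partial>M) = (\<integral>\<^sup>+x. f x \<partial>M) * (\<integral>\<^sup>+x. g x \<partial>M)"
proof -
  have sub: "sets A \<subseteq> events" "sets B \<subseteq> events"
    using ind by (auto simp: indep_set_def indep_sets_def split: bool.splits)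
  have [measurable]: "f \<in> borel_measurable M" "g \<in> borel_measurable M"
    using f g measurable_mono[of borel borel A M] measurable_mono[of borel borel B M] sub sp by auto
  have "(\<integral>\<^sup>+x. f x * g x \<partial>M) = (\<integral>\<^sup>+x. f x * (\<integral>\<^sup>+x. g x \<partial>M) \<partial>M)"
  proof (rule nn_integral_subalgebra_eq[OF sp(1) sub(1) _ _ _ f])
    fix E assume E: "E \<in> sets A"
    then have [measurable]: "E \<in> events" using sub by auto
    have "(\<integral>\<^sup>+x. g x * indicator E x \<partial>M) = (\<integral>\<^sup>+x. g x * emeasure M E \<partial>M)"
    proof (rule nn_integral_subalgebra_eq[OF sp(2) sub(2) _ _ _ g])
      fix E' assume E': "E' \<in> sets B"
      then have [measurable]: "E' \<in> events" using sub by auto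
      have "(\<integral>\<^sup>+x. indicator E' x * indicator E x \<partial>M) = emeasure M (E \<inter> E')"
        by (subst indicator_inter_arith[symmetric]) (simp add: Int_commute)
      also have "\<dots> = emeasure M E * emeasure M E'"
        using indep_setD[OF ind E E'] by (simp add: emeasure_eq_measure ennreal_mult)
      finally show "(\<integral>\<^sup>+x. indicator E' x * indicator E x \<partial>M) = (\<integral>\<^sup>+x. indicator E' x * emeasure M E \<partial>M)"
        by (simp add: nn_integral_multc mult.commute)
    qed auto
    then show "(\<integral>\<^sup>+x. indicator E x * g x \<partial>M) = (\<integral>\<^sup>+x. indicator E x * (\<integral>\<^sup>+x. g x \<partial>M) \<partial>M)"
      by (simp add: nn_integral_multc mult.commute)
  qed auto
  then show ?thesis by (simp add: nn_integral_multc)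
qed

section \<open>The model\<close>

locale model = prob_space M for M :: "'w measure" +
  fixes \<Theta> :: "'w \<Rightarrow> 'a::polish_space set \<Rightarrow> real"
    and S :: "'a set" and \<nu> :: "real measure" and G :: "'a measure"
    and K :: "'w \<Rightarrow> enat" and \<theta> :: "nat \<Rightarrow> 'w \<Rightarrow> real" and \<psi> :: "nat \<Rightarrow> 'w \<Rightarrow> 'a"
    and h :: "real \<Rightarrow> int pmf" and m :: nat
    and x :: "nat \<Rightarrow> nat \<Rightarrow> 'w \<Rightarrow> int"
    and X :: "nat \<Rightarrow> 'w \<Rightarrow> 'a set \<Rightarrow> real"
  assumes h_measurable: "\<And>i. (\<lambda>t. pmf (h t) i) \<in> borel_measurable borel"
    and m: "m \<ge> 1"
    and nu: "sets \<nu> = sets nonzero_reals" "sigma_finite_measure \<nu>"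
    and G: "sets G = sets borel" "prob_space G" "\<And>s. emeasure G {s} = 0"
    and crsm: "completely_random M \<Theta>"
    and A00: "crsm_representation M \<Theta> S (\<lambda>_. 0) (G \<Otimes>\<^sub>M \<nu>)"
    and A0: "finite S"
    and A2: "(\<Sum>\<^sub>\<infinity>i\<in>- {0}. \<integral>\<^sup>+ t. ennreal (pmf (h t) i) \<partial>\<nu>) < \<infinity>"
    and atoms: "atom_enumeration M \<Theta> S K \<theta> \<psi>"
    and weights: "likelihood_weights M K \<theta> \<psi> h m x"
    and X_measurable: "\<And>j. j \<in> {1..m} \<Longrightarrow> X j \<in> M \<rightarrow>\<^sub>M signed_measures"
    and X_atoms: "\<And>j. j \<in> {1..m} \<Longrightarrow>
      AE \<omega> in M. weighted_atoms (K \<omega>) (\<lambda>k. real_of_int (x j k \<omega>)) (\<lambda>k. \<psi> k \<omega>) (X j \<omega>)"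
begin

definition mark :: "nat \<Rightarrow> 'w \<Rightarrow> int list" where
  "mark k \<omega> = map (\<lambda>j. x j k \<omega>) [1..<Suc m]"

text \<open>
  The likelihoods of the \<open>m\<close> observations at one atom of weight \<open>y\<close> are bundled into the
  probability \<open>H v y\<close> of the list \<open>v\<close> of its \<open>m\<close> observed values, the mark of the atom.
\<close>

definition H :: "int list \<Rightarrow> real \<Rightarrow> ennreal" where
  "H v y = ennreal (pmf (mark_pmf m (h y)) v)"

text \<open>Marks range over a countable set, so measurability for each of them separately is
  enough.\<close>

definition lmeas :: "('a \<Rightarrow> real \<Rightarrow> int list \<Rightarrow> ennreal) \<Rightarrow> bool" where
  "lmeas l \<longleftrightarrow> (\<forall>v. (\<lambda>(s, y). l s y v) \<in> borel_measurable (borel \<Otimes>\<^sub>M borel))"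

lemma lmeasD [measurable (raw)]:
  assumes "lmeas l" "f \<in> borel_measurable N" "g \<in> borel_measurable N"
  shows "(\<lambda>x. l (f x) (g x) v) \<in> borel_measurable N"
proof -
  have "(\<lambda>x. (f x, g x)) \<in> N \<rightarrow>\<^sub>M borel \<Otimes>\<^sub>M borel" using assms(2,3) by measurable
  from measurable_compose[OF this, of "\<lambda>(s, y). l s y v"] show ?thesis using assms(1) by (simp add: lmeas_def)
qed

lemma sum_H: "(\<integral>\<^sup>+v. H v y \<partial>count_space UNIV) = 1"
  unfolding H_def by (simp add: nn_integral_pmf' )

lemma H_le_1: "H v y \<le> 1"
  unfolding H_def by (simp add: pmf_le_1)

lemma H_measurable [measurable]: "H v \<in> borel_measurable borel"
  unfolding H_def pmf_mark_pmf using h_measurable by (cases "length v = m") auto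

lemma length_mark [simp]: "length (mark k \<omega>) = m"
  by (simp add: mark_def)

lemma H_prod: "length v = m \<Longrightarrow> H v y = ennreal (\<Prod>i<m. pmf (h y) (v ! i))"
  by (simp add: H_def pmf_mark_pmf)

lemma K_measurable [measurable]: "K \<in> M \<rightarrow>\<^sub>M count_space UNIV"
  and \<theta>_measurable [measurable]: "\<theta> k \<in> borel_measurable M"
  and \<psi>_measurable [measurable]: "\<psi> k \<in> borel_measurable M"
  using atoms by (auto simp: atom_enumeration_def)

lemma x_measurable: "j \<in> {1..m} \<Longrightarrow> x j k \<in> M \<rightarrow>\<^sub>M count_space UNIV"
  using weights by (auto simp: likelihood_weights_def)

lemma mark_eq_iff: "length v = m \<Longrightarrow> mark k \<omega> = v \<longleftrightarrow> (\<forall>j\<in>{1..m}. x j k \<omega> = v ! (j - 1))"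
proof -
  assume v: "length v = m"
  have "mark k \<omega> = v \<longleftrightarrow> (\<forall>i<m. x (Suc i) k \<omega> = v ! i)"
    using v by (auto simp: mark_def list_eq_iff_nth_eq simp del: upt_Suc)
  also have "\<dots> \<longleftrightarrow> (\<forall>j\<in>{1..m}. x j k \<omega> = v ! (j - 1))"
  proof (intro iffI ballI allI impI)
    fix j assume "\<forall>i<m. x (Suc i) k \<omega> = v ! i" "j \<in> {1..m}"
    then show "x j k \<omega> = v ! (j - 1)" by (cases j) auto
  next
    fix i assume "\<forall>j\<in>{1..m}. x j k \<omega> = v ! (j - 1)" "i < m"
    then show "x (Suc i) k \<omega> = v ! i" by (metis Suc_leI atLeastAtMost_iff diff_Suc_1 le_add1 plus_1_eq_Suc)
  qed
  finally show ?thesis .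
qed

lemma mark_measurable [measurable]: "mark k \<in> M \<rightarrow>\<^sub>M count_space UNIV"
proof (subst measurable_count_space_eq2_countable, intro conjI ballI)
  fix v
  show "mark k -` {v} \<inter> space M \<in> sets M"
  proof (cases "length v = m")
    case True
    have "mark k -` {v} \<inter> space M = {\<omega>\<in>space M. \<forall>j\<in>{1..m}. x j k \<omega> = v ! (j - 1)}"
      using mark_eq_iff[OF True] by auto
    also have "\<dots> \<in> sets M"
    proof (intro sets.sets_Collect_finite_All)
      fix j assume "j \<in> {1..m}"
      then have [measurable]: "x j k \<in> M \<rightarrow>\<^sub>M count_space UNIV" by (rule x_measurable)
      show "{\<omega>\<in>space M. x j k \<omega> = v ! (j - 1)} \<in> sets M" by measurable
    qed simp
    finally show ?thesis .
  next
    case False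
    then have "mark k -` {v} \<inter> space M = {}" by auto
    then show ?thesis by simp
  qed
qed auto

abbreviation "Atoms \<equiv> atoms_sigma M K \<theta> \<psi>"

lemma space_Atoms: "space Atoms = space M"
  by (simp add: atoms_sigma_def)

lemma atoms_map_measurable: "(\<lambda>\<omega>. (K \<omega>, \<lambda>k. (\<psi> k \<omega>, \<theta> k \<omega>))) \<in> M \<rightarrow>\<^sub>M count_space UNIV \<Otimes>\<^sub>M (\<Pi>\<^sub>M k\<in>UNIV. borel \<Otimes>\<^sub>M borel)"
  by (intro measurable_Pair K_measurable measurable_PiM_single') (auto simp: space_pair_measure)

lemma sets_Atoms: "sets Atoms \<subseteq> sets M"
  unfolding atoms_sigma_def
  using measurable_sets[OF atoms_map_measurable] measurable_space[OF atoms_map_measurable]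
  by (subst sets_vimage_algebra2) auto

lemma Atoms_measurable [measurable]:
  shows "K \<in> Atoms \<rightarrow>\<^sub>M count_space UNIV" "\<psi> k \<in> borel_measurable Atoms" "\<theta> k \<in> borel_measurable Atoms"
proof -
  have T: "(\<lambda>\<omega>. (K \<omega>, \<lambda>k. (\<psi> k \<omega>, \<theta> k \<omega>))) \<in> Atoms \<rightarrow>\<^sub>M count_space UNIV \<Otimes>\<^sub>M (\<Pi>\<^sub>M k\<in>UNIV. borel \<Otimes>\<^sub>M borel)"
    unfolding atoms_sigma_def using measurable_space[OF atoms_map_measurable]
    by (intro measurable_vimage_algebra1) auto
  show "K \<in> Atoms \<rightarrow>\<^sub>M count_space UNIV" using measurable_compose[OF T measurable_fst] by simp
  have "(\<lambda>\<omega>. (\<psi> k \<omega>, \<theta> k \<omega>)) \<in> Atoms \<rightarrow>\<^sub>M borel \<Otimes>\<^sub>M borel"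
    using measurable_compose[OF measurable_compose[OF T measurable_snd] measurable_component_singleton[of k UNIV]] by simp
  from measurable_compose[OF this measurable_fst] measurable_compose[OF this measurable_snd]
  show "\<psi> k \<in> borel_measurable Atoms" "\<theta> k \<in> borel_measurable Atoms" by simp_all
qed

lemma marks_base:
  assumes E: "E \<in> sets Atoms"
  shows "(\<integral>\<^sup>+\<omega>. indicator E \<omega> * (\<Prod>k<n. of_bool (enat k < K \<omega> \<and> mark k \<omega> = w k)) \<partial>M)
    = (\<integral>\<^sup>+\<omega>. indicator E \<omega> * (\<Prod>k<n. of_bool (enat k < K \<omega>) * H (w k) (\<theta> k \<omega>)) \<partial>M)"
proof (cases "\<forall>k<n. length (w k) = m")
  case True
  \<comment> \<open>Because \<open>m\<close> is positive, every index below \<open>n\<close> occurs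
    in \<open>J\<close>; otherwise the conditions \<open>enat k < K \<omega>\<close> would be
    lost.\<close>
  define J where "J = {1..m} \<times> {..<n}"
  define val where "val j k = w k ! (j - 1)" for j k
  have EM [measurable]: "E \<in> sets M" using E sets_Atoms by auto
  have fJ: "finite J" "J \<subseteq> {1..m} \<times> UNIV" by (auto simp: J_def)
  have cond: "(\<forall>(j, k)\<in>J. enat k < K \<omega> \<and> x j k \<omega> = val j k) \<longleftrightarrow> (\<forall>k<n. enat k < K \<omega> \<and> mark k \<omega> = w k)" for \<omega>
    using True m by (auto simp: J_def val_def mark_eq_iff)
  have cond2: "(\<forall>(j, k)\<in>J. enat k < K \<omega>) \<longleftrightarrow> (\<forall>k<n. enat k < K \<omega>)" for \<omega>
    using m by (auto simp: J_def)
  have prodJ: "(\<Prod>(j, k)\<in>J. pmf (h (\<theta> k \<omega>)) (val j k)) = (\<Prod>k<n. \<Prod>i<m. pmf (h (\<theta> k \<omega>)) (w k ! i))" for \<omega>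
  proof -
    have "(\<Prod>(j, k)\<in>J. pmf (h (\<theta> k \<omega>)) (val j k)) = (\<Prod>j\<in>{1..m}. \<Prod>k<n. pmf (h (\<theta> k \<omega>)) (val j k))"
      by (simp add: J_def prod.cartesian_product)
    also have "\<dots> = (\<Prod>k<n. \<Prod>j\<in>{1..m}. pmf (h (\<theta> k \<omega>)) (val j k))" by (rule prod.swap)
    also have "\<dots> = (\<Prod>k<n. \<Prod>i<m. pmf (h (\<theta> k \<omega>)) (w k ! i))"
    proof (rule prod.cong[OF refl])
      fix k
      show "(\<Prod>j\<in>{1..m}. pmf (h (\<theta> k \<omega>)) (val j k)) = (\<Prod>i<m. pmf (h (\<theta> k \<omega>)) (w k ! i))"
        by (rule prod.reindex_bij_witness[of _ Suc "\<lambda>j. j - 1"]) (auto simp: val_def)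
    qed
    finally show ?thesis .
  qed
  have ob: "(\<Prod>k<n. of_bool (P k)) = (of_bool (\<forall>k<n. P k) :: ennreal)" for P
    by (cases "\<forall>k<n. P k") (auto intro!: prod_zero)
  have "{\<omega>\<in>E. \<forall>(j, k)\<in>J. enat k < K \<omega> \<and> x j k \<omega> = val j k} = {\<omega>\<in>space M. \<omega> \<in> E \<and> (\<forall>k<n. enat k < K \<omega> \<and> mark k \<omega> = w k)}"
    using cond sets.sets_into_space[OF EM] by auto
  also have "\<dots> \<in> sets M" by measurable
  finally have m1: "{\<omega>\<in>E. \<forall>(j, k)\<in>J. enat k < K \<omega> \<and> x j k \<omega> = val j k} \<in> sets M" .
  have "(\<integral>\<^sup>+\<omega>. indicator E \<omega> * (\<Prod>k<n. of_bool (enat k < K \<omega> \<and> mark k \<omega> = w k)) \<partial>M)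
      = (\<integral>\<^sup>+\<omega>. indicator {\<omega>\<in>E. \<forall>(j, k)\<in>J. enat k < K \<omega> \<and> x j k \<omega> = val j k} \<omega> \<partial>M)"
    unfolding ob cond by (intro nn_integral_cong) (auto simp: indicator_def)
  also have "\<dots> = emeasure M {\<omega>\<in>E. \<forall>(j, k)\<in>J. enat k < K \<omega> \<and> x j k \<omega> = val j k}"
    using m1 by simp
  also have "\<dots> = (\<integral>\<^sup>+ \<omega>. indicator {\<omega>\<in>E. \<forall>(j, k)\<in>J. enat k < K \<omega>} \<omega>
                    * ennreal (\<Prod>(j, k)\<in>J. pmf (h (\<theta> k \<omega>)) (val j k)) \<partial>M)"
    using weights E fJ unfolding likelihood_weights_def by blast
  also have "\<dots> = (\<integral>\<^sup>+\<omega>. indicator E \<omega> * (\<Prod>k<n. of_bool (enat k < K \<omega>) * H (w k) (\<theta> k \<omega>)) \<partial>M)"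
    unfolding cond2 prodJ prod.distrib ob
    using True by (intro nn_integral_cong) (auto simp: indicator_def H_prod prod_ennreal prod_nonneg)
  finally show ?thesis .
next
  case False
  then obtain k where k: "k < n" "length (w k) \<noteq> m" by auto
  have "(\<Prod>k<n. of_bool (enat k < K \<omega> \<and> mark k \<omega> = w k)) = (0::ennreal)" for \<omega>
    using k by (intro prod_zero bexI[of _ k]) (auto dest: arg_cong[of _ _ length])
  moreover have "(\<Prod>k<n. of_bool (enat k < K \<omega>) * H (w k) (\<theta> k \<omega>)) = 0" for \<omega>
    using k by (intro prod_zero bexI[of _ k]) (auto simp: H_def pmf_mark_pmf)
  ultimately show ?thesis by (simp only:)
qed

definition expect_mark :: "('a \<Rightarrow> real \<Rightarrow> int list \<Rightarrow> ennreal) \<Rightarrow> 'a \<Rightarrow> real \<Rightarrow> ennreal" where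
  "expect_mark g s y = (\<integral>\<^sup>+v. H v y * g s y v \<partial>count_space UNIV)"

lemma expect_mark_measurable [measurable (raw)]:
  assumes "lmeas g" "f \<in> borel_measurable N" "f' \<in> borel_measurable N"
  shows "(\<lambda>x. expect_mark g (f x) (f' x)) \<in> borel_measurable N"
  unfolding expect_mark_def using assms by measurable

lemma nn_integral_of_bool_point:
  "(\<integral>\<^sup>+u. of_bool (P \<and> v = u) * f u \<partial>count_space UNIV) = of_bool P * (f v :: ennreal)"
proof -
  have "(\<integral>\<^sup>+u. of_bool (P \<and> v = u) * f u \<partial>count_space UNIV) = (\<integral>\<^sup>+u. (of_bool P * f v) * indicator {v} u \<partial>count_space UNIV)"
    by (intro nn_integral_cong) (auto simp: indicator_def)
  also have "\<dots> = of_bool P * f v" by (subst nn_integral_cmult_indicator) auto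
  finally show ?thesis .
qed

text \<open>Passes from events on the marks to functions of them, atom by atom: the first
  \<open>j\<close> factors are already general, the others still prescribe a mark. Summing over the
  mark of atom \<open>j\<close> frees one more factor.\<close>

lemma marks_induct:
  assumes "j \<le> n" and f: "f \<in> borel_measurable Atoms" and g: "\<And>k. lmeas (g k)"
  shows "(\<integral>\<^sup>+\<omega>. f \<omega> * ((\<Prod>k<j. of_bool (enat k < K \<omega>) * g k (\<psi> k \<omega>) (\<theta> k \<omega>) (mark k \<omega>))
        * (\<Prod>k=j..<n. of_bool (enat k < K \<omega> \<and> mark k \<omega> = w k))) \<partial>M)
    = (\<integral>\<^sup>+\<omega>. f \<omega> * ((\<Prod>k<j. of_bool (enat k < K \<omega>) * expect_mark (g k) (\<psi> k \<omega>) (\<theta> k \<omega>))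
        * (\<Prod>k=j..<n. of_bool (enat k < K \<omega>) * H (w k) (\<theta> k \<omega>))) \<partial>M)"
  using assms(1) f
proof (induction j arbitrary: f w)
  case 0
  have "(\<integral>\<^sup>+\<omega>. f \<omega> * (\<Prod>k<n. of_bool (enat k < K \<omega> \<and> mark k \<omega> = w k)) \<partial>M)
    = (\<integral>\<^sup>+\<omega>. f \<omega> * (\<Prod>k<n. of_bool (enat k < K \<omega>) * H (w k) (\<theta> k \<omega>)) \<partial>M)"
    by (rule nn_integral_subalgebra_eq[OF space_Atoms sets_Atoms _ _ marks_base 0(2)]) measurable
  then show ?case by (simp add: atLeast0LessThan)
next
  case (Suc j)
  have fM [measurable]: "f \<in> borel_measurable M"
    using Suc.prems(2) measurable_mono[of borel borel Atoms M] sets_Atoms space_Atoms by auto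
  have [measurable]: "(\<lambda>\<omega>. g k (\<psi> k \<omega>) (\<theta> k \<omega>) (mark k \<omega>)) \<in> borel_measurable M" for k
    by (rule measurable_compose_countable[where f = "\<lambda>v \<omega>. g k (\<psi> k \<omega>) (\<theta> k \<omega>) v" and g = "mark k"])
       (use g in measurable)
  have [measurable]: "(\<lambda>\<omega>. g k (\<psi> k \<omega>) (\<theta> k \<omega>) u) \<in> borel_measurable M"
    "(\<lambda>\<omega>. expect_mark (g k) (\<psi> k \<omega>) (\<theta> k \<omega>)) \<in> borel_measurable M" for k u
    using g by measurable
  have split: "{j..<n} = insert j {Suc j..<n}" using Suc.prems(1) by auto
  define A where "A \<omega> = (\<Prod>k<j. of_bool (enat k < K \<omega>) * g k (\<psi> k \<omega>) (\<theta> k \<omega>) (mark k \<omega>))" for \<omega>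
  define A' where "A' \<omega> = (\<Prod>k<j. of_bool (enat k < K \<omega>) * expect_mark (g k) (\<psi> k \<omega>) (\<theta> k \<omega>))" for \<omega>
  define B where "B \<omega> = (\<Prod>k=Suc j..<n. of_bool (enat k < K \<omega> \<and> mark k \<omega> = w k) :: ennreal)" for \<omega>
  define B' where "B' \<omega> = (\<Prod>k=Suc j..<n. of_bool (enat k < K \<omega>) * H (w k) (\<theta> k \<omega>))" for \<omega>
  have [measurable]: "A \<in> borel_measurable M" "A' \<in> borel_measurable M" "B \<in> borel_measurable M" "B' \<in> borel_measurable M"
    unfolding A_def A'_def B_def B'_def by measurable
  define g' where "g' u \<omega> = g j (\<psi> j \<omega>) (\<theta> j \<omega>) u" for u \<omega>
  have [measurable]: "g' u \<in> borel_measurable M" for u unfolding g'_def by measurable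
  \<comment> \<open>For a fixed mark \<open>u\<close>, the factor \<open>g' u\<close> depends only
    on the atoms and can be absorbed into \<open>f\<close>; \<open>w\<close> is changed at
    \<open>j\<close> to prescribe \<open>u\<close>.\<close>
  have IH: "(\<integral>\<^sup>+\<omega>. (f \<omega> * g' u \<omega>) * (A \<omega> * (of_bool (enat j < K \<omega> \<and> mark j \<omega> = u) * B \<omega>)) \<partial>M)
      = (\<integral>\<^sup>+\<omega>. (f \<omega> * g' u \<omega>) * (A' \<omega> * (of_bool (enat j < K \<omega>) * H u (\<theta> j \<omega>) * B' \<omega>)) \<partial>M)" for u
  proof -
    have "(\<lambda>\<omega>. f \<omega> * g' u \<omega>) \<in> borel_measurable Atoms" unfolding g'_def using Suc.prems(2) g by measurable
    from Suc.IH[OF _ this, of "w(j := u)"] Suc.prems(1)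
    show ?thesis unfolding split by (simp add: A_def A'_def B_def B'_def)
  qed
  have "(\<integral>\<^sup>+\<omega>. f \<omega> * ((\<Prod>k<Suc j. of_bool (enat k < K \<omega>) * g k (\<psi> k \<omega>) (\<theta> k \<omega>) (mark k \<omega>)) * B \<omega>) \<partial>M)
     = (\<integral>\<^sup>+\<omega>. \<integral>\<^sup>+u. (f \<omega> * g' u \<omega>) * (A \<omega> * (of_bool (enat j < K \<omega> \<and> mark j \<omega> = u) * B \<omega>)) \<partial>count_space UNIV \<partial>M)"
  proof (intro nn_integral_cong)
    fix \<omega>
    have "(\<integral>\<^sup>+u. (f \<omega> * g' u \<omega>) * (A \<omega> * (of_bool (enat j < K \<omega> \<and> mark j \<omega> = u) * B \<omega>)) \<partial>count_space UNIV)
      = (\<integral>\<^sup>+u. (f \<omega> * A \<omega> * B \<omega>) * (of_bool (enat j < K \<omega> \<and> mark j \<omega> = u) * g' u \<omega>) \<partial>count_space UNIV)"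
      by (simp add: mult_ac)
    also have "\<dots> = (f \<omega> * A \<omega> * B \<omega>) * (of_bool (enat j < K \<omega>) * g' (mark j \<omega>) \<omega>)"
      by (subst nn_integral_cmult) (auto simp: nn_integral_of_bool_point)
    finally show "f \<omega> * ((\<Prod>k<Suc j. of_bool (enat k < K \<omega>) * g k (\<psi> k \<omega>) (\<theta> k \<omega>) (mark k \<omega>)) * B \<omega>)
      = (\<integral>\<^sup>+u. (f \<omega> * g' u \<omega>) * (A \<omega> * (of_bool (enat j < K \<omega> \<and> mark j \<omega> = u) * B \<omega>)) \<partial>count_space UNIV)"
      by (simp add: A_def g'_def mult_ac)
  qed
  also have "\<dots> = (\<integral>\<^sup>+u. \<integral>\<^sup>+\<omega>. (f \<omega> * g' u \<omega>) * (A \<omega> * (of_bool (enat j < K \<omega> \<and> mark j \<omega> = u) * B \<omega>)) \<partial>M \<partial>count_space UNIV)"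
    by (rule nn_integral_swap_int_list) measurable
  also have "\<dots> = (\<integral>\<^sup>+u. \<integral>\<^sup>+\<omega>. (f \<omega> * g' u \<omega>) * (A' \<omega> * (of_bool (enat j < K \<omega>) * H u (\<theta> j \<omega>) * B' \<omega>)) \<partial>M \<partial>count_space UNIV)"
    unfolding IH ..
  also have "\<dots> = (\<integral>\<^sup>+\<omega>. \<integral>\<^sup>+u. (f \<omega> * g' u \<omega>) * (A' \<omega> * (of_bool (enat j < K \<omega>) * H u (\<theta> j \<omega>) * B' \<omega>)) \<partial>count_space UNIV \<partial>M)"
    by (rule nn_integral_swap_int_list[symmetric]) measurable
  also have "\<dots> = (\<integral>\<^sup>+\<omega>. f \<omega> * ((\<Prod>k<Suc j. of_bool (enat k < K \<omega>) * expect_mark (g k) (\<psi> k \<omega>) (\<theta> k \<omega>)) * B' \<omega>) \<partial>M)"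
  proof (intro nn_integral_cong)
    fix \<omega>
    have "(\<integral>\<^sup>+u. (f \<omega> * g' u \<omega>) * (A' \<omega> * (of_bool (enat j < K \<omega>) * H u (\<theta> j \<omega>) * B' \<omega>)) \<partial>count_space UNIV)
      = (\<integral>\<^sup>+u. (f \<omega> * A' \<omega> * B' \<omega> * of_bool (enat j < K \<omega>)) * (H u (\<theta> j \<omega>) * g' u \<omega>) \<partial>count_space UNIV)"
      by (simp add: mult_ac)
    also have "\<dots> = (f \<omega> * A' \<omega> * B' \<omega> * of_bool (enat j < K \<omega>)) * expect_mark (g j) (\<psi> j \<omega>) (\<theta> j \<omega>)"
      by (subst nn_integral_cmult) (auto simp: expect_mark_def g'_def)
    finally show "(\<integral>\<^sup>+u. (f \<omega> * g' u \<omega>) * (A' \<omega> * (of_bool (enat j < K \<omega>) * H u (\<theta> j \<omega>) * B' \<omega>)) \<partial>count_space UNIV)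
      = f \<omega> * ((\<Prod>k<Suc j. of_bool (enat k < K \<omega>) * expect_mark (g k) (\<psi> k \<omega>) (\<theta> k \<omega>)) * B' \<omega>)"
      by (simp add: A'_def mult_ac)
  qed
  finally show ?case unfolding B_def B'_def .
qed

section \<open>Laplace functional of the marked atoms\<close>

definition ksum :: "('a \<Rightarrow> real \<Rightarrow> int list \<Rightarrow> ennreal) \<Rightarrow> 'w \<Rightarrow> ennreal" where
  "ksum f \<omega> = (\<Sum>k. if enat k < K \<omega> then f (\<psi> k \<omega>) (\<theta> k \<omega>) (mark k \<omega>) else 0)"

lemma ksum_count_space: "ksum f \<omega> = (\<integral>\<^sup>+k. f (\<psi> k \<omega>) (\<theta> k \<omega>) (mark k \<omega>) \<partial>count_space {k. enat k < K \<omega>})"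
  unfolding ksum_def
  by (subst nn_integral_count_space_indicator)
     (auto simp: nn_integral_count_space_nat[symmetric] indicator_def intro!: nn_integral_cong)

lemma lmeas_mark [measurable (raw)]: "lmeas g \<Longrightarrow> (\<lambda>\<omega>. g (\<psi> k \<omega>) (\<theta> k \<omega>) (mark k \<omega>)) \<in> borel_measurable M"
  by (rule measurable_compose_countable[where f = "\<lambda>v \<omega>. g (\<psi> k \<omega>) (\<theta> k \<omega>) v" and g = "mark k"]) measurable

lemma ksum_measurable [measurable (raw)]: "lmeas g \<Longrightarrow> (\<lambda>\<omega>. ksum g \<omega>) \<in> borel_measurable M"
  unfolding ksum_def by measurable

lemma lmeas_en: "lmeas l \<Longrightarrow> lmeas (\<lambda>s y v. en (l s y v))"
  unfolding lmeas_def split_beta' by (intro allI measurable_compose[OF _ en_measurable]) blast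

lemma expect_mark_le_1: "(\<And>v. g s y v \<le> 1) \<Longrightarrow> expect_mark g s y \<le> 1"
proof -
  assume "\<And>v. g s y v \<le> 1"
  then have "expect_mark g s y \<le> (\<integral>\<^sup>+v. H v y * 1 \<partial>count_space UNIV)"
    unfolding expect_mark_def by (intro nn_integral_mono mult_left_mono) auto
  then show ?thesis by (simp add: sum_H)
qed

lemma one_minus_expect_mark:
  "1 - expect_mark (\<lambda>s y v. en (l s y v)) s y = expect_mark (\<lambda>s y v. 1 - en (l s y v)) s y"
proof -
  have *: "expect_mark (\<lambda>s y v. en (l s y v)) s y + expect_mark (\<lambda>s y v. 1 - en (l s y v)) s y
      = (\<integral>\<^sup>+v. H v y * (en (l s y v) + (1 - en (l s y v))) \<partial>count_space UNIV)"
    unfolding expect_mark_def by (simp add: nn_integral_add[symmetric] distrib_left[symmetric])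
  have e1: "en t + (1 - en t) = 1" for t
    using diff_add_cancel_ennreal[OF en_le_1[of t]] by (simp add: add.commute)
  then have "(\<integral>\<^sup>+v. H v y * (en (l s y v) + (1 - en (l s y v))) \<partial>count_space UNIV) = 1"
    by (simp only: e1 mult_1_right sum_H)
  with * have "1 - expect_mark (\<lambda>s y v. en (l s y v)) s y
     = (expect_mark (\<lambda>s y v. en (l s y v)) s y + expect_mark (\<lambda>s y v. 1 - en (l s y v)) s y) - expect_mark (\<lambda>s y v. en (l s y v)) s y"
    by simp
  also have "\<dots> = expect_mark (\<lambda>s y v. 1 - en (l s y v)) s y"
    using expect_mark_le_1[of "\<lambda>s y v. en (l s y v)" s y] ennreal_one_less_top
    by (intro ennreal_add_diff_cancel_left) (auto simp: top_unique)
  finally show ?thesis .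
qed

text \<open>The likelihood hypothesis speaks only of indices below \<open>K\<close>. Splitting by
  the value of \<open>K\<close> turns a product that stops at the random index \<open>K\<close> into
  products of that form.\<close>

lemma prod_split_K:
  fixes c :: "nat \<Rightarrow> ennreal"
  shows "(\<Prod>k<n. if enat k < K \<omega> then c k else 1) =
    (\<Sum>j<n. of_bool (K \<omega> = enat j) * (\<Prod>k<j. of_bool (enat k < K \<omega>) * c k))
    + of_bool (enat n \<le> K \<omega>) * (\<Prod>k<n. of_bool (enat k < K \<omega>) * c k)"
proof (cases "enat n \<le> K \<omega>")
  case True
  then have lt: "enat k < K \<omega>" if "k < n" for k using that by (metis enat_ord_simps(2) less_le_trans)
  then have "of_bool (K \<omega> = enat j) = (0::ennreal)" if "j < n" for j using that by fastforce
  then show ?thesis using True lt by simp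
next
  case False
  then obtain j0 where j0: "K \<omega> = enat j0" "j0 < n" by (cases "K \<omega>") auto
  have "(\<Prod>k<n. if enat k < K \<omega> then c k else 1) = (\<Prod>k<j0. c k)"
    using j0 by (intro prod.mono_neutral_cong_right) auto
  moreover have "(\<Sum>j<n. of_bool (K \<omega> = enat j) * (\<Prod>k<j. of_bool (enat k < K \<omega>) * c k)) = (\<Prod>k<j0. c k)"
    using j0 by (subst sum.remove[of _ j0]) (auto intro!: sum.neutral)
  ultimately show ?thesis using False by simp
qed

text \<open>Given the atoms the marks are independent, so each factor may be replaced by its mean
  over the mark. Written with \<open>lneg\<close>, this mean is again the exponential of a function
  of location and weight, now without marks.\<close>

lemma marks_laplace:
  assumes l: "lmeas l"
  shows "(\<integral>\<^sup>+\<omega>. en (ksum l \<omega>) \<partial>M) = (\<integral>\<^sup>+\<omega>. en (ksum (\<lambda>s y v. lneg (expect_mark (\<lambda>s y v. en (l s y v)) s y)) \<omega>) \<partial>M)"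
proof -
  let ?g = "\<lambda>s y v. en (l s y v)"
  let ?l' = "\<lambda>s y v :: int list. lneg (expect_mark ?g s y)"
  have g: "lmeas ?g" by (rule lmeas_en[OF l])
  have l': "lmeas ?l'" unfolding lmeas_def split_beta'
    by (intro allI measurable_compose[OF _ lneg_measurable] expect_mark_measurable g) measurable
  have lim: "(\<lambda>n. \<integral>\<^sup>+\<omega>. (\<Prod>k<n. if enat k < K \<omega> then en (f (\<psi> k \<omega>) (\<theta> k \<omega>) (mark k \<omega>)) else 1) \<partial>M)
      \<longlonglongrightarrow> (\<integral>\<^sup>+\<omega>. en (ksum f \<omega>) \<partial>M)" if f: "lmeas f" for f
  proof -
    define a where "a k \<omega> = (if enat k < K \<omega> then f (\<psi> k \<omega>) (\<theta> k \<omega>) (mark k \<omega>) else 0)" for k \<omega>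
    have [measurable]: "a k \<in> borel_measurable M" for k unfolding a_def using f by measurable
    have "(\<lambda>n. \<integral>\<^sup>+\<omega>. en (\<Sum>k<n. a k \<omega>) \<partial>M) \<longlonglongrightarrow> (\<integral>\<^sup>+\<omega>. en (SUP n. \<Sum>k<n. a k \<omega>) \<partial>M)"
      by (intro nn_integral_en_SUP finite_measure_axioms) (auto simp: incseq_def intro!: sum_mono2)
    moreover have "(SUP n. \<Sum>k<n. a k \<omega>) = ksum f \<omega>" for \<omega>
      unfolding ksum_def a_def by (simp add: suminf_eq_SUP)
    moreover have "en (\<Sum>k<n. a k \<omega>) = (\<Prod>k<n. if enat k < K \<omega> then en (f (\<psi> k \<omega>) (\<theta> k \<omega>) (mark k \<omega>)) else 1)" for n \<omega>
      by (subst en_sum) (auto simp: a_def intro!: prod.cong)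
    ultimately show ?thesis by simp
  qed
  have eqn: "(\<integral>\<^sup>+\<omega>. (\<Prod>k<n. if enat k < K \<omega> then ?g (\<psi> k \<omega>) (\<theta> k \<omega>) (mark k \<omega>) else 1) \<partial>M)
      = (\<integral>\<^sup>+\<omega>. (\<Prod>k<n. if enat k < K \<omega> then expect_mark ?g (\<psi> k \<omega>) (\<theta> k \<omega>) else 1) \<partial>M)" for n
  proof -
    have [measurable]: "(\<lambda>\<omega>. expect_mark ?g (\<psi> k \<omega>) (\<theta> k \<omega>)) \<in> borel_measurable M"
      "(\<lambda>\<omega>. ?g (\<psi> k \<omega>) (\<theta> k \<omega>) (mark k \<omega>)) \<in> borel_measurable M" for k
      using expect_mark_measurable[OF g \<psi>_measurable \<theta>_measurable] lmeas_mark[OF g] by auto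
    have *: "(\<integral>\<^sup>+\<omega>. f \<omega> * (\<Prod>k<j. of_bool (enat k < K \<omega>) * ?g (\<psi> k \<omega>) (\<theta> k \<omega>) (mark k \<omega>)) \<partial>M)
       = (\<integral>\<^sup>+\<omega>. f \<omega> * (\<Prod>k<j. of_bool (enat k < K \<omega>) * expect_mark ?g (\<psi> k \<omega>) (\<theta> k \<omega>)) \<partial>M)"
      if "f \<in> borel_measurable Atoms" for f j
      using marks_induct[of j j f "\<lambda>_. ?g", OF order_refl that g] by simp
    have 1: "(\<lambda>\<omega>. of_bool (K \<omega> = enat j)) \<in> borel_measurable Atoms" for j by measurable
    have 2: "(\<lambda>\<omega>. of_bool (enat n \<le> K \<omega>)) \<in> borel_measurable Atoms" by measurable
    show ?thesis unfolding prod_split_K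
      by (subst (1 2) nn_integral_add, measurable, subst (1 2) nn_integral_sum, measurable)
         (simp only: *[OF 1] *[OF 2])
  qed
  have enl: "en (?l' s y v) = expect_mark ?g s y" for s y v
    by (rule en_lneg) (simp add: expect_mark_le_1)
  \<comment> \<open>The truncated products of both functionals have equal integrals for every
    \<open>n\<close>; now \<open>n\<close> tends to infinity.\<close>
  show ?thesis by (rule LIMSEQ_unique[OF lim[OF l, unfolded eqn] lim[OF l', unfolded enl]])
qed

text \<open>Gathers the almost sure properties of the enumeration and of the data, so that the
  following identities hold for each single outcome.\<close>

definition good :: "'w \<Rightarrow> bool" where
  "good \<omega> \<longleftrightarrow> inj_on (\<lambda>k. \<psi> k \<omega>) {k. enat k < K \<omega>} \<and>
     S \<subseteq> (\<lambda>k. \<psi> k \<omega>) ` {k. enat k < K \<omega>} \<and>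
     (\<forall>k. enat k < K \<omega> \<and> \<psi> k \<omega> \<notin> S \<longrightarrow> \<theta> k \<omega> \<noteq> 0) \<and>
     weighted_atoms (K \<omega>) (\<lambda>k. \<theta> k \<omega>) (\<lambda>k. \<psi> k \<omega>) (\<Theta> \<omega>) \<and>
     (\<forall>j\<in>{1..m}. weighted_atoms (K \<omega>) (\<lambda>k. real_of_int (x j k \<omega>)) (\<lambda>k. \<psi> k \<omega>) (X j \<omega>))"

lemma AE_good: "AE \<omega> in M. good \<omega>"
proof -
  have "AE \<omega> in M. \<forall>j\<in>{1..m}. weighted_atoms (K \<omega>) (\<lambda>k. real_of_int (x j k \<omega>)) (\<lambda>k. \<psi> k \<omega>) (X j \<omega>)"
    using X_atoms by (intro AE_finite_allI) auto
  moreover have "AE \<omega> in M.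
        inj_on (\<lambda>k. \<psi> k \<omega>) {k. enat k < K \<omega>} \<and>
        S \<subseteq> (\<lambda>k. \<psi> k \<omega>) ` {k. enat k < K \<omega>} \<and>
        (\<forall>k. enat k < K \<omega> \<and> \<psi> k \<omega> \<notin> S \<longrightarrow> \<theta> k \<omega> \<noteq> 0) \<and>
        weighted_atoms (K \<omega>) (\<lambda>k. \<theta> k \<omega>) (\<lambda>k. \<psi> k \<omega>) (\<Theta> \<omega>)"
    using atoms by (simp add: atom_enumeration_def)
  ultimately show ?thesis by eventually_elim (auto simp: good_def)
qed

abbreviation "idx \<omega> \<equiv> {k. enat k < K \<omega>}"

lemma weighted_atoms_facts:
  assumes w: "weighted_atoms (K \<omega>) w (\<lambda>k. \<psi> k \<omega>) \<mu>" and inj: "inj_on (\<lambda>k. \<psi> k \<omega>) (idx \<omega>)"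
  shows "atomic \<mu>" and "\<And>k. k \<in> idx \<omega> \<Longrightarrow> \<mu> {\<psi> k \<omega>} = w k"
    and "\<And>s. s \<notin> (\<lambda>k. \<psi> k \<omega>) ` idx \<omega> \<Longrightarrow> \<mu> {s} = 0"
proof -
  note ps = weighted_atoms_psum[OF w]
  show "atomic \<mu>" using atomic_psum[OF inj ps(1)] atomic_cong[of \<mu> "psum (idx \<omega>) (\<lambda>k. \<psi> k \<omega>) w"] ps(2) by blast
  show "\<mu> {\<psi> k \<omega>} = w k" if "k \<in> idx \<omega>" for k
    using psum_point[OF inj that ps(1)] ps(2)[of "{\<psi> k \<omega>}"] by simp
  show "\<mu> {s} = 0" if "s \<notin> (\<lambda>k. \<psi> k \<omega>) ` idx \<omega>" for s
    using psum_point_0[OF that ps(1)] ps(2)[of "{s}"] by simp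
qed

lemma goodD:
  assumes "good \<omega>"
  shows "atomic (\<Theta> \<omega>)" and "\<And>k. k \<in> idx \<omega> \<Longrightarrow> \<Theta> \<omega> {\<psi> k \<omega>} = \<theta> k \<omega>"
    and "(\<lambda>k. \<psi> k \<omega>) ` idx \<omega> = S \<union> {s. \<Theta> \<omega> {s} \<noteq> 0}"
    and "inj_on (\<lambda>k. \<psi> k \<omega>) (idx \<omega>)"
    and "\<And>j. j \<in> {1..m} \<Longrightarrow> atomic (X j \<omega>)"
    and "\<And>j k. j \<in> {1..m} \<Longrightarrow> k \<in> idx \<omega> \<Longrightarrow> X j \<omega> {\<psi> k \<omega>} = real_of_int (x j k \<omega>)"
    and "\<And>j s. j \<in> {1..m} \<Longrightarrow> s \<notin> S \<union> {s. \<Theta> \<omega> {s} \<noteq> 0} \<Longrightarrow> X j \<omega> {s} = 0"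
    and "\<And>k. k \<in> idx \<omega> \<Longrightarrow> \<psi> k \<omega> \<notin> S \<Longrightarrow> \<theta> k \<omega> \<noteq> 0"
proof -
  show inj: "inj_on (\<lambda>k. \<psi> k \<omega>) (idx \<omega>)" using assms by (simp add: good_def)
  have w: "weighted_atoms (K \<omega>) (\<lambda>k. \<theta> k \<omega>) (\<lambda>k. \<psi> k \<omega>) (\<Theta> \<omega>)" using assms by (simp add: good_def)
  have wX: "weighted_atoms (K \<omega>) (\<lambda>k. real_of_int (x j k \<omega>)) (\<lambda>k. \<psi> k \<omega>) (X j \<omega>)" if "j \<in> {1..m}" for j
    using assms that by (simp add: good_def)
  show n0: "\<And>k. k \<in> idx \<omega> \<Longrightarrow> \<psi> k \<omega> \<notin> S \<Longrightarrow> \<theta> k \<omega> \<noteq> 0" using assms by (simp add: good_def)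
  show "atomic (\<Theta> \<omega>)" by (rule weighted_atoms_facts(1)[OF w inj])
  show pt: "\<Theta> \<omega> {\<psi> k \<omega>} = \<theta> k \<omega>" if "k \<in> idx \<omega>" for k by (rule weighted_atoms_facts(2)[OF w inj that])
  have S: "S \<subseteq> (\<lambda>k. \<psi> k \<omega>) ` idx \<omega>" using assms by (simp add: good_def)
  show im: "(\<lambda>k. \<psi> k \<omega>) ` idx \<omega> = S \<union> {s. \<Theta> \<omega> {s} \<noteq> 0}"
  proof (intro equalityI subsetI)
    fix s assume "s \<in> (\<lambda>k. \<psi> k \<omega>) ` idx \<omega>"
    then obtain k where "k \<in> idx \<omega>" "s = \<psi> k \<omega>" by auto
    then show "s \<in> S \<union> {s. \<Theta> \<omega> {s} \<noteq> 0}" using pt[of k] n0[of k] by auto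
  next
    fix s assume "s \<in> S \<union> {s. \<Theta> \<omega> {s} \<noteq> 0}"
    then show "s \<in> (\<lambda>k. \<psi> k \<omega>) ` idx \<omega>" using S weighted_atoms_facts(3)[OF w inj, of s] by blast
  qed
  show "atomic (X j \<omega>)" if "j \<in> {1..m}" for j by (rule weighted_atoms_facts(1)[OF wX[OF that] inj])
  show "X j \<omega> {\<psi> k \<omega>} = real_of_int (x j k \<omega>)" if "j \<in> {1..m}" "k \<in> idx \<omega>" for j k
    by (rule weighted_atoms_facts(2)[OF wX[OF that(1)] inj that(2)])
  show "X j \<omega> {s} = 0" if "j \<in> {1..m}" "s \<notin> S \<union> {s. \<Theta> \<omega> {s} \<noteq> 0}" for j s
    using weighted_atoms_facts(3)[OF wX[OF that(1)] inj, of s] that(2) im by blast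
qed

lemma nn_integral_count_space_Un:
  assumes "finite S"
  shows "(\<integral>\<^sup>+s. f s \<partial>count_space (S \<union> T)) = (\<Sum>s\<in>S. f s) + (\<integral>\<^sup>+s. f s \<partial>count_space (T - S))"
proof -
  have "(\<integral>\<^sup>+s. f s \<partial>count_space (S \<union> T)) = (\<integral>\<^sup>+s. f s * indicator S s + f s * indicator (T - S) s \<partial>count_space (S \<union> T))"
    by (intro nn_integral_cong) (auto simp: indicator_def)
  also have "\<dots> = (\<integral>\<^sup>+s. f s * indicator S s \<partial>count_space (S \<union> T)) + (\<integral>\<^sup>+s. f s * indicator (T - S) s \<partial>count_space (S \<union> T))"
    by (rule nn_integral_add) auto
  also have "\<dots> = (\<integral>\<^sup>+s. f s \<partial>count_space S) + (\<integral>\<^sup>+s. f s \<partial>count_space (T - S))"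
    by (intro arg_cong2[where f = "(+)"] nn_integral_count_space_restrict) auto
  finally show ?thesis using assms by (simp add: nn_integral_count_space_finite)
qed

lemma ksum_eq:
  assumes g: "good \<omega>" and mk: "\<And>k. k \<in> idx \<omega> \<Longrightarrow> mk (\<psi> k \<omega>) = mark k \<omega>"
  shows "ksum f \<omega> = (\<Sum>s\<in>S. f s (\<Theta> \<omega> {s}) (mk s))
     + (\<integral>\<^sup>+s. f s (\<Theta> \<omega> {s}) (mk s) \<partial>count_space {s. s \<notin> S \<and> \<Theta> \<omega> {s} \<noteq> 0})"
proof -
  have "ksum f \<omega> = (\<integral>\<^sup>+k. f (\<psi> k \<omega>) (\<Theta> \<omega> {\<psi> k \<omega>}) (mk (\<psi> k \<omega>)) \<partial>count_space (idx \<omega>))"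
    unfolding ksum_count_space by (intro nn_integral_cong) (auto simp: goodD(2)[OF g] mk)
  also have "\<dots> = (\<integral>\<^sup>+s. f s (\<Theta> \<omega> {s}) (mk s) \<partial>count_space (S \<union> {s. \<Theta> \<omega> {s} \<noteq> 0}))"
    using goodD(3,4)[OF g]
    by (intro nn_integral_bij_count_space[where g = "\<lambda>k. \<psi> k \<omega>" and f = "\<lambda>s. f s (\<Theta> \<omega> {s}) (mk s)"]) (auto simp: bij_betw_def)
  also have "\<dots> = (\<Sum>s\<in>S. f s (\<Theta> \<omega> {s}) (mk s))
     + (\<integral>\<^sup>+s. f s (\<Theta> \<omega> {s}) (mk s) \<partial>count_space ({s. \<Theta> \<omega> {s} \<noteq> 0} - S))"
    by (rule nn_integral_count_space_Un[OF A0])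
  also have "{s. \<Theta> \<omega> {s} \<noteq> 0} - S = {s. s \<notin> S \<and> \<Theta> \<omega> {s} \<noteq> 0}" by auto
  finally show ?thesis .
qed

lemma \<Theta>_measurable [measurable]: "\<Theta> \<in> M \<rightarrow>\<^sub>M signed_measures"
  using crsm by (simp add: completely_random_def)

lemma nu_borel: "(\<lambda>t. t) \<in> \<nu> \<rightarrow>\<^sub>M borel"
  unfolding measurable_cong_sets[OF nu(1) refl] by (rule measurable_restrict_space1) simp

lemma sets_F: "sets (G \<Otimes>\<^sub>M \<nu>) = sets (borel \<Otimes>\<^sub>M nonzero_reals)"
  by (rule sets_pair_measure_cong[OF G(1) nu(1)])

lemma fst_F [measurable]: "fst \<in> G \<Otimes>\<^sub>M \<nu> \<rightarrow>\<^sub>M borel"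
  using measurable_fst[of G \<nu>] measurable_cong_sets[OF refl G(1)] by blast

lemma snd_F [measurable]: "snd \<in> G \<Otimes>\<^sub>M \<nu> \<rightarrow>\<^sub>M borel"
proof -
  have "(\<lambda>p. snd p) \<in> G \<Otimes>\<^sub>M \<nu> \<rightarrow>\<^sub>M borel" by (rule measurable_compose[OF measurable_snd nu_borel])
  then show ?thesis by simp
qed

lemma sigma_finite_F: "sigma_finite_measure (G \<Otimes>\<^sub>M \<nu>)"
proof -
  interpret G: prob_space G by (rule G(2))
  interpret \<nu>: sigma_finite_measure \<nu> by (rule nu(2))
  interpret P: pair_sigma_finite G \<nu> ..
  show ?thesis ..
qed

lemma levy: "levy_measure (G \<Otimes>\<^sub>M \<nu>)"
  and indep_fixed: "indep_vars (\<lambda>_. borel) (\<lambda>s \<omega>. \<Theta> \<omega> {s}) S"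
  using A00 by (auto simp: crsm_representation_def)

text \<open>The representation only provides some Poisson process whose integrals give
  \<open>\<Theta>\<close>. Almost surely its points are simple and lie above no fixed location, so
  they are exactly the atoms of \<open>\<Theta>\<close> outside \<open>S\<close>.\<close>

lemma poisson_points:
  obtains N where "poisson M N (G \<Otimes>\<^sub>M \<nu>)"
    "indep_set
          (sets (vimage_algebra (space M) (\<lambda>\<omega>. \<lambda>s\<in>S. \<Theta> \<omega> {s}) (\<Pi>\<^sub>M s\<in>S. borel)))
          (sets (vimage_algebra (space M) (\<lambda>\<omega>. \<lambda>A\<in>sets (G \<Otimes>\<^sub>M \<nu>). emeasure (N \<omega>) A)
                  (\<Pi>\<^sub>M A\<in>sets (G \<Otimes>\<^sub>M \<nu>). borel)))"
    "AE \<omega> in M. \<forall>l\<in>borel_measurable (G \<Otimes>\<^sub>M \<nu>). (\<integral>\<^sup>+p. l p \<partial>N \<omega>)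
       = (\<integral>\<^sup>+s. l (s, \<Theta> \<omega> {s}) \<partial>count_space {s. s \<notin> S \<and> \<Theta> \<omega> {s} \<noteq> 0})"
proof -
  let ?F = "G \<Otimes>\<^sub>M \<nu>"
  obtain N where N: "poisson_process M N ?F"
    and ind: "indep_set
          (sets (vimage_algebra (space M) (\<lambda>\<omega>. \<lambda>s\<in>S. \<Theta> \<omega> {s}) (\<Pi>\<^sub>M s\<in>S. borel)))
          (sets (vimage_algebra (space M) (\<lambda>\<omega>. \<lambda>A\<in>sets ?F. emeasure (N \<omega>) A)
                  (\<Pi>\<^sub>M A\<in>sets ?F. borel)))"
    and rep: "AE \<omega> in M. \<forall>B\<in>bounded_borel.
           (\<lambda>s. \<Theta> \<omega> {s}) summable_on (S \<inter> B) \<and>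
           integrable (N \<omega>) (\<lambda>(s, y). indicator B s * y) \<and>
           \<Theta> \<omega> B = (\<Sum>\<^sub>\<infinity>s\<in>S \<inter> B. \<Theta> \<omega> {s}) + 0
                    + (\<integral>(s, y). indicator B s * y \<partial>N \<omega>)"
    using A00 unfolding crsm_representation_def by blast
  interpret poisson M N ?F by (intro poisson.intro poisson_axioms.intro prob_space_axioms N sigma_finite_F)
  have lines: "{s} \<times> - {0} \<in> sets ?F" for s :: 'a
    unfolding sets_F using sets.top[of nonzero_reals] by (intro borel_pair_nonzero) auto
  have AES: "AE \<omega> in M. \<forall>s\<in>S. emeasure (N \<omega>) ({s} \<times> - {0}) = 0"
  proof (intro AE_finite_allI A0)
    fix s
    have z: "emeasure ?F ({s} \<times> - {0}) = 0" using levy by (simp add: levy_measure_def)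
    have "prob {\<omega>\<in>space M. emeasure (N \<omega>) ({s} \<times> - {0}) = of_nat 0} = 1"
      using prob_N[OF lines, of s 0] z by (simp add: measure_def)
    moreover have "{\<omega>\<in>space M. emeasure (N \<omega>) ({s} \<times> - {0}) = of_nat 0} \<in> events"
      using N_measurable[OF lines[of s]] by measurable
    ultimately have "AE \<omega> in M. \<omega> \<in> {\<omega>\<in>space M. emeasure (N \<omega>) ({s} \<times> - {0}) = of_nat 0}"
      using prob_eq_1 by blast
    then show "AE \<omega> in M. emeasure (N \<omega>) ({s} \<times> - {0}) = 0" by eventually_elim simp
  qed
  have AEs: "AE \<omega> in M. \<forall>r. \<exists>n. \<forall>bs. length bs = n \<longrightarrow> emeasure (N \<omega>) (cell bs \<times> Eset r) \<le> 1"
    unfolding AE_all_countable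
    by (intro allI poisson_AE_simple[OF poisson_axioms refl levy nu G])
  have "AE \<omega> in M. \<omega> \<in> space M" by simp
  then have "AE \<omega> in M. \<forall>l\<in>borel_measurable ?F. (\<integral>\<^sup>+p. l p \<partial>N \<omega>)
       = (\<integral>\<^sup>+s. l (s, \<Theta> \<omega> {s}) \<partial>count_space {s. s \<notin> S \<and> \<Theta> \<omega> {s} \<noteq> 0})"
    using AES AEs rep
  proof eventually_elim
    case (elim \<omega>)
    show ?case
    proof
      fix l :: "'a \<times> real \<Rightarrow> ennreal" assume l: "l \<in> borel_measurable ?F"
      show "(\<integral>\<^sup>+p. l p \<partial>N \<omega>) = (\<integral>\<^sup>+s. l (s, \<Theta> \<omega> {s}) \<partial>count_space {s. s \<notin> S \<and> \<Theta> \<omega> {s} \<noteq> 0})"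
      proof (rule point_process_eq_atoms)
        show "sets (N \<omega>) = sets (borel \<Otimes>\<^sub>M nonzero_reals)" using sets_N[OF elim(1)] sets_F by simp
        show "emeasure (N \<omega>) A \<in> insert \<infinity> (range of_nat)" if "A \<in> sets (N \<omega>)" for A
          using N_values[OF elim(1)] that sets_N[OF elim(1)] by simp
        show "\<exists>n. \<forall>bs. length bs = n \<longrightarrow> emeasure (N \<omega>) (cell bs \<times> Eset r) \<le> 1" for r
          using elim(3) by blast
        show "emeasure (N \<omega>) ({s} \<times> - {0}) = 0" if "s \<in> S" for s using elim(2) that by blast
        show "\<Theta> \<omega> {s} = (\<integral>(t, y). indicator {s} t * y \<partial>N \<omega>)" if "s \<notin> S" for s
        proof -
          have "\<Theta> \<omega> {s} = (\<Sum>\<^sub>\<infinity>s\<in>S \<inter> {s}. \<Theta> \<omega> {s}) + 0 + (\<integral>(t, y). indicator {s} t * y \<partial>N \<omega>)"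
            using elim(4) bounded_borel_intros(2)[of s] by blast
          moreover have "S \<inter> {s} = {}" using that by auto
          ultimately show ?thesis by simp
        qed
        show "l \<in> borel_measurable (N \<omega>)" using l measurable_cong_sets[OF sets_N[OF elim(1)] refl] by blast
      qed
    qed
  qed
  then show thesis by (rule that[OF poisson_axioms ind])
qed

text \<open>The exponent that the ordinary atoms contribute once their marks are averaged
  out.\<close>

abbreviation Phi :: "('a \<Rightarrow> real \<Rightarrow> int list \<Rightarrow> ennreal) \<Rightarrow> ennreal" where
  "Phi l \<equiv> (\<integral>\<^sup>+p. expect_mark (\<lambda>s y v. 1 - en (l s y v)) (fst p) (snd p) \<partial>(G \<Otimes>\<^sub>M \<nu>))"

lemma point_\<Theta>_measurable [measurable]: "(\<lambda>\<omega>. \<Theta> \<omega> {s}) \<in> borel_measurable M"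
  by (rule eval_measurable'[OF \<Theta>_measurable]) simp

text \<open>
  Marking thins the Poisson process and leaves the fixed atoms independent of it.
\<close>

lemma marked_laplace:
  assumes l: "lmeas l"
  shows "(\<integral>\<^sup>+\<omega>. en (ksum l \<omega>) \<partial>M)
    = (\<Prod>s\<in>S. \<integral>\<^sup>+\<omega>. expect_mark (\<lambda>s y v. en (l s y v)) s (\<Theta> \<omega> {s}) \<partial>M) * en (Phi l)"
proof -
  let ?F = "G \<Otimes>\<^sub>M \<nu>"
  let ?g = "\<lambda>s y v. en (l s y v)"
  define l' where "l' s y = lneg (expect_mark ?g s y)" for s y
  have g: "lmeas ?g" by (rule lmeas_en[OF l])
  have en_l': "en (l' s y) = expect_mark ?g s y" for s y
    unfolding l'_def by (rule en_lneg) (simp add: expect_mark_le_1)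
  have l'm: "(\<lambda>p. l' (fst p) (snd p)) \<in> borel_measurable ?F" unfolding l'_def
    by (intro measurable_compose[OF _ lneg_measurable] expect_mark_measurable g) measurable
  have l'm2: "(\<lambda>y. l' s y) \<in> borel_measurable borel" for s unfolding l'_def
    by (intro measurable_compose[OF _ lneg_measurable] expect_mark_measurable g) measurable
  obtain N where N: "poisson M N ?F" and ind: "indep_set
          (sets (vimage_algebra (space M) (\<lambda>\<omega>. \<lambda>s\<in>S. \<Theta> \<omega> {s}) (\<Pi>\<^sub>M s\<in>S. borel)))
          (sets (vimage_algebra (space M) (\<lambda>\<omega>. \<lambda>A\<in>sets ?F. emeasure (N \<omega>) A)
                  (\<Pi>\<^sub>M A\<in>sets ?F. borel)))" (is "indep_set (sets ?V1) (sets ?V2)")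
    and pts: "AE \<omega> in M. \<forall>l\<in>borel_measurable ?F. (\<integral>\<^sup>+p. l p \<partial>N \<omega>)
       = (\<integral>\<^sup>+s. l (s, \<Theta> \<omega> {s}) \<partial>count_space {s. s \<notin> S \<and> \<Theta> \<omega> {s} \<noteq> 0})"
    by (rule poisson_points)
  interpret N: poisson M N ?F by (rule N)
  have V1: "(\<lambda>\<omega>. \<Theta> \<omega> {s}) \<in> borel_measurable ?V1" if "s \<in> S" for s
  proof -
    have "(\<lambda>\<omega>. \<lambda>s\<in>S. \<Theta> \<omega> {s}) \<in> ?V1 \<rightarrow>\<^sub>M (\<Pi>\<^sub>M s\<in>S. borel)"
      by (rule measurable_vimage_algebra1) (auto simp: space_PiM)
    from measurable_compose[OF this measurable_component_singleton[OF that]] show ?thesis using that by simp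
  qed
  have V2: "(\<lambda>\<omega>. emeasure (N \<omega>) A) \<in> borel_measurable ?V2" if "A \<in> sets ?F" for A
  proof -
    have "(\<lambda>\<omega>. \<lambda>A\<in>sets ?F. emeasure (N \<omega>) A) \<in> ?V2 \<rightarrow>\<^sub>M (\<Pi>\<^sub>M A\<in>sets ?F. borel)"
      by (rule measurable_vimage_algebra1) (auto simp: space_PiM)
    from measurable_compose[OF this measurable_component_singleton[OF that]] show ?thesis using that by simp
  qed
  \<comment> \<open>The first factor depends on the fixed weights only, the second on the counts of
    \<open>N\<close> only; these are the two families that the representation declares
    independent.\<close>
  have f1: "(\<lambda>\<omega>. \<Prod>s\<in>S. en (l' s (\<Theta> \<omega> {s}))) \<in> borel_measurable ?V1"
    by (intro borel_measurable_prod_ennreal measurable_compose[OF _ en_measurable] measurable_compose[OF V1 l'm2])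
  have f2: "(\<lambda>\<omega>. en (\<integral>\<^sup>+p. l' (fst p) (snd p) \<partial>N \<omega>)) \<in> borel_measurable ?V2"
    by (intro measurable_compose[OF _ en_measurable] nn_integral_kernel_measurable[where F = ?F] V2 l'm)
       (auto simp: N.sets_N)
  have "(\<integral>\<^sup>+\<omega>. en (ksum l \<omega>) \<partial>M) = (\<integral>\<^sup>+\<omega>. en (ksum (\<lambda>s y v. l' s y) \<omega>) \<partial>M)"
    unfolding l'_def by (rule marks_laplace[OF l])
  also have "\<dots> = (\<integral>\<^sup>+\<omega>. (\<Prod>s\<in>S. en (l' s (\<Theta> \<omega> {s}))) * en (\<integral>\<^sup>+p. l' (fst p) (snd p) \<partial>N \<omega>) \<partial>M)"
  proof (rule nn_integral_cong_AE)
    show "AE \<omega> in M. en (ksum (\<lambda>s y v. l' s y) \<omega>) = (\<Prod>s\<in>S. en (l' s (\<Theta> \<omega> {s}))) * en (\<integral>\<^sup>+p. l' (fst p) (snd p) \<partial>N \<omega>)"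
      using AE_good pts
    proof eventually_elim
      case (elim \<omega>)
      \<comment> \<open>The locations are distinct, so the mark is a function of the
        location.\<close>
      define mk where "mk s = mark (THE k. k \<in> idx \<omega> \<and> \<psi> k \<omega> = s) \<omega>" for s
      have mk: "mk (\<psi> k \<omega>) = mark k \<omega>" if "k \<in> idx \<omega>" for k
      proof -
        have "(THE k'. k' \<in> idx \<omega> \<and> \<psi> k' \<omega> = \<psi> k \<omega>) = k"
          using that goodD(4)[OF elim(1)] by (intro the_equality) (auto dest: inj_onD)
        then show ?thesis by (simp add: mk_def)
      qed
      have "(\<integral>\<^sup>+p. l' (fst p) (snd p) \<partial>N \<omega>) = (\<integral>\<^sup>+s. l' s (\<Theta> \<omega> {s}) \<partial>count_space {s. s \<notin> S \<and> \<Theta> \<omega> {s} \<noteq> 0})"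
        using bspec[OF elim(2) l'm] by simp
      then show ?case
        using ksum_eq[OF elim(1) mk, of "\<lambda>s y v. l' s y"] by (simp add: en_add en_sum A0)
    qed
  qed
  also have "\<dots> = (\<integral>\<^sup>+\<omega>. (\<Prod>s\<in>S. en (l' s (\<Theta> \<omega> {s}))) \<partial>M) * (\<integral>\<^sup>+\<omega>. en (\<integral>\<^sup>+p. l' (fst p) (snd p) \<partial>N \<omega>) \<partial>M)"
    by (rule indep_set_nn_integral[OF ind _ _ f1 f2]) auto
  also have "(\<integral>\<^sup>+\<omega>. en (\<integral>\<^sup>+p. l' (fst p) (snd p) \<partial>N \<omega>) \<partial>M) = en (\<integral>\<^sup>+p. (1 - en (l' (fst p) (snd p))) \<partial>?F)"
    by (rule N.laplace[OF l'm])
  also have "(\<integral>\<^sup>+p. (1 - en (l' (fst p) (snd p))) \<partial>?F) = Phi l"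
    unfolding en_l' one_minus_expect_mark ..
  also have "(\<integral>\<^sup>+\<omega>. (\<Prod>s\<in>S. en (l' s (\<Theta> \<omega> {s}))) \<partial>M) = (\<Prod>s\<in>S. \<integral>\<^sup>+\<omega>. en (l' s (\<Theta> \<omega> {s})) \<partial>M)"
    using indep_vars_compose2[OF indep_fixed, of "\<lambda>s y. en (l' s y)" "\<lambda>_. borel"] l'm2
    by (intro indep_vars_nn_integral A0) auto
  finally show ?thesis unfolding en_l' .
qed

end

text \<open>Only finitely many coordinates matter, so the infinite product is projected to them,
  where Fubini's theorem applies.\<close>

lemma indep_prod_PiM:
  assumes prob: "\<And>i. prob_space (Q i)" and J: "finite J"
    and f: "\<And>i. i \<in> J \<Longrightarrow> f i \<in> borel_measurable (Q i)"
  shows "(\<integral>\<^sup>+r. (\<Prod>i\<in>J. f i (r i)) \<partial>PiM UNIV Q) = (\<Prod>i\<in>J. \<integral>\<^sup>+y. f i y \<partial>Q i)"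
proof -
  interpret product_prob_space Q UNIV by (intro product_prob_spaceI prob)
  interpret fin: finite_product_sigma_finite Q J by standard (rule J)
  have "(\<integral>\<^sup>+r. (\<Prod>i\<in>J. f i (r i)) \<partial>PiM UNIV Q) = (\<integral>\<^sup>+r. (\<Prod>i\<in>J. f i (restrict r J i)) \<partial>PiM UNIV Q)"
    by (intro nn_integral_cong prod.cong) auto
  also have "\<dots> = (\<integral>\<^sup>+r. (\<Prod>i\<in>J. f i (r i)) \<partial>distr (PiM UNIV Q) (PiM J Q) (\<lambda>r. restrict r J))"
    using f by (intro nn_integral_distr[symmetric] measurable_restrict_subset borel_measurable_prod_ennreal)
      (auto intro: measurable_compose[OF measurable_component_singleton])
  also have "distr (PiM UNIV Q) (PiM J Q) (\<lambda>r. restrict r J) = PiM J Q"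
    by (rule distr_PiM_restrict_finite) (use J in auto)
  also have "(\<integral>\<^sup>+r. (\<Prod>i\<in>J. f i (r i)) \<partial>PiM J Q) = (\<Prod>i\<in>J. \<integral>\<^sup>+y. f i y \<partial>Q i)"
    by (rule product_nn_integral_prod[OF J f])
  finally show ?thesis .
qed

section \<open>Normalising constants and almost sure properties of the marks\<close>

context model
begin

declare lmeasD [measurable del] \<comment> \<open>as a raw rule it unifies with every function application\<close>

definition z0 :: "int list" where "z0 = replicate m 0"

text \<open>The normalising constant of the posterior weight at a new location with mark
  \<open>v\<close>.\<close>

definition C :: "int list \<Rightarrow> ennreal" where "C v = (\<integral>\<^sup>+y. H v y \<partial>\<nu>)"

text \<open>The probability of the mark \<open>v\<close> at the fixed location \<open>s\<close>, and
  so the normalising constant there.\<close>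

definition cS :: "'a \<Rightarrow> int list \<Rightarrow> ennreal" where "cS s v = (\<integral>\<^sup>+\<omega>. H v (\<Theta> \<omega> {s}) \<partial>M)"

lemma S_borel [measurable]: "S \<in> sets borel"
  using A0 by (intro borel_closed finite_imp_closed)

lemma H_nu [measurable]: "H v \<in> borel_measurable \<nu>"
  using measurable_compose[OF nu_borel H_measurable] by simp

lemma H_z0: "H z0 y = ennreal (pmf (h y) 0 ^ m)"
  by (simp add: H_prod z0_def)

lemma lmeas_If:
  assumes "\<And>v. (\<lambda>s. P s v) \<in> borel \<rightarrow>\<^sub>M count_space UNIV" "lmeas a" "lmeas b"
  shows "lmeas (\<lambda>s y v. if P s v then a s y v else b s y v)"
  unfolding lmeas_def split_beta'
proof
  fix v
  have [measurable]: "Measurable.pred (borel \<Otimes>\<^sub>M borel) (\<lambda>x :: 'a \<times> real. P (fst x) v)"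
    by (rule measurable_compose[OF measurable_fst assms(1)])
  have ab: "(\<lambda>x. a (fst x) (snd x) v) \<in> borel_measurable (borel \<Otimes>\<^sub>M borel)"
    "(\<lambda>x. b (fst x) (snd x) v) \<in> borel_measurable (borel \<Otimes>\<^sub>M borel)"
    using assms(2,3) unfolding lmeas_def split_beta' by blast+
  show "(\<lambda>x. if P (fst x) v then a (fst x) (snd x) v else b (fst x) (snd x) v) \<in> borel_measurable (borel \<Otimes>\<^sub>M borel)"
    by (rule measurable_If[OF ab]) measurable
qed

lemma lmeas_const: "(\<And>v. (\<lambda>s. c s v) \<in> borel_measurable borel) \<Longrightarrow> lmeas (\<lambda>s y v. c s v)"
  unfolding lmeas_def split_beta' by (intro allI measurable_compose[OF measurable_fst])

lemma space_F: "space (G \<Otimes>\<^sub>M \<nu>) = UNIV \<times> - {0}"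
  using sets_eq_imp_space_eq[OF sets_F] by (simp add: space_pair_measure)

lemma AE_F_not_S: "AE p in G \<Otimes>\<^sub>M \<nu>. fst p \<notin> S"
proof -
  have "AE p in G \<Otimes>\<^sub>M \<nu>. \<forall>s\<in>S. fst p \<noteq> s"
  proof (intro AE_finite_allI A0)
    fix s
    have sets: "{s} \<times> - {0} \<in> sets (G \<Otimes>\<^sub>M \<nu>)"
      unfolding sets_F using sets.top[of nonzero_reals] by (intro borel_pair_nonzero) auto
    have "emeasure (G \<Otimes>\<^sub>M \<nu>) ({s} \<times> - {0}) = 0" using levy by (simp add: levy_measure_def)
    then show "AE p in G \<Otimes>\<^sub>M \<nu>. fst p \<noteq> s"
      using sets by (rule AE_I[rotated]) (auto simp: space_F)
  qed
  then show ?thesis by eventually_elim auto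
qed

lemma nn_integral_F:
  assumes "f \<in> borel_measurable (G \<Otimes>\<^sub>M \<nu>)"
  shows "(\<integral>\<^sup>+p. f p \<partial>(G \<Otimes>\<^sub>M \<nu>)) = (\<integral>\<^sup>+s. \<integral>\<^sup>+y. f (s, y) \<partial>\<nu> \<partial>G)"
proof -
  interpret \<nu>: sigma_finite_measure \<nu> by (rule nu(2))
  show ?thesis using \<nu>.nn_integral_fst[OF assms] by simp
qed

lemma nn_integral_F_snd:
  assumes "f \<in> borel_measurable borel"
  shows "(\<integral>\<^sup>+p. f (snd p) \<partial>(G \<Otimes>\<^sub>M \<nu>)) = (\<integral>\<^sup>+y. f y \<partial>\<nu>)"
proof -
  interpret G: prob_space G by (rule G(2))
  have "(\<lambda>p. f (snd p)) \<in> borel_measurable (G \<Otimes>\<^sub>M \<nu>)" using assms by measurable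
  from nn_integral_F[OF this] show ?thesis by (simp add: G.emeasure_space_1)
qed

lemma H_add_le_1: "v \<noteq> z0 \<Longrightarrow> H v y + H z0 y \<le> 1"
proof -
  assume v: "v \<noteq> z0"
  have "H v y + H z0 y = (\<integral>\<^sup>+u. H u y \<partial>count_space {v, z0})"
    using v by (simp add: nn_integral_count_space_finite)
  also have "\<dots> \<le> (\<integral>\<^sup>+u. H u y \<partial>count_space UNIV)"
    by (subst nn_integral_count_space_indicator) (auto intro!: nn_integral_mono simp: indicator_def)
  finally show ?thesis by (simp add: sum_H)
qed

text \<open>Assumption A2 after exchanging sum and integral, as \<open>1 - pmf (h y) 0\<close> is
  the sum of the other probabilities.\<close>

lemma A2_integral: "(\<integral>\<^sup>+y. (1 - ennreal (pmf (h y) 0)) \<partial>\<nu>) < \<infinity>"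
proof -
  have "bij_betw (from_nat_into (- {0})) UNIV (- {0 :: int})"
    by (rule bij_betw_from_nat_into) (auto simp: Compl_eq_Diff_UNIV infinite_UNIV_int)
  define e where "e = from_nat_into (- {0 :: int})"
  have bij: "bij_betw e UNIV (- {0})" unfolding e_def by fact
  have [measurable]: "(\<lambda>y. ennreal (pmf (h y) i)) \<in> borel_measurable \<nu>" for i
    using measurable_compose[OF nu_borel h_measurable[of i]] by measurable
  have "1 - ennreal (pmf (h y) 0) = (\<Sum>n. ennreal (pmf (h y) (e n)))" for y
  proof -
    have "emeasure (measure_pmf (h y)) (space (measure_pmf (h y)) - {0})
        = emeasure (measure_pmf (h y)) (space (measure_pmf (h y))) - emeasure (measure_pmf (h y)) {0}"
      by (rule emeasure_compl) auto
    then have "1 - ennreal (pmf (h y) 0) = emeasure (measure_pmf (h y)) (- {0})"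
      using measure_pmf.emeasure_space_1[of "h y"] by (simp add: emeasure_pmf_single Compl_eq_Diff_UNIV)
    also    have "\<dots> = (\<integral>\<^sup>+i. ennreal (pmf (h y) i) \<partial>count_space (- {0}))" by (simp add: nn_integral_pmf)
    also have "\<dots> = (\<Sum>n. ennreal (pmf (h y) (e n)))"
      by (subst nn_integral_bij_count_space[OF bij, symmetric]) (simp add: nn_integral_count_space_nat)
    finally show ?thesis .
  qed
  then have "(\<integral>\<^sup>+y. (1 - ennreal (pmf (h y) 0)) \<partial>\<nu>) = (\<Sum>n. \<integral>\<^sup>+y. ennreal (pmf (h y) (e n)) \<partial>\<nu>)"
    by (simp only:) (rule nn_integral_suminf, measurable)
  also have "\<dots> = (SUP n. \<Sum>i<n. \<integral>\<^sup>+y. ennreal (pmf (h y) (e i)) \<partial>\<nu>)" by (rule suminf_eq_SUP)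
  also have "\<dots> \<le> (\<Sum>\<^sub>\<infinity>i\<in>- {0}. \<integral>\<^sup>+ t. ennreal (pmf (h t) i) \<partial>\<nu>)"
  proof (rule SUP_least)
    fix n
    have inj: "inj_on e {..<n}" using bij by (auto simp: bij_betw_def intro: inj_on_subset)
    have "(\<Sum>i<n. \<integral>\<^sup>+y. ennreal (pmf (h y) (e i)) \<partial>\<nu>) = (\<Sum>i\<in>e ` {..<n}. \<integral>\<^sup>+y. ennreal (pmf (h y) i) \<partial>\<nu>)"
      by (simp add: sum.reindex[OF inj])
    also have "\<dots> \<le> (\<Sum>\<^sub>\<infinity>i\<in>- {0}. \<integral>\<^sup>+ t. ennreal (pmf (h t) i) \<partial>\<nu>)"
      using bij by (subst nonneg_infsum_complete) (auto simp: bij_betw_def intro!: SUP_upper)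
    finally show "(\<Sum>i<n. \<integral>\<^sup>+y. ennreal (pmf (h y) (e i)) \<partial>\<nu>) \<le> (\<Sum>\<^sub>\<infinity>i\<in>- {0}. \<integral>\<^sup>+ t. ennreal (pmf (h t) i) \<partial>\<nu>)" .
  qed
  also have "\<dots> < \<infinity>" by (rule A2)
  finally show ?thesis .
qed

text \<open>Since \<open>G\<close> has mass one, this is the mean number of ordinary atoms with a
  nonzero mark.\<close>

definition Cnew :: ennreal where "Cnew = (\<integral>\<^sup>+y. (1 - H z0 y) \<partial>\<nu>)"

text \<open>Bernoulli's inequality \<open>1 - p ^ m \<le> m * (1 - p)\<close> reduces
  \<open>m\<close> observations to one.\<close>

lemma Cnew_finite: "Cnew < \<infinity>"
proof -
  have "1 - H z0 y \<le> of_nat m * (1 - ennreal (pmf (h y) 0))" for y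
  proof -
    let ?p = "pmf (h y) 0"
    have p: "0 \<le> ?p" "?p \<le> 1" by (auto simp: pmf_le_1)
    have "1 + real m * (?p - 1) \<le> (1 + (?p - 1)) ^ m" using p by (intro Bernoulli_inequality) auto
    then have "1 - ?p ^ m \<le> real m * (1 - ?p)" by (simp add: algebra_simps)
    then have "ennreal (1 - ?p ^ m) \<le> ennreal (real m * (1 - ?p))" by (rule ennreal_leI)
    then show ?thesis using p
      by (simp add: H_z0 ennreal_mult ennreal_of_nat_eq_real_of_nat ennreal_minus[symmetric] power_le_one)
  qed
  then have "Cnew \<le> (\<integral>\<^sup>+y. of_nat m * (1 - ennreal (pmf (h y) 0)) \<partial>\<nu>)"
    unfolding Cnew_def by (intro nn_integral_mono)
  also have "\<dots> = of_nat m * (\<integral>\<^sup>+y. (1 - ennreal (pmf (h y) 0)) \<partial>\<nu>)"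
    using measurable_compose[OF nu_borel h_measurable[of 0]] by (intro nn_integral_cmult) measurable
  also have "\<dots> < \<infinity>" using A2_integral by (auto simp: ennreal_mult_less_top ennreal_of_nat_eq_real_of_nat)
  finally show ?thesis .
qed

lemma C_finite: "v \<noteq> z0 \<Longrightarrow> C v < \<infinity>"
proof -
  assume v: "v \<noteq> z0"
  have "C v \<le> Cnew" unfolding C_def Cnew_def
  proof (intro nn_integral_mono)
    fix y
    have "H v y = H v y + H z0 y - H z0 y"
      using le_less_trans[OF H_le_1 ennreal_one_less_top] by (intro ennreal_add_diff_cancel_right[symmetric]) (auto simp: less_top)
    also have "\<dots> \<le> 1 - H z0 y" by (intro ennreal_minus_mono H_add_le_1 v order_refl)
    finally show "H v y \<le> 1 - H z0 y" .
  qed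
  then show ?thesis using Cnew_finite by (rule le_less_trans)
qed

lemma expect_mark_one: "(\<And>v. g s y v = 1) \<Longrightarrow> expect_mark g s y = 1"
  unfolding expect_mark_def by (simp add: sum_H)

text \<open>A sum whose Laplace transform is 1 vanishes almost surely. Applied to functions that are
  \<open>\<top>\<close> on a forbidden set and 0 elsewhere, this excludes atoms there.\<close>

lemma AE_ksum_eq_0:
  assumes l: "lmeas l" and 1: "(\<integral>\<^sup>+\<omega>. en (ksum l \<omega>) \<partial>M) = 1"
  shows "AE \<omega> in M. \<forall>k\<in>idx \<omega>. l (\<psi> k \<omega>) (\<theta> k \<omega>) (mark k \<omega>) = 0"
proof -
  have [measurable]: "(\<lambda>\<omega>. ksum l \<omega>) \<in> borel_measurable M" using l by measurable
  have "(\<integral>\<^sup>+\<omega>. 1 - en (ksum l \<omega>) \<partial>M) = (\<integral>\<^sup>+\<omega>. 1 \<partial>M) - (\<integral>\<^sup>+\<omega>. en (ksum l \<omega>) \<partial>M)"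
    by (rule nn_integral_diff) (auto simp: 1)
  also have "\<dots> = 0" by (simp add: 1 emeasure_space_1)
  finally have "AE \<omega> in M. 1 - en (ksum l \<omega>) = 0" by (subst (asm) nn_integral_0_iff_AE) auto
  then show ?thesis
  proof eventually_elim
    case (elim \<omega>)
    then have "1 \<le> en (ksum l \<omega>)" by (simp add: diff_eq_0_iff_ennreal)
    then have "en (ksum l \<omega>) = 1" by (intro antisym) auto
    then have "ksum l \<omega> = 0" by simp
    then have "AE k in count_space (idx \<omega>). l (\<psi> k \<omega>) (\<theta> k \<omega>) (mark k \<omega>) = 0"
      unfolding ksum_count_space by (subst (asm) nn_integral_0_iff_AE) auto
    then show ?case by (simp add: AE_count_space)
  qed
qed

text \<open>Forbidden are the marks \<open>v\<close> with \<open>C v = 0\<close>: their likelihood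
  vanishes for almost every weight under \<open>\<nu>\<close>. This later makes the normalising
  constants of the observed new atoms positive.\<close>

lemma AE_marks_charged: "AE \<omega> in M. \<forall>k\<in>idx \<omega>. \<psi> k \<omega> \<notin> S \<longrightarrow> C (mark k \<omega>) \<noteq> 0"
proof -
  define l where "l s y v = (if s \<in> S \<or> C v \<noteq> 0 then 0 else \<top> :: ennreal)" for s :: 'a and y :: real and v
  have l: "lmeas l" unfolding l_def by (intro lmeas_If lmeas_const) measurable
  have "Phi l \<le> (\<integral>\<^sup>+p. \<integral>\<^sup>+v. H v (snd p) * of_bool (C v = 0) \<partial>count_space UNIV \<partial>(G \<Otimes>\<^sub>M \<nu>))"
    unfolding expect_mark_def by (intro nn_integral_mono mult_left_mono) (auto simp: l_def)
  also have "\<dots> = (\<integral>\<^sup>+y. \<integral>\<^sup>+v. H v y * of_bool (C v = 0) \<partial>count_space UNIV \<partial>\<nu>)"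
    by (rule nn_integral_F_snd) measurable
  also have "\<dots> = (\<integral>\<^sup>+v. \<integral>\<^sup>+y. H v y * of_bool (C v = 0) \<partial>\<nu> \<partial>count_space UNIV)"
    by (rule nn_integral_swap_int_list) measurable
  also have "\<dots> = (\<integral>\<^sup>+v. C v * of_bool (C v = 0) \<partial>count_space UNIV)"
    by (simp add: nn_integral_multc C_def)
  also have "\<dots> = (\<integral>\<^sup>+v. 0 \<partial>count_space (UNIV :: int list set))" by (intro nn_integral_cong) auto
  finally have Phi0: "Phi l = 0" by simp
  have "expect_mark (\<lambda>s y v. en (l s y v)) s y = 1" if "s \<in> S" for s y
    using that by (intro expect_mark_one) (simp add: l_def)
  then have "(\<integral>\<^sup>+\<omega>. en (ksum l \<omega>) \<partial>M) = 1"
    unfolding marked_laplace[OF l] Phi0 by (simp add: emeasure_space_1)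
  from AE_ksum_eq_0[OF l this] show ?thesis
    by eventually_elim (auto simp: l_def split: if_splits)
qed

text \<open>At a fixed location the marks with \<open>cS s v \<noteq> 0\<close> have total
  probability one.\<close>

lemma AE_fixed_marks_charged: "AE \<omega> in M. \<forall>k\<in>idx \<omega>. \<psi> k \<omega> \<in> S \<longrightarrow> cS (\<psi> k \<omega>) (mark k \<omega>) \<noteq> 0"
proof -
  define l where "l s y v = (if s \<in> S \<and> cS s v = 0 then \<top> else 0 :: ennreal)" for s :: 'a and y :: real and v
  have "{s \<in> S. cS s v = 0} \<in> sets borel" for v
    using A0 by (intro borel_closed finite_imp_closed) auto
  then have "Measurable.pred borel (\<lambda>s. s \<in> S \<and> cS s v = 0)" for v
    by (simp add: pred_def)
  then have l: "lmeas l" unfolding l_def by (intro lmeas_If lmeas_const) auto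
  have "Phi l = (\<integral>\<^sup>+p. 0 \<partial>(G \<Otimes>\<^sub>M \<nu>))"
    using AE_F_not_S by (intro nn_integral_cong_AE) (auto simp: expect_mark_def l_def)
  then have Phi0: "Phi l = 0" by simp
  have "(\<integral>\<^sup>+\<omega>. expect_mark (\<lambda>s y v. en (l s y v)) s (\<Theta> \<omega> {s}) \<partial>M) = 1" if s: "s \<in> S" for s
  proof -
    have "(\<integral>\<^sup>+\<omega>. expect_mark (\<lambda>s y v. en (l s y v)) s (\<Theta> \<omega> {s}) \<partial>M)
      = (\<integral>\<^sup>+v. \<integral>\<^sup>+\<omega>. H v (\<Theta> \<omega> {s}) * of_bool (cS s v \<noteq> 0) \<partial>M \<partial>count_space UNIV)"
      unfolding expect_mark_def
      by (subst nn_integral_swap_int_list[symmetric]) (auto intro!: nn_integral_cong simp: l_def s)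
    also have "\<dots> = (\<integral>\<^sup>+v. cS s v \<partial>count_space UNIV)"
      by (intro nn_integral_cong) (auto simp: nn_integral_multc cS_def)
    also have "\<dots> = (\<integral>\<^sup>+\<omega>. \<integral>\<^sup>+v. H v (\<Theta> \<omega> {s}) \<partial>count_space UNIV \<partial>M)"
      unfolding cS_def by (rule nn_integral_swap_int_list[symmetric]) measurable
    finally show ?thesis by (simp add: sum_H emeasure_space_1)
  qed
  then have "(\<integral>\<^sup>+\<omega>. en (ksum l \<omega>) \<partial>M) = 1"
    unfolding marked_laplace[OF l] Phi0 by simp
  from AE_ksum_eq_0[OF l this] show ?thesis
    by eventually_elim (auto simp: l_def split: if_splits)
qed

text \<open>Ensures that an independent copy of \<open>\<Theta>\<close> has no atom at a new
  location prescribed by the data.\<close>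

lemma AE_no_atom_at:
  assumes "s \<notin> S"
  shows "AE \<omega> in M. \<forall>k\<in>idx \<omega>. \<psi> k \<omega> \<noteq> s"
proof -
  define l where "l t y v = (if t = s then \<top> else 0 :: ennreal)" for t :: 'a and y :: real and v :: "int list"
  have "{s} \<in> sets borel" by simp
  then have "Measurable.pred borel (\<lambda>t. t = s)" by (simp add: pred_def)
  then have l: "lmeas l" unfolding l_def by (intro lmeas_If lmeas_const) auto
  have "AE p in G \<Otimes>\<^sub>M \<nu>. fst p \<noteq> s"
  proof (rule AE_I)
    show "{s} \<times> - {0} \<in> sets (G \<Otimes>\<^sub>M \<nu>)"
      unfolding sets_F using sets.top[of nonzero_reals] by (intro borel_pair_nonzero) auto
    show "emeasure (G \<Otimes>\<^sub>M \<nu>) ({s} \<times> - {0}) = 0" using levy by (simp add: levy_measure_def)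
    show "{p \<in> space (G \<Otimes>\<^sub>M \<nu>). \<not> fst p \<noteq> s} \<subseteq> {s} \<times> - {0}"
      unfolding space_F by auto
  qed
  then have "Phi l = (\<integral>\<^sup>+p. 0 \<partial>(G \<Otimes>\<^sub>M \<nu>))"
    by (intro nn_integral_cong_AE) (auto simp: expect_mark_def l_def)
  then have Phi0: "Phi l = 0" by simp
  have "expect_mark (\<lambda>s y v. en (l s y v)) t y = 1" if "t \<in> S" for t y
    using that assms by (intro expect_mark_one) (auto simp: l_def)
  then have "(\<integral>\<^sup>+\<omega>. en (ksum l \<omega>) \<partial>M) = 1"
    unfolding marked_laplace[OF l] Phi0 by (simp add: emeasure_space_1)
  from AE_ksum_eq_0[OF l this] show ?thesis
    by eventually_elim (auto simp: l_def split: if_splits)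
qed

text \<open>For \<open>0 < t < \<top>\<close> the Laplace transform of \<open>t\<close> times the
  number of new atoms is at least \<open>en (t * Cnew)\<close> and at most the probability that this
  number is finite. Letting \<open>t\<close> tend to 0 gives probability one.\<close>

lemma AE_finite_new: "AE \<omega> in M. finite {k\<in>idx \<omega>. \<psi> k \<omega> \<notin> S \<and> mark k \<omega> \<noteq> z0}"
proof -
  define one where "one s y v = (if s \<in> S \<or> v = z0 then 0 else 1 :: ennreal)" for s :: 'a and y :: real and v
  have one: "lmeas one" unfolding one_def by (intro lmeas_If lmeas_const) measurable
  have [measurable]: "(\<lambda>\<omega>. ksum one \<omega>) \<in> borel_measurable M" using one by measurable
  have bound: "en (t * Cnew) \<le> emeasure M {\<omega>\<in>space M. ksum one \<omega> < \<top>}" if t: "0 < t" "t < \<top>" for t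
  proof -
    let ?l = "\<lambda>s y v. t * one s y v"
    have l: "lmeas ?l" using one unfolding lmeas_def split_beta' by (intro allI borel_measurable_times_ennreal) auto
    have ks: "ksum ?l \<omega> = t * ksum one \<omega>" for \<omega> unfolding ksum_count_space by (simp add: nn_integral_cmult)
    have "Phi ?l \<le> (\<integral>\<^sup>+p. t * (1 - H z0 (snd p)) \<partial>(G \<Otimes>\<^sub>M \<nu>))"
    proof (intro nn_integral_mono)
      fix p :: "'a \<times> real"
      have ent: "1 - en t \<le> t"
      proof -
        obtain r where r: "t = ennreal r" "0 \<le> r" using t by (cases t) auto
        have "1 - exp (- r) \<le> r" using exp_ge_add_one_self[of "- r"] by simp
        then have "ennreal (1 - exp (- r)) \<le> ennreal r" by (rule ennreal_leI)
        then show ?thesis using r by (simp add: en_ennreal ennreal_minus[symmetric])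
      qed
      have "expect_mark (\<lambda>s y v. 1 - en (?l s y v)) (fst p) (snd p)
          \<le> (\<integral>\<^sup>+v. t * (H v (snd p) * of_bool (v \<noteq> z0)) \<partial>count_space UNIV)"
        unfolding expect_mark_def
      proof (intro nn_integral_mono)
        fix v
        show "H v (snd p) * (1 - en (?l (fst p) (snd p) v)) \<le> t * (H v (snd p) * of_bool (v \<noteq> z0))"
          using mult_left_mono[OF ent, of "H v (snd p)"] by (auto simp: one_def mult_ac)
      qed
      also have "\<dots> = t * (\<integral>\<^sup>+v. H v (snd p) * of_bool (v \<noteq> z0) \<partial>count_space UNIV)"
        by (rule nn_integral_cmult) auto
      also have "(\<integral>\<^sup>+v. H v (snd p) * of_bool (v \<noteq> z0) \<partial>count_space UNIV) = 1 - H z0 (snd p)"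
      proof -
        have "(\<integral>\<^sup>+v. H v (snd p) \<partial>count_space UNIV)
          = (\<integral>\<^sup>+v. H v (snd p) * of_bool (v \<noteq> z0) + H z0 (snd p) * indicator {z0} v \<partial>count_space UNIV)"
          by (intro nn_integral_cong) (auto simp: indicator_def)
        also have "\<dots> = (\<integral>\<^sup>+v. H v (snd p) * of_bool (v \<noteq> z0) \<partial>count_space UNIV) + H z0 (snd p)"
          by (subst nn_integral_add) (auto simp: nn_integral_cmult_indicator)
        finally have eq: "1 = (\<integral>\<^sup>+v. H v (snd p) * of_bool (v \<noteq> z0) \<partial>count_space UNIV) + H z0 (snd p)" by (simp add: sum_H)
        show ?thesis
          by (subst eq, rule ennreal_add_diff_cancel_right[symmetric])
             (use le_less_trans[OF H_le_1 ennreal_one_less_top] in \<open>auto simp: less_top\<close>)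
      qed
      finally show "expect_mark (\<lambda>s y v. 1 - en (?l s y v)) (fst p) (snd p) \<le> t * (1 - H z0 (snd p))" .
    qed
    also have "\<dots> = (\<integral>\<^sup>+y. t * (1 - H z0 y) \<partial>\<nu>)" by (rule nn_integral_F_snd) measurable
    also have "\<dots> = t * Cnew" unfolding Cnew_def by (rule nn_integral_cmult) measurable
    finally have "en (t * Cnew) \<le> en (Phi ?l)" by (rule en_mono)
    also have "\<dots> = (\<integral>\<^sup>+\<omega>. en (ksum ?l \<omega>) \<partial>M)"
    proof -
      have "expect_mark (\<lambda>s y v. en (?l s y v)) s y = 1" if "s \<in> S" for s y
        using that by (intro expect_mark_one) (simp add: one_def)
      then show ?thesis unfolding marked_laplace[OF l] by (simp add: emeasure_space_1)
    qed
    also have "\<dots> \<le> (\<integral>\<^sup>+\<omega>. indicator {\<omega>\<in>space M. ksum one \<omega> < \<top>} \<omega> \<partial>M)"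
    proof (intro nn_integral_mono)
      fix \<omega> assume "\<omega> \<in> space M"
      then show "en (ksum ?l \<omega>) \<le> indicator {\<omega>\<in>space M. ksum one \<omega> < \<top>} \<omega>"
        using t unfolding ks by (cases "ksum one \<omega> = \<top>") (auto simp: less_top ennreal_mult_top)
    qed
    also have "\<dots> = emeasure M {\<omega>\<in>space M. ksum one \<omega> < \<top>}" by simp
    finally show ?thesis .
  qed
  obtain c where c: "Cnew = ennreal c" "0 \<le> c" using Cnew_finite by (cases Cnew) auto
  have "1 \<le> emeasure M {\<omega>\<in>space M. ksum one \<omega> < \<top>}"
  proof (rule LIMSEQ_le_const2)
    have "(\<lambda>n. ennreal (exp (- (inverse (real (Suc n)) * c)))) \<longlonglongrightarrow> ennreal (exp (- (0 * c)))"
      by (intro tendsto_ennrealI tendsto_exp tendsto_minus tendsto_mult LIMSEQ_inverse_real_of_nat tendsto_const)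
    then show "(\<lambda>n. en (ennreal (inverse (real (Suc n))) * Cnew)) \<longlonglongrightarrow> 1"
      using c by (simp add: en_ennreal ennreal_mult[symmetric])
    show "\<exists>N. \<forall>n\<ge>N. en (ennreal (inverse (real (Suc n))) * Cnew) \<le> emeasure M {\<omega>\<in>space M. ksum one \<omega> < \<top>}"
      using bound by (intro exI[of _ 0]) auto
  qed
  then have "prob {\<omega>\<in>space M. ksum one \<omega> < \<top>} = 1"
    using prob_le_1[of "{\<omega>\<in>space M. ksum one \<omega> < \<top>}"] by (auto simp: emeasure_eq_measure)
  moreover have "{\<omega>\<in>space M. ksum one \<omega> < \<top>} \<in> events" by measurable
  ultimately have "AE \<omega> in M. \<omega> \<in> {\<omega>\<in>space M. ksum one \<omega> < \<top>}" using prob_eq_1 by blast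
  then show ?thesis
  proof eventually_elim
    case (elim \<omega>)
    let ?J = "{k\<in>idx \<omega>. \<psi> k \<omega> \<notin> S \<and> mark k \<omega> \<noteq> z0}"
    have "ksum one \<omega> = (\<integral>\<^sup>+k. indicator ?J k \<partial>count_space (idx \<omega>))"
      unfolding ksum_count_space by (intro nn_integral_cong) (auto simp: one_def indicator_def)
    also have "\<dots> = emeasure (count_space (idx \<omega>)) ?J" by (rule nn_integral_indicator) auto
    finally have "emeasure (count_space (idx \<omega>)) ?J < \<top>" using elim by simp
    then show ?case by (subst (asm) emeasure_count_space) (auto split: if_splits)
  qed
qed

text \<open>
  The value \<open>return borel 1\<close>, used where the normalising constant is degenerate, is a dummy for data of
  probability zero.
\<close>

definition Qnew :: "int list \<Rightarrow> real measure" where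
  "Qnew v = (if 0 < C v \<and> C v < \<infinity> then distr (density \<nu> (\<lambda>y. H v y / C v)) borel (\<lambda>t. t) else return borel 1)"

definition Qfix :: "'a \<Rightarrow> int list \<Rightarrow> real measure" where
  "Qfix s v = (if 0 < cS s v then distr (density (distr M borel (\<lambda>\<omega>. \<Theta> \<omega> {s})) (\<lambda>y. H v y / cS s v)) borel (\<lambda>t. t) else return borel 1)"

lemma sets_Q [simp, measurable_cong]: "sets (Qnew v) = sets borel" "sets (Qfix s v) = sets borel"
  by (auto simp: Qnew_def Qfix_def)

text \<open>Bayes' formula at one atom, multiplied by the normalising constant so that it remains
  true when the constant vanishes.\<close>

lemma nn_integral_Qnew:
  assumes f: "f \<in> borel_measurable borel" and v: "v \<noteq> z0"
  shows "C v * (\<integral>\<^sup>+y. f y \<partial>Qnew v) = (\<integral>\<^sup>+y. H v y * f y \<partial>\<nu>)"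
proof (cases "C v = 0")
  case True
  then have "AE y in \<nu>. H v y = 0" unfolding C_def by (subst (asm) nn_integral_0_iff_AE) auto
  then have "AE y in \<nu>. H v y * f y = 0" by eventually_elim simp
  then have "(\<integral>\<^sup>+y. H v y * f y \<partial>\<nu>) = (\<integral>\<^sup>+y. 0 \<partial>\<nu>)" by (rule nn_integral_cong_AE)
  then show ?thesis using True by simp
next
  case False
  have fin: "C v < \<infinity>" by (rule C_finite[OF v])
  have weight_measurable [measurable]: "f \<in> borel_measurable \<nu>" using measurable_compose[OF nu_borel f] by simp
  have "C v * (\<integral>\<^sup>+y. f y \<partial>Qnew v) = C v * (\<integral>\<^sup>+y. f y \<partial>density \<nu> (\<lambda>y. H v y / C v))"
    using False fin f nu_borel by (simp add: Qnew_def nn_integral_distr zero_less_iff_neq_zero)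
  also have "\<dots> = C v * (\<integral>\<^sup>+y. (H v y / C v) * f y \<partial>\<nu>)" by (subst nn_integral_density) measurable
  also have "\<dots> = (\<integral>\<^sup>+y. C v * ((H v y / C v) * f y) \<partial>\<nu>)" by (rule nn_integral_cmult[symmetric]) measurable
  also have "\<dots> = (\<integral>\<^sup>+y. H v y * f y \<partial>\<nu>)"
    using False fin by (intro nn_integral_cong)
      (simp add: mult.assoc[symmetric] ennreal_times_divide ennreal_mult_divide_eq mult.commute[of "C v"] less_top)
  finally show ?thesis .
qed

lemma cS_le_1: "cS s v \<le> 1"
proof -
  have "cS s v \<le> (\<integral>\<^sup>+\<omega>. 1 \<partial>M)" unfolding cS_def by (intro nn_integral_mono H_le_1)
  then show ?thesis by (simp add: emeasure_space_1)
qed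

lemma nn_integral_Qfix:
  assumes f [measurable]: "f \<in> borel_measurable borel"
  shows "cS s v * (\<integral>\<^sup>+y. f y \<partial>Qfix s v) = (\<integral>\<^sup>+\<omega>. H v (\<Theta> \<omega> {s}) * f (\<Theta> \<omega> {s}) \<partial>M)"
proof (cases "cS s v = 0")
  case True
  then have "AE \<omega> in M. H v (\<Theta> \<omega> {s}) = 0" unfolding cS_def by (subst (asm) nn_integral_0_iff_AE) auto
  then have "AE \<omega> in M. H v (\<Theta> \<omega> {s}) * f (\<Theta> \<omega> {s}) = 0" by eventually_elim simp
  then have "(\<integral>\<^sup>+\<omega>. H v (\<Theta> \<omega> {s}) * f (\<Theta> \<omega> {s}) \<partial>M) = (\<integral>\<^sup>+\<omega>. 0 \<partial>M)" by (rule nn_integral_cong_AE)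
  then show ?thesis using True by simp
next
  case False
  let ?c = "cS s v"
  have fin: "?c < \<infinity>" using le_less_trans[OF cS_le_1 ennreal_one_less_top] by simp
  have "?c * (\<integral>\<^sup>+y. f y \<partial>Qfix s v) = ?c * (\<integral>\<^sup>+y. f y \<partial>density (distr M borel (\<lambda>\<omega>. \<Theta> \<omega> {s})) (\<lambda>y. H v y / ?c))"
    using False by (simp add: Qfix_def nn_integral_distr zero_less_iff_neq_zero)
  also have "\<dots> = ?c * (\<integral>\<^sup>+\<omega>. (H v (\<Theta> \<omega> {s}) / ?c) * f (\<Theta> \<omega> {s}) \<partial>M)"
    by (simp add: nn_integral_density nn_integral_distr)
  also have "\<dots> = (\<integral>\<^sup>+\<omega>. ?c * ((H v (\<Theta> \<omega> {s}) / ?c) * f (\<Theta> \<omega> {s})) \<partial>M)" by (rule nn_integral_cmult[symmetric]) measurable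
  also have "\<dots> = (\<integral>\<^sup>+\<omega>. H v (\<Theta> \<omega> {s}) * f (\<Theta> \<omega> {s}) \<partial>M)"
    using False fin by (intro nn_integral_cong)
      (simp add: mult.assoc[symmetric] ennreal_times_divide ennreal_mult_divide_eq mult.commute[of ?c] less_top)
  finally show ?thesis .
qed

lemma ennreal_mult_cancel_self: "a * b = a \<Longrightarrow> a \<noteq> 0 \<Longrightarrow> a \<noteq> \<top> \<Longrightarrow> b = (1::ennreal)"
  by (metis ennreal_mult_cancel_left mult.right_neutral)

lemma prob_Qnew: "prob_space (Qnew v)"
proof (cases "0 < C v \<and> C v < \<infinity>")
  case True
  have "(\<integral>\<^sup>+y. H v y / C v \<partial>\<nu>) = C v / C v" unfolding C_def by (rule nn_integral_divide) measurable
  then have "emeasure (density \<nu> (\<lambda>y. H v y / C v)) (space (density \<nu> (\<lambda>y. H v y / C v))) = 1"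
    using True by (subst emeasure_density) (auto cong: nn_integral_cong simp: ennreal_divide_self less_top)
  then have "prob_space (density \<nu> (\<lambda>y. H v y / C v))" by (rule prob_spaceI)
  then show ?thesis using True nu_borel unfolding Qnew_def
    by (auto intro!: prob_space.prob_space_distr simp: measurable_cong_sets[OF sets_density refl])
next
  case False
  then have "Qnew v = return borel 1" unfolding Qnew_def by (rule if_not_P)
  then show ?thesis by (simp add: prob_space_return)
qed

lemma prob_Qfix: "prob_space (Qfix s v)"
proof (cases "cS s v = 0")
  case False
  have "cS s v * (\<integral>\<^sup>+y. 1 \<partial>Qfix s v) = cS s v" by (subst nn_integral_Qfix) (auto simp: cS_def)
  then have "(\<integral>\<^sup>+y. 1 \<partial>Qfix s v) = 1"
    using False le_less_trans[OF cS_le_1[of s v] ennreal_one_less_top] by (intro ennreal_mult_cancel_self[of "cS s v"]) auto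
  then show ?thesis by (intro prob_spaceI) simp
next
  case True
  then show ?thesis by (simp add: Qfix_def prob_space_return)
qed

text \<open>The dummy law in \<open>Qnew\<close> sits at 1 so that this holds for every mark,
  charged or not.\<close>

lemma AE_Qnew_nonzero: "AE y in Qnew v. y \<noteq> 0"
proof (cases "0 < C v \<and> C v < \<infinity>")
  case True
  have "space \<nu> = - {0}" using sets_eq_imp_space_eq[OF nu(1)] by simp
  then have "AE y in density \<nu> (\<lambda>y. H v y / C v). y \<noteq> 0" by (intro AE_I2) auto
  then show ?thesis using True nu_borel unfolding Qnew_def by (simp add: AE_distr_iff)
next
  case False
  then have Q: "Qnew v = return borel 1" unfolding Qnew_def by (rule if_not_P)
  have "AE y in return borel (1::real). y \<noteq> 0"
    by (intro AE_I[where N = "{0}"]) (auto simp: emeasure_return indicator_def)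
  then show ?thesis unfolding Q .
qed

end

lemma measurable_map_upt:
  assumes "\<And>j. j \<in> {a..<b} \<Longrightarrow> f j \<in> N \<rightarrow>\<^sub>M count_space (UNIV :: 'c::countable set)"
  shows "(\<lambda>\<omega>. map (\<lambda>j. f j \<omega>) [a..<b]) \<in> N \<rightarrow>\<^sub>M count_space UNIV"
  using assms
proof (induction b)
  case (Suc b)
  show ?case
  proof (cases "a \<le> b")
    case True
    have 1: "(\<lambda>\<omega>. map (\<lambda>j. f j \<omega>) [a..<b]) \<in> N \<rightarrow>\<^sub>M count_space UNIV" using Suc by auto
    have 2: "f b \<in> N \<rightarrow>\<^sub>M count_space UNIV" using Suc.prems True by auto
    have "(\<lambda>\<omega>. (\<lambda>c \<omega>. map (\<lambda>j. f j \<omega>) [a..<b] @ [c]) (f b \<omega>) \<omega>) \<in> N \<rightarrow>\<^sub>M count_space UNIV"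
      by (rule measurable_compose_countable[OF _ 2]) (rule measurable_compose[OF 1], simp)
    then show ?thesis using True by simp
  next
    case False then show ?thesis by simp
  qed
qed simp

lemma nn_integral_count_space_Plus:
  "(\<integral>\<^sup>+i. f i \<partial>count_space (Inl ` A \<union> Inr ` B)) = (\<integral>\<^sup>+a. f (Inl a) \<partial>count_space A) + (\<integral>\<^sup>+b. f (Inr b) \<partial>count_space B)"
proof -
  let ?J = "Inl ` A \<union> Inr ` B"
  have "(\<integral>\<^sup>+i. f i \<partial>count_space ?J) = (\<integral>\<^sup>+i. f i * indicator (Inl ` A) i + f i * indicator (Inr ` B) i \<partial>count_space ?J)"
    by (intro nn_integral_cong) (auto simp: indicator_def)
  also have "\<dots> = (\<integral>\<^sup>+i. f i * indicator (Inl ` A) i \<partial>count_space ?J) + (\<integral>\<^sup>+i. f i * indicator (Inr ` B) i \<partial>count_space ?J)"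
    by (rule nn_integral_add) auto
  also have "\<dots> = (\<integral>\<^sup>+i. f i \<partial>count_space (Inl ` A)) + (\<integral>\<^sup>+i. f i \<partial>count_space (Inr ` B))"
    by (intro arg_cong2[where f = "(+)"] nn_integral_count_space_restrict) auto
  also have "(\<integral>\<^sup>+i. f i \<partial>count_space (Inl ` A)) = (\<integral>\<^sup>+a. f (Inl a) \<partial>count_space A)"
    by (rule nn_integral_bij_count_space[symmetric]) (auto simp: bij_betw_def)
  also have "(\<integral>\<^sup>+i. f i \<partial>count_space (Inr ` B)) = (\<integral>\<^sup>+a. f (Inr a) \<partial>count_space B)"
    by (rule nn_integral_bij_count_space[symmetric]) (auto simp: bij_betw_def)
  finally show ?thesis .
qed

lemma nn_integral_count_space_nat_set: "(\<integral>\<^sup>+k. f k \<partial>count_space A) = (\<Sum>k. if k \<in> A then f k else 0)"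
  by (subst nn_integral_count_space_indicator)
     (auto simp: nn_integral_count_space_nat[symmetric] indicator_def intro!: nn_integral_cong)

lemma AE_pair_snd:
  assumes "prob_space A" "sigma_finite_measure B" "AE x in B. P x"
  shows "AE p in A \<Otimes>\<^sub>M B. P (snd p)"
proof -
  interpret A: prob_space A by fact
  interpret B: sigma_finite_measure B by fact
  have "distr (A \<Otimes>\<^sub>M B) B snd = B"
  proof (rule measure_eqI)
    fix X assume "X \<in> sets (distr (A \<Otimes>\<^sub>M B) B snd)"
    then have X: "X \<in> sets B" by simp
    have "snd -` X \<inter> space (A \<Otimes>\<^sub>M B) = space A \<times> X"
      using sets.sets_into_space[OF X] by (auto simp: space_pair_measure)
    then show "emeasure (distr (A \<Otimes>\<^sub>M B) B snd) X = emeasure B X"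
      using X by (simp add: emeasure_distr B.emeasure_pair_measure_Times A.emeasure_space_1)
  qed simp
  then have "AE x in distr (A \<Otimes>\<^sub>M B) B snd. P x" using assms(3) by (rule ssubst)
  then show ?thesis by (intro AE_distrD[of snd "A \<Otimes>\<^sub>M B" B P]) simp_all
qed

lemma AE_pair_fst:
  assumes "sigma_finite_measure A" "prob_space B" "AE x in A. P x"
  shows "AE p in A \<Otimes>\<^sub>M B. P (fst p)"
proof -
  interpret B: prob_space B by fact
  have "distr (A \<Otimes>\<^sub>M B) A fst = A"
  proof (rule measure_eqI)
    fix X assume "X \<in> sets (distr (A \<Otimes>\<^sub>M B) A fst)"
    then have X: "X \<in> sets A" by simp
    have "fst -` X \<inter> space (A \<Otimes>\<^sub>M B) = X \<times> space B"
      using sets.sets_into_space[OF X] by (auto simp: space_pair_measure)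
    then show "emeasure (distr (A \<Otimes>\<^sub>M B) A fst) X = emeasure A X"
      using X by (simp add: emeasure_distr B.emeasure_pair_measure_Times B.emeasure_space_1)
  qed simp
  then have "AE x in distr (A \<Otimes>\<^sub>M B) A fst. P x" using assms(3) by (rule ssubst)
  then show ?thesis by (intro AE_distrD[of fst "A \<Otimes>\<^sub>M B" A P]) simp_all
qed

section \<open>The posterior kernel\<close>

context model
begin

abbreviation "D \<equiv> \<Pi>\<^sub>M j\<in>{1..m}. (signed_measures :: ('a set \<Rightarrow> real) measure)"

definition XX :: "'w \<Rightarrow> nat \<Rightarrow> 'a set \<Rightarrow> real" where "XX \<omega> = (\<lambda>j\<in>{1..m}. X j \<omega>)"

lemma XX_measurable [measurable]: "XX \<in> M \<rightarrow>\<^sub>M D"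
  unfolding XX_def using X_measurable by (intro measurable_restrict)

definition slist :: "'a list" where "slist = (SOME xs. set xs = S \<and> distinct xs)"

lemma slist: "set slist = S" "distinct slist"
  using someI_ex[OF finite_distinct_list[OF A0]] by (auto simp: slist_def)

abbreviation "ns \<equiv> length slist"

text \<open>The mark as seen in the data. The floor gives an integer for arbitrary \<open>z\<close>;
  on the data of the model, whose atoms have integer weights, it changes nothing.\<close>

definition zmark :: "(nat \<Rightarrow> 'a set \<Rightarrow> real) \<Rightarrow> 'a \<Rightarrow> int list" where
  "zmark z s = map (\<lambda>j. \<lfloor>z j {s}\<rfloor>) [1..<Suc m]"

text \<open>
  For data \<open>z\<close>, the locations \<open>E z n\<close> with \<open>n \<in> V z\<close> list without repetition the fixed atoms
  (the indices below \<open>ns\<close>) and the atoms of the data outside \<open>S\<close>.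
\<close>

definition E :: "(nat \<Rightarrow> 'a set \<Rightarrow> real) \<Rightarrow> nat \<Rightarrow> 'a" where
  "E z n = (if n < ns then slist ! n else case prod_decode (n - ns) of (j, k) \<Rightarrow> loc (z (Suc (j mod m))) k)"

definition V :: "(nat \<Rightarrow> 'a set \<Rightarrow> real) \<Rightarrow> nat set" where
  "V z = {n. n < ns \<or> (E z n \<notin> S \<and> zmark z (E z n) \<noteq> z0 \<and> (\<forall>n'<n. E z n' \<noteq> E z n))}"

definition I0 :: "'w \<Rightarrow> nat set" where
  "I0 \<omega> = {k\<in>idx \<omega>. \<psi> k \<omega> \<notin> S \<and> mark k \<omega> = z0}"

lemma E_fixed: "n < ns \<Longrightarrow> E z n \<in> S"
  using nth_mem[of n slist] by (simp add: E_def slist(1))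

lemma E_new: "n \<in> V z \<Longrightarrow> \<not> n < ns \<Longrightarrow> E z n \<notin> S \<and> zmark z (E z n) \<noteq> z0"
  by (simp add: V_def)

lemma inj_E: "inj_on (E z) (V z)"
proof (rule linorder_inj_onI)
  fix n n' assume "n < n'" and V: "n \<in> V z" "n' \<in> V z"
  show "E z n \<noteq> E z n'"
  proof (cases "n' < ns")
    case True
    then show ?thesis using \<open>n < n'\<close> nth_eq_iff_index_eq[OF slist(2), of n n'] by (simp add: E_def)
  next
    case False
    then show ?thesis using V(2) \<open>n < n'\<close> unfolding V_def by blast
  qed
qed auto

lemma bij_slist: "bij_betw (\<lambda>n. E z n) {..<ns} S"
  using bij_betw_nth[OF slist(2) refl slist(1)[symmetric]]
  by (subst bij_betw_cong[where g = "(!) slist"]) (simp_all add: E_def)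

text \<open>The property of the data that lets a finite list of locations account for every nonzero
  mark outside \<open>S\<close>.\<close>

definition zgood :: "(nat \<Rightarrow> 'a set \<Rightarrow> real) \<Rightarrow> bool" where
  "zgood z \<longleftrightarrow> finite (V z) \<and> (\<forall>s. s \<notin> S \<and> zmark z s \<noteq> z0 \<longrightarrow> s \<in> E z ` V z)"

lemma V_split: "V z = {..<ns} \<union> {n\<in>V z. \<not> n < ns}"
  by (auto simp: V_def)

lemma sum_V:
  fixes a :: "'a \<Rightarrow> 'b::comm_monoid_add"
  assumes "finite (V z)"
  shows "(\<Sum>n\<in>V z. a (E z n)) = (\<Sum>s\<in>S. a s) + (\<Sum>n\<in>{n\<in>V z. \<not> n < ns}. a (E z n))"
proof -
  have "(\<Sum>n\<in>V z. a (E z n)) = (\<Sum>n\<in>{..<ns}. a (E z n)) + (\<Sum>n\<in>{n\<in>V z. \<not> n < ns}. a (E z n))"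
    by (subst V_split, rule sum.union_disjoint) (use assms in auto)
  also have "(\<Sum>n\<in>{..<ns}. a (E z n)) = (\<Sum>s\<in>S. a s)"
    by (rule sum.reindex_bij_betw[OF bij_slist])
  finally show ?thesis .
qed

lemma zmark_XX:
  assumes g: "good \<omega>" and k: "k \<in> idx \<omega>"
  shows "zmark (XX \<omega>) (\<psi> k \<omega>) = mark k \<omega>"
  unfolding zmark_def mark_def using goodD(6)[OF g _ k]
  by (intro map_cong refl) (auto simp: XX_def)

lemma zmark_XX_nonatom:
  assumes g: "good \<omega>" and s: "s \<notin> (\<lambda>k. \<psi> k \<omega>) ` idx \<omega>"
  shows "zmark (XX \<omega>) s = z0"
proof -
  have "zmark (XX \<omega>) s = map (\<lambda>_. 0) [1..<Suc m]"
    unfolding zmark_def using goodD(7)[OF g] s goodD(3)[OF g]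
    by (intro map_cong refl) (auto simp: XX_def)
  also have "\<dots> = z0" by (simp add: z0_def map_replicate_const del: upt_Suc)
  finally show ?thesis .
qed

text \<open>A location with a nonzero mark is an atom of some \<open>X j\<close>, and
  \<open>loc\<close> reaches all atoms of an atomic measure. The least index at which it appears is
  kept by \<open>V\<close>.\<close>

lemma E_XX_new:
  assumes g: "good \<omega>"
  shows "E (XX \<omega>) ` {n\<in>V (XX \<omega>). \<not> n < ns} = {s. s \<notin> S \<and> zmark (XX \<omega>) s \<noteq> z0}"
proof (intro equalityI subsetI)
  fix s assume "s \<in> E (XX \<omega>) ` {n\<in>V (XX \<omega>). \<not> n < ns}"
  then show "s \<in> {s. s \<notin> S \<and> zmark (XX \<omega>) s \<noteq> z0}" using E_new by auto
next
  fix s assume s: "s \<in> {s. s \<notin> S \<and> zmark (XX \<omega>) s \<noteq> z0}"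
  have "\<exists>j\<in>{1..m}. X j \<omega> {s} \<noteq> 0"
  proof (rule ccontr)
    assume "\<not> ?thesis"
    then have "zmark (XX \<omega>) s = map (\<lambda>_. 0) [1..<Suc m]"
      unfolding zmark_def by (intro map_cong refl) (auto simp: XX_def)
    also have "\<dots> = z0" by (simp add: z0_def map_replicate_const del: upt_Suc)
    finally show False using s by simp
  qed
  then obtain j where j: "j \<in> {1..m}" "X j \<omega> {s} \<noteq> 0" by blast
  obtain k where k: "loc (X j \<omega>) k = s" using atomic_loc[OF goodD(5)[OF g j(1)] j(2)] by blast
  have jm: "(j - Suc 0) mod m = j - Suc 0" "Suc (j - Suc 0) = j" using j(1) by auto
  have "E (XX \<omega>) (ns + prod_encode (j - 1, k)) = s"
    using j(1) k by (simp add: E_def jm XX_def)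
  then have ex: "\<exists>n. E (XX \<omega>) n = s" by blast
  define n where "n = (LEAST n. E (XX \<omega>) n = s)"
  have n: "E (XX \<omega>) n = s" unfolding n_def using ex by (rule LeastI_ex)
  moreover have "E (XX \<omega>) n' \<noteq> s" if "n' < n" for n' using that not_less_Least unfolding n_def by blast
  moreover have "\<not> n < ns" using n s E_fixed by auto
  ultimately show "s \<in> E (XX \<omega>) ` {n\<in>V (XX \<omega>). \<not> n < ns}"
    using s by (intro image_eqI[of _ _ n]) (auto simp: V_def)
qed

lemma new_atoms_XX:
  assumes g: "good \<omega>"
  shows "{s. s \<notin> S \<and> zmark (XX \<omega>) s \<noteq> z0} = (\<lambda>k. \<psi> k \<omega>) ` {k\<in>idx \<omega>. \<psi> k \<omega> \<notin> S \<and> mark k \<omega> \<noteq> z0}"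
proof (intro equalityI subsetI)
  fix s assume s: "s \<in> {s. s \<notin> S \<and> zmark (XX \<omega>) s \<noteq> z0}"
  then have "s \<in> (\<lambda>k. \<psi> k \<omega>) ` idx \<omega>" using zmark_XX_nonatom[OF g, of s] by blast
  then show "s \<in> (\<lambda>k. \<psi> k \<omega>) ` {k\<in>idx \<omega>. \<psi> k \<omega> \<notin> S \<and> mark k \<omega> \<noteq> z0}"
    using s zmark_XX[OF g] by auto
qed (auto simp: zmark_XX[OF g])

lemma zgood_XX:
  assumes g: "good \<omega>" and fin: "finite {k\<in>idx \<omega>. \<psi> k \<omega> \<notin> S \<and> mark k \<omega> \<noteq> z0}"
  shows "zgood (XX \<omega>)"
proof -
  have "finite {s. s \<notin> S \<and> zmark (XX \<omega>) s \<noteq> z0}" unfolding new_atoms_XX[OF g] using fin by simp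
  then have "finite {n\<in>V (XX \<omega>). \<not> n < ns}"
    unfolding E_XX_new[OF g, symmetric] by (rule finite_imageD) (rule inj_on_subset[OF inj_E], auto)
  then have "finite (V (XX \<omega>))" by (subst V_split) simp
  then show ?thesis unfolding zgood_def using E_XX_new[OF g] by blast
qed

section \<open>Measurable dependence of the listed locations on the data\<close>

lemma z_component [measurable]: "j \<in> {1..m} \<Longrightarrow> (\<lambda>z. z j) \<in> D \<rightarrow>\<^sub>M signed_measures"
  by (rule measurable_component_singleton)

lemma E_measurable: "(\<lambda>z. E z n) \<in> borel_measurable D"
proof (cases "n < ns")
  case True then show ?thesis by (simp add: E_def)
next
  case False
  obtain j k where jk: "prod_decode (n - ns) = (j, k)" by (cases "prod_decode (n - ns)")
  \<comment> \<open>The remainder modulo \<open>m\<close> in \<open>E\<close> makes every code refer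
    to one of the \<open>m\<close> observations.\<close>
  have "j mod m < m" using m by simp
  then have "Suc (j mod m) \<in> {1..m}" by auto
  from loc_measurable'[OF z_component[OF this], of k] show ?thesis using False jk by (simp add: E_def)
qed

lemma zmark_measurable:
  assumes "f \<in> borel_measurable N" "Z \<in> N \<rightarrow>\<^sub>M D"
  shows "(\<lambda>p. zmark (Z p) (f p)) \<in> N \<rightarrow>\<^sub>M count_space UNIV"
  unfolding zmark_def
proof (rule measurable_map_upt)
  fix j assume "j \<in> {1..<Suc m}"
  then have "j \<in> {1..m}" by auto
  from point_mass_measurable[OF assms(1) measurable_compose[OF assms(2) z_component[OF this]]]
  show "(\<lambda>p. \<lfloor>Z p j {f p}\<rfloor>) \<in> N \<rightarrow>\<^sub>M count_space UNIV" by measurable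
qed

lemma V_measurable: "Measurable.pred D (\<lambda>z. n \<in> V z)"
proof -
  note [measurable] = E_measurable
  have [measurable]: "(\<lambda>z. zmark z (E z n)) \<in> D \<rightarrow>\<^sub>M count_space UNIV"
    by (rule zmark_measurable) measurable
  have [measurable]: "Measurable.pred D (\<lambda>z. E z n' = E z n)" for n'
  proof -
    have "Measurable.pred D (\<lambda>z. dist (E z n') (E z n) = 0)" by measurable
    then show ?thesis by simp
  qed
  show ?thesis unfolding V_def mem_Collect_eq by measurable
qed

section \<open>The candidate for given data\<close>

definition Q :: "nat \<times> int list \<Rightarrow> real measure" where
  "Q = (\<lambda>(n, v). if n < ns then Qfix (slist ! n) v else Qnew v)"

lemma prob_Q: "prob_space (Q i)" and sets_Q' [simp, measurable_cong]: "sets (Q i) = sets borel"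
  by (auto simp: Q_def prob_Qfix prob_Qnew split: prod.split)

abbreviation "R \<equiv> PiM UNIV Q"
abbreviation "L \<equiv> R \<Otimes>\<^sub>M M"

lemma prob_R: "prob_space R"
  by (intro prob_space_PiM prob_Q)

lemma prob_L: "prob_space L"
proof -
  interpret R: prob_space R by (rule prob_R)
  interpret P: pair_prob_space R M ..
  show ?thesis by (rule P.prob_space_axioms)
qed

text \<open>The sum of \<open>f\<close> over the atoms that the candidate is going to have. As a
  series over the natural numbers it is measurable in data, weights and copy at once, and so carries
  the measurability of the candidate.\<close>

definition jsum :: "('a \<Rightarrow> real \<Rightarrow> ennreal) \<Rightarrow> (nat \<Rightarrow> 'a set \<Rightarrow> real) \<Rightarrow> (nat \<times> int list \<Rightarrow> real) \<Rightarrow> 'w \<Rightarrow> ennreal" where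
  "jsum f z r \<omega> = (\<Sum>n. if n \<in> V z then f (E z n) (r (n, zmark z (E z n))) else 0)
     + (\<Sum>k. if k \<in> I0 \<omega> then f (\<psi> k \<omega>) (\<theta> k \<omega>) else 0)"

lemma jsum_measurable:
  assumes f: "(\<lambda>(s, y). f s y) \<in> borel_measurable (borel \<Otimes>\<^sub>M borel)"
    and Z: "Z \<in> N \<rightarrow>\<^sub>M D" and r: "r \<in> N \<rightarrow>\<^sub>M R" and w: "w \<in> N \<rightarrow>\<^sub>M M"
  shows "(\<lambda>p. jsum f (Z p) (r p) (w p)) \<in> borel_measurable N"
proof -
  have f': "(\<lambda>p. f (a p) (b p)) \<in> borel_measurable N" if "a \<in> borel_measurable N" "b \<in> borel_measurable N" for a b
  proof -
    have "(\<lambda>p. (a p, b p)) \<in> N \<rightarrow>\<^sub>M borel \<Otimes>\<^sub>M borel" using that by measurable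
    from measurable_compose[OF this f] show ?thesis by simp
  qed
  have En: "(\<lambda>p. E (Z p) n) \<in> borel_measurable N" for n by (rule measurable_compose[OF Z E_measurable])
  have mk: "(\<lambda>p. zmark (Z p) (E (Z p) n)) \<in> N \<rightarrow>\<^sub>M count_space UNIV" for n
    by (rule zmark_measurable[OF En Z])
  have rn: "(\<lambda>p. r p (n, zmark (Z p) (E (Z p) n))) \<in> borel_measurable N" for n
  proof (rule measurable_compose_countable[OF _ mk])
    fix v
    have "(\<lambda>r. r (n, v)) \<in> R \<rightarrow>\<^sub>M Q (n, v)" by (rule measurable_component_singleton) simp
    then have "(\<lambda>r. r (n, v)) \<in> R \<rightarrow>\<^sub>M borel" by (simp add: measurable_cong_sets[OF refl sets_Q'])
    from measurable_compose[OF r this] show "(\<lambda>p. r p (n, v)) \<in> borel_measurable N" .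
  qed
  have [measurable]: "Measurable.pred N (\<lambda>p. n \<in> V (Z p))" for n
    using measurable_compose[OF Z V_measurable] .
  have "Measurable.pred M (\<lambda>\<omega>. k \<in> I0 \<omega>)" for k unfolding I0_def mem_Collect_eq by measurable
  from measurable_compose[OF w this] have [measurable]: "Measurable.pred N (\<lambda>p. k \<in> I0 (w p))" for k .
  have [measurable]: "(\<lambda>p. f (E (Z p) n) (r p (n, zmark (Z p) (E (Z p) n)))) \<in> borel_measurable N"
    "(\<lambda>p. f (\<psi> k (w p)) (\<theta> k (w p))) \<in> borel_measurable N" for n k
    by (rule f'[OF En rn]) (rule f'[OF measurable_compose[OF w \<psi>_measurable] measurable_compose[OF w \<theta>_measurable]])
  show ?thesis unfolding jsum_def by measurable
qed

definition J :: "(nat \<Rightarrow> 'a set \<Rightarrow> real) \<Rightarrow> 'w \<Rightarrow> (nat + nat) set" where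
  "J z \<omega> = Inl ` V z \<union> Inr ` I0 \<omega>"

definition pos :: "(nat \<Rightarrow> 'a set \<Rightarrow> real) \<Rightarrow> 'w \<Rightarrow> nat + nat \<Rightarrow> 'a" where
  "pos z \<omega> = case_sum (E z) (\<lambda>k. \<psi> k \<omega>)"

definition wt :: "(nat \<Rightarrow> 'a set \<Rightarrow> real) \<Rightarrow> (nat \<times> int list \<Rightarrow> real) \<Rightarrow> 'w \<Rightarrow> nat + nat \<Rightarrow> real" where
  "wt z r \<omega> = case_sum (\<lambda>n. r (n, zmark z (E z n))) (\<lambda>k. \<theta> k \<omega>)"

lemma jsum_J: "jsum f z r \<omega> = (\<integral>\<^sup>+i. f (pos z \<omega> i) (wt z r \<omega> i) \<partial>count_space (J z \<omega>))"
  unfolding J_def nn_integral_count_space_Plus jsum_def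
  by (simp add: nn_integral_count_space_nat_set pos_def wt_def)

text \<open>
  The posterior candidate for data \<open>z\<close>: the ordinary atoms of mark \<open>z0\<close> of a copy of \<open>\<Theta>\<close> that is
  independent of \<open>z\<close>, together with independent weights \<open>r (n, v)\<close> at the locations \<open>E z n\<close>. The weights
  are drawn for all marks \<open>v\<close> at once, so that their joint law \<open>R\<close> does not depend on \<open>z\<close>.
\<close>

definition T :: "(nat \<Rightarrow> 'a set \<Rightarrow> real) \<Rightarrow> (nat \<times> int list \<Rightarrow> real) \<Rightarrow> 'w \<Rightarrow> 'a set \<Rightarrow> real" where
  "T z r \<omega> = (if lfin (J z \<omega>) (pos z \<omega>) (wt z r \<omega>) then psum (J z \<omega>) (pos z \<omega>) (wt z r \<omega>)
     else psum {} (pos z \<omega>) (wt z r \<omega>))"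

lemma T_space: "T z r \<omega> \<in> space signed_measures"
proof -
  have "lfin {} (pos z \<omega>) (wt z r \<omega>)" by (simp add: lfin_def nn_integral_count_space_finite)
  then show ?thesis unfolding T_def by (auto intro: psum_space)
qed

text \<open>Local summability and the values on bounded sets are both expressed by
  \<open>jsum\<close>. The empty sum in the definition of \<open>T\<close> supplies a signed measure
  where summability fails.\<close>

lemma T_measurable:
  assumes Z: "Z \<in> N \<rightarrow>\<^sub>M D" and r: "r \<in> N \<rightarrow>\<^sub>M R" and w: "w \<in> N \<rightarrow>\<^sub>M M"
  shows "(\<lambda>p. T (Z p) (r p) (w p)) \<in> N \<rightarrow>\<^sub>M signed_measures"
proof (rule measurable_signed_measuresI[OF T_space])
  fix B :: "'a set" assume B: "B \<in> bounded_borel"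
  have lf: "lfin (J z \<omega>) (pos z \<omega>) (wt z r \<omega>) \<longleftrightarrow> (\<forall>n. jsum (\<lambda>s y. indicator (bb n) s * ennreal \<bar>y\<bar>) z r \<omega> < \<top>)" for z r \<omega>
    unfolding lfin_def jsum_J ..
  have TB: "T z r \<omega> B = (if \<forall>n. jsum (\<lambda>s y. indicator (bb n) s * ennreal \<bar>y\<bar>) z r \<omega> < \<top>
      then enn2real (jsum (\<lambda>s y. indicator B s * ennreal y) z r \<omega>) - enn2real (jsum (\<lambda>s y. indicator B s * ennreal (- y)) z r \<omega>)
      else 0)" for z r \<omega>
  proof (cases "lfin (J z \<omega>) (pos z \<omega>) (wt z r \<omega>)")
    case True
    then show ?thesis using lf[of z \<omega> r] psum_eq_nn[OF True B] by (simp add: T_def jsum_J)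
  next
    case False
    then have nl: "\<not> (\<forall>n. jsum (\<lambda>s y. indicator (bb n) s * ennreal \<bar>y\<bar>) z r \<omega> < \<top>)" using lf by blast
    show ?thesis unfolding if_not_P[OF nl] T_def if_not_P[OF False]
      using B by (simp add: psum_eq lebesgue_integral_count_space_finite)
  qed
  note [measurable] = bounded_borelD[OF B]
  have 1: "(\<lambda>p. jsum (\<lambda>s y. indicator (bb n) s * ennreal \<bar>y\<bar>) (Z p) (r p) (w p)) \<in> borel_measurable N" for n
    by (rule jsum_measurable[OF _ Z r w]) measurable
  have 2: "(\<lambda>p. jsum (\<lambda>s y. indicator B s * ennreal y) (Z p) (r p) (w p)) \<in> borel_measurable N"
    by (rule jsum_measurable[OF _ Z r w]) measurable
  have 3: "(\<lambda>p. jsum (\<lambda>s y. indicator B s * ennreal (- y)) (Z p) (r p) (w p)) \<in> borel_measurable N"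
    by (rule jsum_measurable[OF _ Z r w]) measurable
  note [measurable] = 1 2 3
  show "(\<lambda>p. T (Z p) (r p) (w p) B) \<in> borel_measurable N" unfolding TB by measurable
qed

definition kernel :: "(nat \<Rightarrow> 'a set \<Rightarrow> real) \<Rightarrow> ('a set \<Rightarrow> real) measure" where
  "kernel z = distr L signed_measures (\<lambda>p. T z (fst p) (snd p))"

lemma kernel_measurable: "kernel \<in> D \<rightarrow>\<^sub>M prob_algebra signed_measures"
  unfolding kernel_def
proof (rule measurable_distr_prob_space2[where M = L])
  show "(\<lambda>z. L) \<in> D \<rightarrow>\<^sub>M prob_algebra L" using prob_L by (intro measurable_const) (simp add: space_prob_algebra)
  show "(\<lambda>(z, p). T z (fst p) (snd p)) \<in> D \<Otimes>\<^sub>M L \<rightarrow>\<^sub>M signed_measures"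
    unfolding split_beta' by (rule T_measurable) measurable
qed

text \<open>The outcomes for which the listed new locations do not collide with atoms of the copy
  and no new atom is lost through a zero weight.\<close>

definition nice :: "(nat \<Rightarrow> 'a set \<Rightarrow> real) \<Rightarrow> (nat \<times> int list \<Rightarrow> real) \<Rightarrow> 'w \<Rightarrow> bool" where
  "nice z r \<omega> \<longleftrightarrow> good \<omega> \<and> (\<forall>n\<in>V z. \<not> n < ns \<longrightarrow> r (n, zmark z (E z n)) \<noteq> 0 \<and> (\<forall>k\<in>idx \<omega>. \<psi> k \<omega> \<noteq> E z n))"

lemma AE_nice: "AE p in L. nice z (fst p) (snd p)"
proof -
  have sf: "sigma_finite_measure R" "sigma_finite_measure M"
    using prob_R prob_space_axioms by (simp_all add: prob_space_imp_sigma_finite)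
  have 1: "AE r in R. \<forall>n. \<not> n < ns \<longrightarrow> r (n, zmark z (E z n)) \<noteq> 0"
    unfolding AE_all_countable
  proof
    fix n
    have ae: "AE y in Q (n, zmark z (E z n)). \<not> n < ns \<longrightarrow> y \<noteq> 0"
    proof (cases "n < ns")
      case False
      then have q: "Q (n, zmark z (E z n)) = Qnew (zmark z (E z n))" by (simp add: Q_def)
      show ?thesis unfolding q using AE_Qnew_nonzero by (rule eventually_mono) simp
    qed simp
    show "AE r in R. \<not> n < ns \<longrightarrow> r (n, zmark z (E z n)) \<noteq> 0"
      by (rule AE_PiM_component[of UNIV Q "(n, zmark z (E z n))" "\<lambda>y. \<not> n < ns \<longrightarrow> y \<noteq> 0"])
         (rule prob_Q UNIV_I ae)+
  qed
  have 2: "AE \<omega> in M. \<forall>n. E z n \<notin> S \<longrightarrow> (\<forall>k\<in>idx \<omega>. \<psi> k \<omega> \<noteq> E z n)"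
    unfolding AE_all_countable
  proof
    fix n show "AE \<omega> in M. E z n \<notin> S \<longrightarrow> (\<forall>k\<in>idx \<omega>. \<psi> k \<omega> \<noteq> E z n)"
      using AE_no_atom_at[of "E z n"] by (cases "E z n \<in> S") auto
  qed
  from AE_pair_fst[OF sf(1) prob_space_axioms 1] AE_pair_snd[OF prob_R sf(2) 2] AE_pair_snd[OF prob_R sf(2) AE_good]
  show ?thesis by eventually_elim (use E_new in \<open>auto simp: nice_def\<close>)
qed

lemma nice_T:
  assumes z: "zgood z" and n: "nice z r \<omega>"
  shows "inj_on (pos z \<omega>) (J z \<omega>)" "lfin (J z \<omega>) (pos z \<omega>) (wt z r \<omega>)"
    and "T z r \<omega> = psum (J z \<omega>) (pos z \<omega>) (wt z r \<omega>)"
    and "atomic (T z r \<omega>)" and "\<And>n. n \<in> V z \<Longrightarrow> T z r \<omega> {E z n} = r (n, zmark z (E z n))"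
proof -
  have g: "good \<omega>" using n by (simp add: nice_def)
  have fin: "finite (V z)" using z by (simp add: zgood_def)
  have disj: "\<psi> k \<omega> \<noteq> E z i" if "k \<in> I0 \<omega>" "i \<in> V z" for k i
  proof (cases "i < ns")
    case True
    then show ?thesis using E_fixed[of i z] that by (auto simp: I0_def)
  next
    case False
    then show ?thesis using n that by (auto simp: nice_def I0_def)
  qed
  show inj: "inj_on (pos z \<omega>) (J z \<omega>)"
  proof (rule inj_onI)
    fix a b assume ab: "a \<in> J z \<omega>" "b \<in> J z \<omega>" "pos z \<omega> a = pos z \<omega> b"
    have inj\<psi>: "inj_on (\<lambda>k. \<psi> k \<omega>) (I0 \<omega>)" using goodD(4)[OF g] by (rule inj_on_subset) (auto simp: I0_def)
    show "a = b"
      using ab inj_onD[OF inj_E[of z]] inj_onD[OF inj\<psi>] disj disj[symmetric]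
      unfolding J_def pos_def by (elim UnE imageE) fastforce+
  qed
  have "weighted_atoms (K \<omega>) (\<lambda>k. \<theta> k \<omega>) (\<lambda>k. \<psi> k \<omega>) (\<Theta> \<omega>)" using g by (simp add: good_def)
  note lf0 = weighted_atoms_psum(1)[OF this]
  show lf: "lfin (J z \<omega>) (pos z \<omega>) (wt z r \<omega>)"
    unfolding lfin_def
  proof
    fix i
    have "(\<integral>\<^sup>+k. indicator (bb i) (\<psi> k \<omega>) * ennreal \<bar>\<theta> k \<omega>\<bar> \<partial>count_space (I0 \<omega>))
      \<le> (\<integral>\<^sup>+k. indicator (bb i) (\<psi> k \<omega>) * ennreal \<bar>\<theta> k \<omega>\<bar> \<partial>count_space (idx \<omega>))"
      by (subst (1 2) nn_integral_count_space_indicator)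
         (auto intro!: nn_integral_mono simp: indicator_def I0_def)
    also have "\<dots> < \<top>" using lf0 by (simp add: lfin_def)
    finally have 1: "(\<integral>\<^sup>+k. indicator (bb i) (\<psi> k \<omega>) * ennreal \<bar>\<theta> k \<omega>\<bar> \<partial>count_space (I0 \<omega>)) < \<top>" .
    have 2: "(\<integral>\<^sup>+n. indicator (bb i) (E z n) * ennreal \<bar>r (n, zmark z (E z n))\<bar> \<partial>count_space (V z)) < \<top>"
      using fin by (subst nn_integral_count_space_finite) (auto simp: indicator_def)
    show "(\<integral>\<^sup>+j. indicator (bb i) (pos z \<omega> j) * ennreal \<bar>wt z r \<omega> j\<bar> \<partial>count_space (J z \<omega>)) < \<top>"
      unfolding J_def nn_integral_count_space_Plus using 1 2 by (simp add: pos_def wt_def)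
  qed
  show T: "T z r \<omega> = psum (J z \<omega>) (pos z \<omega>) (wt z r \<omega>)" unfolding T_def using lf by simp
  show "atomic (T z r \<omega>)" unfolding T by (rule atomic_psum[OF inj lf])
  show "T z r \<omega> {E z n} = r (n, zmark z (E z n))" if "n \<in> V z" for n
    using psum_point[OF inj _ lf, of "Inl n"] that unfolding T by (simp add: pos_def wt_def J_def)
qed

lemma atom_sum_T:
  assumes z: "zgood z" and n: "nice z r \<omega>" and f: "\<And>s. f s 0 = 0"
  shows "atom_sum f (T z r \<omega>) = (\<Sum>n\<in>V z. f (E z n) (r (n, zmark z (E z n))))
     + (\<integral>\<^sup>+k. f (\<psi> k \<omega>) (\<theta> k \<omega>) \<partial>count_space (I0 \<omega>))"
proof -
  have "atom_sum f (T z r \<omega>) = (\<integral>\<^sup>+i. f (pos z \<omega> i) (wt z r \<omega> i) \<partial>count_space (J z \<omega>))"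
    unfolding nice_T(3)[OF z n] nn_integral_psum_atoms[OF nice_T(1,2)[OF z n]]
    by (intro nn_integral_cong) (auto simp: f)
  also have "\<dots> = (\<Sum>n\<in>V z. f (E z n) (r (n, zmark z (E z n)))) + (\<integral>\<^sup>+k. f (\<psi> k \<omega>) (\<theta> k \<omega>) \<partial>count_space (I0 \<omega>))"
    unfolding J_def nn_integral_count_space_Plus using z
    by (simp add: pos_def wt_def nn_integral_count_space_finite zgood_def)
  finally show ?thesis .
qed

text \<open>Both arguments are read through the atoms: the weight from \<open>\<mu>\<close>, the
  mark from \<open>z\<close>. The locations of \<open>S\<close> are summed apart since their weight
  may vanish while their mark does not.\<close>

definition joint :: "('a \<Rightarrow> real \<Rightarrow> int list \<Rightarrow> ennreal) \<Rightarrow> ('a set \<Rightarrow> real) \<Rightarrow> (nat \<Rightarrow> 'a set \<Rightarrow> real) \<Rightarrow> ennreal" where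
  "joint l \<mu> z = (\<Sum>s\<in>S. l s (\<mu> {s}) (zmark z s)) + loc_sum (\<lambda>s y. if s \<in> S then 0 else l s y (zmark z s)) \<mu>"

lemma joint_atomic:
  assumes "atomic \<mu>"
  shows "joint l \<mu> z = (\<integral>\<^sup>+s. l s (\<mu> {s}) (zmark z s) \<partial>count_space (S \<union> {s. \<mu> {s} \<noteq> 0}))"
proof -
  have "loc_sum (\<lambda>s y. if s \<in> S then 0 else l s y (zmark z s)) \<mu> = (\<integral>\<^sup>+s. l s (\<mu> {s}) (zmark z s) \<partial>count_space ({s. \<mu> {s} \<noteq> 0} - S))"
    unfolding loc_sum_eq_atom_sum[OF assms] atom_sum_def
    by (subst (1 2) nn_integral_count_space_indicator) (auto intro!: nn_integral_cong simp: indicator_def)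
  then show ?thesis unfolding joint_def nn_integral_count_space_Un[OF A0] by simp
qed

lemma lmeas_zmark:
  assumes l: "lmeas l" and Z: "Z \<in> N \<rightarrow>\<^sub>M D"
    and s: "f \<in> borel_measurable N" and y: "g \<in> borel_measurable N"
  shows "(\<lambda>p. l (f p) (g p) (zmark (Z p) (f p))) \<in> borel_measurable N"
  by (rule measurable_compose_countable[OF lmeasD[OF l s y] zmark_measurable[OF s Z]])

lemma joint_measurable:
  assumes l: "lmeas l" and F: "F \<in> N \<rightarrow>\<^sub>M signed_measures" and Z: "Z \<in> N \<rightarrow>\<^sub>M D"
  shows "(\<lambda>p. joint l (F p) (Z p)) \<in> borel_measurable N"
proof -
  have 1: "(\<lambda>p. l s (F p {s}) (zmark (Z p) s)) \<in> borel_measurable N" for s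
    by (rule lmeas_zmark[OF l Z]) (auto intro: eval_measurable'[OF F])
  have 2: "(\<lambda>p. loc_sum (\<lambda>s y. if s \<in> S then 0 else l s y (zmark (Z p) s)) (F p)) \<in> borel_measurable N"
  proof (rule loc_sum_measurable[OF F])
    have "(\<lambda>q. l (fst (snd q)) (snd (snd q)) (zmark (Z (fst q)) (fst (snd q)))) \<in> borel_measurable (N \<Otimes>\<^sub>M borel \<Otimes>\<^sub>M borel)"
      (is "?f \<in> _")
      by (rule lmeas_zmark[OF l, where f = "\<lambda>q. fst (snd q)" and g = "\<lambda>q. snd (snd q)" and Z = "\<lambda>q. Z (fst q)",
            OF measurable_compose[OF measurable_fst Z]]) measurable
    moreover have "{q \<in> space (N \<Otimes>\<^sub>M borel \<Otimes>\<^sub>M (borel :: real measure)). fst (snd q) \<in> S} \<in> sets (N \<Otimes>\<^sub>M borel \<Otimes>\<^sub>M borel)"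
      by measurable
    ultimately have "(\<lambda>q. if fst (snd q) \<in> S then 0 else ?f q) \<in> borel_measurable (N \<Otimes>\<^sub>M borel \<Otimes>\<^sub>M borel)"
      by (rule measurable_If[OF measurable_const, rotated]) simp
    then show "(\<lambda>(p, s, y). if s \<in> S then 0 else l s y (zmark (Z p) s)) \<in> borel_measurable (N \<Otimes>\<^sub>M borel \<Otimes>\<^sub>M borel)"
      unfolding split_beta' .
  qed
  show ?thesis unfolding joint_def using 1 2 by (intro borel_measurable_add borel_measurable_sum) auto
qed

lemma joint_model:
  assumes g: "good \<omega>"
  shows "joint l (\<Theta> \<omega>) (XX \<omega>) = ksum l \<omega>"
proof -
  have "{s. \<Theta> \<omega> {s} \<noteq> 0} - S = {s. s \<notin> S \<and> \<Theta> \<omega> {s} \<noteq> 0}" by auto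
  then show ?thesis
    unfolding joint_atomic[OF goodD(1)[OF g]] nn_integral_count_space_Un[OF A0]
    using ksum_eq[OF g, of "zmark (XX \<omega>)" l] zmark_XX[OF g] by simp
qed

text \<open>Nonzero new weights make the listed new locations appear in \<open>loc_sum\<close>. The
  retained atoms of the copy meet no listed location, so the data have the mark \<open>z0\<close>
  there, in agreement with their own mark.\<close>

lemma joint_T:
  assumes z: "zgood z" and n: "nice z r \<omega>"
  shows "joint l (T z r \<omega>) z = (\<Sum>n\<in>V z. l (E z n) (r (n, zmark z (E z n))) (zmark z (E z n)))
     + ksum (\<lambda>s y v. if s \<in> S \<or> v \<noteq> z0 then 0 else l s y v) \<omega>"
proof -
  have g: "good \<omega>" using n by (simp add: nice_def)
  have fin: "finite (V z)" using z by (simp add: zgood_def)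
  let ?T = "T z r \<omega>" and ?f = "\<lambda>s y. if s \<in> S \<or> y = 0 then 0 else l s y (zmark z s)"
  have "loc_sum (\<lambda>s y. if s \<in> S then 0 else l s y (zmark z s)) ?T = atom_sum ?f ?T"
    unfolding loc_sum_eq_atom_sum[OF nice_T(4)[OF z n]] atom_sum_def by (intro nn_integral_cong) auto
  also have "\<dots> = (\<Sum>n\<in>V z. ?f (E z n) (r (n, zmark z (E z n)))) + (\<integral>\<^sup>+k. ?f (\<psi> k \<omega>) (\<theta> k \<omega>) \<partial>count_space (I0 \<omega>))"
    by (rule atom_sum_T[OF z n]) simp
  also have "(\<Sum>n\<in>V z. ?f (E z n) (r (n, zmark z (E z n)))) = (\<Sum>n\<in>{n\<in>V z. \<not> n < ns}. l (E z n) (r (n, zmark z (E z n))) (zmark z (E z n)))"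
  proof (rule sum.mono_neutral_cong_right[OF fin])
    show "\<forall>i\<in>V z - {n \<in> V z. \<not> n < ns}. ?f (E z i) (r (i, zmark z (E z i))) = 0" using E_fixed by auto
    show "?f (E z i) (r (i, zmark z (E z i))) = l (E z i) (r (i, zmark z (E z i))) (zmark z (E z i))"
      if "i \<in> {n \<in> V z. \<not> n < ns}" for i using that n E_new[of i z] by (auto simp: nice_def)
  qed auto
  also have "(\<integral>\<^sup>+k. ?f (\<psi> k \<omega>) (\<theta> k \<omega>) \<partial>count_space (I0 \<omega>)) = ksum (\<lambda>s y v. if s \<in> S \<or> v \<noteq> z0 then 0 else l s y v) \<omega>"
  proof -
    have "zmark z (\<psi> k \<omega>) = z0" if k: "k \<in> I0 \<omega>" for k
    proof (rule ccontr)
      assume "zmark z (\<psi> k \<omega>) \<noteq> z0"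
      then have "\<psi> k \<omega> \<in> E z ` V z" using z k by (auto simp: zgood_def I0_def)
      then obtain i where i: "i \<in> V z" "\<psi> k \<omega> = E z i" by auto
      then have "\<not> i < ns" using E_fixed[of i z] k by (auto simp: I0_def)
      then show False using n i k by (auto simp: nice_def I0_def)
    qed
    then have "(\<integral>\<^sup>+k. ?f (\<psi> k \<omega>) (\<theta> k \<omega>) \<partial>count_space (I0 \<omega>))
      = (\<integral>\<^sup>+k. (if \<psi> k \<omega> \<in> S \<or> mark k \<omega> \<noteq> z0 then 0 else l (\<psi> k \<omega>) (\<theta> k \<omega>) (mark k \<omega>)) \<partial>count_space (I0 \<omega>))"
      using goodD(8)[OF g] by (intro nn_integral_cong) (auto simp: I0_def)
    also have "\<dots> = ksum (\<lambda>s y v. if s \<in> S \<or> v \<noteq> z0 then 0 else l s y v) \<omega>"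
      unfolding ksum_count_space
      by (subst (1 2) nn_integral_count_space_indicator) (auto intro!: nn_integral_cong simp: indicator_def I0_def)
    finally show ?thesis .
  qed
  finally have 1: "loc_sum (\<lambda>s y. if s \<in> S then 0 else l s y (zmark z s)) ?T
    = (\<Sum>n\<in>{n\<in>V z. \<not> n < ns}. l (E z n) (r (n, zmark z (E z n))) (zmark z (E z n)))
      + ksum (\<lambda>s y v. if s \<in> S \<or> v \<noteq> z0 then 0 else l s y v) \<omega>" .
  have "(\<Sum>n\<in>V z. l (E z n) (?T {E z n}) (zmark z (E z n)))
    = (\<Sum>s\<in>S. l s (?T {s}) (zmark z s)) + (\<Sum>n\<in>{n\<in>V z. \<not> n < ns}. l (E z n) (?T {E z n}) (zmark z (E z n)))"
    by (rule sum_V[OF fin, of "\<lambda>s. l s (?T {s}) (zmark z s)"])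
  then show ?thesis unfolding joint_def 1 by (simp add: nice_T(5)[OF z n] add.assoc)
qed

text \<open>Weights and copy are independent, and so are the weights among themselves. Setting the
  test function to 0 at marks other than \<open>z0\<close> performs the thinning of the copy, so
  \<open>marked_laplace\<close> applies to it.\<close>

lemma laplace_T:
  assumes z: "zgood z" and l: "lmeas l"
  shows "(\<integral>\<^sup>+p. en (joint l (T z (fst p) (snd p)) z) \<partial>L)
    = (\<Prod>n\<in>V z. \<integral>\<^sup>+y. en (l (E z n) y (zmark z (E z n))) \<partial>Q (n, zmark z (E z n)))
      * en (Phi (\<lambda>s y v. if s \<in> S \<or> v \<noteq> z0 then 0 else l s y v))"
proof -
  have fin: "finite (V z)" using z by (simp add: zgood_def)
  let ?l0 = "\<lambda>s y v. if s \<in> S \<or> v \<noteq> z0 then 0 else l s y v"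
  have l0: "lmeas ?l0" by (intro lmeas_If lmeas_const l) measurable
  define f where "f i y = en (l (E z (fst i)) y (snd i))" for i y
  have weight_measurable: "f i \<in> borel_measurable (Q i)" for i
    unfolding f_def measurable_cong_sets[OF sets_Q' refl]
    by (intro measurable_compose[OF _ en_measurable] lmeasD[OF l]) auto
  define I where "I = (\<lambda>n. (n, zmark z (E z n))) ` V z"
  have finI: "finite I" using fin by (simp add: I_def)
  define A where "A r = (\<Prod>i\<in>I. f i (r i))" for r
  have Am [measurable]: "A \<in> borel_measurable R"
  proof -
    have "(\<lambda>r. f i (r i)) \<in> borel_measurable R" for i
      by (rule measurable_compose[OF measurable_component_singleton[of i UNIV Q] weight_measurable]) simp
    then show ?thesis unfolding A_def by (intro borel_measurable_prod_ennreal)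
  qed
  have [measurable]: "(\<lambda>\<omega>. en (ksum ?l0 \<omega>)) \<in> borel_measurable M"
    by (intro measurable_compose[OF _ en_measurable] ksum_measurable l0)
  have reI: "(\<Prod>i\<in>I. h i) = (\<Prod>n\<in>V z. h (n, zmark z (E z n)))" for h :: "nat \<times> int list \<Rightarrow> ennreal"
    unfolding I_def by (subst prod.reindex) (auto simp: inj_on_def)
  have "(\<integral>\<^sup>+p. en (joint l (T z (fst p) (snd p)) z) \<partial>L) = (\<integral>\<^sup>+p. A (fst p) * en (ksum ?l0 (snd p)) \<partial>L)"
    using AE_nice[of z]
    by (intro nn_integral_cong_AE, eventually_elim) (simp add: joint_T[OF z] en_add en_sum[OF fin] A_def f_def reI)
  also have "\<dots> = (\<integral>\<^sup>+r. \<integral>\<^sup>+\<omega>. A r * en (ksum ?l0 \<omega>) \<partial>M \<partial>R)"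
    by (subst nn_integral_fst[symmetric]) auto
  also have "\<dots> = (\<integral>\<^sup>+r. A r \<partial>R) * (\<integral>\<^sup>+\<omega>. en (ksum ?l0 \<omega>) \<partial>M)"
    by (simp add: nn_integral_cmult nn_integral_multc)
  also have "(\<integral>\<^sup>+r. A r \<partial>R) = (\<Prod>i\<in>I. \<integral>\<^sup>+y. f i y \<partial>Q i)"
    unfolding A_def by (rule indep_prod_PiM[OF prob_Q finI weight_measurable])
  also have "\<dots> = (\<Prod>n\<in>V z. \<integral>\<^sup>+y. en (l (E z n) y (zmark z (E z n))) \<partial>Q (n, zmark z (E z n)))"
    unfolding reI by (intro prod.cong nn_integral_cong refl) (simp add: f_def)
  also have "(\<integral>\<^sup>+\<omega>. en (ksum ?l0 \<omega>) \<partial>M) = en (Phi ?l0)"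
  proof -
    have "expect_mark (\<lambda>s y v. en (?l0 s y v)) s y = 1" if "s \<in> S" for s y
      using that by (intro expect_mark_one) simp
    then show ?thesis unfolding marked_laplace[OF l0] by (simp add: emeasure_space_1)
  qed
  finally show ?thesis .
qed

text \<open>
  The contribution of the posterior weight at \<open>s\<close> to the Laplace functional, as a function of the
  mark: it turns integration over the posterior into another functional of the marked atoms.
\<close>

definition factor :: "('a \<Rightarrow> real \<Rightarrow> int list \<Rightarrow> ennreal) \<Rightarrow> 'a \<Rightarrow> int list \<Rightarrow> ennreal" where
  "factor l s v = (if s \<in> S then \<integral>\<^sup>+y. en (l s y v) \<partial>Qfix s v
     else if v = z0 then 1 else \<integral>\<^sup>+y. en (l s y v) \<partial>Qnew v)"

lemma prob_integral_le_1: "prob_space A \<Longrightarrow> (\<And>y. f y \<le> 1) \<Longrightarrow> (\<integral>\<^sup>+y. f y \<partial>A) \<le> 1"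
proof -
  assume "prob_space A" and f: "\<And>y. f y \<le> 1"
  then interpret A: prob_space A by simp
  have "(\<integral>\<^sup>+y. f y \<partial>A) \<le> (\<integral>\<^sup>+y. 1 \<partial>A)" by (intro nn_integral_mono f)
  then show ?thesis by (simp add: A.emeasure_space_1)
qed

lemma factor_le_1: "factor l s v \<le> 1"
  unfolding factor_def by (auto intro!: prob_integral_le_1 prob_Qfix prob_Qnew)

lemma en_l_y: "lmeas l \<Longrightarrow> (\<lambda>y. en (l s y v)) \<in> borel_measurable borel"
  by (intro measurable_compose[OF _ en_measurable] lmeasD) auto

lemma Qnew_param_measurable:
  assumes "(\<lambda>(s, y). f s y) \<in> borel_measurable (borel \<Otimes>\<^sub>M borel)"
  shows "(\<lambda>s. \<integral>\<^sup>+y. f s y \<partial>Qnew v) \<in> borel_measurable borel"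
proof -
  interpret Q: prob_space "Qnew v" by (rule prob_Qnew)
  have "(\<lambda>(s, y). f s y) \<in> borel_measurable (borel \<Otimes>\<^sub>M Qnew v)"
    using assms by (simp add: measurable_cong_sets[OF sets_pair_measure_cong[OF refl sets_Q(1)] refl])
  then show ?thesis by (rule Q.borel_measurable_nn_integral)
qed

lemma factor_measurable:
  assumes l: "lmeas l"
  shows "(\<lambda>s. factor l s v) \<in> borel_measurable borel"
proof -
  have [measurable]: "(\<lambda>s. \<integral>\<^sup>+y. en (l s y v) \<partial>Qnew v) \<in> borel_measurable borel"
    using lmeas_en[OF l] by (intro Qnew_param_measurable) (simp add: lmeas_def)
  have "factor l s v = (\<Sum>t\<in>S. (\<integral>\<^sup>+y. en (l t y v) \<partial>Qfix t v) * indicator {t} s)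
      + indicator (- S) s * (if v = z0 then 1 else \<integral>\<^sup>+y. en (l s y v) \<partial>Qnew v)" for s
  proof (cases "s \<in> S")
    case True
    have "(\<Sum>t\<in>S. (\<integral>\<^sup>+y. en (l t y v) \<partial>Qfix t v) * indicator {t} s) = (\<Sum>t\<in>S. if t = s then \<integral>\<^sup>+y. en (l t y v) \<partial>Qfix t v else 0)"
      by (intro sum.cong) (auto simp: indicator_def)
    then show ?thesis using True A0 by (simp add: factor_def)
  next
    case False
    then have "(\<Sum>t\<in>S. (\<integral>\<^sup>+y. en (l t y v) \<partial>Qfix t v) * indicator {t} s) = 0"
      by (intro sum.neutral) (auto simp: indicator_def)
    then show ?thesis using False by (simp add: factor_def)
  qed
  then have "(\<lambda>s. factor l s v) = (\<lambda>s. (\<Sum>t\<in>S. (\<integral>\<^sup>+y. en (l t y v) \<partial>Qfix t v) * indicator {t} s)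
      + indicator (- S) s * (if v = z0 then 1 else \<integral>\<^sup>+y. en (l s y v) \<partial>Qnew v))" by (rule ext)
  moreover have "(\<lambda>s. (\<Sum>t\<in>S. (\<integral>\<^sup>+y. en (l t y v) \<partial>Qfix t v) * indicator {t} s)
      + indicator (- S) s * (if v = z0 then 1 else \<integral>\<^sup>+y. en (l s y v) \<partial>Qnew v)) \<in> borel_measurable borel"
    by (cases "v = z0") (simp_all, measurable)
  ultimately show ?thesis by simp
qed

text \<open>For data of the model the listed locations are the fixed atoms and the ordinary atoms
  with a nonzero mark; at all other atoms \<open>factor\<close> is 1. So the product is a Laplace
  functional of the marked atoms of \<open>\<Theta>\<close> itself.\<close>

lemma prod_V_eq_ksum:
  assumes g: "good \<omega>" and fin: "finite {k\<in>idx \<omega>. \<psi> k \<omega> \<notin> S \<and> mark k \<omega> \<noteq> z0}"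
  shows "(\<Prod>n\<in>V (XX \<omega>). \<integral>\<^sup>+y. en (l (E (XX \<omega>) n) y (zmark (XX \<omega>) (E (XX \<omega>) n))) \<partial>Q (n, zmark (XX \<omega>) (E (XX \<omega>) n)))
    = en (ksum (\<lambda>s y v. lneg (factor l s v)) \<omega>)"
proof -
  let ?z = "XX \<omega>" and ?a = "\<lambda>s. lneg (factor l s (zmark (XX \<omega>) s))"
  let ?N = "{s. s \<notin> S \<and> zmark (XX \<omega>) s \<noteq> z0}"
  have zgood_z: "finite (V ?z)" using zgood_XX[OF g fin] by (simp add: zgood_def)
  have finN: "finite ?N" unfolding new_atoms_XX[OF g] using fin by simp
  have "(\<integral>\<^sup>+y. en (l (E ?z n) y (zmark ?z (E ?z n))) \<partial>Q (n, zmark ?z (E ?z n))) = en (?a (E ?z n))" if n: "n \<in> V ?z" for n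
  proof -
    have "(\<integral>\<^sup>+y. en (l (E ?z n) y (zmark ?z (E ?z n))) \<partial>Q (n, zmark ?z (E ?z n))) = factor l (E ?z n) (zmark ?z (E ?z n))"
    proof (cases "n < ns")
      case True
      then show ?thesis using E_fixed[OF True, of ?z] by (simp add: factor_def Q_def E_def)
    next
      case False
      then show ?thesis using E_new[OF n False] by (simp add: factor_def Q_def)
    qed
    then show ?thesis by (simp add: en_lneg factor_le_1)
  qed
  then have "(\<Prod>n\<in>V ?z. \<integral>\<^sup>+y. en (l (E ?z n) y (zmark ?z (E ?z n))) \<partial>Q (n, zmark ?z (E ?z n))) = (\<Prod>n\<in>V ?z. en (?a (E ?z n)))"
    by (rule prod.cong[OF refl])
  also have "\<dots> = en (\<Sum>n\<in>V ?z. ?a (E ?z n))" by (rule en_sum[OF zgood_z, symmetric])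
  also have "(\<Sum>n\<in>V ?z. ?a (E ?z n)) = (\<Sum>s\<in>S. ?a s) + (\<Sum>n\<in>{n\<in>V ?z. \<not> n < ns}. ?a (E ?z n))"
    by (rule sum_V[OF zgood_z])
  also have "(\<Sum>n\<in>{n\<in>V ?z. \<not> n < ns}. ?a (E ?z n)) = (\<Sum>s\<in>?N. ?a s)"
    unfolding E_XX_new[OF g, symmetric]
    by (rule sum.reindex[symmetric, unfolded comp_def]) (rule inj_on_subset[OF inj_E], auto)
  also have "\<dots> = (\<integral>\<^sup>+s. ?a s \<partial>count_space ?N)" by (rule nn_integral_count_space_finite[OF finN, symmetric])
  also have "\<dots> = (\<integral>\<^sup>+s. ?a s \<partial>count_space {s. s \<notin> S \<and> \<Theta> \<omega> {s} \<noteq> 0})"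
  proof -
    have sub: "?N \<subseteq> {s. s \<notin> S \<and> \<Theta> \<omega> {s} \<noteq> 0}"
      using zmark_XX_nonatom[OF g] goodD(3)[OF g] by blast
    have "(\<integral>\<^sup>+s. ?a s \<partial>count_space ?N) = (\<integral>\<^sup>+s. ?a s * indicator ?N s \<partial>count_space {s. s \<notin> S \<and> \<Theta> \<omega> {s} \<noteq> 0})"
      by (rule nn_integral_count_space_restrict[OF sub, symmetric])
    also have "\<dots> = (\<integral>\<^sup>+s. ?a s \<partial>count_space {s. s \<notin> S \<and> \<Theta> \<omega> {s} \<noteq> 0})"
    proof (intro nn_integral_cong)
      fix s assume "s \<in> space (count_space {s. s \<notin> S \<and> \<Theta> \<omega> {s} \<noteq> 0})"
      moreover have "lneg 1 = 0" using lneg_en[of 0] by simp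
      ultimately show "?a s * indicator ?N s = ?a s" by (auto simp: indicator_def factor_def)
    qed
    finally show ?thesis .
  qed
  also have "(\<Sum>s\<in>S. ?a s) + (\<integral>\<^sup>+s. ?a s \<partial>count_space {s. s \<notin> S \<and> \<Theta> \<omega> {s} \<noteq> 0}) = ksum (\<lambda>s y v. lneg (factor l s v)) \<omega>"
    by (rule ksum_eq[OF g, symmetric]) (rule zmark_XX[OF g])
  finally show ?thesis .
qed

text \<open>Summed over all marks, Bayes' formula restores the joint mean of weight and mark, so
  integrating out the posterior weight leaves the fixed part unchanged.\<close>

lemma fixed_part_eq:
  assumes l: "lmeas l" and s: "s \<in> S"
  shows "(\<integral>\<^sup>+\<omega>. expect_mark (\<lambda>s y v. en (lneg (factor l s v))) s (\<Theta> \<omega> {s}) \<partial>M)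
    = (\<integral>\<^sup>+\<omega>. expect_mark (\<lambda>s y v. en (l s y v)) s (\<Theta> \<omega> {s}) \<partial>M)"
proof -
  note [measurable] = measurable_compose[OF point_\<Theta>_measurable en_l_y[OF l]]
  have "(\<integral>\<^sup>+\<omega>. expect_mark (\<lambda>s y v. en (lneg (factor l s v))) s (\<Theta> \<omega> {s}) \<partial>M)
      = (\<integral>\<^sup>+v. \<integral>\<^sup>+\<omega>. H v (\<Theta> \<omega> {s}) * factor l s v \<partial>M \<partial>count_space UNIV)"
    unfolding expect_mark_def en_lneg[OF factor_le_1] by (rule nn_integral_swap_int_list) measurable
  also have "\<dots> = (\<integral>\<^sup>+v. cS s v * (\<integral>\<^sup>+y. en (l s y v) \<partial>Qfix s v) \<partial>count_space UNIV)"
    using s by (simp add: nn_integral_multc cS_def factor_def)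
  also have "\<dots> = (\<integral>\<^sup>+v. \<integral>\<^sup>+\<omega>. H v (\<Theta> \<omega> {s}) * en (l s (\<Theta> \<omega> {s}) v) \<partial>M \<partial>count_space UNIV)"
    unfolding nn_integral_Qfix[OF en_l_y[OF l]] ..
  also have "\<dots> = (\<integral>\<^sup>+\<omega>. expect_mark (\<lambda>s y v. en (l s y v)) s (\<Theta> \<omega> {s}) \<partial>M)"
    unfolding expect_mark_def by (rule nn_integral_swap_int_list[symmetric]) measurable
  finally show ?thesis .
qed

text \<open>The exponent splits by mark. Nonzero marks come from the observed atoms, where
  \<open>C v\<close> cancels the normalisation of \<open>Qnew v\<close>; the mark \<open>z0\<close>
  comes from the thinned copy.\<close>

lemma Phi_eq:
  assumes l: "lmeas l"
  shows "Phi (\<lambda>s y v. lneg (factor l s v)) + Phi (\<lambda>s y v. if s \<in> S \<or> v \<noteq> z0 then 0 else l s y v) = Phi l"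
proof -
  interpret \<nu>: sigma_finite_measure \<nu> by (rule nu(2))
  let ?F = "G \<Otimes>\<^sub>M \<nu>"
  define d where "d v s y = 1 - en (l s y v)" for v s y
  have dm: "(\<lambda>(s, y). d v s y) \<in> borel_measurable (borel \<Otimes>\<^sub>M borel)" for v
    using lmeas_en[OF l] unfolding d_def lmeas_def split_beta' by (intro borel_measurable_minus_ennreal) auto
  have dF [measurable]: "(\<lambda>p. d v (fst p) (snd p)) \<in> borel_measurable ?F" for v
  proof -
    have "(\<lambda>p. (fst p, snd p)) \<in> ?F \<rightarrow>\<^sub>M borel \<Otimes>\<^sub>M borel" by (intro measurable_Pair fst_F snd_F)
    from measurable_compose[OF this dm[of v]] show ?thesis by simp
  qed
  have dy [measurable]: "(\<lambda>y. d v s y) \<in> borel_measurable borel" for v s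
    using en_l_y[OF l, of s v] unfolding d_def by measurable
  define b where "b v s = (\<integral>\<^sup>+y. d v s y \<partial>Qnew v)" for v s
  have bm [measurable]: "b v \<in> borel_measurable borel" for v
    unfolding b_def by (rule Qnew_param_measurable[OF dm])
  have HF [measurable]: "(\<lambda>p. H v (snd p)) \<in> borel_measurable ?F" for v
    by (rule measurable_compose[OF snd_F H_measurable])
  have bF [measurable]: "(\<lambda>p. b v (fst p)) \<in> borel_measurable ?F" for v
    by (rule measurable_compose[OF fst_F bm])
  have q: "1 - factor l s v = (if v = z0 then 0 else b v s)" if s: "s \<notin> S" for s v
  proof (cases "v = z0")
    case False
    interpret Qn: prob_space "Qnew v" by (rule prob_Qnew)
    have [measurable]: "(\<lambda>y. en (l s y v)) \<in> borel_measurable (Qnew v)"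
      using en_l_y[OF l] by (simp add: measurable_cong_sets[OF sets_Q(1) refl])
    have "(\<integral>\<^sup>+y. en (l s y v) \<partial>Qnew v) \<le> 1" by (rule prob_integral_le_1[OF prob_Qnew]) simp
    then have "(\<integral>\<^sup>+y. en (l s y v) \<partial>Qnew v) \<noteq> \<infinity>" using ennreal_one_less_top by (auto simp: top_unique)
    then have "b v s = (\<integral>\<^sup>+y. 1 \<partial>Qnew v) - (\<integral>\<^sup>+y. en (l s y v) \<partial>Qnew v)"
      unfolding b_def d_def by (intro nn_integral_diff) auto
    then show ?thesis using s False by (simp add: factor_def Qn.emeasure_space_1)
  qed (use s in \<open>simp add: factor_def\<close>)
  have "Phi (\<lambda>s y v. lneg (factor l s v)) = (\<integral>\<^sup>+p. \<integral>\<^sup>+v. H v (snd p) * (if v = z0 then 0 else b v (fst p)) \<partial>count_space UNIV \<partial>?F)"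
    unfolding expect_mark_def en_lneg[OF factor_le_1]
    using AE_F_not_S by (intro nn_integral_cong_AE, eventually_elim) (simp add: q)
  also have "\<dots> = (\<integral>\<^sup>+v. \<integral>\<^sup>+p. H v (snd p) * (if v = z0 then 0 else b v (fst p)) \<partial>?F \<partial>count_space UNIV)"
  proof (rule nn_integral_swap_int_list)
    show "(\<lambda>p. H v (snd p) * (if v = z0 then 0 else b v (fst p))) \<in> borel_measurable ?F" for v
      by (cases "v = z0") (simp_all, measurable)
  qed
  also have "\<dots> = (\<integral>\<^sup>+v. \<integral>\<^sup>+p. H v (snd p) * (if v = z0 then 0 else d v (fst p) (snd p)) \<partial>?F \<partial>count_space UNIV)"
  proof (rule nn_integral_cong)
    fix v
    show "(\<integral>\<^sup>+p. H v (snd p) * (if v = z0 then 0 else b v (fst p)) \<partial>?F)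
      = (\<integral>\<^sup>+p. H v (snd p) * (if v = z0 then 0 else d v (fst p) (snd p)) \<partial>?F)"
    proof (cases "v = z0")
      case False
      have "(\<integral>\<^sup>+p. H v (snd p) * b v (fst p) \<partial>?F) = (\<integral>\<^sup>+s. \<integral>\<^sup>+y. H v y * b v s \<partial>\<nu> \<partial>G)"
        by (subst nn_integral_F) auto
      also have "\<dots> = (\<integral>\<^sup>+s. C v * (\<integral>\<^sup>+y. d v s y \<partial>Qnew v) \<partial>G)"
        by (simp add: nn_integral_multc C_def b_def)
      also have "\<dots> = (\<integral>\<^sup>+s. \<integral>\<^sup>+y. H v y * d v s y \<partial>\<nu> \<partial>G)"
        unfolding nn_integral_Qnew[OF dy False] ..
      also have "\<dots> = (\<integral>\<^sup>+p. H v (snd p) * d v (fst p) (snd p) \<partial>?F)"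
        by (subst nn_integral_F) auto
      finally show ?thesis using False by simp
    qed simp
  qed
  also have "\<dots> = (\<integral>\<^sup>+p. \<integral>\<^sup>+v. H v (snd p) * (if v = z0 then 0 else d v (fst p) (snd p)) \<partial>count_space UNIV \<partial>?F)"
  proof (rule nn_integral_swap_int_list[symmetric])
    show "(\<lambda>p. H v (snd p) * (if v = z0 then 0 else d v (fst p) (snd p))) \<in> borel_measurable ?F" for v
      by (cases "v = z0") (simp_all, measurable)
  qed
  finally have 1: "Phi (\<lambda>s y v. lneg (factor l s v)) = \<dots>" .
  have 2: "Phi (\<lambda>s y v. if s \<in> S \<or> v \<noteq> z0 then 0 else l s y v)
     = (\<integral>\<^sup>+p. \<integral>\<^sup>+v. H v (snd p) * (if v = z0 then d v (fst p) (snd p) else 0) \<partial>count_space UNIV \<partial>?F)"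
    unfolding expect_mark_def
    using AE_F_not_S by (intro nn_integral_cong_AE, eventually_elim) (auto intro!: nn_integral_cong simp: d_def)
  have m1: "(\<lambda>p. H v (snd p) * (if v = z0 then 0 else d v (fst p) (snd p))) \<in> borel_measurable ?F"
    "(\<lambda>p. H v (snd p) * (if v = z0 then d v (fst p) (snd p) else 0)) \<in> borel_measurable ?F" for v
    by (cases "v = z0", simp_all, measurable)+
  show ?thesis
    unfolding 1 2
    by (subst nn_integral_add[symmetric], intro borel_measurable_nn_integral_int_list m1, intro borel_measurable_nn_integral_int_list m1)
       (auto simp: nn_integral_add[symmetric] expect_mark_def d_def intro!: nn_integral_cong)
qed

text \<open>The inner Laplace functional of the candidate is a functional of the marked atoms, so a
  second application of \<open>marked_laplace\<close> integrates over the data. Fixed parts and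
  exponents then match those of the model.\<close>

lemma total_laplace:
  assumes l: "lmeas l"
  shows "(\<integral>\<^sup>+\<omega>. en (joint l (\<Theta> \<omega>) (XX \<omega>)) \<partial>M)
    = (\<integral>\<^sup>+\<omega>. \<integral>\<^sup>+p. en (joint l (T (XX \<omega>) (fst p) (snd p)) (XX \<omega>)) \<partial>L \<partial>M)"
proof -
  let ?l' = "\<lambda>s y v :: int list. lneg (factor l s v)" and ?l0 = "\<lambda>s y v. if s \<in> S \<or> v \<noteq> z0 then 0 else l s y v"
  have l': "lmeas ?l'" by (intro lmeas_const measurable_compose[OF factor_measurable[OF l] lneg_measurable])
  have "(\<integral>\<^sup>+\<omega>. \<integral>\<^sup>+p. en (joint l (T (XX \<omega>) (fst p) (snd p)) (XX \<omega>)) \<partial>L \<partial>M)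
      = (\<integral>\<^sup>+\<omega>. en (ksum ?l' \<omega>) * en (Phi ?l0) \<partial>M)"
    using AE_good AE_finite_new
    by (intro nn_integral_cong_AE, eventually_elim) (simp only: laplace_T[OF zgood_XX l] prod_V_eq_ksum)
  also have "\<dots> = (\<integral>\<^sup>+\<omega>. en (ksum ?l' \<omega>) \<partial>M) * en (Phi ?l0)"
    by (intro nn_integral_multc measurable_compose[OF _ en_measurable] ksum_measurable l')
  also have "\<dots> = (\<Prod>s\<in>S. \<integral>\<^sup>+\<omega>. expect_mark (\<lambda>s y v. en (l s y v)) s (\<Theta> \<omega> {s}) \<partial>M) * (en (Phi ?l') * en (Phi ?l0))"
    unfolding marked_laplace[OF l'] mult.assoc
    by (intro arg_cong2[where f = "(*)"] prod.cong refl fixed_part_eq[OF l])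
  also have "\<dots> = (\<integral>\<^sup>+\<omega>. en (ksum l \<omega>) \<partial>M)"
    unfolding en_add[symmetric] Phi_eq[OF l] marked_laplace[OF l] ..
  also have "\<dots> = (\<integral>\<^sup>+\<omega>. en (joint l (\<Theta> \<omega>) (XX \<omega>)) \<partial>M)"
    using AE_good by (intro nn_integral_cong_AE, eventually_elim) (simp add: joint_model)
  finally show ?thesis by simp
qed

text \<open>Pairs for which the values of \<open>\<mu>\<close> and of the data are sums over the
  atoms of \<open>\<mu>\<close> and the points of \<open>S\<close>. They have probability one under
  both joint laws that are to be compared.\<close>

definition regular :: "('a set \<Rightarrow> real) \<Rightarrow> (nat \<Rightarrow> 'a set \<Rightarrow> real) \<Rightarrow> bool" where
  "regular \<mu> z \<longleftrightarrow> atomic \<mu> \<and> (\<forall>j\<in>{1..m}. atomic (z j) \<and>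
     (\<forall>s. z j {s} = real_of_int \<lfloor>z j {s}\<rfloor> \<and> (z j {s} \<noteq> 0 \<longrightarrow> s \<in> S \<or> \<mu> {s} \<noteq> 0)))"

lemma regular_XX:
  assumes g: "good \<omega>" and at: "atomic \<mu>"
    and sup: "\<And>s. s \<notin> S \<Longrightarrow> zmark (XX \<omega>) s \<noteq> z0 \<Longrightarrow> \<mu> {s} \<noteq> 0"
  shows "regular \<mu> (XX \<omega>)"
  unfolding regular_def
proof (intro conjI ballI allI impI at)
  fix j s assume j: "j \<in> {1..m}"
  show "atomic (XX \<omega> j)" using goodD(5)[OF g j] j by (simp add: XX_def)
  show int: "XX \<omega> j {s} = real_of_int \<lfloor>XX \<omega> j {s}\<rfloor>"
  proof (cases "s \<in> (\<lambda>k. \<psi> k \<omega>) ` idx \<omega>")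
    case True
    then obtain k where k: "k \<in> idx \<omega>" "s = \<psi> k \<omega>" by auto
    show ?thesis using goodD(6)[OF g j k(1)] j by (simp add: XX_def k(2))
  next
    case False
    then have "X j \<omega> {s} = 0" using goodD(7)[OF g j, of s] unfolding goodD(3)[OF g] by blast
    then show ?thesis using j by (simp add: XX_def)
  qed
  assume nz: "XX \<omega> j {s} \<noteq> 0"
  have "zmark (XX \<omega>) s \<noteq> z0"
  proof
    assume "zmark (XX \<omega>) s = z0"
    then have "zmark (XX \<omega>) s ! (j - 1) = z0 ! (j - 1)" by simp
    moreover have "j - 1 < m" "Suc (j - 1) = j" using j by auto
    ultimately have "\<lfloor>XX \<omega> j {s}\<rfloor> = 0" by (simp add: zmark_def z0_def del: upt_Suc)
    then show False using nz int by simp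
  qed
  then show "s \<in> S \<or> \<mu> {s} \<noteq> 0" using sup by blast
qed

text \<open>A component of the data is a sum over the same atoms, with an entry of the mark in place
  of the weight; the index is \<open>j - 1\<close> because list positions start at 0.\<close>

lemma regular_eval:
  assumes r: "regular \<mu> z" and B: "B \<in> bounded_borel"
  shows "\<mu> B = enn2real (joint (\<lambda>s y v. indicator B s * ennreal y) \<mu> z) - enn2real (joint (\<lambda>s y v. indicator B s * ennreal (- y)) \<mu> z)"
    and "j \<in> {1..m} \<Longrightarrow> z j B = enn2real (joint (\<lambda>s y v. indicator B s * ennreal (real_of_int (v ! (j - 1)))) \<mu> z)
      - enn2real (joint (\<lambda>s y v. indicator B s * ennreal (- real_of_int (v ! (j - 1)))) \<mu> z)"
proof -
  have at: "atomic \<mu>" using r by (simp add: regular_def)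
  have *: "joint (\<lambda>s y v. f s y) \<mu> z = atom_sum f \<mu>" if "\<And>s. f s 0 = 0" for f
    unfolding joint_atomic[OF at] atom_sum_UNIV using that
    by (subst nn_integral_count_space_indicator) (auto intro!: nn_integral_cong simp: indicator_def)
  show "\<mu> B = enn2real (joint (\<lambda>s y v. indicator B s * ennreal y) \<mu> z) - enn2real (joint (\<lambda>s y v. indicator B s * ennreal (- y)) \<mu> z)"
    using atomic_eval(1)[OF at B] by (simp add: *)
  assume j: "j \<in> {1..m}"
  have atj: "atomic (z j)" and int: "real_of_int \<lfloor>z j {s}\<rfloor> = z j {s}" and sup: "z j {s} \<noteq> 0 \<Longrightarrow> s \<in> S \<or> \<mu> {s} \<noteq> 0" for s
    using r j unfolding regular_def by metis+
  have nth: "zmark z s ! (j - 1) = \<lfloor>z j {s}\<rfloor>" for s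
    using j by (auto simp: zmark_def simp del: upt_Suc)
  have **: "joint (\<lambda>s y v. f s (real_of_int (v ! (j - 1)))) \<mu> z = atom_sum f (z j)" if "\<And>s. f s 0 = 0" for f
    unfolding joint_atomic[OF at] atom_sum_UNIV nth int using that sup
    by (subst nn_integral_count_space_indicator) (auto intro!: nn_integral_cong simp: indicator_def)
  show "z j B = enn2real (joint (\<lambda>s y v. indicator B s * ennreal (real_of_int (v ! (j - 1)))) \<mu> z)
      - enn2real (joint (\<lambda>s y v. indicator B s * ennreal (- real_of_int (v ! (j - 1)))) \<mu> z)"
    using atomic_eval(1)[OF atj B] **[of "\<lambda>s y. indicator B s * ennreal y"] **[of "\<lambda>s y. indicator B s * ennreal (- y)"] by simp
qed

section \<open>Equality of the joint laws\<close>

lemma loc_sum_add: "loc_sum (\<lambda>s y. f s y + g s y) \<mu> = loc_sum f \<mu> + loc_sum g \<mu>"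
  unfolding loc_sum_fresh by (rule nn_integral_add) auto

lemma joint_add: "joint (\<lambda>s y v. l s y v + l' s y v) \<mu> z = joint l \<mu> z + joint l' \<mu> z"
proof -
  have "(\<lambda>s y. if s \<in> S then 0 else l s y (zmark z s) + l' s y (zmark z s))
    = (\<lambda>s y. (if s \<in> S then 0 else l s y (zmark z s)) + (if s \<in> S then 0 else l' s y (zmark z s)))" by (intro ext) auto
  then show ?thesis unfolding joint_def by (simp add: loc_sum_add sum.distrib add_ac)
qed

lemma joint_0: "joint (\<lambda>s y v. 0) \<mu> z = 0"
  by (simp add: joint_def loc_sum_fresh)

text \<open>The functions \<open>en (joint l \<mu> z)\<close> are closed under products and
  integrate alike by \<open>total_laplace\<close>. It remains to see that their completed
  sigma-algebra is large enough to contain that of the product space.\<close>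

lemma joint_law_eq:
  defines "W \<equiv> (signed_measures :: ('a set \<Rightarrow> real) measure) \<Otimes>\<^sub>M D"
  shows "distr M W (\<lambda>\<omega>. (\<Theta> \<omega>, XX \<omega>))
    = distr (M \<Otimes>\<^sub>M L) W (\<lambda>p. (T (XX (fst p)) (fst (snd p)) (snd (snd p)), XX (fst p)))" (is "?\<mu>1 = ?\<mu>2")
proof -
  interpret L: prob_space L by (rule prob_L)
  interpret PP: pair_prob_space M "L" ..
  have f1 [measurable]: "(\<lambda>\<omega>. (\<Theta> \<omega>, XX \<omega>)) \<in> M \<rightarrow>\<^sub>M W" unfolding W_def by measurable
  have Tm: "(\<lambda>p. T (XX (fst p)) (fst (snd p)) (snd (snd p))) \<in> M \<Otimes>\<^sub>M L \<rightarrow>\<^sub>M signed_measures"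
    by (rule T_measurable) measurable
  have XXm: "(\<lambda>p. XX (fst p)) \<in> M \<Otimes>\<^sub>M L \<rightarrow>\<^sub>M D" by measurable
  have f2 [measurable]: "(\<lambda>p. (T (XX (fst p)) (fst (snd p)) (snd (snd p)), XX (fst p))) \<in> M \<Otimes>\<^sub>M L \<rightarrow>\<^sub>M W"
    unfolding W_def by (intro measurable_Pair Tm XXm)
  have fstW: "fst \<in> W \<rightarrow>\<^sub>M signed_measures" and sndW: "snd \<in> W \<rightarrow>\<^sub>M D" unfolding W_def by measurable
  interpret m1: prob_space ?\<mu>1 by (rule prob_space_distr[OF f1])
  interpret m2: prob_space ?\<mu>2 by (rule PP.prob_space_distr[OF f2])
  define \<F> where "\<F> = {(\<lambda>q. en (joint l (fst q) (snd q))) | l. lmeas l}"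
  define Y where "Y l q = joint l (fst q) (snd q)" for l and q :: "('a set \<Rightarrow> real) \<times> (nat \<Rightarrow> 'a set \<Rightarrow> real)"
  have Ym: "Y l \<in> borel_measurable W" if "lmeas l" for l
    unfolding Y_def by (rule joint_measurable[OF that fstW sndW])
  have FW: "f \<in> borel_measurable W" if fF: "f \<in> \<F>" for f
  proof -
    obtain l where l: "lmeas l" "f = (\<lambda>q. en (Y l q))" using fF unfolding \<F>_def Y_def by blast
    show ?thesis unfolding l(2) by (rule measurable_compose[OF Ym[OF l(1)] en_measurable])
  qed
  let ?Ms = "{?\<mu>1, ?\<mu>2}"
  let ?A = "ae_sigma ?Ms W \<F>"
  have spMs: "\<And>N. N \<in> ?Ms \<Longrightarrow> space N = space W" by auto
  have YA: "Y l \<in> borel_measurable ?A" if "lmeas l" for l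
  proof -
    have "(\<lambda>q. en (Y l q)) \<in> borel_measurable ?A"
      by (rule measurable_ae_sigma[OF spMs FW]) (use that in \<open>auto simp: \<F>_def Y_def\<close>)
    from measurable_compose[OF this lneg_measurable] show ?thesis by (simp add: lneg_en)
  qed
  \<comment> \<open>An identity on regular pairs holds almost surely under both laws. For the second
    law, the new locations of the data are atoms of the candidate because their weights are
    nonzero.\<close>
  have aeMs: "AE q in N. P q = P' q"
    if N: "N \<in> ?Ms" and P: "P \<in> borel_measurable W" "P' \<in> borel_measurable W"
      and reg: "\<And>\<mu> z. regular \<mu> z \<Longrightarrow> P (\<mu>, z) = P' (\<mu>, z)" for N and P P' :: "_ \<Rightarrow> real"
  proof -
    have set: "{q \<in> space W. P q = P' q} \<in> sets W" using P by measurable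
    have "AE q in ?\<mu>1. P q = P' q"
    proof (subst AE_distr_iff[OF f1 set])
      show "AE \<omega> in M. P (\<Theta> \<omega>, XX \<omega>) = P' (\<Theta> \<omega>, XX \<omega>)"
        using AE_good
      proof eventually_elim
        case (elim \<omega>)
        show ?case
        proof (rule reg, rule regular_XX[OF elim goodD(1)[OF elim]])
          fix s assume "s \<notin> S" "zmark (XX \<omega>) s \<noteq> z0"
          then show "\<Theta> \<omega> {s} \<noteq> 0" using zmark_XX_nonatom[OF elim, of s] goodD(3)[OF elim] by blast
        qed
      qed
    qed
    moreover have "AE q in ?\<mu>2. P q = P' q"
    proof (subst AE_distr_iff[OF f2 set], rule PP.AE_pair_measure)
      have [measurable]: "(\<lambda>p. P (T (XX (fst p)) (fst (snd p)) (snd (snd p)), XX (fst p))) \<in> borel_measurable (M \<Otimes>\<^sub>M L)"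
        "(\<lambda>p. P' (T (XX (fst p)) (fst (snd p)) (snd (snd p)), XX (fst p))) \<in> borel_measurable (M \<Otimes>\<^sub>M L)"
        using measurable_compose[OF f2 P(1)] measurable_compose[OF f2 P(2)] by simp_all
      show "{p \<in> space (M \<Otimes>\<^sub>M L). P (T (XX (fst p)) (fst (snd p)) (snd (snd p)), XX (fst p))
          = P' (T (XX (fst p)) (fst (snd p)) (snd (snd p)), XX (fst p))} \<in> sets (M \<Otimes>\<^sub>M L)" by measurable
      show "AE \<omega> in M. AE p in L. P (T (XX (fst (\<omega>, p))) (fst (snd (\<omega>, p))) (snd (snd (\<omega>, p))), XX (fst (\<omega>, p)))
          = P' (T (XX (fst (\<omega>, p))) (fst (snd (\<omega>, p))) (snd (snd (\<omega>, p))), XX (fst (\<omega>, p)))"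
        using AE_good AE_finite_new
      proof eventually_elim
        case (elim \<omega>)
        note zgood_z = zgood_XX[OF elim]
        show ?case
          using AE_nice[of "XX \<omega>"]
        proof eventually_elim
          case ni: (elim p)
          have "regular (T (XX \<omega>) (fst p) (snd p)) (XX \<omega>)"
          proof (rule regular_XX[OF elim(1) nice_T(4)[OF zgood_z ni]])
            fix s assume s: "s \<notin> S" "zmark (XX \<omega>) s \<noteq> z0"
            then obtain n where n: "n \<in> V (XX \<omega>)" "s = E (XX \<omega>) n" using zgood_z by (auto simp: zgood_def)
            then have "\<not> n < ns" using s(1) E_fixed by auto
            then show "T (XX \<omega>) (fst p) (snd p) {s} \<noteq> 0"
              using ni n nice_T(5)[OF zgood_z ni n(1)] by (simp add: nice_def)
          qed
          from reg[OF this] show ?case by simp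
        qed
      qed
    qed
    ultimately show ?thesis using N by auto
  qed
  have lm1: "lmeas (\<lambda>s y v. indicator B s * ennreal (c y v))" if [measurable]: "B \<in> sets borel" and c: "\<And>v. (\<lambda>y. c y v) \<in> borel_measurable borel"
    for B :: "'a set" and c
    unfolding lmeas_def split_beta'
  proof
    fix v
    have [measurable]: "(\<lambda>x :: 'a \<times> real. c (snd x) v) \<in> borel_measurable (borel \<Otimes>\<^sub>M borel)"
      by (rule measurable_compose[OF measurable_snd c])
    show "(\<lambda>x :: 'a \<times> real. indicator B (fst x) * ennreal (c (snd x) v)) \<in> borel_measurable (borel \<Otimes>\<^sub>M borel)" by measurable
  qed
  \<comment> \<open>Evaluations are almost surely differences of two sums over atoms, and these sums
    are recovered from the test functions through \<open>lneg\<close>. The same works for the data,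
    where the mark supplies the weight.\<close>
  have fstA: "fst \<in> ?A \<rightarrow>\<^sub>M signed_measures"
  proof (rule measurable_signed_measuresI)
    show "fst q \<in> space signed_measures" if "q \<in> space ?A" for q
      using that measurable_space[OF fstW] by simp
    fix B :: "'a set" assume B: "B \<in> bounded_borel"
    note Bb [measurable] = bounded_borelD[OF B]
    have l: "lmeas (\<lambda>s y v. indicator B s * ennreal y)" "lmeas (\<lambda>s y v. indicator B s * ennreal (- y))"
      by (rule lm1[OF Bb], measurable)+
    show "(\<lambda>q. fst q B) \<in> borel_measurable ?A"
    proof (rule measurable_ae_sigma_cong[OF spMs])
      show "(\<lambda>q. fst q B) \<in> borel_measurable W" by (rule eval_measurable'[OF fstW B])
      show "(\<lambda>q. enn2real (Y (\<lambda>s y v. indicator B s * ennreal y) q) - enn2real (Y (\<lambda>s y v. indicator B s * ennreal (- y)) q)) \<in> borel_measurable ?A"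
        by (intro borel_measurable_diff borel_measurable_enn2real YA l)
      show "AE q in N. fst q B = enn2real (Y (\<lambda>s y v. indicator B s * ennreal y) q) - enn2real (Y (\<lambda>s y v. indicator B s * ennreal (- y)) q)"
        if "N \<in> ?Ms" for N
        by (rule aeMs[OF that eval_measurable'[OF fstW B]])
           (intro borel_measurable_diff borel_measurable_enn2real Ym l, simp only: Y_def fst_conv snd_conv regular_eval(1)[OF _ B])
    qed
  qed
  have sndA: "snd \<in> ?A \<rightarrow>\<^sub>M D"
  proof -
    have comp: "(\<lambda>q. snd q j) \<in> ?A \<rightarrow>\<^sub>M signed_measures" if j: "j \<in> {1..m}" for j
    proof (rule measurable_signed_measuresI)
      have zj: "(\<lambda>q. snd q j) \<in> W \<rightarrow>\<^sub>M signed_measures" by (rule measurable_compose[OF sndW z_component[OF j]])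
      show "snd q j \<in> space signed_measures" if "q \<in> space ?A" for q
        using that measurable_space[OF zj] by simp
      fix B :: "'a set" assume B: "B \<in> bounded_borel"
      note Bb [measurable] = bounded_borelD[OF B]
      have l: "lmeas (\<lambda>s y v. indicator B s * ennreal (real_of_int (v ! (j - 1))))" "lmeas (\<lambda>s y v. indicator B s * ennreal (- real_of_int (v ! (j - 1))))"
        by (rule lm1[OF Bb], measurable)+
      show "(\<lambda>q. snd q j B) \<in> borel_measurable ?A"
      proof (rule measurable_ae_sigma_cong[OF spMs])
        show "(\<lambda>q. snd q j B) \<in> borel_measurable W" by (rule eval_measurable'[OF zj B])
        show "(\<lambda>q. enn2real (Y (\<lambda>s y v. indicator B s * ennreal (real_of_int (v ! (j - 1)))) q)
          - enn2real (Y (\<lambda>s y v. indicator B s * ennreal (- real_of_int (v ! (j - 1)))) q)) \<in> borel_measurable ?A"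
          by (intro borel_measurable_diff borel_measurable_enn2real YA l)
        show "AE q in N. snd q j B = enn2real (Y (\<lambda>s y v. indicator B s * ennreal (real_of_int (v ! (j - 1)))) q)
          - enn2real (Y (\<lambda>s y v. indicator B s * ennreal (- real_of_int (v ! (j - 1)))) q)"
          if "N \<in> ?Ms" for N
          by (rule aeMs[OF that eval_measurable'[OF zj B]])
             (intro borel_measurable_diff borel_measurable_enn2real Ym l, simp only: Y_def fst_conv snd_conv regular_eval(2)[OF _ B j])
      qed
    qed
    have "(\<lambda>q j. snd q j) \<in> ?A \<rightarrow>\<^sub>M D"
      using measurable_space[OF sndW] by (intro measurable_PiM_single' comp) (auto simp: space_PiM)
    then show ?thesis by simp
  qed
  have "(\<lambda>q. (fst q, snd q)) \<in> ?A \<rightarrow>\<^sub>M signed_measures \<Otimes>\<^sub>M D" by (intro measurable_Pair fstA sndA)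
  \<comment> \<open>So every measurable set of the product space lies in the completed
    sigma-algebra.\<close>
  then have idA: "(\<lambda>q. q) \<in> ?A \<rightarrow>\<^sub>M W" by (simp add: W_def)
  show ?thesis
  proof (rule measure_eqI)
    fix A assume "A \<in> sets ?\<mu>1"
    then have A: "A \<in> sets W" by simp
    have "(\<lambda>q. q) -` A \<inter> space ?A \<in> sets ?A" by (rule measurable_sets[OF idA A])
    then have A': "A \<in> sets ?A" using sets.sets_into_space[OF A] by (simp add: Int_absorb2)
    show "emeasure ?\<mu>1 A = emeasure ?\<mu>2 A"
    proof (rule emeasure_eq_on_ae_sigma[where \<F> = \<F> and R = W and Ms = ?Ms, OF m1.finite_measure_axioms m2.finite_measure_axioms])
      show "f \<in> borel_measurable ?\<mu>1" if fF: "f \<in> \<F>" for f using FW[OF fF] by simp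
      show "f q \<le> 1" if "f \<in> \<F>" for f q using that by (auto simp: \<F>_def)
      show "(\<lambda>q. f q * g q) \<in> \<F>" if fg: "f \<in> \<F>" "g \<in> \<F>" for f g
      proof -
        obtain l l' where l: "lmeas l" "f = (\<lambda>q. en (joint l (fst q) (snd q)))" "lmeas l'" "g = (\<lambda>q. en (joint l' (fst q) (snd q)))"
          using fg unfolding \<F>_def by blast
        have "lmeas (\<lambda>s y v. l s y v + l' s y v)" using l(1,3) unfolding lmeas_def split_beta' by (intro allI borel_measurable_add) blast+
        moreover have "(\<lambda>q. f q * g q) = (\<lambda>q. en (joint (\<lambda>s y v. l s y v + l' s y v) (fst q) (snd q)))"
          unfolding l joint_add en_add ..
        ultimately show ?thesis unfolding \<F>_def by blast
      qed
      have "lmeas (\<lambda>s y v. 0)" by (simp add: lmeas_def)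
      then show "(\<lambda>_. 1) \<in> \<F>" unfolding \<F>_def by (intro CollectI exI[of _ "\<lambda>s y v. 0"]) (simp add: joint_0)
      show "(\<integral>\<^sup>+q. f q \<partial>?\<mu>1) = (\<integral>\<^sup>+q. f q \<partial>?\<mu>2)" if fF: "f \<in> \<F>" for f
      proof -
        obtain l where l: "lmeas l" "f = (\<lambda>q. en (joint l (fst q) (snd q)))" using fF unfolding \<F>_def by blast
        have "(\<integral>\<^sup>+q. f q \<partial>?\<mu>2) = (\<integral>\<^sup>+p. f (T (XX (fst p)) (fst (snd p)) (snd (snd p)), XX (fst p)) \<partial>(M \<Otimes>\<^sub>M L))"
          by (rule nn_integral_distr[OF f2]) (simp add: FW[OF fF])
        also have "\<dots> = (\<integral>\<^sup>+\<omega>. \<integral>\<^sup>+p. f (T (XX \<omega>) (fst p) (snd p), XX \<omega>) \<partial>L \<partial>M)"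
          using measurable_compose[OF f2 FW[OF fF]] by (subst L.nn_integral_fst[symmetric]) simp_all
        also have "\<dots> = (\<integral>\<^sup>+\<omega>. f (\<Theta> \<omega>, XX \<omega>) \<partial>M)"
          unfolding l(2) fst_conv snd_conv by (rule total_laplace[OF l(1), symmetric])
        also have "\<dots> = (\<integral>\<^sup>+q. f q \<partial>?\<mu>1)" by (rule nn_integral_distr[OF f1, symmetric]) (simp add: FW[OF fF])
        finally show ?thesis by simp
      qed
    qed (use A' in auto)
  qed simp
qed

text \<open>The second form of the joint law draws the data first and the candidate afterwards, so
  Fubini's theorem disintegrates it.\<close>

lemma conditional_distribution_kernel: "conditional_distribution M D XX signed_measures \<Theta> kernel"
  unfolding conditional_distribution_def
proof (intro conjI ballI kernel_measurable)
  interpret L: prob_space L by (rule prob_L)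
  let ?W = "(signed_measures :: ('a set \<Rightarrow> real) measure) \<Otimes>\<^sub>M D"
  fix A B assume A: "A \<in> sets (signed_measures :: ('a set \<Rightarrow> real) measure)" and B: "B \<in> sets D"
  have AB: "A \<times> B \<in> sets ?W" using A B by auto
  have f1: "(\<lambda>\<omega>. (\<Theta> \<omega>, XX \<omega>)) \<in> M \<rightarrow>\<^sub>M ?W" by measurable
  have Tm: "(\<lambda>p. T (XX (fst p)) (fst (snd p)) (snd (snd p))) \<in> M \<Otimes>\<^sub>M L \<rightarrow>\<^sub>M signed_measures"
    by (rule T_measurable) measurable
  have f2: "(\<lambda>p. (T (XX (fst p)) (fst (snd p)) (snd (snd p)), XX (fst p))) \<in> M \<Otimes>\<^sub>M L \<rightarrow>\<^sub>M ?W"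
    by (intro measurable_Pair Tm) measurable
  have T_fst_snd_measurable: "(\<lambda>p. T z (fst p) (snd p)) \<in> L \<rightarrow>\<^sub>M signed_measures" if "z \<in> space D" for z
    by (rule T_measurable) (use that in measurable)
  have "{\<omega>\<in>space M. \<Theta> \<omega> \<in> A \<and> XX \<omega> \<in> B} = (\<lambda>\<omega>. (\<Theta> \<omega>, XX \<omega>)) -` (A \<times> B) \<inter> space M" by auto
  then have "emeasure M {\<omega>\<in>space M. \<Theta> \<omega> \<in> A \<and> XX \<omega> \<in> B} = emeasure (distr M ?W (\<lambda>\<omega>. (\<Theta> \<omega>, XX \<omega>))) (A \<times> B)"
    using emeasure_distr[OF f1 AB] by simp
  also have "\<dots> = (\<integral>\<^sup>+q. indicator (A \<times> B) q \<partial>distr (M \<Otimes>\<^sub>M L) ?W (\<lambda>p. (T (XX (fst p)) (fst (snd p)) (snd (snd p)), XX (fst p))))"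
    unfolding joint_law_eq using AB by simp
  also have "\<dots> = (\<integral>\<^sup>+p. indicator (A \<times> B) (T (XX (fst p)) (fst (snd p)) (snd (snd p)), XX (fst p)) \<partial>(M \<Otimes>\<^sub>M L))"
    using AB by (intro nn_integral_distr[OF f2]) auto
  also have "\<dots> = (\<integral>\<^sup>+\<omega>. \<integral>\<^sup>+p. indicator (A \<times> B) (T (XX \<omega>) (fst p) (snd p), XX \<omega>) \<partial>L \<partial>M)"
    using measurable_compose[OF f2 borel_measurable_indicator[OF AB]]
    by (subst L.nn_integral_fst[symmetric]) simp_all
  also have "\<dots> = (\<integral>\<^sup>+\<omega>. indicator B (XX \<omega>) * emeasure (kernel (XX \<omega>)) A \<partial>M)"
  proof (rule nn_integral_cong)
    fix \<omega> assume "\<omega> \<in> space M"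
    then have z: "XX \<omega> \<in> space D" by (rule measurable_space[OF XX_measurable])
    have "emeasure (kernel (XX \<omega>)) A = (\<integral>\<^sup>+q. indicator A q \<partial>kernel (XX \<omega>))" using A by (simp add: kernel_def)
    also have "\<dots> = (\<integral>\<^sup>+p. indicator A (T (XX \<omega>) (fst p) (snd p)) \<partial>L)"
      unfolding kernel_def using A by (intro nn_integral_distr[OF T_fst_snd_measurable[OF z]]) auto
    finally have kA: "emeasure (kernel (XX \<omega>)) A = (\<integral>\<^sup>+p. indicator A (T (XX \<omega>) (fst p) (snd p)) \<partial>L)" .
    have im: "(\<lambda>p. indicator A (T (XX \<omega>) (fst p) (snd p)) :: ennreal) \<in> borel_measurable L"
      by (rule measurable_compose[OF T_fst_snd_measurable[OF z] borel_measurable_indicator[OF A]])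
    have "indicator B (XX \<omega>) * emeasure (kernel (XX \<omega>)) A = (\<integral>\<^sup>+p. indicator B (XX \<omega>) * indicator A (T (XX \<omega>) (fst p) (snd p)) \<partial>L)"
      unfolding kA by (rule nn_integral_cmult[OF im, symmetric])
    also have "\<dots> = (\<integral>\<^sup>+p. indicator (A \<times> B) (T (XX \<omega>) (fst p) (snd p), XX \<omega>) \<partial>L)"
      by (intro nn_integral_cong) (auto simp: indicator_def)
    finally show "(\<integral>\<^sup>+p. indicator (A \<times> B) (T (XX \<omega>) (fst p) (snd p), XX \<omega>) \<partial>L) = indicator B (XX \<omega>) * emeasure (kernel (XX \<omega>)) A" by simp
  qed
  finally show "emeasure M {\<omega>\<in>space M. \<Theta> \<omega> \<in> A \<and> XX \<omega> \<in> B} = (\<integral>\<^sup>+\<omega>. indicator B (XX \<omega>) * emeasure (kernel (XX \<omega>)) A \<partial>M)" .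
qed

end

text \<open>\<open>N\<close> is the Poisson law as a measure on \<open>ennreal\<close>. The
  functions \<open>en (t * x)\<close> are closed under products, and \<open>t = 1\<close> alone
  generates the Borel sets because \<open>lneg\<close> recovers \<open>x\<close>.\<close>

lemma poisson_law_of_laplace:
  assumes P: "prob_space P" and X: "X \<in> borel_measurable P" and q: "0 \<le> q"
    and laplace: "\<And>t. (\<integral>\<^sup>+\<eta>. en (t * X \<eta>) \<partial>P) = en ((1 - en t) * ennreal q)"
  shows "measure P {\<eta>\<in>space P. X \<eta> = of_nat n} = exp (- q) * q ^ n / fact n"
proof -
  interpret P: prob_space P by fact
  define w where "w n = ennreal (exp (- q) * q ^ n / fact n)" for n :: nat
  define N where "N = distr (density (count_space UNIV) w) borel (of_nat :: nat \<Rightarrow> ennreal)"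
  have Nint: "(\<integral>\<^sup>+x. f x \<partial>N) = (\<Sum>n. w n * f (of_nat n))" if "f \<in> borel_measurable borel" for f
    unfolding N_def using that
    by (subst nn_integral_distr) (auto simp: nn_integral_density nn_integral_count_space_nat)
  have N1: "emeasure N (space N) = 1"
    using Nint[of "\<lambda>_. 1"] sums_poisson_en[OF q, of 0] by (simp add: w_def)
  define \<F> where "\<F> = range (\<lambda>t x. en (t * x) :: ennreal)"
  have "{x :: ennreal. x = of_nat n} \<in> sets (fsigma (space (distr P borel X)) \<F>)"
  proof -
    have "(\<lambda>x. en (1 * x)) \<in> borel_measurable (fsigma UNIV \<F>)" by (rule measurable_fsigma, unfold \<F>_def, rule rangeI[of "\<lambda>t x. en (t * x)" 1])
    then have "(\<lambda>x. lneg (en (1 * x))) \<in> borel_measurable (fsigma UNIV \<F>)" by (rule measurable_compose[OF _ lneg_measurable])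
    then have "(\<lambda>x. x) \<in> borel_measurable (fsigma UNIV \<F>)" by (simp add: lneg_en)
    then have "{x \<in> space (fsigma UNIV \<F>). x = of_nat n} \<in> sets (fsigma UNIV \<F>)" by measurable
    then show ?thesis by simp
  qed
  moreover have "prob_space (distr P borel X)" by (rule P.prob_space_distr[OF X])
  moreover have "prob_space N" using N1 by (rule prob_spaceI)
  ultimately have "emeasure (distr P borel X) {x. x = of_nat n} = emeasure N {x. x = of_nat n}"
  proof (intro emeasure_eq_on_fsigma[where \<F> = \<F>])
    show "(\<integral>\<^sup>+x. f x \<partial>distr P borel X) = (\<integral>\<^sup>+x. f x \<partial>N)" if fF: "f \<in> \<F>" for f
    proof -
      obtain t where f: "f = (\<lambda>x. en (t * x))" using fF by (auto simp: \<F>_def)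
      have weight_measurable: "f \<in> borel_measurable borel" unfolding f by measurable
      have "(\<integral>\<^sup>+x. f x \<partial>N) = (\<Sum>n. en t ^ n * w n)"
        unfolding Nint[OF weight_measurable] unfolding f by (simp only: mult.commute[of t] en_power mult.commute[of "w _"])
      also have "\<dots> = (\<integral>\<^sup>+\<eta>. f (X \<eta>) \<partial>P)" unfolding f laplace w_def by (rule sums_poisson_en[OF q])
      also have "\<dots> = (\<integral>\<^sup>+x. f x \<partial>distr P borel X)" by (rule nn_integral_distr[OF X, symmetric]) (simp add: weight_measurable)
      finally show ?thesis by simp
    qed
    show "(\<lambda>x. f x * g x) \<in> \<F>" if "f \<in> \<F>" "g \<in> \<F>" for f g
      using that by (auto simp: \<F>_def en_add[symmetric] distrib_right[symmetric])
    show "(\<lambda>_. 1) \<in> \<F>" unfolding \<F>_def by (intro image_eqI[of _ _ 0]) auto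
    show "f \<in> borel_measurable (distr P borel X)" if "f \<in> \<F>" for f
      using that by (auto simp: \<F>_def)
  qed (auto simp: \<F>_def N_def prob_space.finite_measure)
  also have "emeasure N {x. x = of_nat n} = (\<integral>\<^sup>+x. indicator {of_nat n} x \<partial>N)"
    by (subst nn_integral_indicator) (auto simp: N_def)
  also have "\<dots> = (\<Sum>k. w k * indicator {n} k)"
    by (subst Nint) (auto simp: indicator_def)
  also have "\<dots> = (\<integral>\<^sup>+k. w k * indicator {n} k \<partial>count_space UNIV)" by (simp add: nn_integral_count_space_nat)
  also have "\<dots> = w n" by (subst nn_integral_indicator_singleton) auto
  also have "emeasure (distr P borel X) {x. x = of_nat n} = emeasure P {\<eta>\<in>space P. X \<eta> = of_nat n}"
    using X by (subst emeasure_distr) (auto intro!: arg_cong[where f = "emeasure P"])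
  finally show ?thesis using q by (simp add: w_def P.emeasure_eq_measure)
qed

section \<open>The posterior distribution\<close>

text \<open>Fixes one outcome outside the null sets collected so far and an arbitrary random measure
  on another probability space with the kernel as its law. Nothing else is known about that
  space.\<close>

locale posterior = model M \<Theta> S \<nu> G K \<theta> \<psi> h m x X + P: prob_space P
  for M :: "'w measure" and \<Theta> :: "'w \<Rightarrow> 'a::polish_space set \<Rightarrow> real" and S \<nu> G K \<theta> \<psi> h m x X
    and P :: "'p measure" +
  fixes \<Theta>' :: "'p \<Rightarrow> 'a set \<Rightarrow> real" and \<omega> :: 'w
  assumes \<Theta>' [measurable]: "\<Theta>' \<in> P \<rightarrow>\<^sub>M signed_measures"
    and law: "distr P signed_measures \<Theta>' = kernel (XX \<omega>)"
    and \<omega>: "\<omega> \<in> space M" "good \<omega>" "finite {k\<in>idx \<omega>. \<psi> k \<omega> \<notin> S \<and> mark k \<omega> \<noteq> z0}"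
    and charged: "\<And>k. k \<in> idx \<omega> \<Longrightarrow> \<psi> k \<omega> \<notin> S \<Longrightarrow> C (mark k \<omega>) \<noteq> 0"
      "\<And>k. k \<in> idx \<omega> \<Longrightarrow> \<psi> k \<omega> \<in> S \<Longrightarrow> cS (\<psi> k \<omega>) (mark k \<omega>) \<noteq> 0"
begin

abbreviation "z \<equiv> XX \<omega>"

definition S' :: "'a set" where "S' = S \<union> {s. s \<notin> S \<and> zmark z s \<noteq> z0}"

definition law_at :: "'a \<Rightarrow> real measure" where
  "law_at s = (if s \<in> S then Qfix s (zmark z s) else Qnew (zmark z s))"

definition \<nu>' :: "real measure" where "\<nu>' = density \<nu> (H z0)"

abbreviation "F' \<equiv> G \<Otimes>\<^sub>M \<nu>'"

text \<open>With \<open>f s 0 = 0\<close>, sums over atoms do not notice listed locations whose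
  weight happens to be zero.\<close>

definition weight_measurable :: "('a \<Rightarrow> real \<Rightarrow> ennreal) \<Rightarrow> bool" where
  "weight_measurable f \<longleftrightarrow> (\<lambda>(s, y). f s y) \<in> borel_measurable (borel \<Otimes>\<^sub>M borel) \<and> (\<forall>s. f s 0 = 0)"

lemma zgood_z: "zgood z"
  by (rule zgood_XX[OF \<omega>(2,3)])

lemma finite_V: "finite (V z)"
  using zgood_z by (simp add: zgood_def)

lemma image_E: "E z ` V z = S'"
proof -
  have "E z ` V z = E z ` {..<ns} \<union> E z ` {n\<in>V z. \<not> n < ns}" by (subst V_split) (simp add: image_Un)
  also have "E z ` {..<ns} = S" using bij_slist[of z] by (simp add: bij_betw_def)
  finally show ?thesis by (simp add: S'_def E_XX_new[OF \<omega>(2)])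
qed

lemma finite_S': "finite S'"
  unfolding image_E[symmetric] using finite_V by simp

lemma S'_borel [measurable]: "S' \<in> sets borel"
  using finite_S' by (intro borel_closed finite_imp_closed)

lemma Q_law_at: "n \<in> V z \<Longrightarrow> Q (n, zmark z (E z n)) = law_at (E z n)"
  using E_fixed[of n z] E_new[of n z] by (cases "n < ns") (auto simp: Q_def law_at_def E_def)

lemma prob_law_at: "prob_space (law_at s)"
  by (simp add: law_at_def prob_Qfix prob_Qnew)

lemma sets_law_at [measurable_cong, simp]: "sets (law_at s) = sets borel"
  by (simp add: law_at_def)

lemma z_space: "z \<in> space D"
  by (rule measurable_space[OF XX_measurable \<omega>(1)])

lemma T_fst_snd_measurable: "(\<lambda>p. T z (fst p) (snd p)) \<in> L \<rightarrow>\<^sub>M signed_measures"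
  by (rule T_measurable) (use z_space in measurable)

lemma sets_\<nu>': "sets \<nu>' = sets nonzero_reals"
  using nu(1) by (simp add: \<nu>'_def)

lemma sigma_finite_\<nu>': "sigma_finite_measure \<nu>'"
proof -
  interpret \<nu>: sigma_finite_measure \<nu> by (rule nu(2))
  show ?thesis unfolding \<nu>'_def
    by (subst \<nu>.sigma_finite_iff_density_finite) (auto intro: le_less_trans[OF H_le_1] simp: ennreal_one_less_top H_z0)
qed

lemma sets_F': "sets F' = sets (borel \<Otimes>\<^sub>M nonzero_reals)"
  by (rule sets_pair_measure_cong[OF G(1) sets_\<nu>'])

lemma sets_F'_F: "sets F' = sets (G \<Otimes>\<^sub>M \<nu>)"
  using sets_F' sets_F by simp

lemma nn_integral_F':
  assumes f: "f \<in> borel_measurable (G \<Otimes>\<^sub>M \<nu>)"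
  shows "(\<integral>\<^sup>+p. f p \<partial>F') = (\<integral>\<^sup>+p. H z0 (snd p) * f p \<partial>(G \<Otimes>\<^sub>M \<nu>))"
proof -
  interpret \<nu>': sigma_finite_measure \<nu>' by (rule sigma_finite_\<nu>')
  have f': "f \<in> borel_measurable F'" using f by (simp add: measurable_cong_sets[OF sets_F'_F refl])
  have fy: "(\<lambda>y. f (s, y)) \<in> borel_measurable \<nu>" if "s \<in> space G" for s
    by (rule measurable_compose[OF measurable_Pair1'[OF that] f])
  have "(\<integral>\<^sup>+p. f p \<partial>F') = (\<integral>\<^sup>+s. \<integral>\<^sup>+y. f (s, y) \<partial>\<nu>' \<partial>G)" by (rule \<nu>'.nn_integral_fst[OF f', symmetric])
  also have "\<dots> = (\<integral>\<^sup>+s. \<integral>\<^sup>+y. H z0 y * f (s, y) \<partial>\<nu> \<partial>G)"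
    unfolding \<nu>'_def by (intro nn_integral_cong nn_integral_density fy H_nu)
  also have "\<dots> = (\<integral>\<^sup>+p. H z0 (snd p) * f p \<partial>(G \<Otimes>\<^sub>M \<nu>))"
    using f measurable_compose[OF snd_F H_measurable[of z0]] by (subst nn_integral_F) auto
  finally show ?thesis .
qed

lemma weight_measurable_F: "weight_measurable f \<Longrightarrow> (\<lambda>p. f (fst p) (snd p)) \<in> borel_measurable (G \<Otimes>\<^sub>M \<nu>)"
proof -
  assume "weight_measurable f"
  then have f: "(\<lambda>(s, y). f s y) \<in> borel_measurable (borel \<Otimes>\<^sub>M borel)" by (simp add: weight_measurable_def)
  have "(\<lambda>p. (fst p, snd p)) \<in> G \<Otimes>\<^sub>M \<nu> \<rightarrow>\<^sub>M borel \<Otimes>\<^sub>M borel" by (intro measurable_Pair fst_F snd_F)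
  from measurable_compose[OF this f] show ?thesis by simp
qed

lemma loc_sum_meas:
  assumes "weight_measurable f"
  shows "(\<lambda>\<mu>. loc_sum f \<mu>) \<in> borel_measurable signed_measures"
proof (rule loc_sum_measurable)
  have "(\<lambda>(s, y). f s y) \<in> borel_measurable (borel \<Otimes>\<^sub>M borel)" using assms by (simp add: weight_measurable_def)
  from measurable_compose[OF measurable_snd this]
  show "(\<lambda>(x, s, y). f s y) \<in> borel_measurable (signed_measures \<Otimes>\<^sub>M borel \<Otimes>\<^sub>M borel)" by (simp add: split_beta')
qed simp

text \<open>Transfers \<open>laplace_T\<close> along the law, with test functions that ignore marks.
  In the exponent only the mark \<open>z0\<close> survives, and its probability \<open>H z0\<close>
  becomes the density of \<open>\<nu>'\<close>.\<close>

lemma laplace':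
  assumes f: "weight_measurable f"
  shows "(\<integral>\<^sup>+\<eta>. en (loc_sum f (\<Theta>' \<eta>)) \<partial>P)
    = (\<Prod>s\<in>S'. \<integral>\<^sup>+y. en (f s y) \<partial>law_at s) * en (\<integral>\<^sup>+p. (1 - en (f (fst p) (snd p))) \<partial>F')"
proof -
  let ?l = "\<lambda>s y v :: int list. f s y"
  have l: "lmeas ?l" using f by (simp add: weight_measurable_def lmeas_def)
  have em: "(\<lambda>\<mu>. en (loc_sum f \<mu>)) \<in> borel_measurable signed_measures"
    by (rule measurable_compose[OF loc_sum_meas[OF f] en_measurable])
  have "(\<integral>\<^sup>+\<eta>. en (loc_sum f (\<Theta>' \<eta>)) \<partial>P) = (\<integral>\<^sup>+\<mu>. en (loc_sum f \<mu>) \<partial>distr P signed_measures \<Theta>')"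
    using em by (subst nn_integral_distr) auto
  also have "\<dots> = (\<integral>\<^sup>+p. en (loc_sum f (T z (fst p) (snd p))) \<partial>L)"
    unfolding law kernel_def using em by (intro nn_integral_distr[OF T_fst_snd_measurable]) simp
  also have "\<dots> = (\<integral>\<^sup>+p. en (joint ?l (T z (fst p) (snd p)) z) \<partial>L)"
  proof (rule nn_integral_cong_AE)
    show "AE p in L. en (loc_sum f (T z (fst p) (snd p))) = en (joint ?l (T z (fst p) (snd p)) z)"
      using AE_nice[of z]
    proof eventually_elim
      case (elim p)
      note at = nice_T(4)[OF zgood_z elim]
      have "joint ?l (T z (fst p) (snd p)) z = atom_sum f (T z (fst p) (snd p))"
        unfolding joint_atomic[OF at] atom_sum_UNIV using f
        by (subst nn_integral_count_space_indicator) (auto intro!: nn_integral_cong simp: indicator_def weight_measurable_def)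
      then show ?case by (simp add: loc_sum_eq_atom_sum[OF at])
    qed
  qed
  also have "\<dots> = (\<Prod>n\<in>V z. \<integral>\<^sup>+y. en (f (E z n) y) \<partial>Q (n, zmark z (E z n)))
      * en (Phi (\<lambda>s y v. if s \<in> S \<or> v \<noteq> z0 then 0 else f s y))"
    by (rule laplace_T[OF zgood_z l])
  also have "(\<Prod>n\<in>V z. \<integral>\<^sup>+y. en (f (E z n) y) \<partial>Q (n, zmark z (E z n))) = (\<Prod>s\<in>S'. \<integral>\<^sup>+y. en (f s y) \<partial>law_at s)"
    unfolding image_E[symmetric] by (simp add: prod.reindex[OF inj_E] Q_law_at)
  also have "Phi (\<lambda>s y v. if s \<in> S \<or> v \<noteq> z0 then 0 else f s y)
      = (\<integral>\<^sup>+p. H z0 (snd p) * (1 - en (f (fst p) (snd p))) \<partial>(G \<Otimes>\<^sub>M \<nu>))"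
  proof (rule nn_integral_cong_AE)
    show "AE p in G \<Otimes>\<^sub>M \<nu>. expect_mark (\<lambda>s y v. 1 - en (if s \<in> S \<or> v \<noteq> z0 then 0 else f s y)) (fst p) (snd p)
        = H z0 (snd p) * (1 - en (f (fst p) (snd p)))"
      using AE_F_not_S
    proof eventually_elim
      case (elim p)
      have "expect_mark (\<lambda>s y v. 1 - en (if s \<in> S \<or> v \<noteq> z0 then 0 else f s y)) (fst p) (snd p)
        = (\<integral>\<^sup>+v. (H z0 (snd p) * (1 - en (f (fst p) (snd p)))) * indicator {z0} v \<partial>count_space UNIV)"
        unfolding expect_mark_def using elim by (intro nn_integral_cong) (auto simp: indicator_def)
      also have "\<dots> = H z0 (snd p) * (1 - en (f (fst p) (snd p)))"
        by (subst nn_integral_cmult_indicator) auto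
      finally show ?case .
    qed
  qed
  also have "\<dots> = (\<integral>\<^sup>+p. (1 - en (f (fst p) (snd p))) \<partial>F')"
    using measurable_compose[OF weight_measurable_F[OF f] en_measurable] by (intro nn_integral_F'[symmetric] borel_measurable_minus_ennreal) auto
  finally show ?thesis .
qed

lemma AE_atomic: "AE \<eta> in P. atomic (\<Theta>' \<eta>)"
proof -
  have set: "{\<mu> \<in> space (signed_measures :: ('a set \<Rightarrow> real) measure). atomic \<mu>} \<in> sets signed_measures" by measurable
  have "AE p in L. atomic (T z (fst p) (snd p))"
    using AE_nice[of z] by eventually_elim (rule nice_T(4)[OF zgood_z])
  then have "AE \<mu> in kernel z. atomic \<mu>" unfolding kernel_def by (subst AE_distr_iff[OF T_fst_snd_measurable set])
  then show ?thesis unfolding law[symmetric] by (subst (asm) AE_distr_iff[OF \<Theta>' set])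
qed

text \<open>
  The functions of the atoms \<open>(s, \<Theta>' \<eta> {s})\<close> lying in \<open>A\<close>. Independence of the atoms in disjoint
  sets is read off the Laplace functional on products of such functions.
\<close>

definition \<F> :: "('a \<times> real) set \<Rightarrow> ('p \<Rightarrow> ennreal) set" where
  "\<F> A = {(\<lambda>\<eta>. en (loc_sum f (\<Theta>' \<eta>))) | f. weight_measurable f \<and> (\<forall>s y. (s, y) \<notin> A \<longrightarrow> f s y = 0)}"

abbreviation "sig A \<equiv> ae_sigma {P} P (\<F> A)"

lemma \<F>_meas: "u \<in> \<F> A \<Longrightarrow> u \<in> borel_measurable P"
  unfolding \<F>_def by (auto intro!: measurable_compose[OF \<Theta>'] measurable_compose[OF loc_sum_meas en_measurable])

lemma weight_measurable_add: "weight_measurable f \<Longrightarrow> weight_measurable g \<Longrightarrow> weight_measurable (\<lambda>s y. f s y + g s y)"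
  unfolding weight_measurable_def split_beta' by (auto intro: borel_measurable_add)

lemma weight_measurable_sum: "finite I \<Longrightarrow> (\<And>i. i \<in> I \<Longrightarrow> weight_measurable (g i)) \<Longrightarrow> weight_measurable (\<lambda>s y. \<Sum>i\<in>I. g i s y)"
  by (induction I rule: finite_induct) (auto simp: weight_measurable_add weight_measurable_def[of "\<lambda>s y. 0"])

lemma loc_sum_sum: "finite I \<Longrightarrow> loc_sum (\<lambda>s y. \<Sum>i\<in>I. g i s y) \<mu> = (\<Sum>i\<in>I. loc_sum (g i) \<mu>)"
  by (induction I rule: finite_induct) (simp_all add: loc_sum_add, simp add: loc_sum_fresh)

text \<open>On disjoint sets the exponents of the ordinary part add. A fixed location contributes a
  single integral; by the condition \<open>fiber\<close> at most one of the sets meets the line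
  above it, so this integral belongs to one factor.\<close>

lemma indep_sig:
  assumes disj: "\<And>i j. i \<in> I \<Longrightarrow> j \<in> I \<Longrightarrow> i \<noteq> j \<Longrightarrow> A i \<inter> A j = {}"
    and fiber: "\<And>s i j y y'. s \<in> S' \<Longrightarrow> i \<in> I \<Longrightarrow> j \<in> I \<Longrightarrow> (s, y) \<in> A i \<Longrightarrow> (s, y') \<in> A j \<Longrightarrow> i = j"
  shows "P.indep_sets (\<lambda>i. sets (sig (A i))) I"
proof (rule P.indep_sets_ae_sigma)
  show "u \<in> borel_measurable P" if "u \<in> \<F> (A i)" for i u using \<F>_meas[OF that] .
  show "u \<eta> \<le> 1" if "u \<in> \<F> (A i)" for i u \<eta> using that by (auto simp: \<F>_def)
  show "(\<lambda>_. 1) \<in> \<F> (A i)" for i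
    unfolding \<F>_def by (intro CollectI exI[of _ "\<lambda>s y. 0"]) (simp add: weight_measurable_def loc_sum_fresh)
  show "(\<lambda>\<eta>. u \<eta> * w \<eta>) \<in> \<F> (A i)" if uw: "u \<in> \<F> (A i)" "w \<in> \<F> (A i)" for i u w
  proof -
    obtain f g where f: "u = (\<lambda>\<eta>. en (loc_sum f (\<Theta>' \<eta>)))" "weight_measurable f" "\<forall>s y. (s, y) \<notin> A i \<longrightarrow> f s y = 0"
      and g: "w = (\<lambda>\<eta>. en (loc_sum g (\<Theta>' \<eta>)))" "weight_measurable g" "\<forall>s y. (s, y) \<notin> A i \<longrightarrow> g s y = 0"
      using uw unfolding \<F>_def by blast
    have "(\<lambda>\<eta>. u \<eta> * w \<eta>) = (\<lambda>\<eta>. en (loc_sum (\<lambda>s y. f s y + g s y) (\<Theta>' \<eta>)))"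
      unfolding f(1) g(1) loc_sum_add en_add ..
    then show ?thesis unfolding \<F>_def using f g weight_measurable_add[of f g] by (intro CollectI exI[of _ "\<lambda>s y. f s y + g s y"]) auto
  qed
  fix J u assume J: "finite J" "J \<subseteq> I" and u: "\<And>i. i \<in> J \<Longrightarrow> u i \<in> \<F> (A i)"
  have "\<forall>i\<in>J. \<exists>f. u i = (\<lambda>\<eta>. en (loc_sum f (\<Theta>' \<eta>))) \<and> weight_measurable f \<and> (\<forall>s y. (s, y) \<notin> A i \<longrightarrow> f s y = 0)"
    using u unfolding \<F>_def by blast
  then obtain g where g: "\<And>i. i \<in> J \<Longrightarrow> u i = (\<lambda>\<eta>. en (loc_sum (g i) (\<Theta>' \<eta>)))" "\<And>i. i \<in> J \<Longrightarrow> weight_measurable (g i)"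
    "\<And>i s y. i \<in> J \<Longrightarrow> (s, y) \<notin> A i \<Longrightarrow> g i s y = 0"
    by metis
  let ?g = "\<lambda>s y. \<Sum>i\<in>J. g i s y"
  have gfm: "weight_measurable ?g" using J(1) g(2) by (rule weight_measurable_sum)
  have fib: "(\<integral>\<^sup>+y. en (?g s y) \<partial>law_at s) = (\<Prod>i\<in>J. \<integral>\<^sup>+y. en (g i s y) \<partial>law_at s)" if s: "s \<in> S'" for s
  proof -
    interpret Ls: prob_space "law_at s" by (rule prob_law_at)
    show ?thesis
    proof (cases "\<exists>i\<in>J. \<exists>y. g i s y \<noteq> 0")
      case True
      then obtain i y where i: "i \<in> J" "g i s y \<noteq> 0" by blast
      have 0: "g j s y' = 0" if j: "j \<in> J" "j \<noteq> i" for j y'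
      proof (rule ccontr)
        assume "g j s y' \<noteq> 0"
        then have "(s, y') \<in> A j" "(s, y) \<in> A i" using g(3) i j by blast+
        then show False using fiber[OF s, of i j y y'] i j J(2) by blast
      qed
      have "?g s y' = g i s y'" for y'
        using J(1) i(1) 0 by (subst sum.remove[of _ i]) (auto intro!: sum.neutral)
      moreover have "(\<Prod>j\<in>J. \<integral>\<^sup>+y. en (g j s y) \<partial>law_at s) = (\<integral>\<^sup>+y. en (g i s y) \<partial>law_at s)"
        using J(1) i(1) by (subst prod.remove[of _ i]) (auto intro!: prod.neutral simp: 0 Ls.emeasure_space_1)
      ultimately show ?thesis by simp
    next
      case False
      then show ?thesis by (simp add: Ls.emeasure_space_1)
    qed
  qed
  have pt: "1 - en (?g s y) = (\<Sum>i\<in>J. 1 - en (g i s y))" for s y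
  proof (cases "\<exists>i\<in>J. g i s y \<noteq> 0")
    case True
    then obtain i where i: "i \<in> J" "g i s y \<noteq> 0" by blast
    have 0: "g j s y = 0" if j: "j \<in> J" "j \<noteq> i" for j
      using g(3) i j disj[of i j] J(2) by blast
    have "?g s y = g i s y" using J(1) i(1) 0 by (subst sum.remove[of _ i]) (auto intro!: sum.neutral)
    moreover have "(\<Sum>i\<in>J. 1 - en (g i s y)) = 1 - en (g i s y)"
      using J(1) i(1) by (subst sum.remove[of _ i]) (auto intro!: sum.neutral simp: 0)
    ultimately show ?thesis by simp
  qed simp
  have ord: "(\<integral>\<^sup>+p. (1 - en (?g (fst p) (snd p))) \<partial>F') = (\<Sum>i\<in>J. \<integral>\<^sup>+p. (1 - en (g i (fst p) (snd p))) \<partial>F')"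
    unfolding pt
  proof (rule nn_integral_sum)
    fix i assume "i \<in> J"
    from measurable_compose[OF weight_measurable_F[OF g(2)[OF this]] en_measurable]
    show "(\<lambda>p. 1 - en (g i (fst p) (snd p))) \<in> borel_measurable F'"
      unfolding measurable_cong_sets[OF sets_F'_F refl] by (intro borel_measurable_minus_ennreal) auto
  qed
  have "(\<integral>\<^sup>+\<eta>. (\<Prod>i\<in>J. u i \<eta>) \<partial>P) = (\<integral>\<^sup>+\<eta>. en (loc_sum ?g (\<Theta>' \<eta>)) \<partial>P)"
    by (intro nn_integral_cong) (simp add: loc_sum_sum J(1) en_sum g(1))
  also have "\<dots> = (\<Prod>s\<in>S'. \<Prod>i\<in>J. \<integral>\<^sup>+y. en (g i s y) \<partial>law_at s) * (\<Prod>i\<in>J. en (\<integral>\<^sup>+p. (1 - en (g i (fst p) (snd p))) \<partial>F'))"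
    unfolding laplace'[OF gfm] ord by (intro arg_cong2[where f = "(*)"] prod.cong fib en_sum[OF J(1)] refl)
  also have "\<dots> = (\<Prod>i\<in>J. (\<Prod>s\<in>S'. \<integral>\<^sup>+y. en (g i s y) \<partial>law_at s) * en (\<integral>\<^sup>+p. (1 - en (g i (fst p) (snd p))) \<partial>F'))"
    by (subst prod.swap) (simp add: prod.distrib)
  also have "\<dots> = (\<Prod>i\<in>J. \<integral>\<^sup>+\<eta>. u i \<eta> \<partial>P)"
    by (intro prod.cong refl) (simp add: laplace'[OF g(2)] g(1))
  finally show "(\<integral>\<^sup>+\<eta>. (\<Prod>i\<in>J. u i \<eta>) \<partial>P) = (\<Prod>i\<in>J. \<integral>\<^sup>+\<eta>. u i \<eta> \<partial>P)" .
qed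

lemma indep_vars_sig:
  assumes ind: "P.indep_sets (\<lambda>i. sets (sig (A i))) I"
    and Y: "\<And>i. i \<in> I \<Longrightarrow> Y i \<in> sig (A i) \<rightarrow>\<^sub>M borel" "\<And>i. i \<in> I \<Longrightarrow> Y i \<in> P \<rightarrow>\<^sub>M borel"
  shows "P.indep_vars (\<lambda>_. borel) Y I"
  unfolding P.indep_vars_def2
proof (intro conjI ballI)
  show "P.indep_sets (\<lambda>i. {Y i -` B \<inter> space P | B. B \<in> sets borel}) I"
  proof (rule P.indep_sets_mono_sets[OF ind])
    fix i assume "i \<in> I"
    from measurable_sets[OF Y(1)[OF this]]
    show "{Y i -` B \<inter> space P | B. B \<in> sets borel} \<subseteq> sets (sig (A i))" by auto
  qed
qed (rule Y(2))

lemma sig_loc_sum: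
  assumes f: "weight_measurable f" "\<And>s y. (s, y) \<notin> A \<Longrightarrow> f s y = 0"
  shows "(\<lambda>\<eta>. loc_sum f (\<Theta>' \<eta>)) \<in> borel_measurable (sig A)"
proof -
  have "(\<lambda>\<eta>. en (loc_sum f (\<Theta>' \<eta>))) \<in> borel_measurable (sig A)"
  proof (rule measurable_ae_sigma)
    show "(\<lambda>\<eta>. en (loc_sum f (\<Theta>' \<eta>))) \<in> \<F> A" unfolding \<F>_def using f by blast
  qed (auto intro: \<F>_meas)
  from measurable_compose[OF this lneg_measurable] show ?thesis by (simp add: lneg_en)
qed

text \<open>Here the completion enters: the value at \<open>B\<close> is a difference of sums over
  atoms only almost surely.\<close>

lemma sig_eval:
  assumes B: "B \<in> bounded_borel" and A: "B \<times> - {0} \<subseteq> A"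
  shows "(\<lambda>\<eta>. \<Theta>' \<eta> B) \<in> borel_measurable (sig A)"
proof -
  note [measurable] = bounded_borelD[OF B]
  let ?p = "\<lambda>s y. indicator B s * ennreal y" and ?n = "\<lambda>s y. indicator B s * ennreal (- y)"
  have f: "weight_measurable ?p" "weight_measurable ?n" unfolding weight_measurable_def split_beta' by auto
  have 0: "?p s y = 0" "?n s y = 0" if "(s, y) \<notin> A" for s y using that A by (cases "y = 0"; auto simp: indicator_def)+
  show ?thesis
  proof (rule measurable_ae_sigma_cong)
    show "(\<lambda>\<eta>. \<Theta>' \<eta> B) \<in> borel_measurable P" by (rule eval_measurable'[OF \<Theta>' B])
    show "(\<lambda>\<eta>. enn2real (loc_sum ?p (\<Theta>' \<eta>)) - enn2real (loc_sum ?n (\<Theta>' \<eta>))) \<in> borel_measurable (sig A)"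
      by (intro borel_measurable_diff borel_measurable_enn2real sig_loc_sum f 0)
    show "AE \<eta> in N. \<Theta>' \<eta> B = enn2real (loc_sum ?p (\<Theta>' \<eta>)) - enn2real (loc_sum ?n (\<Theta>' \<eta>))" if "N \<in> {P}" for N
    proof -
      have N: "N = P" using that by simp
      show ?thesis unfolding N using AE_atomic
        by eventually_elim (simp add: loc_sum_eq_atom_sum atomic_eval(1)[OF _ B])
    qed
  qed auto
qed

lemma posterior_completely_random: "completely_random P \<Theta>'"
  unfolding completely_random_def
proof (intro conjI allI impI \<Theta>')
  fix A :: "nat \<Rightarrow> 'a set" assume A: "range A \<subseteq> bounded_borel \<and> disjoint_family A"
  then have Ab: "A i \<in> bounded_borel" for i by auto
  have dj: "s \<in> A i \<Longrightarrow> s \<in> A j \<Longrightarrow> i = j" for s i j using A by (auto simp: disjoint_family_on_def)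
  show "P.indep_vars (\<lambda>_. borel) (\<lambda>i \<eta>. \<Theta>' \<eta> (A i)) UNIV"
  proof (rule indep_vars_sig[where A = "\<lambda>i. A i \<times> - {0}"])
    show "P.indep_sets (\<lambda>i. sets (sig (A i \<times> - {0}))) UNIV"
      by (rule indep_sig) (use dj in auto)
    show "(\<lambda>\<eta>. \<Theta>' \<eta> (A i)) \<in> borel_measurable (sig (A i \<times> - {0}))" for i by (rule sig_eval[OF Ab order_refl])
    show "(\<lambda>\<eta>. \<Theta>' \<eta> (A i)) \<in> borel_measurable P" for i by (rule eval_measurable'[OF \<Theta>' Ab])
  qed
qed

end

lemma sets_borel_pair_nonzero:
  assumes A: "A \<in> sets (borel \<Otimes>\<^sub>M nonzero_reals)"
  shows "A \<in> sets (borel \<Otimes>\<^sub>M borel)" "A \<subseteq> UNIV \<times> - {0}"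
proof -
  show sub: "A \<subseteq> UNIV \<times> - {0}" using sets.sets_into_space[OF A] by (simp add: space_pair_measure)
  \<comment> \<open>The map moves weight 0 to 1 and is therefore measurable into the nonzero reals.
    Where the weight is nonzero it is the identity, so \<open>A\<close> is its preimage
    there.\<close>
  let ?g = "\<lambda>p :: 'a \<times> real. (fst p, if snd p = 0 then 1 else snd p)"
  have "(\<lambda>p :: 'a \<times> real. if snd p = 0 then 1 else snd p) \<in> borel \<Otimes>\<^sub>M borel \<rightarrow>\<^sub>M nonzero_reals"
    by (rule measurable_restrict_space2) auto
  then have "?g \<in> borel \<Otimes>\<^sub>M borel \<rightarrow>\<^sub>M borel \<Otimes>\<^sub>M nonzero_reals" by (intro measurable_Pair) auto
  from measurable_sets[OF this A] have "?g -` A \<inter> space (borel \<Otimes>\<^sub>M borel) \<in> sets (borel \<Otimes>\<^sub>M borel)" .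
  moreover have "{p \<in> space (borel \<Otimes>\<^sub>M borel). snd p \<noteq> (0::real)} \<in> sets (borel \<Otimes>\<^sub>M borel :: ('a \<times> real) measure)" by measurable
  ultimately have "(?g -` A \<inter> space (borel \<Otimes>\<^sub>M borel)) \<inter> {p \<in> space (borel \<Otimes>\<^sub>M borel). snd p \<noteq> 0} \<in> sets (borel \<Otimes>\<^sub>M borel)" by (rule sets.Int)
  moreover have "(?g -` A \<inter> space (borel \<Otimes>\<^sub>M borel)) \<inter> {p \<in> space (borel \<Otimes>\<^sub>M borel). snd p \<noteq> 0} = A"
    using sub by (auto simp: space_pair_measure)
  ultimately show "A \<in> sets (borel \<Otimes>\<^sub>M borel)" by simp
qed

lemma sets_vimage_algebra_subset:
  assumes "f \<in> W \<rightarrow>\<^sub>M N" "space W = B"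
  shows "sets (vimage_algebra B f N) \<subseteq> sets W"
  unfolding sets_vimage_algebra assms(2)[symmetric] using measurable_sets[OF assms(1)] by (intro sets.sigma_sets_subset) auto

lemma (in model) S_new:
  assumes g: "good \<omega>"
  shows "(\<Union>j\<in>{1..m}. {\<psi> k \<omega> | k. enat k < K \<omega> \<and> x j k \<omega> \<noteq> 0}) - S = {s. s \<notin> S \<and> zmark (XX \<omega>) s \<noteq> z0}"
proof -
  have z: "z0 ! (j - 1) = 0" if "j \<in> {1..m}" for j using that by (auto simp: z0_def)
  have "length z0 = m" by (simp add: z0_def)
  from mark_eq_iff[OF this] have "mark k \<omega> \<noteq> z0 \<longleftrightarrow> (\<exists>j\<in>{1..m}. x j k \<omega> \<noteq> 0)" for k
    by (metis z)
  then show ?thesis unfolding new_atoms_XX[OF g] by blast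
qed

section \<open>The ordinary component of the posterior\<close>

context posterior
begin

text \<open>The Poisson process that the representation asks for on \<open>P\<close>, built from the
  random measure itself: the points \<open>(s, \<Theta>' \<eta> {s})\<close> at its atoms outside
  \<open>S'\<close>.\<close>

definition Np :: "'p \<Rightarrow> ('a \<times> real) measure" where
  "Np \<eta> = distr (count_space {k. fresh (\<Theta>' \<eta>) k \<and> loc (\<Theta>' \<eta>) k \<notin> S'}) (borel \<Otimes>\<^sub>M nonzero_reals)
     (\<lambda>k. (loc (\<Theta>' \<eta>) k, \<Theta>' \<eta> {loc (\<Theta>' \<eta>) k}))"

lemma Np_map: "(\<lambda>k. (loc (\<Theta>' \<eta>) k, \<Theta>' \<eta> {loc (\<Theta>' \<eta>) k}))
    \<in> count_space {k. fresh (\<Theta>' \<eta>) k \<and> loc (\<Theta>' \<eta>) k \<notin> S'} \<rightarrow>\<^sub>M borel \<Otimes>\<^sub>M nonzero_reals"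
  by (auto simp: measurable_count_space_eq1 space_pair_measure fresh_def)

definition ordinary_indicator :: "('a \<times> real) set \<Rightarrow> 'a \<Rightarrow> real \<Rightarrow> ennreal" where
  "ordinary_indicator A s y = indicator (A \<inter> ((- S') \<times> UNIV)) (s, y)"

lemma weight_measurable_ordinary:
  assumes "A \<in> sets F'"
  shows "weight_measurable (\<lambda>s y. t * ordinary_indicator A s y)" "weight_measurable (ordinary_indicator A)"
proof -
  have A: "A \<in> sets (borel \<Otimes>\<^sub>M borel)" "A \<subseteq> UNIV \<times> - {0}"
    using assms sets_borel_pair_nonzero[of A] unfolding sets_F' by auto
  have "(- S') \<times> UNIV \<in> sets (borel \<Otimes>\<^sub>M (borel :: real measure))"
    by (intro pair_measureI) auto
  then have [measurable]: "A \<inter> ((- S') \<times> UNIV) \<in> sets (borel \<Otimes>\<^sub>M borel)" using A(1) by auto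
  have 0: "ordinary_indicator A s 0 = 0" for s using A(2) by (auto simp: ordinary_indicator_def indicator_def)
  show "weight_measurable (\<lambda>s y. t * ordinary_indicator A s y)" "weight_measurable (ordinary_indicator A)"
    unfolding weight_measurable_def using 0 by (auto simp: ordinary_indicator_def split_beta')
qed

lemma emeasure_Np:
  assumes A: "A \<in> sets F'"
  shows "emeasure (Np \<eta>) A = loc_sum (ordinary_indicator A) (\<Theta>' \<eta>)"
proof -
  have A': "A \<in> sets (borel \<Otimes>\<^sub>M nonzero_reals)" using A by (simp only: sets_F')
  have "emeasure (Np \<eta>) A = (\<integral>\<^sup>+p. indicator A p \<partial>Np \<eta>)" using A' by (simp add: Np_def)
  also have "\<dots> = (\<integral>\<^sup>+k. indicator A (loc (\<Theta>' \<eta>) k, \<Theta>' \<eta> {loc (\<Theta>' \<eta>) k})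
      \<partial>count_space {k. fresh (\<Theta>' \<eta>) k \<and> loc (\<Theta>' \<eta>) k \<notin> S'})"
    unfolding Np_def using A' by (intro nn_integral_distr[OF Np_map]) auto
  also have "\<dots> = (\<integral>\<^sup>+k. ordinary_indicator A (loc (\<Theta>' \<eta>) k) (\<Theta>' \<eta> {loc (\<Theta>' \<eta>) k}) \<partial>count_space {k. fresh (\<Theta>' \<eta>) k})"
    by (subst (1 2) nn_integral_count_space_indicator)
       (auto intro!: nn_integral_cong simp: indicator_def ordinary_indicator_def)
  finally show ?thesis by (simp add: loc_sum_fresh)
qed

lemma AE_F'_not_S': "AE p in F'. fst p \<notin> S'"
proof (rule AE_I[where N = "S' \<times> space \<nu>'"])
  interpret \<nu>': sigma_finite_measure \<nu>' by (rule sigma_finite_\<nu>')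
  have S': "S' \<in> sets G" unfolding G(1) by (rule S'_borel)
  have "emeasure G S' = (\<Sum>s\<in>S'. emeasure G {s})"
    by (rule emeasure_eq_sum_singleton[OF finite_S']) (simp add: G(1))
  then have "emeasure G S' = 0" by (simp add: G(3))
  then show "emeasure F' (S' \<times> space \<nu>') = 0" using S' by (subst \<nu>'.emeasure_pair_measure_Times) auto
  show "S' \<times> space \<nu>' \<in> sets F'" using S' by auto
qed (auto simp: space_pair_measure)

lemma laplace_Np:
  assumes A: "A \<in> sets F'"
  shows "(\<integral>\<^sup>+\<eta>. en (t * emeasure (Np \<eta>) A) \<partial>P) = en ((1 - en t) * emeasure F' A)"
proof -
  have "(\<integral>\<^sup>+\<eta>. en (t * emeasure (Np \<eta>) A) \<partial>P) = (\<integral>\<^sup>+\<eta>. en (loc_sum (\<lambda>s y. t * ordinary_indicator A s y) (\<Theta>' \<eta>)) \<partial>P)"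
    unfolding emeasure_Np[OF A] loc_sum_fresh
    by (intro nn_integral_cong arg_cong[where f = en] nn_integral_cmult[symmetric]) auto
  also have "\<dots> = (\<Prod>s\<in>S'. \<integral>\<^sup>+y. en (t * ordinary_indicator A s y) \<partial>law_at s) * en (\<integral>\<^sup>+p. (1 - en (t * ordinary_indicator A (fst p) (snd p))) \<partial>F')"
    by (rule laplace'[OF weight_measurable_ordinary(1)[OF A]])
  also have "(\<Prod>s\<in>S'. \<integral>\<^sup>+y. en (t * ordinary_indicator A s y) \<partial>law_at s) = 1"
    using prob_space.emeasure_space_1[OF prob_law_at] by (intro prod.neutral) (simp add: ordinary_indicator_def)
  also have "(\<integral>\<^sup>+p. (1 - en (t * ordinary_indicator A (fst p) (snd p))) \<partial>F') = (\<integral>\<^sup>+p. (1 - en t) * indicator A p \<partial>F')"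
  proof (rule nn_integral_cong_AE)
    show "AE p in F'. 1 - en (t * ordinary_indicator A (fst p) (snd p)) = (1 - en t) * indicator A p"
      using AE_F'_not_S' by eventually_elim (auto simp: ordinary_indicator_def indicator_def)
  qed
  also have "\<dots> = (1 - en t) * emeasure F' A" using A by (rule nn_integral_cmult_indicator)
  finally show ?thesis by simp
qed

lemma Np_sig: "A \<in> sets F' \<Longrightarrow> (\<lambda>\<eta>. emeasure (Np \<eta>) A) \<in> borel_measurable (sig (A \<inter> ((- S') \<times> UNIV)))"
  unfolding emeasure_Np by (rule sig_loc_sum[OF weight_measurable_ordinary(2)]) (auto simp: ordinary_indicator_def)

lemma Np_measurable: "A \<in> sets F' \<Longrightarrow> (\<lambda>\<eta>. emeasure (Np \<eta>) A) \<in> borel_measurable P"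
  unfolding emeasure_Np by (rule measurable_compose[OF \<Theta>' loc_sum_meas[OF weight_measurable_ordinary(2)]])

lemma poisson_Np: "poisson_process P Np F'"
  unfolding poisson_process_def
proof (intro conjI ballI allI impI Np_measurable)
  fix \<eta> assume "\<eta> \<in> space P"
  show "sets (Np \<eta>) = sets F'" by (simp only: Np_def sets_distr sets_F')
next
  fix \<eta> A assume "\<eta> \<in> space P" and A: "A \<in> sets F'"
  have A': "A \<in> sets (borel \<Otimes>\<^sub>M nonzero_reals)" using A by (simp only: sets_F')
  show "emeasure (Np \<eta>) A \<in> insert \<infinity> (range of_nat)"
    unfolding Np_def emeasure_distr[OF Np_map A'] by (subst emeasure_count_space) auto
next
  fix A n assume A: "A \<in> sets F'" and fin: "emeasure F' A < \<infinity>"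
  show "measure P {\<eta>\<in>space P. emeasure (Np \<eta>) A = of_nat n} = exp (- measure F' A) * measure F' A ^ n / fact n"
  proof (rule poisson_law_of_laplace[OF P.prob_space_axioms Np_measurable[OF A]])
    show "(\<integral>\<^sup>+\<eta>. en (t * emeasure (Np \<eta>) A) \<partial>P) = en ((1 - en t) * ennreal (measure F' A))" for t
      using fin by (simp add: laplace_Np[OF A] emeasure_eq_ennreal_measure less_top)
  qed simp
next
  fix A assume A: "A \<in> sets F'" and inf: "emeasure F' A = \<infinity>"
  \<comment> \<open>With infinite intensity the Laplace transform at \<open>t = 1\<close> is
    \<open>en \<top> = 0\<close>, which forces an infinite count; for this the factor
    \<open>1 - en 1\<close> must not vanish.\<close>
  have "1 - en 1 \<noteq> 0" 
  proof
    assume "1 - en 1 = 0"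
    then have "1 \<le> en 1" by (simp add: diff_eq_0_iff_ennreal)
    then have "en 1 = 1" by (intro antisym en_le_1)
    then show False by simp
  qed
  then have "(\<integral>\<^sup>+\<eta>. en (emeasure (Np \<eta>) A) \<partial>P) = 0"
    using laplace_Np[OF A, of 1] inf by (simp add: ennreal_mult_top)
  then have "AE \<eta> in P. en (emeasure (Np \<eta>) A) = 0"
    using measurable_compose[OF Np_measurable[OF A] en_measurable] by (subst (asm) nn_integral_0_iff_AE)
  then show "AE \<eta> in P. emeasure (Np \<eta>) A = \<infinity>" by eventually_elim simp
next
  fix A :: "nat \<Rightarrow> ('a \<times> real) set" assume A: "range A \<subseteq> sets F' \<and> disjoint_family A"
  then have As: "A i \<in> sets F'" for i by auto
  show "P.indep_vars (\<lambda>_. borel) (\<lambda>i \<eta>. emeasure (Np \<eta>) (A i)) UNIV"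
  proof (rule indep_vars_sig[where A = "\<lambda>i. A i \<inter> ((- S') \<times> UNIV)"])
    show "P.indep_sets (\<lambda>i. sets (sig (A i \<inter> ((- S') \<times> UNIV)))) UNIV"
    proof (rule indep_sig)
      show "A i \<inter> ((- S') \<times> UNIV) \<inter> (A j \<inter> ((- S') \<times> UNIV)) = {}" if "i \<noteq> j" for i j
        using A that unfolding disjoint_family_on_def by blast
    qed auto
  qed (rule Np_sig[OF As] Np_measurable[OF As])+
qed

lemma levy_F': "levy_measure F'"
  unfolding levy_measure_def
proof (intro conjI ballI allI sets_F')
  fix B :: "'a set" assume B: "B \<in> bounded_borel"
  note [measurable] = bounded_borelD[OF B]
  let ?f = "\<lambda>p :: 'a \<times> real. case p of (s, y) \<Rightarrow> indicator B s * ennreal (min 1 \<bar>y\<bar>)"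
  have f: "?f \<in> borel_measurable (G \<Otimes>\<^sub>M \<nu>)" unfolding split_beta' by measurable
  have "(\<integral>\<^sup>+p. ?f p \<partial>F') = (\<integral>\<^sup>+p. H z0 (snd p) * ?f p \<partial>(G \<Otimes>\<^sub>M \<nu>))" by (rule nn_integral_F'[OF f])
  also have "\<dots> \<le> (\<integral>\<^sup>+p. ?f p \<partial>(G \<Otimes>\<^sub>M \<nu>))"
  proof (rule nn_integral_mono)
    fix p :: "'a \<times> real"
    show "H z0 (snd p) * ?f p \<le> ?f p" using mult_right_mono[OF H_le_1, of "?f p" z0 "snd p"] by simp
  qed
  also have "\<dots> < \<infinity>" using levy B by (simp add: levy_measure_def)
  finally show "(\<integral>\<^sup>+p. ?f p \<partial>F') < \<infinity>" .
next
  fix s :: 'a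
  interpret \<nu>': sigma_finite_measure \<nu>' by (rule sigma_finite_\<nu>')
  have "- {0} \<in> sets \<nu>'" unfolding sets_\<nu>' using sets.top[of nonzero_reals] by simp
  then show "emeasure F' ({s} \<times> - {0}) = 0" by (subst \<nu>'.emeasure_pair_measure_Times) (auto simp: G)
qed

text \<open>Removing the finitely many fixed atoms from the absolutely convergent sum over all atoms
  leaves a sum over the points of \<open>Np \<eta>\<close>.\<close>

lemma atomic_representation:
  assumes at: "atomic (\<Theta>' \<eta>)" and B: "B \<in> bounded_borel"
  shows "(\<lambda>s. \<Theta>' \<eta> {s}) summable_on (S' \<inter> B) \<and>
           integrable (Np \<eta>) (\<lambda>(s, y). indicator B s * y) \<and>
           \<Theta>' \<eta> B = (\<Sum>\<^sub>\<infinity>s\<in>S' \<inter> B. \<Theta>' \<eta> {s}) + 0 + (\<integral>(s, y). indicator B s * y \<partial>Np \<eta>)"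
proof -
  let ?\<mu> = "\<Theta>' \<eta>"
  let ?I = "{k. fresh ?\<mu> k \<and> loc ?\<mu> k \<notin> S'}" and ?W = "{s. ?\<mu> {s} \<noteq> 0 \<and> s \<notin> S'}"
  let ?g = "\<lambda>p :: 'a \<times> real. case p of (s, y) \<Rightarrow> indicator B s * y"
  define r where "r = ?\<mu> B - (\<Sum>\<^sub>\<infinity>s\<in>S' \<inter> B. ?\<mu> {s})"
  note [measurable] = bounded_borelD[OF B]
  have fin: "finite (S' \<inter> B)" using finite_S' by simp
  then have sm: "(\<lambda>s. ?\<mu> {s}) summable_on (S' \<inter> B)" by (rule summable_on_finite)
  have "((\<lambda>s. ?\<mu> {s}) has_sum ?\<mu> B) B" using at B by (simp add: atomic_def)
  from has_sum_Diff[OF this has_sum_infsum[OF sm]]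
  have "((\<lambda>s. ?\<mu> {s}) has_sum r) (B - S' \<inter> B)" by (simp add: r_def)
  also have "((\<lambda>s. ?\<mu> {s}) has_sum r) (B - S' \<inter> B) \<longleftrightarrow> ((\<lambda>s. indicator B s * ?\<mu> {s}) has_sum r) ?W"
    by (rule has_sum_cong_neutral) (auto simp: indicator_def)
  also have "\<dots> \<longleftrightarrow> ((\<lambda>k. indicator B (loc ?\<mu> k) * ?\<mu> {loc ?\<mu> k}) has_sum r) ?I"
  proof (rule has_sum_reindex_bij_betw[symmetric])
    have "loc ?\<mu> ` {k. fresh ?\<mu> k} = {s. ?\<mu> {s} \<noteq> 0}" "inj_on (loc ?\<mu>) {k. fresh ?\<mu> k}"
      using bij_betw_loc[OF at] by (auto simp: bij_betw_def)
    then show "bij_betw (loc ?\<mu>) ?I ?W" unfolding bij_betw_def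
      by (intro conjI) (auto intro: inj_on_subset)
  qed
  finally have int: "integrable (count_space ?I) (\<lambda>k. indicator B (loc ?\<mu> k) * ?\<mu> {loc ?\<mu> k})"
    "(\<integral>k. indicator B (loc ?\<mu> k) * ?\<mu> {loc ?\<mu> k} \<partial>count_space ?I) = r"
    unfolding has_sum_iff_integral by auto
  have g: "?g \<in> borel_measurable (borel \<Otimes>\<^sub>M nonzero_reals)"
  proof -
    have "(\<lambda>x. x) \<in> nonzero_reals \<rightarrow>\<^sub>M borel" by (rule measurable_restrict_space1) simp
    then have [measurable]: "snd \<in> borel \<Otimes>\<^sub>M nonzero_reals \<rightarrow>\<^sub>M borel" by (rule measurable_compose[OF measurable_snd])
    show ?thesis unfolding split_beta' by measurable
  qed
  have "integrable (Np \<eta>) ?g" unfolding Np_def integrable_distr_eq[OF Np_map g] using int(1) by simp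
  moreover have "(\<integral>p. ?g p \<partial>Np \<eta>) = r" unfolding Np_def integral_distr[OF Np_map g] using int(2) by simp
  ultimately show ?thesis using sm by (simp add: r_def)
qed

text \<open>Fixed weights and ordinary points are functions of the atoms over \<open>S'\<close> and
  off \<open>S'\<close>, and no fixed location lies in both regions.\<close>

lemma indep_fixed_Np:
  "P.indep_set
     (sets (vimage_algebra (space P) (\<lambda>\<eta>. \<lambda>s\<in>S'. \<Theta>' \<eta> {s}) (\<Pi>\<^sub>M s\<in>S'. borel)))
     (sets (vimage_algebra (space P) (\<lambda>\<eta>. \<lambda>A\<in>sets F'. emeasure (Np \<eta>) A) (\<Pi>\<^sub>M A\<in>sets F'. borel)))"
  (is "P.indep_set ?a ?b")
proof -
  let ?A = "case_bool (S' \<times> - {0}) ((- S') \<times> UNIV) :: bool \<Rightarrow> ('a \<times> real) set"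
  have ind: "P.indep_sets (\<lambda>i. sets (sig (?A i))) UNIV"
    by (rule indep_sig) (auto split: bool.splits)
  have a: "?a \<subseteq> sets (sig (S' \<times> - {0}))"
    by (intro sets_vimage_algebra_subset measurable_restrict sig_eval) auto
  have b: "?b \<subseteq> sets (sig ((- S') \<times> UNIV))"
  proof (intro sets_vimage_algebra_subset measurable_restrict)
    fix A assume A: "A \<in> sets F'"
    show "(\<lambda>\<eta>. emeasure (Np \<eta>) A) \<in> borel_measurable (sig ((- S') \<times> UNIV))"
      unfolding emeasure_Np[OF A] by (rule sig_loc_sum[OF weight_measurable_ordinary(2)[OF A]]) (auto simp: ordinary_indicator_def)
  qed simp
  show ?thesis unfolding P.indep_set_def
    by (rule P.indep_sets_mono_sets[OF ind]) (use a b in \<open>auto split: bool.splits\<close>)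
qed

lemma posterior_crsm: "crsm_representation P \<Theta>' S' (\<lambda>_. 0) F'"
  unfolding crsm_representation_def
proof (intro conjI exI[of _ Np] levy_F' poisson_Np indep_fixed_Np allI refl)
  show "countable S'" using finite_S' by (rule countable_finite)
  show "signed_measure (\<lambda>_ :: 'a set. 0)" by (simp add: signed_measure_def)
  show "P.indep_vars (\<lambda>_. borel) (\<lambda>s \<eta>. \<Theta>' \<eta> {s}) S'"
  proof (rule indep_vars_sig[where A = "\<lambda>s. {s} \<times> - {0}"])
    show "P.indep_sets (\<lambda>s. sets (sig ({s} \<times> - {0}))) S'" by (rule indep_sig) auto
    show "(\<lambda>\<eta>. \<Theta>' \<eta> {s}) \<in> borel_measurable (sig ({s} \<times> - {0}))" for s by (rule sig_eval) auto
    show "(\<lambda>\<eta>. \<Theta>' \<eta> {s}) \<in> borel_measurable P" for s by (rule eval_measurable'[OF \<Theta>']) simp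
  qed
  show "AE \<eta> in P. \<forall>B\<in>bounded_borel. (\<lambda>s. \<Theta>' \<eta> {s}) summable_on (S' \<inter> B) \<and>
           integrable (Np \<eta>) (\<lambda>(s, y). indicator B s * y) \<and>
           \<Theta>' \<eta> B = (\<Sum>\<^sub>\<infinity>s\<in>S' \<inter> B. \<Theta>' \<eta> {s}) + 0 + (\<integral>(s, y). indicator B s * y \<partial>Np \<eta>)"
    using AE_atomic by eventually_elim (intro ballI atomic_representation)
qed

text \<open>Read off the construction of the kernel: the mass of the candidate at a listed location
  is almost surely one coordinate of the product law \<open>R\<close>.\<close>

lemma distr_fixed:
  assumes s: "s \<in> S'"
  shows "distr P borel (\<lambda>\<eta>. \<Theta>' \<eta> {s}) = law_at s"
proof -
  obtain n where n: "n \<in> V z" "s = E z n" using s unfolding image_E[symmetric] by auto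
  let ?i = "(n, zmark z (E z n))"
  interpret R: prob_space R by (rule prob_R)
  have ev: "(\<lambda>\<mu>. \<mu> {s}) \<in> borel_measurable signed_measures" by (rule eval_measurable) simp
  have ci: "(\<lambda>r. r ?i) \<in> R \<rightarrow>\<^sub>M borel"
    using measurable_component_singleton[of ?i UNIV Q] by (simp add: measurable_cong_sets[OF refl sets_Q'])
  have "distr P borel (\<lambda>\<eta>. \<Theta>' \<eta> {s}) = distr (distr P signed_measures \<Theta>') borel (\<lambda>\<mu>. \<mu> {s})"
    by (subst distr_distr[OF ev \<Theta>']) (simp add: comp_def)
  also have "\<dots> = distr L borel (\<lambda>p. T z (fst p) (snd p) {s})"
    unfolding law kernel_def by (subst distr_distr[OF ev T_fst_snd_measurable]) (simp add: comp_def)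
  also have "\<dots> = distr L borel (\<lambda>p. fst p ?i)"
  proof (rule distr_cong_AE)
    show "AE p in L. T z (fst p) (snd p) {s} = fst p ?i"
      using AE_nice[of z] by eventually_elim (simp add: n(2) nice_T(5)[OF zgood_z _ n(1)])
    show "(\<lambda>p. T z (fst p) (snd p) {s}) \<in> borel_measurable L" by (rule measurable_compose[OF T_fst_snd_measurable ev])
    show "(\<lambda>p. fst p ?i) \<in> borel_measurable L" by (rule measurable_compose[OF measurable_fst ci])
  qed auto
  also have "\<dots> = distr (distr L R fst) borel (\<lambda>r. r ?i)"
    by (subst distr_distr[OF ci measurable_fst]) (simp add: comp_def)
  also have "distr L R fst = R"
  proof (rule measure_eqI)
    fix A assume "A \<in> sets (distr L R fst)"
    then have A: "A \<in> sets R" by simp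
    have "fst -` A \<inter> space L = A \<times> space M" using sets.sets_into_space[OF A] by (auto simp: space_pair_measure)
    then show "emeasure (distr L R fst) A = emeasure R A"
      using A by (subst emeasure_distr[OF measurable_fst A]) (simp add: emeasure_pair_measure_Times emeasure_space_1)
  qed simp
  also have "distr R borel (\<lambda>r. r ?i) = distr R (Q ?i) (\<lambda>r. r ?i)" by (rule distr_cong) simp_all
  also have "\<dots> = Q ?i" by (rule distr_PiM_component) (simp_all add: prob_Q)
  finally show ?thesis using Q_law_at[OF n(1)] n(2) by simp
qed

lemma H_zmark: "H (zmark z s) t = ennreal (\<Prod>j\<in>{1..m}. pmf (h t) \<lfloor>X j \<omega> {s}\<rfloor>)"
proof -
  have "length (zmark z s) = m" by (simp add: zmark_def)
  moreover have "zmark z s ! i = \<lfloor>X (Suc i) \<omega> {s}\<rfloor>" if "i < m" for i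
    using that by (simp add: zmark_def XX_def del: upt_Suc)
  ultimately show ?thesis by (simp add: H_prod prod.atLeast1_atMost_eq)
qed

lemma law_fixed:
  assumes s: "s \<in> S"
  shows "distr P borel (\<lambda>\<eta>. \<Theta>' \<eta> {s}) = proportional_law (distr M borel (\<lambda>\<omega>'. \<Theta> \<omega>' {s}))
    (\<lambda>t. \<Prod>j\<in>{1..m}. pmf (h t) \<lfloor>X j \<omega> {s}\<rfloor>)"
proof -
  have "s \<in> (\<lambda>k. \<psi> k \<omega>) ` idx \<omega>" using goodD(3)[OF \<omega>(2)] s by auto
  then obtain k where k: "k \<in> idx \<omega>" "s = \<psi> k \<omega>" by auto
  \<comment> \<open>The mark was observed at a charged outcome, so its probability is positive and
    \<open>Qfix\<close> is not the dummy law.\<close>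
  have c: "cS s (zmark z s) \<noteq> 0" using charged(2)[OF k(1)] k(2) s zmark_XX[OF \<omega>(2) k(1)] by simp
  have norm: "(\<integral>\<^sup>+u. H (zmark z s) u \<partial>distr M borel (\<lambda>\<omega>'. \<Theta> \<omega>' {s})) = cS s (zmark z s)"
    unfolding cS_def by (rule nn_integral_distr) measurable
  have "distr P borel (\<lambda>\<eta>. \<Theta>' \<eta> {s}) = Qfix s (zmark z s)" using s by (simp add: distr_fixed S'_def law_at_def)
  also have "\<dots> = distr (density (distr M borel (\<lambda>\<omega>'. \<Theta> \<omega>' {s})) (\<lambda>y. H (zmark z s) y / cS s (zmark z s))) borel (\<lambda>t. t)"
    using c by (simp add: Qfix_def zero_less_iff_neq_zero)
  finally show ?thesis unfolding proportional_law_def H_zmark[symmetric] norm .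
qed

lemma law_new:
  assumes s: "s \<notin> S" "zmark z s \<noteq> z0"
  shows "distr P borel (\<lambda>\<eta>. \<Theta>' \<eta> {s}) = proportional_law \<nu> (\<lambda>t. \<Prod>j\<in>{1..m}. pmf (h t) \<lfloor>X j \<omega> {s}\<rfloor>)"
proof -
  have "s \<in> (\<lambda>k. \<psi> k \<omega>) ` {k\<in>idx \<omega>. \<psi> k \<omega> \<notin> S \<and> mark k \<omega> \<noteq> z0}"
    unfolding new_atoms_XX[OF \<omega>(2), symmetric] using s by simp
  then obtain k where k: "k \<in> idx \<omega>" "s = \<psi> k \<omega>" by auto
  \<comment> \<open>An observed mark is charged, and \<open>C\<close> is finite at marks other than
    \<open>z0\<close>, so \<open>Qnew\<close> is not the dummy law.\<close>
  have c: "0 < C (zmark z s) \<and> C (zmark z s) < \<infinity>"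
    using charged(1)[OF k(1)] k(2) s zmark_XX[OF \<omega>(2) k(1)] C_finite[OF s(2)] by (simp add: zero_less_iff_neq_zero)
  have "distr P borel (\<lambda>\<eta>. \<Theta>' \<eta> {s}) = Qnew (zmark z s)" using s by (simp add: distr_fixed S'_def law_at_def)
  also have "\<dots> = distr (density \<nu> (\<lambda>y. H (zmark z s) y / C (zmark z s))) borel (\<lambda>t. t)"
    unfolding Qnew_def by (rule if_P[OF c])
  finally show ?thesis unfolding proportional_law_def C_def H_zmark .
qed

end

theorem proposition4p1:
  fixes M :: "'w measure"
    and \<Theta> :: "'w \<Rightarrow> 'a::polish_space set \<Rightarrow> real"
    and S\<^sub>f\<^sub>i\<^sub>x :: "'a set"
    and \<nu> :: "real measure" and G :: "'a measure"
    and K :: "'w \<Rightarrow> enat" and \<theta> :: "nat \<Rightarrow> 'w \<Rightarrow> real" and \<psi> :: "nat \<Rightarrow> 'w \<Rightarrow> 'a"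
    and h :: "real \<Rightarrow> int pmf" and m :: nat
    and x :: "nat \<Rightarrow> nat \<Rightarrow> 'w \<Rightarrow> int"
    and X :: "nat \<Rightarrow> 'w \<Rightarrow> 'a set \<Rightarrow> real"
  defines "D \<equiv> (\<Pi>\<^sub>M j\<in>{1..m}. signed_measures :: ('a set \<Rightarrow> real) measure)"
    and "XX \<equiv> (\<lambda>\<omega>. \<lambda>j\<in>{1..m}. X j \<omega>)"
    and "S\<^sub>n\<^sub>e\<^sub>w \<equiv> (\<lambda>\<omega>. (\<Union>j\<in>{1..m}. {\<psi> k \<omega> | k. enat k < K \<omega> \<and> x j k \<omega> \<noteq> 0}) - S\<^sub>f\<^sub>i\<^sub>x)"
    and "\<nu>\<^sub>p\<^sub>o\<^sub>s\<^sub>t \<equiv> density \<nu> (\<lambda>t. ennreal (pmf (h t) 0 ^ m))"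
  assumes "prob_space M"
    and h_measurable: "\<And>i. (\<lambda>t. pmf (h t) i) \<in> borel_measurable borel"
    and "m \<ge> 1"
    and nu: "sets \<nu> = sets nonzero_reals" "sigma_finite_measure \<nu>"
    and G: "sets G = sets borel" "prob_space G" "\<And>s. emeasure G {s} = 0"
    and crsm: "completely_random M \<Theta>"
    and A00: "crsm_representation M \<Theta> S\<^sub>f\<^sub>i\<^sub>x (\<lambda>_. 0) (G \<Otimes>\<^sub>M \<nu>)"
    and A0: "finite S\<^sub>f\<^sub>i\<^sub>x"
    and A1: "emeasure \<nu> (space \<nu>) = \<infinity>"
    and A2: "(\<Sum>\<^sub>\<infinity>i\<in>- {0}. \<integral>\<^sup>+ t. ennreal (pmf (h t) i) \<partial>\<nu>) < \<infinity>"
    and atoms: "atom_enumeration M \<Theta> S\<^sub>f\<^sub>i\<^sub>x K \<theta> \<psi>"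
    and weights: "likelihood_weights M K \<theta> \<psi> h m x"
    and X_measurable: "\<And>j. j \<in> {1..m} \<Longrightarrow> X j \<in> M \<rightarrow>\<^sub>M signed_measures"
    and X_atoms: "\<And>j. j \<in> {1..m} \<Longrightarrow>
      AE \<omega> in M. weighted_atoms (K \<omega>) (\<lambda>k. real_of_int (x j k \<omega>)) (\<lambda>k. \<psi> k \<omega>) (X j \<omega>)"
  shows "(\<exists>\<kappa>. conditional_distribution M D XX signed_measures \<Theta> \<kappa>) \<and>
    (\<forall>\<kappa>. conditional_distribution M D XX signed_measures \<Theta> \<kappa> \<longrightarrow>
      (AE \<omega> in M. finite (S\<^sub>n\<^sub>e\<^sub>w \<omega>) \<and>
        (\<forall>(P :: 'p measure) \<Theta>\<^sub>p\<^sub>o\<^sub>s\<^sub>t.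
          prob_space P \<and> \<Theta>\<^sub>p\<^sub>o\<^sub>s\<^sub>t \<in> P \<rightarrow>\<^sub>M signed_measures \<and>
          distr P signed_measures \<Theta>\<^sub>p\<^sub>o\<^sub>s\<^sub>t = \<kappa> (XX \<omega>) \<longrightarrow>
            completely_random P \<Theta>\<^sub>p\<^sub>o\<^sub>s\<^sub>t \<and>
            crsm_representation P \<Theta>\<^sub>p\<^sub>o\<^sub>s\<^sub>t (S\<^sub>f\<^sub>i\<^sub>x \<union> S\<^sub>n\<^sub>e\<^sub>w \<omega>) (\<lambda>_. 0) (G \<Otimes>\<^sub>M \<nu>\<^sub>p\<^sub>o\<^sub>s\<^sub>t) \<and>
            (\<forall>s\<in>S\<^sub>f\<^sub>i\<^sub>x. distr P borel (\<lambda>\<eta>. \<Theta>\<^sub>p\<^sub>o\<^sub>s\<^sub>t \<eta> {s}) =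
               proportional_law (distr M borel (\<lambda>\<omega>'. \<Theta> \<omega>' {s}))
                 (\<lambda>t. \<Prod>j\<in>{1..m}. pmf (h t) \<lfloor>X j \<omega> {s}\<rfloor>)) \<and>
            (\<forall>s\<in>S\<^sub>n\<^sub>e\<^sub>w \<omega>. distr P borel (\<lambda>\<eta>. \<Theta>\<^sub>p\<^sub>o\<^sub>s\<^sub>t \<eta> {s}) =
               proportional_law \<nu> (\<lambda>t. \<Prod>j\<in>{1..m}. pmf (h t) \<lfloor>X j \<omega> {s}\<rfloor>)))))"
proof -
  interpret model: model M \<Theta> "S\<^sub>f\<^sub>i\<^sub>x" \<nu> G K \<theta> \<psi> h m x X
    by (intro model.intro model_axioms.intro assms(5)) (fact assms)+
  have XX: "XX = model.XX" unfolding XX_def by (rule ext) (simp add: model.XX_def)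
  have \<kappa>0: "conditional_distribution M D XX signed_measures \<Theta> model.kernel"
    unfolding D_def XX by (rule model.conditional_distribution_kernel)
  show ?thesis
  proof (intro conjI allI impI)
    show "\<exists>\<kappa>. conditional_distribution M D XX signed_measures \<Theta> \<kappa>" using \<kappa>0 by blast
  next
    fix \<kappa> assume \<kappa>: "conditional_distribution M D XX signed_measures \<Theta> \<kappa>"
    obtain E where E: "countable E" "Int_stable E" "E \<subseteq> Pow (space signed_measures)" "space signed_measures \<in> E"
      "sets (signed_measures :: ('a set \<Rightarrow> real) measure) = sigma_sets (space signed_measures) E"
      using signed_measures_countably_generated by blast
    have "XX \<in> M \<rightarrow>\<^sub>M D" unfolding D_def XX by (rule model.XX_measurable)
    \<comment> \<open>Every version agrees almost surely with the constructed kernel, so only the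
      latter has to be analysed.\<close>
    from conditional_distribution_unique[OF assms(5) this E \<kappa> \<kappa>0]
    have "AE \<omega> in M. \<kappa> (XX \<omega>) = model.kernel (XX \<omega>)" .
    \<comment> \<open>All exceptional sets depend on the model and the version only; they are
      collected before \<open>P\<close> and the random measure on it are chosen.\<close>
    with AE_space model.AE_good model.AE_finite_new model.AE_marks_charged model.AE_fixed_marks_charged
    show "AE \<omega> in M. finite (S\<^sub>n\<^sub>e\<^sub>w \<omega>) \<and>
        (\<forall>(P :: 'p measure) \<Theta>\<^sub>p\<^sub>o\<^sub>s\<^sub>t.
          prob_space P \<and> \<Theta>\<^sub>p\<^sub>o\<^sub>s\<^sub>t \<in> P \<rightarrow>\<^sub>M signed_measures \<and>
          distr P signed_measures \<Theta>\<^sub>p\<^sub>o\<^sub>s\<^sub>t = \<kappa> (XX \<omega>) \<longrightarrow>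
            completely_random P \<Theta>\<^sub>p\<^sub>o\<^sub>s\<^sub>t \<and>
            crsm_representation P \<Theta>\<^sub>p\<^sub>o\<^sub>s\<^sub>t (S\<^sub>f\<^sub>i\<^sub>x \<union> S\<^sub>n\<^sub>e\<^sub>w \<omega>) (\<lambda>_. 0) (G \<Otimes>\<^sub>M \<nu>\<^sub>p\<^sub>o\<^sub>s\<^sub>t) \<and>
            (\<forall>s\<in>S\<^sub>f\<^sub>i\<^sub>x. distr P borel (\<lambda>\<eta>. \<Theta>\<^sub>p\<^sub>o\<^sub>s\<^sub>t \<eta> {s}) =
               proportional_law (distr M borel (\<lambda>\<omega>'. \<Theta> \<omega>' {s}))
                 (\<lambda>t. \<Prod>j\<in>{1..m}. pmf (h t) \<lfloor>X j \<omega> {s}\<rfloor>)) \<and>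
            (\<forall>s\<in>S\<^sub>n\<^sub>e\<^sub>w \<omega>. distr P borel (\<lambda>\<eta>. \<Theta>\<^sub>p\<^sub>o\<^sub>s\<^sub>t \<eta> {s}) =
               proportional_law \<nu> (\<lambda>t. \<Prod>j\<in>{1..m}. pmf (h t) \<lfloor>X j \<omega> {s}\<rfloor>)))"
    proof eventually_elim
      case (elim \<omega>)
      have new: "S\<^sub>n\<^sub>e\<^sub>w \<omega> = {s. s \<notin> S\<^sub>f\<^sub>i\<^sub>x \<and> model.zmark (model.XX \<omega>) s \<noteq> model.z0}"
        unfolding S\<^sub>n\<^sub>e\<^sub>w_def by (rule model.S_new[OF elim(2)])
      have "finite (S\<^sub>n\<^sub>e\<^sub>w \<omega>)" unfolding new model.new_atoms_XX[OF elim(2)] using elim(3) by simp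
      moreover have "completely_random P \<Theta>' \<and>
            crsm_representation P \<Theta>' (S\<^sub>f\<^sub>i\<^sub>x \<union> S\<^sub>n\<^sub>e\<^sub>w \<omega>) (\<lambda>_. 0) (G \<Otimes>\<^sub>M \<nu>\<^sub>p\<^sub>o\<^sub>s\<^sub>t) \<and>
            (\<forall>s\<in>S\<^sub>f\<^sub>i\<^sub>x. distr P borel (\<lambda>\<eta>. \<Theta>' \<eta> {s}) =
               proportional_law (distr M borel (\<lambda>\<omega>'. \<Theta> \<omega>' {s}))
                 (\<lambda>t. \<Prod>j\<in>{1..m}. pmf (h t) \<lfloor>X j \<omega> {s}\<rfloor>)) \<and>
            (\<forall>s\<in>S\<^sub>n\<^sub>e\<^sub>w \<omega>. distr P borel (\<lambda>\<eta>. \<Theta>' \<eta> {s}) =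
               proportional_law \<nu> (\<lambda>t. \<Prod>j\<in>{1..m}. pmf (h t) \<lfloor>X j \<omega> {s}\<rfloor>))"
        if P: "prob_space P" and \<Theta>': "\<Theta>' \<in> P \<rightarrow>\<^sub>M signed_measures" and law: "distr P signed_measures \<Theta>' = \<kappa> (XX \<omega>)"
        for P :: "'p measure" and \<Theta>'
      proof -
        interpret posterior M \<Theta> "S\<^sub>f\<^sub>i\<^sub>x" \<nu> G K \<theta> \<psi> h m x X P \<Theta>' \<omega>
        proof (intro posterior.intro posterior_axioms.intro model.model_axioms P \<Theta>')
          show "distr P signed_measures \<Theta>' = model.kernel (model.XX \<omega>)" using law elim(6) by (simp add: XX)
        qed (use elim in auto)
        have \<nu>: "\<nu>\<^sub>p\<^sub>o\<^sub>s\<^sub>t = \<nu>'" unfolding \<nu>\<^sub>p\<^sub>o\<^sub>s\<^sub>t_def \<nu>'_def model.H_z0 ..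
        have S': "S\<^sub>f\<^sub>i\<^sub>x \<union> S\<^sub>n\<^sub>e\<^sub>w \<omega> = S'" unfolding new S'_def ..
        show ?thesis unfolding \<nu> S' using posterior_completely_random posterior_crsm law_fixed law_new
          unfolding new by blast
      qed
      ultimately show ?case by blast
    qed
  qed
qed

end
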